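(* Let $r\ge 1$ and $\lambda\vdash r$. Let $\{C_Q : Q\in \mathrm{SYT}(\lambda)\}$ and $\{C'_Q : Q\in\mathrm{SYT}(\lambda)\}$ be the upper and lower canonical bases of the irreducible $K\mathcal{H}_r$-module $M_\lambda$ (see context), and let $S(\lambda)=(S_{Q'Q})_{Q',Q\in\mathrm{SYT}(\lambda)}$ be the transition matrix defined by $C'_Q=\sum_{Q'\in\mathrm{SYT}(\lambda)} S_{Q'Q}\,C_{Q'}$. Then, after multiplying $S(\lambda)$ by a suitable nonzero scalar in $K$ (equivalently, for a suitable choice of the isomorphism identifying the two realizations of $M_\lambda$), every entry of $S(\lambda)$ is invariant under the involution $u\mapsto u^{-1}$ of $K$, every entry lies in $K_0\cap K_\infty$, and $S(\lambda)$ evaluated at $u=0$ and evaluated at $u=\infty$ is the identity matrix.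
   Context: Let $\mathbf{A}=\mathbb{Z}[u,u^{-1}]$, $K=\mathbb{Q}(u)$, with the ring involution $\overline{\cdot}$ determined by $\overline{u}=u^{-1}$. Let $K_0$ (resp. $K_\infty$) be the subring of $K$ of rational functions with no pole at $u=0$ (resp. $u=\infty$). Put $[k]=(u^k-u^{-k})/(u-u^{-1})$. Let $S=\{s_1,\dots,s_{r-1}\}$ be the adjacent transpositions of $\mathfrak{S}_r$, $\ell$ the length function, $\le$ Bruhat order, and $R(w)=\{s\in S: ws<w\}$. The Hecke algebra $\mathcal{H}_r$ is the $\mathbf{A}$-algebra with basis $\{T_w\}_{w\in\mathfrak{S}_r}$ and relations $T_vT_w=T_{vw}$ if $\ell(vw)=\ell(v)+\ell(w)$, $(T_s-u)(T_s+u^{-1})=0$ for $s\in S$. Its bar involution is the additive map extending $\overline{\cdot}$ on $\mathbf{A}$ with $\overline{T_w}=T_{w^{-1}}^{-1}$ (a ring automorphism). $C_w$ (resp. $C'_w$) is the unique bar-invariant element congruent to $T_w$ modulo $u\,\mathbb{Z}[u]\{T_x\}$ (resp. modulo $u^{-1}\mathbb{Z}[u^{-1}]\{T_x\}$). Write $C'_w=\sum_x P'_{x,w}T_x$ and let $\mu(x,w)$ be the coefficient of $u^{-1}$ in $P'_{x,w}$ if $x\le w$, in $P'_{w,x}$ if $w\le x$, and $0$ otherwise. For $w\in\mathfrak{S}_r$, $P(w),Q(w)$ are the RSK insertion and recording tableaux of the word $w(1)\cdots w(r)$; $Q^T$ denotes the transpose of a tableau. Note $C_s=T_s-u$, $C'_s=T_s+u^{-1}$.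 Upper canonical basis of $M_\lambda$: $M_\lambda$ is the $K\mathcal{H}_r$-module with basis $\{C_Q\}_{Q\in\mathrm{SYT}(\lambda)}$ and right action $C_QC_s=-[2]C_Q$ if $s\in R(C_Q)$, and $C_QC_s=\sum_{Q': s\in R(C_{Q'})}\mu(Q',Q)C_{Q'}$ otherwise, where $R(C_Q)=\{s_i: i+1 \text{ lies strictly south of } i \text{ in } Q\}$ and $\mu(Q',Q)=\mu(w',w)$ for any $w',w$ with $P(w')=P(w)$, $Q(w')=Q'$, $Q(w)=Q$ (this is the right cellular subquotient of $\mathcal{H}_r$ spanned by $\{C_w:P(w)=P\}$ for any fixed $P$ of shape $\lambda$; the $M_\lambda$, $\lambda\vdash r$, are the irreducible $K\mathcal{H}_r$-modules). Lower canonical basis: the module with basis $\{C'_Q\}_{Q\in\mathrm{SYT}(\lambda)}$ and action $C'_QC'_s=[2]C'_Q$ if $s\in R(C'_Q)=\{s_i: i+1\text{ lies strictly east of } i \text{ in } Q\}$, and $C'_QC'_s=\sum_{Q': s\in R(C'_{Q'})}\mu(Q',Q)C'_{Q'}$ otherwise, where here $\mu(Q',Q)=\mu(w',w)$ for any $w',w$ with $P(w')^T=P(w)^T$, $Q(w')^T=Q'$, $Q(w)^T=Q$, is isomorphic to $M_\lambda$; via such an isomorphism (unique up to a nonzero scalar) $\{C'_Q\}$ is regarded as a second basis of $M_\lambda$. A matrix is "the identity at $u=0$" (resp. $u=\infty$) if its entries lie in $K_0$ (resp. $K_\infty$) and its evaluation there is the identity matrix. *)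

theory Defs
  imports "HOL-Library.Poly_Mapping" "HOL-Combinatorics.Permutations"
    "HOL-Computational_Algebra.Polynomial" "HOL-Computational_Algebra.Fraction_Field"
begin

type_synonym laurent = "int \<Rightarrow>\<^sub>0 int"

definition lp_u :: laurent where "lp_u = Poly_Mapping.single 1 1"
definition lp_uinv :: laurent where "lp_uinv = Poly_Mapping.single (-1) 1"

definition lp_bar :: "laurent \<Rightarrow> laurent" where
  "lp_bar f = Abs_poly_mapping (\<lambda>k. Poly_Mapping.lookup f (- k))"

definition neg_part :: "laurent \<Rightarrow> bool" where
  "neg_part f \<longleftrightarrow> (\<forall>k\<ge>0. Poly_Mapping.lookup f k = 0)"

definition Sr :: "nat \<Rightarrow> (nat \<Rightarrow> nat) set" where
  "Sr r = {w. w permutes {1..r}}"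

definition sref :: "nat \<Rightarrow> nat \<Rightarrow> nat" where
  "sref i = Transposition.transpose i (Suc i)"

text \<open>Length = number of inversions; products are composition (vw = v o w).\<close>
definition len :: "(nat \<Rightarrow> nat) \<Rightarrow> nat" where
  "len w = card {(i, j). i < j \<and> w j < w i}"

definition bruhat_le :: "nat \<Rightarrow> (nat \<Rightarrow> nat) \<Rightarrow> (nat \<Rightarrow> nat) \<Rightarrow> bool" where
  "bruhat_le r x w \<longleftrightarrow> x \<in> Sr r \<and> w \<in> Sr r \<and>
     (x, w) \<in> {(y, y \<circ> Transposition.transpose a b) | y a b.
                 y \<in> Sr r \<and> a \<in> {1..r} \<and> b \<in> {1..r} \<and> a \<noteq> b \<and>
                 len y < len (y \<circ> Transposition.transpose a b)}\<^sup>*"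

section \<open>Hecke algebra H_r: elements are coefficient functions w |-> coefficient of T_w\<close>

type_synonym hecke = "(nat \<Rightarrow> nat) \<Rightarrow> laurent"

text \<open>Right multiplication by T_{s_i}:
  T_w T_s = T_{ws} if ws > w, and T_w T_s = T_{ws} + (u - u^-1) T_w if ws < w.\<close>
definition mulTs :: "nat \<Rightarrow> hecke \<Rightarrow> hecke" where
  "mulTs i h = (\<lambda>y. h (y \<circ> sref i) +
      (if len (y \<circ> sref i) < len y then (lp_u - lp_uinv) * h y else 0))"

definition mulTsinv :: "nat \<Rightarrow> hecke \<Rightarrow> hecke" where
  "mulTsinv i h = (\<lambda>y. mulTs i h y - (lp_u - lp_uinv) * h y)"

definition hone :: hecke where "hone = (\<lambda>y. if y = id then 1 else 0)"

definition desc :: "(nat \<Rightarrow> nat) \<Rightarrow> nat" where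
  "desc w = (SOME i. 1 \<le> i \<and> len (w \<circ> sref i) < len w)"

text \<open>Right multiplication by T_w, via T_w = T_{ws} T_s for a right descent s of w.\<close>
fun mulT_aux :: "nat \<Rightarrow> hecke \<Rightarrow> (nat \<Rightarrow> nat) \<Rightarrow> hecke" where
  "mulT_aux 0 h w = h"
| "mulT_aux (Suc n) h w = mulTs (desc w) (mulT_aux n h (w \<circ> sref (desc w)))"

definition mulT :: "hecke \<Rightarrow> (nat \<Rightarrow> nat) \<Rightarrow> hecke" where
  "mulT h w = mulT_aux (len w) h w"

definition hmul :: "nat \<Rightarrow> hecke \<Rightarrow> hecke \<Rightarrow> hecke" where
  "hmul r h g = (\<lambda>y. \<Sum>w\<in>Sr r. mulT h w y * g w)"

text \<open>bar(T_w) = T_{w^-1}^-1 = bar(T_{ws}) T_s^-1 for a right descent s of w.\<close>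
fun barT_aux :: "nat \<Rightarrow> (nat \<Rightarrow> nat) \<Rightarrow> hecke" where
  "barT_aux 0 w = hone"
| "barT_aux (Suc n) w = mulTsinv (desc w) (barT_aux n (w \<circ> sref (desc w)))"

definition barT :: "(nat \<Rightarrow> nat) \<Rightarrow> hecke" where
  "barT w = barT_aux (len w) w"

definition hbar :: "nat \<Rightarrow> hecke \<Rightarrow> hecke" where
  "hbar r h = (\<lambda>y. \<Sum>w\<in>Sr r. lp_bar (h w) * barT w y)"

definition Cp :: "nat \<Rightarrow> (nat \<Rightarrow> nat) \<Rightarrow> hecke" where
  "Cp r w = (THE h. (\<forall>y. y \<notin> Sr r \<longrightarrow> h y = 0) \<and> hbar r h = h \<and>
                    (\<forall>x. neg_part (h x - (if x = w then 1 else 0))))"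

text \<open>P'_{x,w} = Cp r w x;  mu(x,w).\<close>
definition mu :: "nat \<Rightarrow> (nat \<Rightarrow> nat) \<Rightarrow> (nat \<Rightarrow> nat) \<Rightarrow> int" where
  "mu r x w = (if bruhat_le r x w then Poly_Mapping.lookup (Cp r w x) (-1)
               else if bruhat_le r w x then Poly_Mapping.lookup (Cp r x w) (-1) else 0)"

section \<open>Tableaux and RSK (tableaux = lists of rows, top row first, English notation)\<close>

type_synonym tableau = "nat list list"

fun row_ins :: "nat \<Rightarrow> nat list \<Rightarrow> nat list \<times> nat option" where
  "row_ins x [] = ([x], None)"
| "row_ins x (y # ys) = (if x < y then (x # ys, Some y)
                         else (let (zs, b) = row_ins x ys in (y # zs, b)))"

fun tab_ins :: "nat \<Rightarrow> tableau \<Rightarrow> tableau \<times> nat" where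
  "tab_ins x [] = ([[x]], 0)"
| "tab_ins x (r # rs) = (case row_ins x r of
      (r', None) \<Rightarrow> (r' # rs, 0)
    | (r', Some y) \<Rightarrow> (let (rs', k) = tab_ins y rs in (r' # rs', Suc k)))"

definition add_box :: "nat \<Rightarrow> nat \<Rightarrow> tableau \<Rightarrow> tableau" where
  "add_box n k Q = (if k < length Q then Q[k := Q ! k @ [n]] else Q @ [[n]])"

fun rsk_aux :: "nat \<Rightarrow> nat list \<Rightarrow> tableau \<times> tableau \<Rightarrow> tableau \<times> tableau" where
  "rsk_aux n [] PQ = PQ"
| "rsk_aux n (x # xs) (P, Q) =
     (let (P', k) = tab_ins x P in rsk_aux (Suc n) xs (P', add_box n k Q))"

definition rsk :: "nat list \<Rightarrow> tableau \<times> tableau" where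
  "rsk w = rsk_aux 1 w ([], [])"

definition Ptab :: "nat \<Rightarrow> (nat \<Rightarrow> nat) \<Rightarrow> tableau" where
  "Ptab r w = fst (rsk (map w [1..<r+1]))"

definition Qtab :: "nat \<Rightarrow> (nat \<Rightarrow> nat) \<Rightarrow> tableau" where
  "Qtab r w = snd (rsk (map w [1..<r+1]))"

definition tabT :: "tableau \<Rightarrow> tableau" where
  "tabT T = List.transpose T"

definition is_partition :: "nat list \<Rightarrow> bool" where
  "is_partition lam \<longleftrightarrow> sorted_wrt (\<ge>) lam \<and> (\<forall>x\<in>set lam. 0 < x)"

definition SYT :: "nat list \<Rightarrow> tableau set" where
  "SYT lam = {T. map length T = lam \<and> mset (concat T) = mset [1..<sum_list lam + 1] \<and>
      (\<forall>row\<in>set T. sorted_wrt (<) row) \<and>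
      (\<forall>i j. Suc i < length T \<and> j < length (T ! Suc i) \<longrightarrow> T ! i ! j < T ! Suc i ! j)}"

definition row_of :: "tableau \<Rightarrow> nat \<Rightarrow> nat" where
  "row_of T k = (THE i. i < length T \<and> k \<in> set (T ! i))"

definition col_of :: "tableau \<Rightarrow> nat \<Rightarrow> nat" where
  "col_of T k = (THE j. j < length (T ! row_of T k) \<and> T ! row_of T k ! j = k)"

definition R_up :: "nat \<Rightarrow> tableau \<Rightarrow> nat set" where
  "R_up r Q = {i. 1 \<le> i \<and> i < r \<and> row_of Q i < row_of Q (Suc i)}"

definition R_low :: "nat \<Rightarrow> tableau \<Rightarrow> nat set" where
  "R_low r Q = {i. 1 \<le> i \<and> i < r \<and> col_of Q i < col_of Q (Suc i)}"

definition mu_up :: "nat \<Rightarrow> tableau \<Rightarrow> tableau \<Rightarrow> int" where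
  "mu_up r Q' Q = (let (w', w) = (SOME (w', w). w' \<in> Sr r \<and> w \<in> Sr r \<and>
        Ptab r w' = Ptab r w \<and> Qtab r w' = Q' \<and> Qtab r w = Q) in mu r w' w)"

definition mu_low :: "nat \<Rightarrow> tableau \<Rightarrow> tableau \<Rightarrow> int" where
  "mu_low r Q' Q = (let (w', w) = (SOME (w', w). w' \<in> Sr r \<and> w \<in> Sr r \<and>
        tabT (Ptab r w') = tabT (Ptab r w) \<and> tabT (Qtab r w') = Q' \<and> tabT (Qtab r w) = Q)
      in mu r w' w)"

type_synonym fieldK = "rat poly fract"

definition q2 :: fieldK where "q2 = Fract [:1, 0, 1:] [:0, 1:]"  \<comment> \<open>[2] = u + u^-1\<close>

text \<open>Bar involution u |-> u^-1 on K: p(u)/q(u) |-> p(u^-1)/q(u^-1).\<close>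
definition barK :: "fieldK \<Rightarrow> fieldK" where
  "barK f = (let (p, q) = (SOME (p, q). q \<noteq> 0 \<and> f = Fract p q) in
     Fract (reflect_poly p * monom 1 (degree q)) (reflect_poly q * monom 1 (degree p)))"

definition K0 :: "fieldK set" where
  "K0 = {f. \<exists>p q. poly q 0 \<noteq> 0 \<and> f = Fract p q}"

definition val0 :: "fieldK \<Rightarrow> rat" where
  "val0 f = (let (p, q) = (SOME (p, q). poly q 0 \<noteq> 0 \<and> f = Fract p q) in poly p 0 / poly q 0)"

definition Kinf :: "fieldK set" where
  "Kinf = {f. \<exists>p q. q \<noteq> 0 \<and> degree p \<le> degree q \<and> f = Fract p q}"

definition valinf :: "fieldK \<Rightarrow> rat" where
  "valinf f = (let (p, q) = (SOME (p, q). q \<noteq> 0 \<and> degree p \<le> degree q \<and> f = Fract p q) in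
     if degree p = degree q then lead_coeff p / lead_coeff q else 0)"

text \<open>Matrix of right action of C_{s_i} on the upper basis: entry (Q'', Q') is the
  coefficient of C_{Q''} in C_{Q'} C_{s_i}.\<close>
definition Uact :: "nat \<Rightarrow> nat \<Rightarrow> tableau \<Rightarrow> tableau \<Rightarrow> fieldK" where
  "Uact r i Q'' Q' = (if i \<in> R_up r Q' then (if Q'' = Q' then - q2 else 0)
                      else if i \<in> R_up r Q'' then of_int (mu_up r Q'' Q') else 0)"

text \<open>Matrix of right action of C'_{s_i} on the lower basis.\<close>
definition Lact :: "nat \<Rightarrow> nat \<Rightarrow> tableau \<Rightarrow> tableau \<Rightarrow> fieldK" where
  "Lact r i Q'' Q' = (if i \<in> R_low r Q' then (if Q'' = Q' then q2 else 0)
                      else if i \<in> R_low r Q'' then of_int (mu_low r Q'' Q') else 0)"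

text \<open>S is the matrix (C'_Q = sum_{Q'} S Q' Q C_{Q'}) of a module isomorphism from the lower
  realization to the upper one.  Since C'_s = C_s + [2] and the T_s generate H_r, being a
  module map means S * Lact_i = (Uact_i + [2] I) * S for all i.\<close>
definition is_iso :: "nat list \<Rightarrow> (tableau \<Rightarrow> tableau \<Rightarrow> fieldK) \<Rightarrow> bool" where
  "is_iso lam S \<longleftrightarrow> (let r = sum_list lam in
     (\<forall>i\<in>{1..<r}. \<forall>Q''\<in>SYT lam. \<forall>Q\<in>SYT lam.
        (\<Sum>Q'\<in>SYT lam. S Q'' Q' * Lact r i Q' Q) =
        (\<Sum>Q'\<in>SYT lam. Uact r i Q'' Q' * S Q' Q) + q2 * S Q'' Q) \<and>
     (\<exists>S'. \<forall>Q''\<in>SYT lam. \<forall>Q\<in>SYT lam.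
        (\<Sum>Q'\<in>SYT lam. S Q'' Q' * S' Q' Q) = (if Q'' = Q then 1 else 0)))"

end

theory Submission
  imports Defs
begin

text \<open>Upper and lower descent sets are complementary and \<open>mu\<close> is symmetric, so the upper action
  (shifted by \<open>[2]\<close>) is the transpose of the lower one, and an isomorphism between the two
  realizations is the Gram matrix of an invariant form on the lower one. Such a form exists:
  multiplication by the longest element preserves \<open>mu\<close> and realizes the lower module as a cellular
  subquotient of the Hecke algebra, and the trace form, definite because the field of rational
  functions is orderable, descends to subquotients.

  An isomorphism can be scaled to have entries regular at \<open>u = 0\<close>, not all vanishing there. Its
  value at \<open>u = 0\<close> then respects descent sets and commutes with Knuth moves on standard tableaux.
  These moves connect all tableaux of one shape, and together with the descent sets they separate
  the tableaux, so this value is a nonzero scalar matrix. In particular an intertwiner with one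
  vanishing diagonal entry is zero. If the scaling makes one diagonal entry equal to 1, this applies
  to the difference of the intertwiner and its bar conjugate; hence the intertwiner is bar
  invariant, which carries the statement at \<open>u = 0\<close> over to \<open>u = \<infinity>\<close>.\<close>

section \<open>Permutations, length and Bruhat order\<close>

text \<open>The definitions of \<open>mu_up\<close> and \<open>mu_low\<close> read mu off an
  arbitrarily chosen pair of permutations, so the two actions cannot be compared before mu is known
  to depend on the recording tableaux alone. This dictates the size of the proof: commuting left and
  right multiplications make mu invariant under left star operations, and these lead from any right
  cell to every other one of the same shape. The actions use mu only for pairs that differ at some
  descent, and the transport lemmas for mu are stated for such pairs. Descent sets are respected at
  u = 0 because [2] has a pole there: an entry joining two different descent sets, multiplied by
  [2], is still a combination of regular entries, so it vanishes at 0. Knuth moves are respected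
  because mu is 0 or 1 between elements that have, of two adjacent generators, exactly one as a
  descent and not the same one; the intertwining relations then collapse to one term at u = 0. The
  separation principle for lattice words serves three times: for cells, for the longest element and
  for the value at u = 0.\<close>

lemma sref_simps [simp]:
  "sref i i = Suc i" "sref i (Suc i) = i" "a \<noteq> i \<Longrightarrow> a \<noteq> Suc i \<Longrightarrow> sref i a = a"
  by (auto simp: sref_def Transposition.transpose_def)

lemma sref_sref [simp]: "sref i (sref i a) = a"
  by (simp add: sref_def)

lemma sref_comp [simp]: "sref i \<circ> sref i = id"
  by (simp add: fun_eq_iff)

lemma comp_sref_sref [simp]: "w \<circ> sref i \<circ> sref i = w"
  by (simp add: fun_eq_iff)

lemma inv_sref [simp]: "inv (sref i) = sref i"
  by (simp add: sref_def)

lemma bij_sref [simp]: "bij (sref i)"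
  by (simp add: sref_def)

lemma sref_less_iff: "a < b \<Longrightarrow> (a, b) \<noteq> (i, Suc i) \<Longrightarrow> sref i a < sref i b"
  by (cases "a = i"; cases "a = Suc i"; cases "b = i"; cases "b = Suc i"; simp)

definition Inv :: "(nat \<Rightarrow> nat) \<Rightarrow> (nat \<times> nat) set" where
  "Inv w = {(i, j). i < j \<and> w j < w i}"

lemma len_Inv: "len w = card (Inv w)"
  by (simp add: len_def Inv_def)

lemma Sr_comp: "v \<in> Sr r \<Longrightarrow> w \<in> Sr r \<Longrightarrow> v \<circ> w \<in> Sr r"
  by (simp add: Sr_def permutes_compose)

lemma Sr_inv: "w \<in> Sr r \<Longrightarrow> inv w \<in> Sr r"
  by (simp add: Sr_def permutes_inv)

lemma Sr_id [simp]: "id \<in> Sr r"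
  by (simp add: Sr_def permutes_id)

lemma Sr_bij: "w \<in> Sr r \<Longrightarrow> bij w"
  by (auto simp: Sr_def permutes_bij)

lemma Sr_inj: "w \<in> Sr r \<Longrightarrow> w a = w b \<longleftrightarrow> a = b"
  by (metis Sr_bij bij_is_inj injD)

lemma Sr_inv_inv: "w \<in> Sr r \<Longrightarrow> inv (inv w) = w"
  by (simp add: Sr_bij inv_inv_eq)

lemma Sr_mono: "r \<le> n \<Longrightarrow> w \<in> Sr r \<Longrightarrow> w \<in> Sr n"
  by (auto simp: Sr_def intro: permutes_subset)

lemma transpose_Sr: "a \<in> {1..r} \<Longrightarrow> b \<in> {1..r} \<Longrightarrow> Transposition.transpose a b \<in> Sr r"
  by (simp add: Sr_def permutes_swap_id)

lemma sref_Sr: "1 \<le> i \<Longrightarrow> i < r \<Longrightarrow> sref i \<in> Sr r"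
  by (simp add: sref_def transpose_Sr)

lemma Sr_sref [simp]: "1 \<le> i \<Longrightarrow> i < r \<Longrightarrow> w \<circ> sref i \<in> Sr r \<longleftrightarrow> w \<in> Sr r"
  by (metis Sr_comp sref_Sr comp_sref_sref)

lemma Sr_sref_left [simp]: "1 \<le> i \<Longrightarrow> i < r \<Longrightarrow> sref i \<circ> w \<in> Sr r \<longleftrightarrow> w \<in> Sr r"
  by (metis Sr_comp sref_Sr sref_comp comp_assoc id_comp)

lemma finite_Sr [simp]: "finite (Sr r)"
  by (simp add: Sr_def finite_permutations)

lemma Inv_subset: "w \<in> Sr n \<Longrightarrow> Inv w \<subseteq> {..n} \<times> {..n}"
proof clarsimp
  fix i j assume w: "w \<in> Sr n" and "(i, j) \<in> Inv w"
  then have ij: "i < j" "w j < w i" by (auto simp: Inv_def)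
  have p: "w permutes {1..n}" using w by (simp add: Sr_def)
  have out: "w k = k" if "k > n" for k using p that by (simp add: permutes_def)
  have ins: "w k \<le> n" if "k \<le> n" for k
  proof (cases "k = 0")
    case True then show ?thesis using p by (simp add: permutes_def)
  next
    case False then have "k \<in> {1..n}" using that by simp
    then show ?thesis using permutes_in_image[OF p, of k] by simp
  qed
  show "i \<le> n \<and> j \<le> n"
  proof (cases "j \<le> n")
    case True with ij show ?thesis by simp
  next
    case False
    then have "w j = j" using out by simp
    then have "w i > n" using ij False by simp
    then have "i > n" using ins by (meson not_le)
    then show ?thesis using out[of i] ij \<open>w j = j\<close> by simp
  qed
qed

lemma finite_Inv: "w \<in> Sr n \<Longrightarrow> finite (Inv w)"
  by (rule finite_subset[OF Inv_subset]) auto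

text \<open>Relabelling positions by \<open>sref i\<close> reverses the order of no pair except
  \<open>(i, Suc i)\<close>; that pair is not an inversion of \<open>w\<close> and becomes
  one.\<close>

lemma Inv_sref:
  assumes "w i < w (Suc i)"
  shows "Inv (w \<circ> sref i) = insert (i, Suc i) (map_prod (sref i) (sref i) ` Inv w)"
proof (intro set_eqI iffI)
  fix p assume p: "p \<in> Inv (w \<circ> sref i)"
  obtain a b where ab: "p = (a, b)" by (cases p)
  show "p \<in> insert (i, Suc i) (map_prod (sref i) (sref i) ` Inv w)"
  proof (cases "(a, b) = (i, Suc i)")
    case False
    then have "sref i a < sref i b" using p ab by (intro sref_less_iff) (auto simp: Inv_def)
    then have "(sref i a, sref i b) \<in> Inv w" using p ab by (auto simp: Inv_def)
    then have "map_prod (sref i) (sref i) (sref i a, sref i b) \<in> map_prod (sref i) (sref i) ` Inv w"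
      by (rule imageI)
    then show ?thesis using ab by simp
  qed (simp add: ab)
next
  fix p assume "p \<in> insert (i, Suc i) (map_prod (sref i) (sref i) ` Inv w)"
  then show "p \<in> Inv (w \<circ> sref i)"
  proof
    assume "p = (i, Suc i)" then show ?thesis using assms by (simp add: Inv_def)
  next
    assume "p \<in> map_prod (sref i) (sref i) ` Inv w"
    then obtain a b where ab: "(a, b) \<in> Inv w" "p = (sref i a, sref i b)" by auto
    then have "(a, b) \<noteq> (i, Suc i)" using assms by (auto simp: Inv_def)
    then have "sref i a < sref i b" using ab by (intro sref_less_iff) (auto simp: Inv_def)
    then show ?thesis using ab by (auto simp: Inv_def)
  qed
qed

lemma len_sref_up:
  assumes "w \<in> Sr n" "w i < w (Suc i)"
  shows "len (w \<circ> sref i) = Suc (len w)"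
proof -
  have "inj (map_prod (sref i) (sref i))" by (simp add: prod.inj_map bij_is_inj)
  moreover have "(i, Suc i) \<notin> map_prod (sref i) (sref i) ` Inv w"
  proof
    assume "(i, Suc i) \<in> map_prod (sref i) (sref i) ` Inv w"
    then obtain a b where "a < b" "sref i a = i" "sref i b = Suc i" by (auto simp: Inv_def)
    then have "sref i (sref i a) = Suc i" "sref i (sref i b) = i" by simp_all
    then show False using \<open>a < b\<close> by simp
  qed
  ultimately show ?thesis
    unfolding len_Inv Inv_sref[OF assms(2)]
    by (subst card_insert_disjoint) (auto simp: finite_Inv[OF assms(1)] card_image inj_on_subset)
qed

lemma len_sref_down:
  assumes "w \<in> Sr n" "w (Suc i) < w i" "1 \<le> i"
  shows "Suc (len (w \<circ> sref i)) = len w"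
proof -
  \<comment> \<open>The index \<open>i\<close> need not be below \<open>n\<close>, so the product is
    placed in a larger symmetric group.\<close>
  have "w \<circ> sref i \<in> Sr (Suc (max n i))"
    using assms by (subst Sr_sref) (auto intro: Sr_mono[of n])
  from len_sref_up[OF this, of i] assms show ?thesis by simp
qed

lemma len_sref_less_iff:
  assumes "w \<in> Sr n" "1 \<le> i"
  shows "len (w \<circ> sref i) < len w \<longleftrightarrow> w (Suc i) < w i"
proof (cases "w (Suc i) < w i")
  case True then show ?thesis using len_sref_down[OF assms(1) True assms(2)] by simp
next
  case False
  then have "w i < w (Suc i)" using Sr_inj[OF assms(1), of i "Suc i"] by linarith
  then show ?thesis using len_sref_up[OF assms(1)] False by simp
qed

text \<open>The map \<open>f\<close> injects the inversions of \<open>w\<close> into those of the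
  product: a pair is moved along the transposition when this keeps its order and is left alone
  otherwise. The new inversion \<open>(a, b)\<close> is never hit.\<close>

lemma len_transpose_up:
  assumes w: "w \<in> Sr n" and ab: "1 \<le> a" "a < b" and wab: "w a < w b"
  shows "len w < len (w \<circ> Transposition.transpose a b)"
proof -
  let ?t = "Transposition.transpose a b"
  define f where "f = (\<lambda>(i, j). if ?t i < ?t j then (?t i, ?t j) else (i, j))"
  have "w \<circ> ?t \<in> Sr (max n b)"
    using ab by (intro Sr_comp Sr_mono[OF _ w] transpose_Sr) auto
  then have fin: "finite (Inv (w \<circ> ?t))" using finite_Inv by blast
  have tt: "?t (?t i) = i" for i by simp
  have sub: "f p \<in> Inv (w \<circ> ?t) - {(a, b)}" if "p \<in> Inv w" for p
  proof -
    obtain i j where p: "p = (i, j)" by (cases p)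
    have ij: "i < j" "w j < w i" using that p by (auto simp: Inv_def)
    show ?thesis
    proof (cases "?t i < ?t j")
      case True
      have "(?t i, ?t j) \<noteq> (a, b)"
      proof
        assume "(?t i, ?t j) = (a, b)"
        then have "i = ?t a" "j = ?t b" by (metis prod.inject tt)+
        then show False using ij ab by simp
      qed
      then show ?thesis using True ij p by (auto simp: f_def Inv_def)
    next
      case False
      have "w (?t j) < w (?t i)"
        using False ij ab wab
        by (cases "i = a"; cases "i = b"; cases "j = a"; cases "j = b") simp_all
      moreover have "(i, j) \<noteq> (a, b)" using ij wab by auto
      ultimately show ?thesis using False ij p by (auto simp: f_def Inv_def)
    qed
  qed
  have "inj_on f (Inv w)"
  proof (rule inj_onI)
    fix p q assume pq: "p \<in> Inv w" "q \<in> Inv w" "f p = f q"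
    obtain i j k l where e: "p = (i, j)" "q = (k, l)" by (cases p; cases q)
    have lt: "i < j" "k < l" using pq e by (auto simp: Inv_def)
    have inj: "?t x = ?t y \<longleftrightarrow> x = y" for x y by (metis tt)
    show "p = q"
      using pq(3) lt unfolding e f_def by (auto simp: inj split: if_splits)
  qed
  then have "len w = card (f ` Inv w)" by (simp add: len_Inv card_image)
  also have "\<dots> \<le> card (Inv (w \<circ> ?t) - {(a, b)})"
    using sub fin by (intro card_mono image_subsetI) simp_all
  also have "\<dots> < card (Inv (w \<circ> ?t))"
  proof (rule psubset_card_mono[OF fin])
    have "(a, b) \<in> Inv (w \<circ> ?t)" using ab wab by (simp add: Inv_def)
    then show "Inv (w \<circ> ?t) - {(a, b)} \<subset> Inv (w \<circ> ?t)" by blast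
  qed
  finally show ?thesis by (simp add: len_Inv)
qed

lemma len_inv:
  assumes "w \<in> Sr r" shows "len (inv w) = len w"
proof -
  have b: "bij w" using assms by (rule Sr_bij)
  have "bij_betw (\<lambda>(i, j). (w j, w i)) (Inv w) (Inv (inv w))"
  proof (rule bij_betwI[where g = "\<lambda>(i, j). (inv w j, inv w i)"])
    show "(\<lambda>(i, j). (w j, w i)) \<in> Inv w \<rightarrow> Inv (inv w)"
      using b by (auto simp: Inv_def inv_f_f bij_is_inj)
    show "(\<lambda>(i, j). (inv w j, inv w i)) \<in> Inv (inv w) \<rightarrow> Inv w"
      using b by (auto simp: Inv_def surj_f_inv_f bij_is_surj)
  qed (use b in \<open>auto simp: inv_f_f bij_is_inj surj_f_inv_f bij_is_surj\<close>)
  then show ?thesis by (simp add: len_Inv bij_betw_same_card)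
qed

lemma len_id [simp]: "len id = 0"
proof -
  have "Inv id = {}" by (auto simp: Inv_def)
  then show ?thesis by (simp add: len_Inv)
qed

lemma inv_comp_sref:
  assumes "w \<in> Sr r" shows "inv (w \<circ> sref i) = sref i \<circ> inv w"
  using assms by (simp add: o_inv_distrib Sr_bij)

lemma inv_sref_comp:
  assumes "w \<in> Sr r" shows "inv (sref i \<circ> w) = inv w \<circ> sref i"
  using assms by (simp add: o_inv_distrib Sr_bij)

text \<open>Without a descent in range, \<open>w\<close> increases on \<open>{1..r}\<close>.
  Counting from the bottom gives \<open>i \<le> w i\<close>, counting from the top gives
  \<open>w i \<le> i\<close>.\<close>

lemma exists_descent:
  assumes w: "w \<in> Sr r" and "w \<noteq> id"
  shows "\<exists>i. 1 \<le> i \<and> i < r \<and> w (Suc i) < w i"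
proof (rule ccontr)
  assume "\<not> ?thesis"
  then have up: "w i < w (Suc i)" if "1 \<le> i" "i < r" for i
    using that Sr_inj[OF w, of i "Suc i"] by (metis n_not_Suc_n nat_neq_iff)
  have p: "w permutes {1..r}" using w by (simp add: Sr_def)
  have img: "1 \<le> w i \<and> w i \<le> r" if "1 \<le> i" "i \<le> r" for i
    using permutes_in_image[OF p, of i] that by simp
  have ge: "i \<le> w i" if "1 \<le> i" "i \<le> r" for i
    using that
  proof (induction i rule: nat_induct_at_least)
    case base then show ?case using img by simp
  next
    case (Suc n) then show ?case using up[of n] by simp
  qed
  have le: "w (r - k) \<le> r - k" if "k < r" for k
    using that
  proof (induction k)
    case 0 then show ?case using img[of r] by simp
  next
    case (Suc k)
    have "Suc (r - Suc k) = r - k" using Suc.prems by simp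
    moreover have "w (r - Suc k) < w (r - k)" using up[of "r - Suc k"] \<open>Suc (r - Suc k) = r - k\<close> Suc.prems by simp
    moreover have "w (r - k) \<le> r - k" using Suc by simp
    ultimately show ?case by simp
  qed
  have "w i = i" for i
  proof (cases "1 \<le> i \<and> i \<le> r")
    case True
    then show ?thesis using ge[of i] le[of "r - i"] by simp
  next
    case False
    then show ?thesis using p by (auto simp: permutes_def)
  qed
  then show False using \<open>w \<noteq> id\<close> by auto
qed

text \<open>\<open>desc\<close> chooses its index without an upper bound; this confines the choice
  to indices below \<open>r\<close>.\<close>

lemma asc_outside:
  assumes "w \<in> Sr r" "r \<le> i" "1 \<le> i" shows "w i < w (Suc i)"
proof -
  have p: "w permutes {1..r}" using assms by (simp add: Sr_def)
  then have "w (Suc i) = Suc i" using assms by (auto simp: permutes_def)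
  moreover have "w i \<le> i"
  proof (cases "i = r")
    case True then show ?thesis using permutes_in_image[OF p, of i] assms by simp
  next
    case False then show ?thesis using p assms by (auto simp: permutes_def)
  qed
  ultimately show ?thesis by simp
qed

lemma desc_props:
  assumes "w \<in> Sr r" "w \<noteq> id"
  shows "1 \<le> desc w" "desc w < r" "w (Suc (desc w)) < w (desc w)"
proof -
  obtain i where "1 \<le> i" "w (Suc i) < w i" using exists_descent[OF assms] by blast
  then have "\<exists>i. 1 \<le> i \<and> len (w \<circ> sref i) < len w"
    using len_sref_less_iff[OF assms(1)] by blast
  from someI_ex[OF this]
  have d: "1 \<le> desc w" "len (w \<circ> sref (desc w)) < len w" by (auto simp: desc_def)
  then show "1 \<le> desc w" "w (Suc (desc w)) < w (desc w)"
    using len_sref_less_iff[OF assms(1)] by auto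
  then show "desc w < r"
    using asc_outside[OF assms(1), of "desc w"] by (meson not_less less_asym)
qed

lemma len_eq_0_iff: "w \<in> Sr r \<Longrightarrow> len w = 0 \<longleftrightarrow> w = id"
  using desc_props[of w r] len_sref_down[of w r "desc w"] by fastforce

lemma Sr_induct [consumes 1, case_names id step]:
  assumes "w \<in> Sr r" and "P id"
    and "\<And>w i. \<lbrakk>w \<in> Sr r; 1 \<le> i; i < r; w i < w (Suc i); P w\<rbrakk> \<Longrightarrow> P (w \<circ> sref i)"
  shows "P w"
  using assms(1)
proof (induction "len w" arbitrary: w)
  case 0 then show ?case using len_eq_0_iff assms(2) by fastforce
next
  case (Suc n)
  then have "w \<noteq> id" by auto
  note d = desc_props[OF Suc.prems this]
  let ?v = "w \<circ> sref (desc w)"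
  have v: "?v \<in> Sr r" using d Suc.prems by simp
  have "len ?v = n" using len_sref_down[OF Suc.prems d(3) d(1)] Suc.hyps(2) by simp
  then have "P ?v" using Suc.hyps(1) v by simp
  moreover have "?v (desc w) < ?v (Suc (desc w))" using d by simp
  ultimately have "P (?v \<circ> sref (desc w))" using assms(3) v d by blast
  then show ?case by simp
qed

section \<open>The longest element\<close>

definition w0 :: "nat \<Rightarrow> nat \<Rightarrow> nat" where
  "w0 r i = (if 1 \<le> i \<and> i \<le> r then Suc r - i else i)"

lemma w0_w0 [simp]: "w0 r (w0 r i) = i"
  by (auto simp: w0_def)

lemma w0_comp [simp]: "w0 r \<circ> (w0 r \<circ> w) = w" "w0 r \<circ> w0 r = id"
  by (auto simp: fun_eq_iff)

lemma w0_Sr [simp]: "w0 r \<in> Sr r"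
  unfolding Sr_def mem_Collect_eq
  by (intro bij_imp_permutes bij_betwI[where g = "w0 r"]) (auto simp: w0_def)

lemma w0_comp_Sr [simp]: "w0 r \<circ> w \<in> Sr r \<longleftrightarrow> w \<in> Sr r"
  by (metis Sr_comp w0_Sr w0_comp(1))

lemma Sr_range: "w \<in> Sr r \<Longrightarrow> 1 \<le> i \<Longrightarrow> i \<le> r \<Longrightarrow> 1 \<le> w i \<and> w i \<le> r"
  using permutes_in_image[of w "{1..r}" i] by (auto simp: Sr_def)

lemma w0_less_iff: "1 \<le> a \<Longrightarrow> a \<le> r \<Longrightarrow> 1 \<le> b \<Longrightarrow> b \<le> r \<Longrightarrow> w0 r a < w0 r b \<longleftrightarrow> b < a"
  by (auto simp: w0_def)

lemma w0_comp_less_iff: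
  assumes "w \<in> Sr r" "1 \<le> i" "i < r"
  shows "(w0 r \<circ> w) (Suc i) < (w0 r \<circ> w) i \<longleftrightarrow> w i < w (Suc i)"
  using Sr_range[OF assms(1), of i] Sr_range[OF assms(1), of "Suc i"] assms
  by (simp add: w0_less_iff)

section \<open>Bruhat order and its lifting property\<close>

definition brel :: "nat \<Rightarrow> ((nat \<Rightarrow> nat) \<times> (nat \<Rightarrow> nat)) set" where
  "brel r = {(y, y \<circ> Transposition.transpose a b) | y a b.
      y \<in> Sr r \<and> a \<in> {1..r} \<and> b \<in> {1..r} \<and> a \<noteq> b \<and> len y < len (y \<circ> Transposition.transpose a b)}"

lemma bruhat_le_brel: "bruhat_le r x w \<longleftrightarrow> x \<in> Sr r \<and> w \<in> Sr r \<and> (x, w) \<in> (brel r)\<^sup>*"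
  by (simp add: bruhat_le_def brel_def)

text \<open>If \<open>x b < x a\<close> held for \<open>a < b\<close>, then
  \<open>len_transpose_up\<close> applied to \<open>y\<close> would make \<open>x\<close> longer
  than \<open>y\<close>.\<close>

lemma brelE:
  assumes "(x, y) \<in> brel r"
  obtains a b where "x \<in> Sr r" "1 \<le> a" "a < b" "b \<le> r" "x a < x b"
    "y = x \<circ> Transposition.transpose a b"
proof -
  obtain a b where ab: "x \<in> Sr r" "a \<in> {1..r}" "b \<in> {1..r}" "a \<noteq> b"
    "y = x \<circ> Transposition.transpose a b" "len x < len y"
    using assms by (auto simp: brel_def)
  have key: "x a < x b" if "a < b" "a \<in> {1..r}" "b \<in> {1..r}"
      "y = x \<circ> Transposition.transpose a b" for a b
  proof (rule ccontr)
    assume "\<not> x a < x b"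
    then have "x b < x a" using Sr_inj[OF ab(1), of a b] that by linarith
    moreover have "y \<in> Sr r" using that ab(1) Sr_comp transpose_Sr by metis
    moreover have "1 \<le> a" "y a = x b" "y b = x a" using that by auto
    ultimately have "len y < len (y \<circ> Transposition.transpose a b)"
      using that(1) by (intro len_transpose_up[where n = r]) auto
    moreover have "y \<circ> Transposition.transpose a b = x" using that by (auto simp: fun_eq_iff)
    ultimately show False using ab(6) by simp
  qed
  show thesis
  proof (cases "a < b")
    case True then show thesis using key[of a b] ab that by auto
  next
    case False then show thesis using key[of b a] ab that[of b a]
      by (auto simp: transpose_commute)
  qed
qed

lemma brelI:
  assumes "x \<in> Sr r" "a \<in> {1..r}" "b \<in> {1..r}" "a < b" "x a < x b"
  shows "(x, x \<circ> Transposition.transpose a b) \<in> brel r"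
  using assms len_transpose_up[of x r a b] unfolding brel_def by force

lemma brel_len: "(x, y) \<in> brel r \<Longrightarrow> len x < len y \<and> x \<in> Sr r \<and> y \<in> Sr r"
  using Sr_comp transpose_Sr unfolding brel_def by force

lemma bruhat_le_len: "bruhat_le r x w \<Longrightarrow> x = w \<or> len x < len w"
proof -
  assume "bruhat_le r x w"
  then have "(x, w) \<in> (brel r)\<^sup>*" by (simp add: bruhat_le_brel)
  then show ?thesis
    by (induction rule: rtrancl_induct) (auto dest: brel_len)
qed

lemma bruhat_le_refl [simp]: "x \<in> Sr r \<Longrightarrow> bruhat_le r x x"
  by (simp add: bruhat_le_brel)

lemma bruhat_le_Sr: "bruhat_le r x w \<Longrightarrow> x \<in> Sr r \<and> w \<in> Sr r"
  by (simp add: bruhat_le_brel)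

lemma bruhat_le_trans: "bruhat_le r x y \<Longrightarrow> bruhat_le r y z \<Longrightarrow> bruhat_le r x z"
  by (auto simp: bruhat_le_brel)

lemma bruhat_sref_up:
  assumes "w \<in> Sr r" "1 \<le> i" "i < r" "w i < w (Suc i)"
  shows "bruhat_le r w (w \<circ> sref i)"
  using brelI[of w r i "Suc i"] assms by (auto simp: bruhat_le_brel sref_def[symmetric])

text \<open>Multiplication by \<open>sref i\<close> conjugates the transposition of
  \<open>(a, b)\<close> into that of \<open>(sref i a, sref i b)\<close>. The order of these
  positions survives unless the transposition is \<open>sref i\<close> itself.\<close>

lemma brel_sref:
  assumes "(x, y) \<in> brel r" "1 \<le> i" "i < r"
  shows "x \<circ> sref i = y \<or> (x \<circ> sref i, y \<circ> sref i) \<in> brel r"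
proof -
  obtain a b where ab: "x \<in> Sr r" "1 \<le> a" "a < b" "b \<le> r" "x a < x b"
    "y = x \<circ> Transposition.transpose a b" using brelE[OF assms(1)] .
  show ?thesis
  proof (cases "(a, b) = (i, Suc i)")
    case True then show ?thesis using ab by (simp add: sref_def)
  next
    case False
    then have lt: "sref i a < sref i b" using ab by (intro sref_less_iff) auto
    have "sref i \<in> Sr r" using assms by (intro sref_Sr) auto
    then have rng: "1 \<le> sref i k \<and> sref i k \<le> r" if "1 \<le> k" "k \<le> r" for k
      using that Sr_range by blast
    have "(x \<circ> sref i, x \<circ> sref i \<circ> Transposition.transpose (sref i a) (sref i b)) \<in> brel r"
      using lt ab assms rng[of a] rng[of b] by (intro brelI) auto
    moreover have "x \<circ> sref i \<circ> Transposition.transpose (sref i a) (sref i b) = y \<circ> sref i"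
    proof
      fix k
      have inj: "sref i k = c \<longleftrightarrow> k = sref i c" for c by (metis sref_sref)
      show "(x \<circ> sref i \<circ> Transposition.transpose (sref i a) (sref i b)) k = (y \<circ> sref i) k"
        using ab(6) by (auto simp: Transposition.transpose_def inj)
    qed
    ultimately show ?thesis by simp
  qed
qed

text \<open>A chain from \<open>x\<close> to \<open>w\<close> is multiplied by \<open>sref i\<close>
  step by step. If some step \<open>(y, z)\<close> collapses to \<open>y \<circ> sref i = z\<close>,
  the old chain is followed from there to \<open>w\<close>, which lies below
  \<open>w \<circ> sref i\<close>.\<close>

lemma bruhat_lift:
  assumes "bruhat_le r x w" "1 \<le> i" "i < r" "w i < w (Suc i)"
  shows "bruhat_le r (x \<circ> sref i) (w \<circ> sref i)"
proof -
  have S: "x \<in> Sr r" "w \<in> Sr r" "(x, w) \<in> (brel r)\<^sup>*" using assms by (auto simp: bruhat_le_brel)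
  have "(x \<circ> sref i, w) \<in> (brel r)\<^sup>* \<or> (x \<circ> sref i, w \<circ> sref i) \<in> (brel r)\<^sup>*"
    using S(3)
  proof (induction rule: converse_rtrancl_induct)
    case base then show ?case by simp
  next
    case (step y z)
    then show ?case using brel_sref[OF step(1) assms(2,3)]
      by (metis converse_rtrancl_into_rtrancl)
  qed
  then have "bruhat_le r (x \<circ> sref i) w \<or> bruhat_le r (x \<circ> sref i) (w \<circ> sref i)"
    using S assms by (auto simp: bruhat_le_brel)
  then show ?thesis using bruhat_sref_up[OF S(2) assms(2-4)] bruhat_le_trans by blast
qed

section \<open>Laurent polynomials\<close>

lemma laurent_induct [case_names single add]:
  fixes f :: laurent
  assumes "\<And>k v. P (Poly_Mapping.single k v)" and "\<And>f g. P f \<Longrightarrow> P g \<Longrightarrow> P (f + g)"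
  shows "P f"
proof -
  have f: "f = (\<Sum>k\<in>Poly_Mapping.keys f. Poly_Mapping.single k (Poly_Mapping.lookup f k))"
    by (rule poly_mapping_eqI)
      (auto simp: lookup_sum lookup_single when_def in_keys_iff)
  have "P (\<Sum>k\<in>A. Poly_Mapping.single k (Poly_Mapping.lookup f k))" if "finite A" for A
    using that
  proof (induction A rule: finite_induct)
    case empty
    then show ?case using assms(1)[of 0 0] by simp
  next
    case (insert x F)
    then show ?case using assms by simp
  qed
  then show ?thesis using f finite_keys by metis
qed

lemma lookup_single_mult:
  fixes f :: laurent
  shows "Poly_Mapping.lookup (Poly_Mapping.single a v * f) k = v * Poly_Mapping.lookup f (k - a)"
proof (induction f rule: laurent_induct)
  case (single l x)
  then show ?case by (auto simp: mult_single lookup_single when_def)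
next
  case (add f g)
  then show ?case by (simp add: distrib_left lookup_add)
qed

lemma lookup_u [simp]: "Poly_Mapping.lookup (lp_u * f) k = Poly_Mapping.lookup f (k - 1)"
  by (simp add: lp_u_def lookup_single_mult)

lemma lookup_uinv [simp]: "Poly_Mapping.lookup (lp_uinv * f) k = Poly_Mapping.lookup f (k + 1)"
  by (simp add: lp_uinv_def lookup_single_mult)

lemma of_int_laurent: "(of_int n :: laurent) = Poly_Mapping.single 0 n"
  using single_of_int[of n, where ?'a = int and ?'b = int] by (simp del: single_of_int)

lemma lookup_of_int_mult [simp]:
  fixes f :: laurent
  shows "Poly_Mapping.lookup (of_int n * f) k = n * Poly_Mapping.lookup f k"
  using lookup_single_mult[of 0 n f k] by (simp add: of_int_laurent)

lemma u_uinv [simp]: "lp_u * lp_uinv = 1" "lp_uinv * lp_u = 1"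
  by (simp_all add: lp_u_def lp_uinv_def mult_single)

text \<open>The substitutions \<open>u \<mapsto> \<plusminus>u\<close>, \<open>u \<mapsto> u\<inverse>\<close> act on exponents and signs; both are instances of the
  following.\<close>
definition lp_sub :: "(int \<Rightarrow> int) \<Rightarrow> (int \<Rightarrow> int) \<Rightarrow> laurent \<Rightarrow> laurent" where
  "lp_sub e g f = Abs_poly_mapping (\<lambda>k. e k * Poly_Mapping.lookup f (g k))"

lemma lookup_lp_sub:
  assumes "inj g"
  shows "Poly_Mapping.lookup (lp_sub e g f) k = e k * Poly_Mapping.lookup f (g k)"
proof -
  have "finite (g -` {k. Poly_Mapping.lookup f k \<noteq> 0})"
    using assms by (intro finite_vimageI) auto
  then have "finite {k. e k * Poly_Mapping.lookup f (g k) \<noteq> 0}"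
    by (rule rev_finite_subset) auto
  then show ?thesis by (simp add: lp_sub_def)
qed

lemma lookup_lp_bar [simp]: "Poly_Mapping.lookup (lp_bar f) k = Poly_Mapping.lookup f (- k)"
  using lookup_lp_sub[of uminus "\<lambda>_. 1" f k] by (simp add: lp_sub_def lp_bar_def)

lemma lp_bar_add [simp]: "lp_bar (f + g) = lp_bar f + lp_bar g"
  by (rule poly_mapping_eqI) (simp add: lookup_add)

lemma lp_bar_diff [simp]: "lp_bar (f - g) = lp_bar f - lp_bar g"
  by (rule poly_mapping_eqI) (simp add: lookup_minus)

lemma lp_bar_0 [simp]: "lp_bar 0 = 0"
  by (rule poly_mapping_eqI) simp

lemma lp_bar_single [simp]: "lp_bar (Poly_Mapping.single k v) = Poly_Mapping.single (- k) v"
  by (rule poly_mapping_eqI) (auto simp: lookup_single when_def)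

lemma lp_bar_mult [simp]: "lp_bar (f * g) = lp_bar f * lp_bar g"
proof (induction f rule: laurent_induct)
  case (single k v)
  then show ?case
    by (induction g rule: laurent_induct) (simp_all add: mult_single distrib_left)
qed (simp add: distrib_right)

lemma lp_bar_sum [simp]: "lp_bar (sum f A) = (\<Sum>x\<in>A. lp_bar (f x))"
  by (induction A rule: infinite_finite_induct) auto

lemma lp_bar_u [simp]: "lp_bar lp_u = lp_uinv" "lp_bar lp_uinv = lp_u" "lp_bar 1 = 1"
  using lp_bar_single[of 0 1] by (simp_all add: lp_u_def lp_uinv_def)

lemma lp_bar_of_int [simp]: "lp_bar (of_int n) = of_int n"
  using lp_bar_single[of 0 n] by (simp add: of_int_laurent)

definition lp_neg :: "laurent \<Rightarrow> laurent" where
  "lp_neg = lp_sub (\<lambda>k. if even k then 1 else -1) (\<lambda>k. k)"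

lemma lookup_lp_neg [simp]:
  "Poly_Mapping.lookup (lp_neg f) k = (if even k then 1 else -1) * Poly_Mapping.lookup f k"
  by (simp add: lp_neg_def lookup_lp_sub)

lemma lp_neg_add [simp]: "lp_neg (f + g) = lp_neg f + lp_neg g"
  by (rule poly_mapping_eqI) (simp add: lookup_add)

lemma lp_neg_diff [simp]: "lp_neg (f - g) = lp_neg f - lp_neg g"
  by (rule poly_mapping_eqI) (simp add: lookup_minus)

lemma lp_neg_0 [simp]: "lp_neg 0 = 0"
  by (rule poly_mapping_eqI) simp

lemma lp_neg_single: "lp_neg (Poly_Mapping.single k v) = Poly_Mapping.single k ((if even k then 1 else -1) * v)"
  by (rule poly_mapping_eqI) (auto simp: lookup_single when_def)

lemma lp_neg_mult [simp]: "lp_neg (f * g) = lp_neg f * lp_neg g"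
proof (induction f rule: laurent_induct)
  case (single k v)
  then show ?case
    by (induction g rule: laurent_induct) (simp_all add: mult_single distrib_left lp_neg_single)
qed (simp add: distrib_right)

lemma lp_neg_sum [simp]: "lp_neg (sum f A) = (\<Sum>x\<in>A. lp_neg (f x))"
  by (induction A rule: infinite_finite_induct) auto

lemma lp_neg_u [simp]: "lp_neg lp_u = - lp_u" "lp_neg lp_uinv = - lp_uinv" "lp_neg 1 = 1"
  using lp_neg_single[of 0 1]
  by (simp_all add: lp_u_def lp_uinv_def lp_neg_single single_uminus)

lemma lp_neg_of_int [simp]: "lp_neg (of_int n) = of_int n"
  using lp_neg_single[of 0 n] by (simp add: of_int_laurent)

lemma lp_bar_neg: "lp_bar (lp_neg f) = lp_neg (lp_bar f)"
  by (rule poly_mapping_eqI) simp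

lemma neg_part_0 [simp]: "neg_part 0"
  by (simp add: neg_part_def)

lemma neg_part_add: "neg_part f \<Longrightarrow> neg_part g \<Longrightarrow> neg_part (f + g)"
  by (simp add: neg_part_def lookup_add)

lemma neg_part_diff: "neg_part f \<Longrightarrow> neg_part g \<Longrightarrow> neg_part (f - g)"
  by (simp add: neg_part_def lookup_minus)

lemma neg_part_sum: "(\<And>x. x \<in> A \<Longrightarrow> neg_part (f x)) \<Longrightarrow> neg_part (sum f A)"
  by (simp add: neg_part_def lookup_sum)

lemma neg_part_of_int_mult: "neg_part f \<Longrightarrow> neg_part (of_int n * f)"
  by (simp add: neg_part_def)

lemma neg_part_uinv_mult: "neg_part f \<Longrightarrow> neg_part (lp_uinv * f)"
  by (simp add: neg_part_def)

lemma neg_part_uinv: "neg_part lp_uinv"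
  by (simp add: neg_part_def lp_uinv_def lookup_single)

lemma neg_part_lp_neg: "neg_part f \<Longrightarrow> neg_part (lp_neg f)"
  by (simp add: neg_part_def)

lemma neg_part_mult: "neg_part f \<Longrightarrow> neg_part g \<Longrightarrow> neg_part (f * g)"
proof -
  have *: "neg_part ((\<Sum>k\<in>A. Poly_Mapping.single k (Poly_Mapping.lookup f k)) * g)"
    if "neg_part f" "neg_part g" "finite A" for A
    using that(3)
  proof (induction A rule: finite_induct)
    case (insert x F)
    have "neg_part (Poly_Mapping.single x (Poly_Mapping.lookup f x) * g)"
      using that by (cases "x \<ge> 0") (auto simp: neg_part_def lookup_single_mult)
    with insert show ?case by (simp add: distrib_right neg_part_add)
  qed simp
  have f: "f = (\<Sum>k\<in>Poly_Mapping.keys f. Poly_Mapping.single k (Poly_Mapping.lookup f k))"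
    by (rule poly_mapping_eqI)
      (auto simp: lookup_sum lookup_single when_def in_keys_iff)
  show "neg_part f \<Longrightarrow> neg_part g \<Longrightarrow> neg_part (f * g)"
    using *[of "Poly_Mapping.keys f"] f by simp
qed

text \<open>The coefficients at \<open>k\<close> and \<open>-k\<close> agree, and one of the two
  exponents is nonnegative. The uniqueness of the Kazhdan-Lusztig basis and its duality rest on
  this.\<close>

lemma bar_neg_part_zero: "lp_bar f = f \<Longrightarrow> neg_part f \<Longrightarrow> f = 0"
proof (rule poly_mapping_eqI)
  fix k assume f: "lp_bar f = f" "neg_part f"
  have "Poly_Mapping.lookup f k = Poly_Mapping.lookup f (- k)" by (metis f(1) lookup_lp_bar)
  then show "Poly_Mapping.lookup f k = Poly_Mapping.lookup 0 k"
    using f(2) by (cases "k \<ge> 0") (auto simp: neg_part_def)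
qed

section \<open>The Hecke algebra as a bimodule\<close>

abbreviation lq :: laurent where "lq \<equiv> lp_u - lp_uinv"

definition hsupp :: "nat \<Rightarrow> hecke \<Rightarrow> bool" where
  "hsupp r h \<longleftrightarrow> (\<forall>y. y \<notin> Sr r \<longrightarrow> h y = 0)"

definition Tb :: "(nat \<Rightarrow> nat) \<Rightarrow> hecke" where
  "Tb w = (\<lambda>y. if y = w then 1 else 0)"

lemma hone_Tb: "hone = Tb id"
  by (simp add: hone_def Tb_def)

lemma hsupp_Tb [simp]: "w \<in> Sr r \<Longrightarrow> hsupp r (Tb w)"
  by (auto simp: hsupp_def Tb_def)

lemma hsupp_eqI:
  "hsupp r f \<Longrightarrow> hsupp r g \<Longrightarrow> (\<And>y. y \<in> Sr r \<Longrightarrow> f y = g y) \<Longrightarrow> f = g"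
  by (rule ext) (metis hsupp_def)

lemma mulTs_at:
  assumes "y \<in> Sr r" "1 \<le> i"
  shows "mulTs i h y = h (y \<circ> sref i) + (if y (Suc i) < y i then lq * h y else 0)"
  using len_sref_less_iff[OF assms] by (simp add: mulTs_def)

lemma mulTsinv_at:
  assumes "y \<in> Sr r" "1 \<le> i"
  shows "mulTsinv i h y = h (y \<circ> sref i) - (if y (Suc i) < y i then 0 else lq * h y)"
  using mulTs_at[OF assms] by (simp add: mulTsinv_def)

lemma hsupp_mulTs [simp]: "1 \<le> i \<Longrightarrow> i < r \<Longrightarrow> hsupp r h \<Longrightarrow> hsupp r (mulTs i h)"
  by (simp add: hsupp_def mulTs_def)

lemma hsupp_mulTsinv [simp]: "1 \<le> i \<Longrightarrow> i < r \<Longrightarrow> hsupp r h \<Longrightarrow> hsupp r (mulTsinv i h)"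
  by (simp add: hsupp_def mulTs_def mulTsinv_def)

lemma mulTsinv_mulTs:
  assumes "1 \<le> i" "i < r" "hsupp r h" shows "mulTsinv i (mulTs i h) = h"
proof (rule hsupp_eqI)
  fix y assume y: "y \<in> Sr r"
  then have "y \<circ> sref i \<in> Sr r" using assms by simp
  note at = mulTsinv_at[OF y assms(1)] mulTs_at[OF y assms(1)] mulTs_at[OF this assms(1)]
  show "mulTsinv i (mulTs i h) y = h y"
    using Sr_inj[OF y, of i "Suc i"] by (auto simp: at)
qed (use assms in auto)

lemma mulTs_mulTsinv:
  assumes "1 \<le> i" "i < r" "hsupp r h" shows "mulTs i (mulTsinv i h) = h"
proof (rule hsupp_eqI)
  fix y assume y: "y \<in> Sr r"
  then have "y \<circ> sref i \<in> Sr r" using assms by simp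
  note at = mulTs_at[OF y assms(1)] mulTsinv_at[OF y assms(1)] mulTsinv_at[OF this assms(1)]
  show "mulTs i (mulTsinv i h) y = h y"
    using Sr_inj[OF y, of i "Suc i"] by (auto simp: at)
qed (use assms in auto)

lemma mulTs_sum: "mulTs i (\<lambda>y. \<Sum>x\<in>A. c x * f x y) = (\<lambda>y. \<Sum>x\<in>A. c x * mulTs i (f x) y)"
  by (rule ext) (simp add: mulTs_def sum.distrib distrib_left sum_distrib_left mult.left_commute)

lemma mulTsinv_sum: "mulTsinv i (\<lambda>y. \<Sum>x\<in>A. c x * f x y) = (\<lambda>y. \<Sum>x\<in>A. c x * mulTsinv i (f x) y)"
  by (rule ext)
    (simp add: mulTsinv_def mulTs_sum right_diff_distrib sum_subtractf sum_distrib_left mult.left_commute)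

lemma hsupp_expand: "hsupp r h \<Longrightarrow> h = (\<lambda>y. \<Sum>x\<in>Sr r. h x * Tb x y)"
proof
  fix y assume "hsupp r h"
  then show "h y = (\<Sum>x\<in>Sr r. h x * Tb x y)"
    by (cases "y \<in> Sr r") (auto simp: Tb_def hsupp_def if_distrib cong: if_cong)
qed

text \<open>The anti-automorphism \<open>T\<^sub>w \<mapsto> T\<close> of \<open>w\<inverse>\<close>; it turns right multiplication into left
  multiplication.\<close>
definition hinv :: "nat \<Rightarrow> hecke \<Rightarrow> hecke" where
  "hinv r h = (\<lambda>y. if y \<in> Sr r then h (inv y) else 0)"

definition lmulTs :: "nat \<Rightarrow> nat \<Rightarrow> hecke \<Rightarrow> hecke" where
  "lmulTs r i h = hinv r (mulTs i (hinv r h))"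

lemma hsupp_hinv [simp]: "hsupp r (hinv r h)"
  by (simp add: hsupp_def hinv_def)

lemma hinv_hinv: "hsupp r h \<Longrightarrow> hinv r (hinv r h) = h"
  by (rule ext) (simp add: hinv_def hsupp_def Sr_inv Sr_inv_inv)

lemma hsupp_lmulTs [simp]: "hsupp r (lmulTs r i h)"
  by (simp add: lmulTs_def)

lemma lmulTs_at:
  assumes "y \<in> Sr r" "1 \<le> i" "i < r"
  shows "lmulTs r i h y = h (sref i \<circ> y) + (if inv y (Suc i) < inv y i then lq * h y else 0)"
proof -
  have "inv y \<circ> sref i \<in> Sr r" using assms by (simp add: Sr_inv)
  then show ?thesis
    using mulTs_at[OF Sr_inv[OF assms(1)] assms(2), of "hinv r h"] assms
    by (simp add: lmulTs_def hinv_def Sr_inv Sr_inv_inv inv_comp_sref[OF Sr_inv[OF assms(1)]])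
qed

text \<open>\<open>sref a\<close> can reverse the order of the values at \<open>b\<close> and
  \<open>Suc b\<close> only if these values are \<open>a\<close> and \<open>Suc a\<close>, and then
  both products coincide.\<close>

lemma sref_comp_less_iff:
  assumes "y \<in> Sr r" "sref a \<circ> y \<noteq> y \<circ> sref b"
  shows "sref a (y (Suc b)) < sref a (y b) \<longleftrightarrow> y (Suc b) < y b"
proof -
  have ne: "(y b, y (Suc b)) \<noteq> (a, Suc a)" "(y (Suc b), y b) \<noteq> (a, Suc a)"
  proof -
    have "sref a \<circ> y = y \<circ> sref b" if yy: "y b \<in> {a, Suc a}" "y (Suc b) \<in> {a, Suc a}"
    proof
      fix k
      have "y b \<noteq> y (Suc b)" using Sr_inj[OF assms(1)] by simp
      consider "y b = a" "y (Suc b) = Suc a" | "y b = Suc a" "y (Suc b) = a"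
        using yy \<open>y b \<noteq> y (Suc b)\<close> by auto
      then show "(sref a \<circ> y) k = (y \<circ> sref b) k"
        using Sr_inj[OF assms(1), of k b] Sr_inj[OF assms(1), of k "Suc b"]
        by cases (cases "k = b"; cases "k = Suc b"; simp)+
    qed
    with assms(2) show "(y b, y (Suc b)) \<noteq> (a, Suc a)" "(y (Suc b), y b) \<noteq> (a, Suc a)" by auto
  qed
  then show ?thesis
    using sref_less_iff[of "y b" "y (Suc b)" a] sref_less_iff[of "y (Suc b)" "y b" a]
      Sr_inj[OF assms(1), of b "Suc b"] by (metis less_asym linorder_neqE_nat n_not_Suc_n)
qed

text \<open>In the exceptional case the values \<open>a\<close>, \<open>Suc a\<close> occupy the
  positions \<open>b\<close>, \<open>Suc b\<close>, so one and the same inversion decides both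
  comparisons.\<close>

lemma sref_comp_eq_less_iff:
  assumes "y \<in> Sr r" "sref a \<circ> y = y \<circ> sref b"
  shows "inv y (Suc a) < inv y a \<longleftrightarrow> y (Suc b) < y b"
proof -
  have e: "sref a (y b) = y (Suc b)" using fun_cong[OF assms(2), of b] by simp
  have iy: "inv y (y k) = k" for k using Sr_bij[OF assms(1)] by (simp add: bij_is_inj inv_f_f)
  have ne: "y b \<noteq> y (Suc b)" using Sr_inj[OF assms(1)] by simp
  consider "y b = a" | "y b = Suc a" using e ne by (metis sref_simps(3))
  then show ?thesis
  proof cases
    case 1 then have "y (Suc b) = Suc a" using e by simp
    then show ?thesis using 1 iy by (metis not_less_iff_gr_or_eq lessI)
  next
    case 2 then have "y (Suc b) = a" using e by simp
    then show ?thesis using 2 iy by (metis lessI)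
  qed
qed

text \<open>Associativity, coefficientwise. In general the left factor leaves the right descent at
  \<open>b\<close> alone and the right factor leaves the left descent at \<open>a\<close> alone;
  when \<open>sref a \<circ> y = y \<circ> sref b\<close> the two descents agree and the sums match
  term by term.\<close>

lemma lmulTs_mulTs:
  assumes a: "1 \<le> a" "a < r" and b: "1 \<le> b" "b < r" and h: "hsupp r h"
  shows "lmulTs r a (mulTs b h) = mulTs b (lmulTs r a h)"
proof (rule hsupp_eqI)
  fix y assume y: "y \<in> Sr r"
  have ay: "sref a \<circ> y \<in> Sr r" and yb: "y \<circ> sref b \<in> Sr r" using y a b by simp_all
  have L: "lmulTs r a (mulTs b h) y = h (sref a \<circ> y \<circ> sref b)
      + (if sref a (y (Suc b)) < sref a (y b) then lq * h (sref a \<circ> y) else 0)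
      + (if inv y (Suc a) < inv y a then lq * (h (y \<circ> sref b) + (if y (Suc b) < y b then lq * h y else 0)) else 0)"
    by (simp add: lmulTs_at[OF y a] mulTs_at[OF ay b(1)] mulTs_at[OF y b(1)] comp_assoc)
  have R: "mulTs b (lmulTs r a h) y = h (sref a \<circ> y \<circ> sref b)
      + (if sref b (inv y (Suc a)) < sref b (inv y a) then lq * h (y \<circ> sref b) else 0)
      + (if y (Suc b) < y b then lq * (h (sref a \<circ> y) + (if inv y (Suc a) < inv y a then lq * h y else 0)) else 0)"
    by (simp add: mulTs_at[OF y b(1)] lmulTs_at[OF yb a] lmulTs_at[OF y a] comp_assoc
        inv_comp_sref[OF y])
  show "lmulTs r a (mulTs b h) y = mulTs b (lmulTs r a h) y"
  proof (cases "sref a \<circ> y = y \<circ> sref b")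
    case False
    have "sref b \<circ> inv y \<noteq> inv y \<circ> sref a"
      using False inv_comp_sref[OF y, of b] inv_sref_comp[OF y, of a] Sr_inv_inv[OF ay] Sr_inv_inv[OF yb]
      by metis
    then show ?thesis
      unfolding L R using sref_comp_less_iff[OF y False] sref_comp_less_iff[OF Sr_inv[OF y], of b a]
      by (simp add: algebra_simps)
  next
    case True
    note c = sref_comp_eq_less_iff[OF y True]
    have e: "sref a (y k) = y (sref b k)" for k using fun_cong[OF True, of k] by simp
    have "sref b \<circ> inv y = inv y \<circ> sref a"
      using True inv_comp_sref[OF y, of b] inv_sref_comp[OF y, of a] by metis
    then have e': "sref b (inv y k) = inv y (sref a k)" for k by (metis comp_apply)
    have "inv y a \<noteq> inv y (Suc a)" using Sr_inj[OF Sr_inv[OF y]] by simp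
    moreover have "y b \<noteq> y (Suc b)" using Sr_inj[OF y] by simp
    ultimately show ?thesis
      unfolding L R e e' True using c by (auto simp: algebra_simps)
  qed
qed (use a b h in auto)

section \<open>Reduced words and the bar involution\<close>

definition wprod :: "nat list \<Rightarrow> nat \<Rightarrow> nat" where
  "wprod xs = fold (\<lambda>i w. w \<circ> sref i) xs id"

lemma wprod_simps: "wprod [] = id" "wprod (xs @ [i]) = wprod xs \<circ> sref i"
  by (simp_all add: wprod_def)

lemma wprod_Cons: "wprod (i # xs) = sref i \<circ> wprod xs"
proof (induction xs rule: rev_induct)
  case Nil show ?case using wprod_simps(2)[of "[]" i] by (simp add: wprod_simps(1))
next
  case (snoc j xs)
  then show ?case using wprod_simps(2)[of "i # xs" j] wprod_simps(2)[of xs j] by (simp add: comp_assoc)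
qed

lemma wprod_Sr: "set xs \<subseteq> {1..<r} \<Longrightarrow> wprod xs \<in> Sr r"
proof (induction xs rule: rev_induct)
  case Nil show ?case by (simp only: wprod_simps Sr_id)
next
  case (snoc i xs)
  then have "1 \<le> i" "i < r" "wprod xs \<in> Sr r" by auto
  then show ?case by (simp only: wprod_simps Sr_sref)
qed

lemma wprod_rev: "set xs \<subseteq> {1..<r} \<Longrightarrow> wprod (rev xs) = inv (wprod xs)"
proof (induction xs rule: rev_induct)
  case Nil show ?case by (simp only: wprod_simps rev.simps inv_id)
next
  case (snoc i xs)
  then have IH: "wprod (rev xs) = inv (wprod xs)" by simp
  have "wprod xs \<in> Sr r" using wprod_Sr snoc by auto
  from inv_comp_sref[OF this, of i] show ?case
    by (simp only: wprod_simps rev_append rev.simps append.simps wprod_Cons IH)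
qed

definition redw :: "nat \<Rightarrow> nat list \<Rightarrow> (nat \<Rightarrow> nat) \<Rightarrow> bool" where
  "redw r xs w \<longleftrightarrow> set xs \<subseteq> {1..<r} \<and> wprod xs = w \<and> len w = length xs"

lemma len_sref_le: "w \<in> Sr n \<Longrightarrow> 1 \<le> i \<Longrightarrow> len (w \<circ> sref i) \<le> Suc (len w)"
  using len_sref_up[of w n i] len_sref_down[of w n i] Sr_inj[of w n i "Suc i"]
  by (cases "w i < w (Suc i)") simp_all

lemma len_wprod_le: "set xs \<subseteq> {1..<r} \<Longrightarrow> len (wprod xs) \<le> length xs"
proof (induction xs rule: rev_induct)
  case Nil show ?case by (simp only: wprod_simps len_id)
next
  case (snoc i xs)
  then have "wprod xs \<in> Sr r" "1 \<le> i" "len (wprod xs) \<le> length xs" using wprod_Sr by auto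
  moreover from len_sref_le[OF this(1,2)] this(3) have "len (wprod xs \<circ> sref i) \<le> Suc (length xs)"
    by (rule le_trans[OF _ Suc_leI[OF le_imp_less_Suc]])
  ultimately show ?case by (simp only: wprod_simps length_append_singleton)
qed

text \<open>A last letter that did not increase the length would leave \<open>w\<close> shorter than
  the number of letters.\<close>

lemma redw_snoc: "redw r (xs @ [i]) w \<Longrightarrow>
  redw r xs (w \<circ> sref i) \<and> 1 \<le> i \<and> i < r \<and> (w \<circ> sref i) i < (w \<circ> sref i) (Suc i) \<and> w \<circ> sref i \<in> Sr r"
proof -
  assume a: "redw r (xs @ [i]) w"
  then have s: "set xs \<subseteq> {1..<r}" "1 \<le> i" "i < r" and w: "w = wprod xs \<circ> sref i"
    and l: "len w = Suc (length xs)"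
    by (auto simp: redw_def wprod_simps(2))
  have S: "wprod xs \<in> Sr r" using wprod_Sr s by blast
  have "wprod xs i < wprod xs (Suc i)"
  proof (rule ccontr)
    assume "\<not> ?thesis"
    then have "wprod xs (Suc i) < wprod xs i" using Sr_inj[OF S, of i "Suc i"] by linarith
    from len_sref_down[OF S this s(2)] len_wprod_le[OF s(1)] l w show False by simp
  qed
  moreover from len_sref_up[OF S this] l w have "len (wprod xs) = length xs" by simp
  ultimately show ?thesis using s S by (simp add: w redw_def)
qed

lemma redw_Nil: "redw r [] w \<longleftrightarrow> w = id"
proof
  assume "redw r [] w" then show "w = id" unfolding redw_def wprod_simps by metis
next
  assume "w = id" then show "redw r [] w" unfolding redw_def wprod_simps by (simp only: len_id) auto
qed

lemma redw_snocI:
  "redw r xs w \<Longrightarrow> 1 \<le> i \<Longrightarrow> i < r \<Longrightarrow> w i < w (Suc i) \<Longrightarrow> redw r (xs @ [i]) (w \<circ> sref i)"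
  using len_sref_up[of w r i] wprod_Sr[of xs r] unfolding redw_def wprod_simps by fastforce

lemma redw_Sr: "redw r xs w \<Longrightarrow> w \<in> Sr r"
  using wprod_Sr by (auto simp: redw_def)

lemma redw_rev: "redw r xs w \<Longrightarrow> redw r (rev xs) (inv w)"
  using wprod_rev[of xs r] len_inv[of w r] redw_Sr[of r xs w] by (auto simp: redw_def)

lemma mulTs_Tb_up:
  assumes "w \<in> Sr r" "1 \<le> i" "i < r" "w i < w (Suc i)"
  shows "mulTs i (Tb w) = Tb (w \<circ> sref i)"
proof (rule hsupp_eqI[where r = r])
  fix y assume y: "y \<in> Sr r"
  have "y \<circ> sref i = w \<longleftrightarrow> y = w \<circ> sref i" by (metis comp_sref_sref)
  then show "mulTs i (Tb w) y = Tb (w \<circ> sref i) y"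
    using assms by (auto simp: mulTs_at[OF y assms(2)] Tb_def)
qed (use assms in auto)

lemma lmulTs_Tb_up:
  assumes "w \<in> Sr r" "1 \<le> i" "i < r" "inv w i < inv w (Suc i)"
  shows "lmulTs r i (Tb w) = Tb (sref i \<circ> w)"
proof (rule hsupp_eqI[where r = r])
  fix y assume y: "y \<in> Sr r"
  have "sref i \<circ> y = w \<longleftrightarrow> y = sref i \<circ> w" by (metis comp_assoc sref_comp id_comp)
  then show "lmulTs r i (Tb w) y = Tb (sref i \<circ> w) y"
    using assms by (auto simp: lmulTs_at[OF y assms(2,3)] Tb_def)
qed (use assms in auto)

lemma hsupp_fold_mulTs: "set xs \<subseteq> {1..<r} \<Longrightarrow> hsupp r h \<Longrightarrow> hsupp r (fold mulTs xs h)"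
  by (induction xs arbitrary: h) auto

lemma hsupp_fold_mulTsinv: "set xs \<subseteq> {1..<r} \<Longrightarrow> hsupp r h \<Longrightarrow> hsupp r (fold mulTsinv xs h)"
  by (induction xs arbitrary: h) auto

lemma fold_mulTs_hone: "redw r xs w \<Longrightarrow> fold mulTs xs hone = Tb w"
proof (induction xs arbitrary: w rule: rev_induct)
  case Nil then show ?case unfolding redw_Nil fold_simps hone_Tb by metis
next
  case (snoc i xs)
  note s = redw_snoc[OF snoc.prems]
  then have "fold mulTs xs hone = Tb (w \<circ> sref i)" using snoc.IH by blast
  then show ?case using mulTs_Tb_up[of "w \<circ> sref i" r i] s by simp
qed

lemma fold_mulTs_sum:
  "fold mulTs xs (\<lambda>y. \<Sum>x\<in>A. c x * f x y) = (\<lambda>y. \<Sum>x\<in>A. c x * fold mulTs xs (f x) y)"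
  by (induction xs arbitrary: f) (simp_all add: mulTs_sum)

lemma fold_mulTs_lmulTs:
  assumes "set xs \<subseteq> {1..<r}" "1 \<le> a" "a < r" "hsupp r h"
  shows "fold mulTs xs (lmulTs r a h) = lmulTs r a (fold mulTs xs h)"
  using assms(1,4)
proof (induction xs arbitrary: h)
  case (Cons b xs)
  then have "fold mulTs xs (lmulTs r a (mulTs b h)) = lmulTs r a (fold mulTs xs (mulTs b h))" by simp
  moreover have "lmulTs r a (mulTs b h) = mulTs b (lmulTs r a h)"
    using Cons assms(2,3) by (intro lmulTs_mulTs) auto
  ultimately show ?case by simp
qed simp

text \<open>Left multiplications act transitively on the basis and commute with right
  multiplications, so a product of right multiplications is determined by its value at 1.\<close>
lemma fold_mulTs_unique:
  assumes "redw r xs w" "redw r ys w" "hsupp r h"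
  shows "fold mulTs xs h = fold mulTs ys h"
proof -
  have s: "set xs \<subseteq> {1..<r}" "set ys \<subseteq> {1..<r}" using assms by (auto simp: redw_def)
  have Tb: "fold mulTs xs (Tb (inv v)) = fold mulTs ys (Tb (inv v))" if "v \<in> Sr r" for v
    using that
  proof (induction rule: Sr_induct)
    case id
    then show ?case using fold_mulTs_hone[OF assms(1)] fold_mulTs_hone[OF assms(2)]
      by (simp add: hone_Tb id_def)
  next
    case (step w i)
    have iw: "inv w \<in> Sr r" using step Sr_inv by blast
    have "Tb (inv (w \<circ> sref i)) = lmulTs r i (Tb (inv w))"
      using lmulTs_Tb_up[OF iw, of i] step Sr_inv_inv[of w r] inv_comp_sref[of w r i] by simp
    then show "fold mulTs xs (Tb (inv (w \<circ> sref i))) = fold mulTs ys (Tb (inv (w \<circ> sref i)))"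
      using step fold_mulTs_lmulTs[OF s(1), of i "Tb (inv w)"] fold_mulTs_lmulTs[OF s(2), of i "Tb (inv w)"] iw
      by simp
  qed
  have Tb: "fold mulTs xs (Tb v) = fold mulTs ys (Tb v)" if "v \<in> Sr r" for v
    using Tb[OF Sr_inv[OF that]] Sr_inv_inv[OF that] by simp
  have "fold mulTs xs (\<lambda>y. \<Sum>x\<in>Sr r. h x * Tb x y) = fold mulTs ys (\<lambda>y. \<Sum>x\<in>Sr r. h x * Tb x y)"
    by (simp add: fold_mulTs_sum Tb)
  then show ?thesis using hsupp_expand[OF assms(3)] by simp
qed

lemma fold_mulTs_rev_mulTsinv:
  "set xs \<subseteq> {1..<r} \<Longrightarrow> hsupp r h \<Longrightarrow> fold mulTs (rev xs) (fold mulTsinv xs h) = h"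
  by (induction xs arbitrary: h) (auto simp: mulTs_mulTsinv[where r = r])

lemma fold_mulTsinv_mulTs_rev:
  "set xs \<subseteq> {1..<r} \<Longrightarrow> hsupp r h \<Longrightarrow> fold mulTsinv xs (fold mulTs (rev xs) h) = h"
proof (induction xs arbitrary: h rule: rev_induct)
  case (snoc i xs)
  then show ?case by (simp add: mulTsinv_mulTs[where r = r])
qed simp

text \<open>Multiplying by inverses along a word is undone by multiplying along the reversed word.
  Both reversed words are reduced words of \<open>inv w\<close>, so the uniqueness for
  \<open>mulTs\<close> transfers.\<close>

lemma fold_mulTsinv_unique:
  assumes "redw r xs w" "redw r ys w" "hsupp r h"
  shows "fold mulTsinv xs h = fold mulTsinv ys h"
proof -
  have s: "set xs \<subseteq> {1..<r}" "set ys \<subseteq> {1..<r}" using assms by (auto simp: redw_def)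
  have hy: "hsupp r (fold mulTsinv ys h)" using hsupp_fold_mulTsinv s assms by blast
  have "fold mulTs (rev xs) (fold mulTsinv ys h) = fold mulTs (rev ys) (fold mulTsinv ys h)"
    by (rule fold_mulTs_unique[OF redw_rev[OF assms(1)] redw_rev[OF assms(2)] hy])
  also have "\<dots> = h" using fold_mulTs_rev_mulTsinv s assms by blast
  finally show ?thesis using fold_mulTsinv_mulTs_rev[OF s(1) hy] by simp
qed

lemma barT_word:
  assumes "w \<in> Sr r" shows "\<exists>xs. redw r xs w \<and> barT w = fold mulTsinv xs hone"
  using assms
proof (induction "len w" arbitrary: w)
  case 0
  then have "w = id" using len_eq_0_iff by metis
  moreover have "barT id = hone" by (simp add: barT_def)
  ultimately show ?case by (intro exI[of _ "[]"]) (metis redw_Nil fold_simps(1))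
next
  case (Suc n)
  then have "w \<noteq> id" by auto
  note d = desc_props[OF Suc.prems this]
  let ?v = "w \<circ> sref (desc w)"
  have v: "?v \<in> Sr r" using d Suc.prems by simp
  have lv: "len ?v = n" using len_sref_down[OF Suc.prems d(3) d(1)] Suc.hyps(2) by simp
  then obtain xs where xs: "redw r xs ?v" "barT ?v = fold mulTsinv xs hone"
    using Suc.hyps(1) v by blast
  have "redw r (xs @ [desc w]) (?v \<circ> sref (desc w))"
    using d by (intro redw_snocI xs) auto
  moreover have "barT w = mulTsinv (desc w) (barT ?v)"
    by (simp add: barT_def Suc.hyps(2)[symmetric] lv)
  ultimately show ?case using xs by (intro exI[of _ "xs @ [desc w]"]) simp
qed

text \<open>Removes the dependence of \<open>barT\<close> on the descents picked by
  \<open>desc\<close>: these spell one reduced word, and all reduced words give the same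
  product.\<close>

lemma barT_redw:
  assumes "redw r xs w" shows "barT w = fold mulTsinv xs hone"
proof -
  obtain ys where ys: "redw r ys w" "barT w = fold mulTsinv ys hone"
    using barT_word[OF redw_Sr[OF assms]] by blast
  have "hsupp r hone" by (simp only: hone_Tb hsupp_Tb Sr_id)
  from fold_mulTsinv_unique[OF ys(1) assms this] ys(2) show ?thesis by simp
qed

lemma hsupp_barT [simp]: "w \<in> Sr r \<Longrightarrow> hsupp r (barT w)"
  using barT_word[of w r] hsupp_fold_mulTsinv[of _ r hone] by (auto simp: redw_def hone_Tb)

lemma barT_id [simp]: "barT id = Tb id"
  using barT_redw[of 0 "[]" id] by (simp add: redw_Nil hone_Tb)

lemma barT_up:
  assumes "w \<in> Sr r" "1 \<le> i" "i < r" "w i < w (Suc i)"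
  shows "barT (w \<circ> sref i) = mulTsinv i (barT w)"
proof -
  obtain xs where "redw r xs w" "barT w = fold mulTsinv xs hone" using barT_word assms by blast
  with barT_redw[OF redw_snocI[of r xs w i]] assms show ?thesis by simp
qed

text \<open>The bar involution is unitriangular for the length: an inverse generator only mixes the
  coefficients at \<open>x\<close> and \<open>x \<circ> sref i\<close>, whose lengths differ by
  one.\<close>

lemma barT_supp:
  assumes "w \<in> Sr r"
  shows "barT w w = 1 \<and> (\<forall>x. barT w x \<noteq> 0 \<longrightarrow> x = w \<or> len x < len w)"
  using assms
proof (induction rule: Sr_induct)
  case id show "barT id id = 1 \<and> (\<forall>x. barT id x \<noteq> 0 \<longrightarrow> x = id \<or> len x < len id)"
    by (simp only: barT_id) (simp add: Tb_def)
next
  case (step w i)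
  have ws: "w \<circ> sref i \<in> Sr r" using step by simp
  note l = len_sref_up[OF step(1,4)]
  show "barT (w \<circ> sref i) (w \<circ> sref i) = 1 \<and>
    (\<forall>x. barT (w \<circ> sref i) x \<noteq> 0 \<longrightarrow> x = w \<circ> sref i \<or> len x < len (w \<circ> sref i))"
  proof (intro conjI allI impI)
    show "barT (w \<circ> sref i) (w \<circ> sref i) = 1"
      using step by (simp add: barT_up[OF step(1-4)] mulTsinv_at[OF ws])
    fix x assume nz: "barT (w \<circ> sref i) x \<noteq> 0"
    then have x: "x \<in> Sr r" using hsupp_barT[OF ws] by (auto simp: hsupp_def)
    have "barT w (x \<circ> sref i) \<noteq> 0 \<or> barT w x \<noteq> 0"
      using nz by (auto simp: barT_up[OF step(1-4)] mulTsinv_at[OF x step(2)] split: if_splits)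
    then show "x = w \<circ> sref i \<or> len x < len (w \<circ> sref i)"
    proof
      assume "barT w (x \<circ> sref i) \<noteq> 0"
      then consider "x \<circ> sref i = w" | "len (x \<circ> sref i) < len w" using step(5) by blast
      then show ?thesis
      proof cases
        case 1 then show ?thesis by (metis comp_sref_sref)
      next
        case 2
        then show ?thesis using l len_sref_up[OF x, of i] len_sref_down[OF x, of i] step(2)
            Sr_inj[OF x, of i "Suc i"] by (cases "x i < x (Suc i)") auto
      qed
    next
      assume "barT w x \<noteq> 0"
      then show ?thesis using step(5) l by fastforce
    qed
  qed
qed

lemma hsupp_hbar [simp]: "hsupp r (hbar r h)"
  unfolding hsupp_def hbar_def
proof (intro allI impI sum.neutral ballI)
  fix y w assume "y \<notin> Sr r" "w \<in> Sr r"
  then have "barT w y = 0" using hsupp_barT[of w r] by (simp add: hsupp_def)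
  then show "lp_bar (h w) * barT w y = 0" by simp
qed

lemma hbar_diff: "hbar r (\<lambda>y. f y - g y) = (\<lambda>y. hbar r f y - hbar r g y)"
  by (rule ext) (simp add: hbar_def left_diff_distrib sum_subtractf)

lemma hbar_add: "hbar r (\<lambda>y. f y + g y) = (\<lambda>y. hbar r f y + hbar r g y)"
  by (rule ext) (simp add: hbar_def distrib_right sum.distrib)

lemma hbar_scale: "hbar r (\<lambda>y. c * f y) = (\<lambda>y. lp_bar c * hbar r f y)"
  by (rule ext) (simp add: hbar_def sum_distrib_left mult.assoc)

lemma hbar_sum: "hbar r (\<lambda>y. \<Sum>x\<in>A. f x y) = (\<lambda>y. \<Sum>x\<in>A. hbar r (f x) y)"
  by (rule ext) (simp add: hbar_def sum_distrib_right sum.swap[of _ "Sr r"])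

lemma hbar_Tb: "w \<in> Sr r \<Longrightarrow> hbar r (Tb w) = barT w"
  by (rule ext) (simp add: hbar_def Tb_def if_distrib[of lp_bar] if_distrib[of "\<lambda>x. x * _"] cong: if_cong)

lemma barT_mulTsinv:
  assumes "w \<in> Sr r" "1 \<le> i" "i < r"
  shows "mulTsinv i (barT w) y = barT (w \<circ> sref i) y - (if w (Suc i) < w i then lq * barT w y else 0)"
proof (cases "w (Suc i) < w i")
  case True
  let ?v = "w \<circ> sref i"
  have v: "?v \<in> Sr r" "?v i < ?v (Suc i)" using assms True by simp_all
  have w: "barT w = mulTsinv i (barT ?v)" using barT_up[OF v(1) assms(2,3) v(2)] by (simp only: comp_sref_sref)
  have "mulTsinv i (barT w) y = mulTs i (barT w) y - lq * barT w y" by (simp add: mulTsinv_def)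
  also have "mulTs i (barT w) = barT ?v" unfolding w
    by (rule mulTs_mulTsinv[OF assms(2,3)]) (use v in simp)
  finally show ?thesis using True by simp
next
  case False
  then have "w i < w (Suc i)" using Sr_inj[OF assms(1), of i "Suc i"] by linarith
  then show ?thesis using barT_up[OF assms] by simp
qed

lemma Sr_reindex:
  assumes "1 \<le> i" "i < r"
  shows "(\<Sum>w\<in>Sr r. f (w \<circ> sref i)) = (\<Sum>w\<in>Sr r. f w)"
proof (rule sum.reindex_bij_betw)
  show "bij_betw (\<lambda>w. w \<circ> sref i) (Sr r) (Sr r)"
    by (rule bij_betwI[where g = "\<lambda>w. w \<circ> sref i"]) (use assms in auto)
qed

text \<open>The generator case of the multiplicativity of the bar involution. Reindexing the shifted
  part of the sum by \<open>w \<mapsto> w \<circ> sref i\<close> leaves, for each \<open>w\<close>,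
  the expression computed in \<open>barT_mulTsinv\<close>.\<close>

lemma hbar_mulTs:
  assumes h: "hsupp r h" and i: "1 \<le> i" "i < r"
  shows "hbar r (mulTs i h) = mulTsinv i (hbar r h)"
proof
  fix y
  have "hbar r (mulTs i h) y
     = (\<Sum>w\<in>Sr r. lp_bar (h (w \<circ> sref i)) * barT w y)
       + (\<Sum>w\<in>Sr r. (if w (Suc i) < w i then - lq * lp_bar (h w) else 0) * barT w y)"
    unfolding hbar_def sum.distrib[symmetric]
    by (rule sum.cong) (auto simp: mulTs_at[OF _ i(1)] algebra_simps)
  also have "(\<Sum>w\<in>Sr r. lp_bar (h (w \<circ> sref i)) * barT w y)
     = (\<Sum>w\<in>Sr r. lp_bar (h w) * barT (w \<circ> sref i) y)"
    using Sr_reindex[OF i, of "\<lambda>w. lp_bar (h (w \<circ> sref i)) * barT w y"] by (simp add: comp_assoc)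
  also have "(\<Sum>w\<in>Sr r. lp_bar (h w) * barT (w \<circ> sref i) y)
       + (\<Sum>w\<in>Sr r. (if w (Suc i) < w i then - lq * lp_bar (h w) else 0) * barT w y)
     = (\<Sum>w\<in>Sr r. lp_bar (h w) * mulTsinv i (barT w) y)"
    unfolding sum.distrib[symmetric]
    by (rule sum.cong) (auto simp: barT_mulTsinv[OF _ i] algebra_simps)
  also have "\<dots> = mulTsinv i (hbar r h) y"
    using fun_cong[OF mulTsinv_sum[of i "\<lambda>w. lp_bar (h w)" barT "Sr r"], of y] by (simp add: hbar_def[abs_def])
  finally show "hbar r (mulTs i h) y = mulTsinv i (hbar r h) y" .
qed

lemma hbar_mulTsinv:
  assumes h: "hsupp r h" and i: "1 \<le> i" "i < r"
  shows "hbar r (mulTsinv i h) = mulTs i (hbar r h)"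
  using hbar_mulTs[OF hsupp_mulTsinv[OF i h] i] mulTs_mulTsinv[OF i h]
    mulTs_mulTsinv[OF i hsupp_hbar] by metis

lemma hbar_top:
  assumes "x \<in> Sr r" "\<And>v. v \<in> Sr r \<Longrightarrow> len x < len v \<Longrightarrow> h v = 0"
  shows "hbar r h x = lp_bar (h x)"
proof -
  have "hbar r h x = (\<Sum>w\<in>Sr r. if w = x then lp_bar (h x) else 0)"
    unfolding hbar_def
  proof (rule sum.cong)
    fix w assume w: "w \<in> Sr r"
    show "lp_bar (h w) * barT w x = (if w = x then lp_bar (h x) else 0)"
      using barT_supp[OF w] assms(2)[OF w] by (cases "w = x"; cases "barT w x = 0") auto
  qed simp
  then show ?thesis using assms(1) by simp
qed

section \<open>The Kazhdan--Lusztig basis\<close>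

abbreviation rdesc :: "(nat \<Rightarrow> nat) \<Rightarrow> nat \<Rightarrow> bool" where
  "rdesc w i \<equiv> w (Suc i) < w i"

definition isKL :: "nat \<Rightarrow> (nat \<Rightarrow> nat) \<Rightarrow> hecke \<Rightarrow> bool" where
  "isKL r w h \<longleftrightarrow> hsupp r h \<and> hbar r h = h \<and> (\<forall>x. neg_part (h x - (if x = w then 1 else 0)))"

text \<open>At a longest element of the support the bar involution merely conjugates the
  coefficient, which is therefore symmetric and has only negative exponents.\<close>

lemma bar_inv_neg_part_zero:
  assumes "hsupp r g" "hbar r g = g" "\<And>x. neg_part (g x)"
  shows "g = (\<lambda>_. 0)"
proof (rule ccontr)
  assume "g \<noteq> (\<lambda>_. 0)"
  define B where "B = {x \<in> Sr r. g x \<noteq> 0}"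
  have fin: "finite B" "B \<noteq> {}" using \<open>g \<noteq> _\<close> assms(1) by (auto simp: B_def hsupp_def fun_eq_iff)
  define n where "n = Max (len ` B)"
  have "n \<in> len ` B" unfolding n_def by (rule Max_in) (use fin in auto)
  then obtain x where x: "x \<in> B" "len x = n" by auto
  have "g v = 0" if "v \<in> Sr r" "len x < len v" for v
  proof (rule ccontr)
    assume "g v \<noteq> 0"
    then have "len v \<le> n" unfolding n_def using that fin by (intro Max_ge) (auto simp: B_def)
    then show False using that x by simp
  qed
  then have "hbar r g x = lp_bar (g x)" using x by (intro hbar_top) (auto simp: B_def)
  then have "g x = 0" using assms(2,3) bar_neg_part_zero by metis
  then show False using x by (simp add: B_def)
qed

lemma isKL_unique:
  assumes "isKL r w h" "isKL r w g" shows "h = g"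
proof -
  have "(\<lambda>x. h x - g x) = (\<lambda>_. 0)"
  proof (rule bar_inv_neg_part_zero)
    show "hsupp r (\<lambda>x. h x - g x)" "hbar r (\<lambda>x. h x - g x) = (\<lambda>x. h x - g x)"
      using assms by (auto simp: isKL_def hsupp_def hbar_diff)
    fix x
    have "neg_part ((h x - (if x = w then 1 else 0)) - (g x - (if x = w then 1 else 0)))"
      using assms unfolding isKL_def by (blast intro: neg_part_diff)
    then show "neg_part (h x - g x)" by simp
  qed
  then show ?thesis by (simp add: fun_eq_iff)
qed

lemma Cp_eqI: "isKL r w h \<Longrightarrow> Cp r w = h"
  unfolding Cp_def
  by (rule the_equality) (auto simp: isKL_def hsupp_def intro: isKL_unique[unfolded isKL_def hsupp_def])

text \<open>Right multiplication by \<open>C'\<close> of a simple reflection, \<open>T\<^sub>s + u\<inverse>\<close>.\<close>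
definition mulC :: "nat \<Rightarrow> hecke \<Rightarrow> hecke" where
  "mulC i h = (\<lambda>y. mulTs i h y + lp_uinv * h y)"

lemma mulC_at:
  assumes "y \<in> Sr r" "1 \<le> i"
  shows "mulC i h y = h (y \<circ> sref i) + (if rdesc y i then lp_u else lp_uinv) * h y"
  by (simp add: mulC_def mulTs_at[OF assms] algebra_simps)

lemma hsupp_mulC [simp]: "1 \<le> i \<Longrightarrow> i < r \<Longrightarrow> hsupp r h \<Longrightarrow> hsupp r (mulC i h)"
  using hsupp_mulTs[of i r h] by (simp add: mulC_def hsupp_def)

lemma mulC_sum: "mulC i (\<lambda>y. \<Sum>x\<in>A. c x * f x y) = (\<lambda>y. \<Sum>x\<in>A. c x * mulC i (f x) y)"
  unfolding mulC_def mulTs_sum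
  by (rule ext) (simp add: sum.distrib distrib_left sum_distrib_left mult.left_commute)

lemma mulC_diff: "mulC i (\<lambda>y. f y - g y) = (\<lambda>y. mulC i f y - mulC i g y)"
  by (rule ext) (simp add: mulC_def mulTs_def algebra_simps)

lemma hbar_mulC:
  assumes "hsupp r h" "1 \<le> i" "i < r"
  shows "hbar r (mulC i h) = mulC i (hbar r h)"
  using hbar_mulTs[OF assms]
  by (simp add: mulC_def hbar_add hbar_scale mulTsinv_def fun_eq_iff algebra_simps)

lemma u_uinv_cancel [simp]: "lp_u * (lp_uinv * f) = f" "lp_uinv * (lp_u * f) = f"
  by (simp_all flip: mult.assoc)

abbreviation l2 :: laurent where "l2 \<equiv> lp_u + lp_uinv"

lemma mulC_mulC:
  assumes "hsupp r h" "1 \<le> i" "i < r"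
  shows "mulC i (mulC i h) = (\<lambda>y. l2 * mulC i h y)"
proof (rule hsupp_eqI[where r = r])
  fix y assume y: "y \<in> Sr r"
  then have ys: "y \<circ> sref i \<in> Sr r" using assms by simp
  have "y i \<noteq> y (Suc i)" using Sr_inj[OF y] by simp
  then have d: "rdesc (y \<circ> sref i) i \<longleftrightarrow> \<not> rdesc y i" by auto
  have e: "mulC i h (y \<circ> sref i) = h y + (if rdesc y i then lp_uinv else lp_u) * h (y \<circ> sref i)"
    unfolding mulC_at[OF ys assms(2)] comp_sref_sref d by simp
  show "mulC i (mulC i h) y = l2 * mulC i h y"
    unfolding mulC_at[OF y assms(2), of "mulC i h"] e unfolding mulC_at[OF y assms(2), of h]
    by (simp add: algebra_simps)
qed (use assms in \<open>auto simp: hsupp_def mulC_def mulTs_def\<close>)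

text \<open>The Bruhat support is carried through the construction because \<open>mu\<close> tests
  \<open>bruhat_le\<close> before it reads a coefficient.\<close>

definition KLs :: "nat \<Rightarrow> (nat \<Rightarrow> nat) \<Rightarrow> hecke \<Rightarrow> bool" where
  "KLs r w h \<longleftrightarrow> isKL r w h \<and> (\<forall>x. h x \<noteq> 0 \<longrightarrow> bruhat_le r x w)"

lemma KLs_Cp: "KLs r w h \<Longrightarrow> KLs r w (Cp r w)"
  using Cp_eqI by (auto simp: KLs_def)

lemma KLs_one: "KLs r id (Tb id)"
proof -
  have "hbar r (Tb id) = Tb id" using hbar_Tb[OF Sr_id] barT_id by metis
  moreover have "Tb id x \<noteq> 0 \<Longrightarrow> bruhat_le r x id" for x
    using bruhat_le_refl[OF Sr_id] by (metis Tb_def)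
  moreover have "neg_part (Tb id x - (if x = id then 1 else 0))" for x by (simp add: Tb_def)
  ultimately show ?thesis by (simp only: KLs_def isKL_def hsupp_Tb Sr_id) simp
qed

abbreviation mcoef :: "nat \<Rightarrow> (nat \<Rightarrow> nat) \<Rightarrow> (nat \<Rightarrow> nat) \<Rightarrow> int" where
  "mcoef r x w \<equiv> Poly_Mapping.lookup (Cp r w x) (-1)"

text \<open>The Kazhdan-Lusztig recursion for \<open>w \<circ> sref i\<close>. The raw coefficient
  \<open>mcoef\<close> stands in for mu: it vanishes at every \<open>x\<close> longer than
  \<open>w\<close>, so the correction involves only elements that are already available.\<close>

definition KLnext :: "nat \<Rightarrow> nat \<Rightarrow> (nat \<Rightarrow> nat) \<Rightarrow> hecke" where
  "KLnext r i w = (\<lambda>y. mulC i (Cp r w) y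
     - (\<Sum>x\<in>{x \<in> Sr r. rdesc x i}. of_int (mcoef r x w) * Cp r x y))"

lemma KLs_next:
  assumes w: "w \<in> Sr r" and i: "1 \<le> i" "i < r" "w i < w (Suc i)"
    and KL: "\<And>x. x \<in> Sr r \<Longrightarrow> len x \<le> len w \<Longrightarrow> KLs r x (Cp r x)"
  shows "KLs r (w \<circ> sref i) (KLnext r i w)"
proof -
  let ?D = "{x \<in> Sr r. rdesc x i}" and ?ws = "w \<circ> sref i"
  have ws: "?ws \<in> Sr r" using w i by simp
  have Kw: "hsupp r (Cp r w)" "hbar r (Cp r w) = Cp r w"
    "\<And>x. neg_part (Cp r w x - (if x = w then 1 else 0))" "\<And>x. Cp r w x \<noteq> 0 \<Longrightarrow> bruhat_le r x w"
    using KL[OF w] by (auto simp: KLs_def isKL_def)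
  \<comment> \<open>The sum in \<open>KLnext\<close> ranges over the whole group, but wherever its
    coefficient is nonzero the hypothesis \<open>KL\<close> applies.\<close>
  have short: "bruhat_le r x w \<and> KLs r x (Cp r x)" if "mcoef r x w \<noteq> 0" for x
  proof -
    have b: "bruhat_le r x w" using that Kw(4)[of x] by fastforce
    moreover have "len x \<le> len w" using bruhat_le_len[OF b] by auto
    ultimately show ?thesis using KL bruhat_le_Sr by blast
  qed
  have "hsupp r (KLnext r i w)"
    unfolding hsupp_def
  proof (intro allI impI)
    fix y assume y: "y \<notin> Sr r"
    have z: "of_int (mcoef r x w) * Cp r x y = 0" for x
      using short[of x] y by (cases "mcoef r x w = 0") (auto simp: KLs_def isKL_def hsupp_def)
    then show "KLnext r i w y = 0"
      using y hsupp_mulC[OF i(1,2) Kw(1)] by (simp only: KLnext_def hsupp_def z) simp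
  qed
  moreover have "hbar r (KLnext r i w) = KLnext r i w"
  proof -
    have "of_int (mcoef r x w) * hbar r (Cp r x) y = of_int (mcoef r x w) * Cp r x y" for x y
      using short[of x] by (cases "mcoef r x w = 0") (auto simp: KLs_def isKL_def)
    then show ?thesis
      by (simp only: KLnext_def hbar_diff hbar_sum hbar_scale hbar_mulC[OF Kw(1) i(1,2)] Kw(2) lp_bar_of_int)
  qed
  moreover have "neg_part (KLnext r i w y - (if y = ?ws then 1 else 0))" for y
  proof (cases "y \<in> Sr r")
    case False
    then have "KLnext r i w y = 0" "y \<noteq> ?ws" using \<open>hsupp r (KLnext r i w)\<close> ws by (auto simp: hsupp_def)
    then show ?thesis by simp
  next
    case y: True
    have ew: "y \<circ> sref i = w \<longleftrightarrow> y = ?ws" by (metis comp_sref_sref)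
    have A: "neg_part (Cp r w (y \<circ> sref i) - (if y = ?ws then 1 else 0))"
      using Kw(3)[of "y \<circ> sref i"] unfolding ew .
    have S: "neg_part ((\<Sum>x\<in>?D. of_int (mcoef r x w) * Cp r x y)
        - (if rdesc y i then of_int (mcoef r y w) else 0))"
    proof -
      have "(if rdesc y i then of_int (mcoef r y w) else 0)
          = (\<Sum>x\<in>?D. of_int (mcoef r x w) * (if y = x then 1 else 0) :: laurent)"
        using y by (simp add: if_distrib cong: if_cong)
      then have "(\<Sum>x\<in>?D. of_int (mcoef r x w) * Cp r x y) - (if rdesc y i then of_int (mcoef r y w) else 0)
          = (\<Sum>x\<in>?D. of_int (mcoef r x w) * (Cp r x y - (if y = x then 1 else 0)))"
        by (simp only: right_diff_distrib sum_subtractf)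
      moreover have "neg_part (of_int (mcoef r x w) * (Cp r x y - (if y = x then 1 else 0)))" for x
        using short[of x] neg_part_of_int_mult
        by (cases "mcoef r x w = 0") (auto simp: KLs_def isKL_def)
      ultimately show ?thesis by (simp only: neg_part_sum)
    qed
    \<comment> \<open>At a descent the factor u raises the coefficient of \<open>u^-1\<close> to a
      constant term; the correction sum exists to cancel precisely this constant.\<close>
    have B: "neg_part ((if rdesc y i then lp_u else lp_uinv) * Cp r w y
        - (if rdesc y i then of_int (mcoef r y w) else 0))"
    proof (cases "rdesc y i")
      case True
      then have "y \<noteq> w" using i by auto
      then have "neg_part (Cp r w y)" using Kw(3)[of y] by simp
      then show ?thesis using True
        by (auto simp: neg_part_def lookup_minus lookup_of_int when_def)
    next
      case False
      have "neg_part (lp_uinv * (Cp r w y - (if y = w then 1 else 0)) + (if y = w then lp_uinv else 0))"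
        using Kw(3)[of y] neg_part_uinv by (intro neg_part_add neg_part_uinv_mult) auto
      then show ?thesis using False by (simp add: algebra_simps split: if_splits)
    qed
    have "KLnext r i w y - (if y = ?ws then 1 else 0)
       = (Cp r w (y \<circ> sref i) - (if y = ?ws then 1 else 0))
         + ((if rdesc y i then lp_u else lp_uinv) * Cp r w y - (if rdesc y i then of_int (mcoef r y w) else 0))
         - ((\<Sum>x\<in>?D. of_int (mcoef r x w) * Cp r x y) - (if rdesc y i then of_int (mcoef r y w) else 0))"
      by (simp only: KLnext_def mulC_at[OF y i(1)]) (simp add: algebra_simps)
    then show ?thesis using A B S by (simp only: neg_part_add neg_part_diff)
  qed
  moreover have "bruhat_le r y ?ws" if nz: "KLnext r i w y \<noteq> 0" for y
  proof -
    have y: "y \<in> Sr r" using nz \<open>hsupp r (KLnext r i w)\<close> by (auto simp: hsupp_def)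
    have wws: "bruhat_le r w ?ws" by (rule bruhat_sref_up[OF w i])
    have "mulC i (Cp r w) y \<noteq> 0 \<or> (\<exists>x\<in>?D. of_int (mcoef r x w) * Cp r x y \<noteq> 0)"
      using nz sum.neutral[of ?D "\<lambda>x. of_int (mcoef r x w) * Cp r x y"] by (fastforce simp: KLnext_def)
    moreover have "Cp r w (y \<circ> sref i) \<noteq> 0 \<or> Cp r w y \<noteq> 0" if "mulC i (Cp r w) y \<noteq> 0"
      using that unfolding mulC_at[OF y i(1)] by (rule contrapos_np) simp
    moreover have "mcoef r x w \<noteq> 0 \<and> Cp r x y \<noteq> 0" if "of_int (mcoef r x w) * Cp r x y \<noteq> 0" for x
      using that by auto
    ultimately consider "Cp r w (y \<circ> sref i) \<noteq> 0" | "Cp r w y \<noteq> 0"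
      | x where "mcoef r x w \<noteq> 0" "Cp r x y \<noteq> 0"
      by blast
    then show ?thesis
    proof cases
      case 1
      then show ?thesis using bruhat_lift[OF Kw(4) i, of "y \<circ> sref i"] by simp
    next
      case 2 then show ?thesis using Kw(4) wws bruhat_le_trans by blast
    next
      case 3
      then have "bruhat_le r y x" "bruhat_le r x w" using short[of x] by (auto simp: KLs_def)
      then show ?thesis using wws bruhat_le_trans by blast
    qed
  qed
  ultimately show ?thesis by (simp add: KLs_def isKL_def)
qed

lemma KLs_ex: "w \<in> Sr r \<Longrightarrow> KLs r w (Cp r w)"
proof (induction "len w" arbitrary: w rule: less_induct)
  case less
  show ?case
  proof (cases "w = id")
    case True then show ?thesis using KLs_Cp[OF KLs_one] by metis
  next
    case False
    note d = desc_props[OF less.prems False]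
    let ?v = "w \<circ> sref (desc w)"
    have v: "?v \<in> Sr r" using d less.prems by simp
    have up: "?v (desc w) < ?v (Suc (desc w))" using d by simp
    have l: "Suc (len ?v) = len w" using len_sref_down[OF less.prems d(3,1)] .
    have "KLs r (?v \<circ> sref (desc w)) (KLnext r (desc w) ?v)"
    proof (rule KLs_next[OF v d(1,2) up])
      fix x assume x: "x \<in> Sr r" "len x \<le> len ?v"
      from x(2) l have "len x < len w" by linarith
      then show "KLs r x (Cp r x)" using less.hyps x(1) by blast
    qed
    then have "KLs r w (KLnext r (desc w) ?v)" by (simp only: comp_sref_sref)
    then show ?thesis by (rule KLs_Cp)
  qed
qed

lemma Cp_hsupp [simp]: "w \<in> Sr r \<Longrightarrow> hsupp r (Cp r w)"
  and Cp_bar: "w \<in> Sr r \<Longrightarrow> hbar r (Cp r w) = Cp r w"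
  and Cp_neg: "w \<in> Sr r \<Longrightarrow> neg_part (Cp r w x - (if x = w then 1 else 0))"
  and Cp_bruhat: "w \<in> Sr r \<Longrightarrow> Cp r w x \<noteq> 0 \<Longrightarrow> bruhat_le r x w"
  using KLs_ex[of w r] by (auto simp: KLs_def isKL_def)

text \<open>The definition gives 1 only up to negative exponents. As \<open>w\<close> is longest in
  the support, bar invariance of the coefficient removes them.\<close>

lemma Cp_self: "w \<in> Sr r \<Longrightarrow> Cp r w w = 1"
proof -
  assume w: "w \<in> Sr r"
  have "hbar r (Cp r w) w = lp_bar (Cp r w w)"
  proof (rule hbar_top[OF w])
    fix v assume "len w < len v"
    then have "\<not> bruhat_le r v w" using bruhat_le_len by fastforce
    then show "Cp r w v = 0" using Cp_bruhat[OF w] by blast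
  qed
  then have "lp_bar (Cp r w w - 1) = Cp r w w - 1" by (simp add: Cp_bar[OF w])
  moreover have "neg_part (Cp r w w - 1)" using Cp_neg[OF w, of w] by simp
  ultimately have "Cp r w w - 1 = 0" by (rule bar_neg_part_zero)
  then show ?thesis by simp
qed

lemma Cp_supp_len: "w \<in> Sr r \<Longrightarrow> Cp r w x \<noteq> 0 \<Longrightarrow> x = w \<or> len x < len w"
  using Cp_bruhat bruhat_le_len by blast

lemma Cp_up:
  assumes "w \<in> Sr r" "1 \<le> i" "i < r" "w i < w (Suc i)"
  shows "Cp r (w \<circ> sref i) = KLnext r i w"
  using KLs_next[OF assms KLs_ex] Cp_eqI by (auto simp: KLs_def)

text \<open>Through the recursion: applying \<open>mulC i\<close> to a product by the same generator
  yields the factor [2], and each correction term is a shorter basis element with descent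
  \<open>i\<close>, covered by induction.\<close>

lemma Cp_mulC_down:
  "w \<in> Sr r \<Longrightarrow> 1 \<le> i \<Longrightarrow> i < r \<Longrightarrow> rdesc w i \<Longrightarrow> mulC i (Cp r w) = (\<lambda>y. l2 * Cp r w y)"
proof (induction "len w" arbitrary: w rule: less_induct)
  case less
  let ?v = "w \<circ> sref i" and ?D = "{x \<in> Sr r. rdesc x i}"
  have v: "?v \<in> Sr r" using less.prems by simp
  have up: "?v i < ?v (Suc i)" using less.prems by simp
  have l: "len ?v < len w" using len_sref_down[OF less.prems(1,4,2)] by simp
  have "Cp r (?v \<circ> sref i) = KLnext r i ?v" by (rule Cp_up[OF v less.prems(2,3) up])
  then have w: "Cp r w = KLnext r i ?v" by (simp only: comp_sref_sref)
  have "of_int (mcoef r x ?v) * mulC i (Cp r x) y = l2 * (of_int (mcoef r x ?v) * Cp r x y)"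
    if "x \<in> ?D" for x y
  proof (cases "mcoef r x ?v = 0")
    case False
    then have "Cp r ?v x \<noteq> 0" by auto
    then have "len x < len w" using Cp_supp_len[OF v] l by fastforce
    then have "mulC i (Cp r x) = (\<lambda>y. l2 * Cp r x y)" using less that by auto
    then show ?thesis by (simp add: algebra_simps)
  qed simp
  then have "(\<Sum>x\<in>?D. of_int (mcoef r x ?v) * mulC i (Cp r x) y)
      = (\<Sum>x\<in>?D. l2 * (of_int (mcoef r x ?v) * Cp r x y))" for y
    by (intro sum.cong) auto
  then show ?case
    unfolding w KLnext_def mulC_diff mulC_sum mulC_mulC[OF Cp_hsupp[OF v] less.prems(2,3)]
    by (simp only: right_diff_distrib sum_distrib_left)
qed

text \<open>The [2]-eigenvector equation read at \<open>y\<close>. The extra factor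
  \<open>u^-1\<close> is what makes mu vanish or equal 1 in the lemmas below.\<close>

lemma Cp_desc:
  assumes "w \<in> Sr r" "1 \<le> i" "i < r" "rdesc w i" "y \<in> Sr r" "\<not> rdesc y i"
  shows "Cp r w y = lp_uinv * Cp r w (y \<circ> sref i)"
proof -
  have "Cp r w (y \<circ> sref i) + lp_uinv * Cp r w y = l2 * Cp r w y"
    using fun_cong[OF Cp_mulC_down[OF assms(1-4)], of y] mulC_at[OF assms(5,2)] assms(6) by simp
  then have "Cp r w (y \<circ> sref i) = lp_u * Cp r w y" by (simp add: algebra_simps)
  then show ?thesis by simp
qed

lemma mu_sym: "mu r x w = mu r w x"
proof -
  have "x = w" if "bruhat_le r x w" "bruhat_le r w x"
    using bruhat_le_len[OF that(1)] bruhat_le_len[OF that(2)] by auto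
  then show ?thesis by (auto simp: mu_def)
qed

lemma mu_lower:
  assumes "w \<in> Sr r" "len x < len w"
  shows "mu r x w = mcoef r x w"
proof (cases "bruhat_le r x w")
  case False
  have "\<not> bruhat_le r w x" using bruhat_le_len[of r w x] assms by auto
  then show ?thesis using False Cp_bruhat[OF assms(1), of x] by (cases "Cp r w x = 0") (auto simp: mu_def)
qed (simp add: mu_def)

lemma mu_eq_len: "len x = len w \<Longrightarrow> x \<noteq> w \<Longrightarrow> mu r x w = 0"
  using bruhat_le_len[of r x w] bruhat_le_len[of r w x] by (auto simp: mu_def)

lemma mu_sref:
  assumes "w \<in> Sr r" "1 \<le> i" "i < r" "w i < w (Suc i)"
  shows "mu r w (w \<circ> sref i) = 1"
proof -
  have S: "w \<circ> sref i \<in> Sr r" "rdesc (w \<circ> sref i) i" using assms by simp_all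
  have "Cp r (w \<circ> sref i) w = lp_uinv * Cp r (w \<circ> sref i) (w \<circ> sref i)"
    by (rule Cp_desc[OF S(1) assms(2,3) S(2) assms(1)]) (use assms(4) in simp)
  then have "mcoef r w (w \<circ> sref i) = 1" by (simp add: Cp_self[OF S(1)] lp_uinv_def)
  moreover have "len w < len (w \<circ> sref i)" using len_sref_up[OF assms(1,4)] by simp
  ultimately show ?thesis using mu_lower[OF S(1)] by simp
qed

text \<open>By \<open>Cp_desc\<close> the coefficient of \<open>u^-1\<close> at \<open>w\<close> is
  the constant term at \<open>w \<circ> sref i\<close>, which is zero unless that element is
  \<open>y\<close> itself.\<close>

lemma mu_desc_up:
  assumes "w \<in> Sr r" "y \<in> Sr r" "1 \<le> i" "i < r" "rdesc y i" "\<not> rdesc w i" "len w < len y" "mu r w y \<noteq> 0"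
  shows "y = w \<circ> sref i"
proof (rule ccontr)
  assume ne: "y \<noteq> w \<circ> sref i"
  have "neg_part (Cp r y (w \<circ> sref i))" using Cp_neg[OF assms(2), of "w \<circ> sref i"] ne by simp
  then have "Poly_Mapping.lookup (Cp r y (w \<circ> sref i)) 0 = 0" by (simp add: neg_part_def)
  then have "mcoef r w y = 0" using Cp_desc[OF assms(2-5,1,6)] by simp
  then show False using mu_lower[OF assms(2,7)] assms(8) by simp
qed

text \<open>Structure constants: the coefficient of \<open>C'_x\<close> in \<open>C'_w C'_s\<close>
  for the generator with index \<open>i\<close>. Left multiplication has the same constants at the
  inverse elements.\<close>

definition actc :: "nat \<Rightarrow> nat \<Rightarrow> (nat \<Rightarrow> nat) \<Rightarrow> (nat \<Rightarrow> nat) \<Rightarrow> laurent" where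
  "actc r i x w = (if rdesc w i then (if x = w then l2 else 0)
     else if rdesc x i then of_int (mu r x w) else 0)"

text \<open>The recursion with its leading term absorbed into the sum: passing from
  \<open>mcoef\<close> to the symmetric \<open>mu\<close> adds 1 at \<open>w \<circ> sref i\<close>,
  and \<open>mu_desc_up\<close> excludes every other \<open>x\<close> longer than
  \<open>w\<close>.\<close>

theorem Cp_mulC:
  assumes w: "w \<in> Sr r" and i: "1 \<le> i" "i < r"
  shows "mulC i (Cp r w) = (\<lambda>y. \<Sum>x\<in>Sr r. actc r i x w * Cp r x y)"
proof (cases "rdesc w i")
  case True
  then show ?thesis using w
    by (simp add: Cp_mulC_down[OF w i True] actc_def if_distrib[of "\<lambda>x. x * _"] cong: if_cong)
next
  case False
  then have up: "w i < w (Suc i)" using Sr_inj[OF w, of i "Suc i"] by linarith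
  let ?ws = "w \<circ> sref i"
  have ws: "?ws \<in> Sr r" "rdesc ?ws i" using w i up by simp_all
  have lw: "len ?ws = Suc (len w)" by (rule len_sref_up[OF w up])
  have "(mu r x w) = mcoef r x w + (if x = ?ws then 1 else 0)" if x: "x \<in> Sr r" "rdesc x i" for x
  proof -
    have "x \<noteq> w" using x False by auto
    consider "len x < len w" | "len x = len w" | "len w < len x" by linarith
    then show ?thesis
    proof cases
      case 1
      then have "x \<noteq> ?ws" using lw by auto
      then show ?thesis using mu_lower[OF w 1] by simp
    next
      case 2
      then have "x \<noteq> ?ws" "Cp r w x = 0" using lw Cp_supp_len[OF w, of x] \<open>x \<noteq> w\<close> by auto
      then show ?thesis using mu_eq_len[OF 2 \<open>x \<noteq> w\<close>] by simp
    next
      case 3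
      then have z: "Cp r w x = 0" using Cp_supp_len[OF w, of x] \<open>x \<noteq> w\<close> by auto
      show ?thesis
      proof (cases "x = ?ws")
        case True
        then show ?thesis using z mu_sref[OF w i up] mu_sym[of r x w] by simp
      next
        case False
        then have "mu r w x = 0" using mu_desc_up[OF w x(1) i x(2)] \<open>\<not> rdesc w i\<close> 3 by blast
        then show ?thesis using z False mu_sym[of r x w] by simp
      qed
    qed
  qed
  then have "(\<Sum>x\<in>Sr r. actc r i x w * Cp r x y)
      = (\<Sum>x\<in>{x \<in> Sr r. rdesc x i}. of_int (mcoef r x w) * Cp r x y + (if x = ?ws then Cp r x y else 0))" for y
    unfolding sum.inter_filter[OF finite_Sr]
    by (intro sum.cong) (auto simp: actc_def False algebra_simps)
  also have "\<dots> y = (\<Sum>x\<in>{x \<in> Sr r. rdesc x i}. of_int (mcoef r x w) * Cp r x y) + Cp r ?ws y" for y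
    using ws by (simp add: sum.distrib)
  finally show ?thesis
    using Cp_up[OF w i up] by (simp add: KLnext_def fun_eq_iff)
qed

text \<open>The basis is unitriangular, hence coefficients may be compared.\<close>
lemma Cp_lin_indep:
  fixes c :: "(nat \<Rightarrow> nat) \<Rightarrow> laurent"
  assumes "(\<lambda>y. \<Sum>x\<in>Sr r. c x * Cp r x y) = (\<lambda>y. \<Sum>x\<in>Sr r. d x * Cp r x y)" "x \<in> Sr r"
  shows "c x = d x"
proof (rule ccontr)
  assume ne: "c x \<noteq> d x"
  define B where "B = {x \<in> Sr r. c x \<noteq> d x}"
  have fin: "finite B" "B \<noteq> {}" using ne assms(2) by (auto simp: B_def)
  define n where "n = Max (len ` B)"
  have "n \<in> len ` B" unfolding n_def by (rule Max_in) (use fin in auto)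
  then obtain z where z: "z \<in> B" "len z = n" by auto
  have max: "len v \<le> len z" if "v \<in> B" for v
    unfolding z(2) n_def using that fin by (intro Max_ge) auto
  have zS: "z \<in> Sr r" using z by (simp add: B_def)
  have "(\<Sum>x\<in>Sr r. (c x - d x) * Cp r x z) = 0"
    using fun_cong[OF assms(1), of z] by (simp add: left_diff_distrib sum_subtractf)
  moreover have "(c v - d v) * Cp r v z = (if v = z then c z - d z else 0)" if v: "v \<in> Sr r" for v
  proof (cases "v = z")
    case False
    have "Cp r v z = 0 \<or> c v = d v"
      using Cp_supp_len[OF v, of z] max[of v] False v by (fastforce simp: B_def)
    then show ?thesis using False by auto
  qed (use Cp_self zS in auto)
  ultimately have "c z - d z = 0" using zS by simp
  then show False using z by (simp add: B_def)
qed

section \<open>Inversion symmetry\<close>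

lemma hinv_Tb: "w \<in> Sr r \<Longrightarrow> hinv r (Tb w) = Tb (inv w)"
  by (rule ext) (auto simp: hinv_def Tb_def Sr_inv_inv Sr_inv)

lemma hinv_mulTs: "hsupp r h \<Longrightarrow> hinv r (mulTs i h) = lmulTs r i (hinv r h)"
  by (simp add: lmulTs_def hinv_hinv)

lemma hinv_mulTsinv_lin: "hinv r (mulTsinv i h) = (\<lambda>y. hinv r (mulTs i h) y - lq * hinv r h y)"
  by (rule ext) (simp add: hinv_def mulTsinv_def)

text \<open>\<open>barT\<close> can also be built from left multiplications, since these commute with the right ones.\<close>
lemma lmulTs_barT:
  assumes "w \<in> Sr r" "1 \<le> a" "a < r"
  shows "hbar r (lmulTs r a (Tb w)) = (\<lambda>y. lmulTs r a (barT w) y - lq * barT w y)"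
  using assms(1)
proof (induction rule: Sr_induct)
  case id
  have hs: "hsupp r (Tb id)" by (simp only: hsupp_Tb Sr_id)
  have e: "lmulTs r a (Tb id) = mulTs a (Tb id)"
  proof -
    have "lmulTs r a (Tb id) = Tb (sref a \<circ> id)"
      by (rule lmulTs_Tb_up[OF Sr_id assms(2,3)]) (simp only: inv_id, simp)
    moreover have "mulTs a (Tb id) = Tb (id \<circ> sref a)"
      by (rule mulTs_Tb_up[OF Sr_id assms(2,3)]) simp
    ultimately show ?thesis by (simp only: id_comp comp_id)
  qed
  have "hbar r (lmulTs r a (Tb id)) = mulTsinv a (barT id)"
    unfolding e hbar_mulTs[OF hs assms(2,3)] hbar_Tb[OF Sr_id] ..
  then show "hbar r (lmulTs r a (Tb id)) = (\<lambda>y. lmulTs r a (barT id) y - lq * barT id y)"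
    by (simp only: mulTsinv_def barT_id e)
next
  case (step w i)
  have hs: "hsupp r (Tb w)" "hsupp r (lmulTs r a (Tb w))" "hsupp r (barT w)" using step by simp_all
  have t: "Tb (w \<circ> sref i) = mulTs i (Tb w)" using mulTs_Tb_up[OF step(1-4)] by simp
  have "hbar r (lmulTs r a (Tb (w \<circ> sref i))) = hbar r (mulTs i (lmulTs r a (Tb w)))"
    unfolding t lmulTs_mulTs[OF assms(2,3) step(2,3) hs(1)] ..
  also have "\<dots> = mulTsinv i (\<lambda>y. lmulTs r a (barT w) y - lq * barT w y)"
    by (simp only: hbar_mulTs[OF hs(2) step(2,3)] step(5))
  also have "\<dots> = (\<lambda>y. lmulTs r a (mulTsinv i (barT w)) y - lq * mulTsinv i (barT w) y)"
  proof -
    have l: "lmulTs r a (\<lambda>y. f y - c * g y) = (\<lambda>y. lmulTs r a f y - c * lmulTs r a g y)" for f g c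
      by (rule ext) (simp add: lmulTs_def hinv_def mulTs_def algebra_simps)
    have m: "mulTsinv i (\<lambda>y. f y - c * g y) = (\<lambda>y. mulTsinv i f y - c * mulTsinv i g y)" for f g c
      by (rule ext) (simp add: mulTsinv_def mulTs_def algebra_simps)
    have "lmulTs r a (mulTsinv i (barT w)) = mulTsinv i (lmulTs r a (barT w))"
      unfolding mulTsinv_def l lmulTs_mulTs[OF assms(2,3) step(2,3) hs(3)] ..
    then show ?thesis by (simp only: m)
  qed
  finally show "hbar r (lmulTs r a (Tb (w \<circ> sref i)))
      = (\<lambda>y. lmulTs r a (barT (w \<circ> sref i)) y - lq * barT (w \<circ> sref i) y)"
    by (simp only: barT_up[OF step(1-4)])
qed

text \<open>The two sides obey one recursion, on the left through left multiplications by
  \<open>lmulTs_barT\<close> and on the right through right ones.\<close>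

lemma barT_inv: "w \<in> Sr r \<Longrightarrow> barT (inv w) = hinv r (barT w)"
proof (induction rule: Sr_induct)
  case id
  show "barT (inv id) = hinv r (barT id)"
    using hinv_Tb[OF Sr_id, of r] by (simp only: inv_id barT_id)
next
  case (step w i)
  have iw: "inv w \<in> Sr r" using step Sr_inv by blast
  have "barT (sref i \<circ> inv w) = hbar r (Tb (sref i \<circ> inv w))"
    using hbar_Tb[of "sref i \<circ> inv w" r] iw step by simp
  also have "Tb (sref i \<circ> inv w) = lmulTs r i (Tb (inv w))"
    using lmulTs_Tb_up[OF iw, of i] step Sr_inv_inv[of w r] by simp
  also have "hbar r \<dots> = (\<lambda>y. lmulTs r i (barT (inv w)) y - lq * barT (inv w) y)"
    by (rule lmulTs_barT[OF iw step(2,3)])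
  also have "\<dots> = hinv r (mulTsinv i (barT w))"
    using step hinv_mulTs[of r "barT w" i] by (simp add: hinv_mulTsinv_lin)
  finally show "barT (inv (w \<circ> sref i)) = hinv r (barT (w \<circ> sref i))"
    by (simp only: inv_comp_sref[OF step(1)] barT_up[OF step(1-4)])
qed

lemma Sr_inv_reindex: "(\<Sum>w\<in>Sr r. f (inv w)) = (\<Sum>w\<in>Sr r. f w)"
proof (rule sum.reindex_bij_betw)
  show "bij_betw inv (Sr r) (Sr r)"
    by (rule bij_betwI[where g = inv]) (auto simp: Sr_inv Sr_inv_inv)
qed

lemma hbar_hinv: "hbar r (hinv r h) = hinv r (hbar r h)"
proof
  fix y
  have "hbar r (hinv r h) y = (\<Sum>w\<in>Sr r. lp_bar (h (inv (inv w))) * barT (inv w) y)"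
    using Sr_inv_reindex[of "\<lambda>w. lp_bar (h (inv w)) * barT w y" r] by (simp add: hbar_def hinv_def)
  also have "\<dots> = (\<Sum>w\<in>Sr r. lp_bar (h w) * hinv r (barT w) y)"
    by (intro sum.cong) (simp_all add: Sr_inv_inv barT_inv)
  finally show "hbar r (hinv r h) y = hinv r (hbar r h) y"
    by (simp add: hinv_def hbar_def)
qed

text \<open>By uniqueness, since the anti-automorphism commutes with bar and permutes the standard
  basis. It turns the formula for right multiplication into one for left multiplication.\<close>

lemma Cp_inv: "w \<in> Sr r \<Longrightarrow> Cp r (inv w) = hinv r (Cp r w)"
proof (rule Cp_eqI)
  assume w: "w \<in> Sr r"
  have "neg_part (hinv r (Cp r w) x - (if x = inv w then 1 else 0))" for x
    using Cp_neg[OF w, of "inv x"] w Sr_inv_inv[of x r] Sr_inv_inv[of w r] Sr_inv[OF w]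
    by (auto simp: hinv_def split: if_splits)
  then show "isKL r (inv w) (hinv r (Cp r w))"
    using w by (simp add: isKL_def hbar_hinv Cp_bar)
qed

section \<open>Duality under the longest element\<close>

text \<open>Composition with the longest element exchanges ascents and descents, and the
  substitution u \<mapsto> -u corrects the resulting sign of \<open>lq\<close>; together they turn
  multiplication by a generator into multiplication by its inverse.\<close>

definition hflip :: "nat \<Rightarrow> hecke \<Rightarrow> hecke" where
  "hflip r h = (\<lambda>y. if y \<in> Sr r then lp_neg (h (w0 r \<circ> y)) else 0)"

lemma hsupp_hflip [simp]: "hsupp r (hflip r h)"
  by (simp add: hsupp_def hflip_def)

lemma hflip_mulTs:
  assumes "1 \<le> i" "i < r"
  shows "hflip r (mulTs i h) = mulTsinv i (hflip r h)"
proof (rule hsupp_eqI[where r = r])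
  fix y assume y: "y \<in> Sr r"
  have wy: "w0 r \<circ> y \<in> Sr r" using y by simp
  have ys: "y \<circ> sref i \<in> Sr r" using y assms by simp
  have "hflip r (mulTs i h) y = lp_neg (mulTs i h (w0 r \<circ> y))" using y by (simp only: hflip_def if_True)
  also have "\<dots> = lp_neg (h (w0 r \<circ> (y \<circ> sref i))) - (if rdesc y i then 0 else lq * lp_neg (h (w0 r \<circ> y)))"
    unfolding mulTs_at[OF wy assms(1)] w0_comp_less_iff[OF y assms] comp_assoc
    using Sr_inj[OF y, of i "Suc i"] by (auto simp: algebra_simps)
  also have "\<dots> = mulTsinv i (hflip r h) y"
    unfolding mulTsinv_at[OF y assms(1)] by (simp only: hflip_def y ys if_True)
  finally show "hflip r (mulTs i h) y = mulTsinv i (hflip r h) y" .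
qed (use assms in auto)

lemma hflip_mulTsinv:
  assumes "1 \<le> i" "i < r" "hsupp r h"
  shows "hflip r (mulTsinv i h) = mulTs i (hflip r h)"
  using hflip_mulTs[OF assms(1,2), of "mulTsinv i h"] mulTs_mulTsinv[OF assms]
    mulTs_mulTsinv[OF assms(1,2) hsupp_hflip] by metis

definition hinner :: "nat \<Rightarrow> hecke \<Rightarrow> hecke \<Rightarrow> laurent" where
  "hinner r f g = (\<Sum>x\<in>Sr r. f x * g x)"

text \<open>The matrix of a right multiplication in the standard basis is symmetric: the shift by
  \<open>sref i\<close> is an involution of the index set and the remaining part is
  diagonal.\<close>

lemma hinner_mulTs:
  assumes "1 \<le> i" "i < r"
  shows "hinner r (mulTs i f) g = hinner r f (mulTs i g)"
proof -
  have "hinner r (mulTs i f) g = (\<Sum>x\<in>Sr r. f (x \<circ> sref i) * g x) + (\<Sum>x\<in>Sr r. (if rdesc x i then lq * f x * g x else 0))"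
    unfolding hinner_def sum.distrib[symmetric]
    by (rule sum.cong) (auto simp: mulTs_at[OF _ assms(1)] algebra_simps)
  also have "(\<Sum>x\<in>Sr r. f (x \<circ> sref i) * g x) = (\<Sum>x\<in>Sr r. f x * g (x \<circ> sref i))"
    using Sr_reindex[OF assms, of "\<lambda>x. f (x \<circ> sref i) * g x"] by (simp only: comp_sref_sref)
  also have "\<dots> + (\<Sum>x\<in>Sr r. (if rdesc x i then lq * f x * g x else 0)) = hinner r f (mulTs i g)"
    unfolding hinner_def sum.distrib[symmetric]
    by (rule sum.cong) (auto simp: mulTs_at[OF _ assms(1)] algebra_simps)
  finally show ?thesis .
qed

lemma hinner_diff_left: "hinner r (\<lambda>y. f y - c * g y) h = hinner r f h - c * hinner r g h"
  by (simp add: hinner_def left_diff_distrib sum_subtractf sum_distrib_left mult.assoc)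

lemma hinner_diff_right: "hinner r h (\<lambda>y. f y - c * g y) = hinner r h f - c * hinner r h g"
  by (simp add: hinner_def right_diff_distrib sum_subtractf sum_distrib_left mult.left_commute)

lemma hinner_sum_left: "hinner r (\<lambda>y. \<Sum>x\<in>A. c x * f x y) g = (\<Sum>x\<in>A. c x * hinner r (f x) g)"
  by (simp add: hinner_def sum_distrib_left sum_distrib_right mult.assoc sum.swap[of _ "Sr r"])

lemma hinner_sum_right: "hinner r g (\<lambda>y. \<Sum>x\<in>A. c x * f x y) = (\<Sum>x\<in>A. c x * hinner r g (f x))"
  by (simp add: hinner_def sum_distrib_left mult.left_commute sum.swap[of _ "Sr r"])

lemma hinner_mulTsinv:
  assumes "1 \<le> i" "i < r"
  shows "hinner r (mulTsinv i f) g = hinner r f (mulTsinv i g)"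
  by (simp only: mulTsinv_def hinner_diff_left hinner_diff_right hinner_mulTs[OF assms])

lemma len_le_w0:
  assumes "v \<in> Sr r" shows "len v \<le> len (w0 r)"
proof -
  have "Inv v \<subseteq> Inv (w0 r)"
  proof clarify
    fix i j assume "(i, j) \<in> Inv v"
    then have ij: "i < j" "v j < v i" by (auto simp: Inv_def)
    have "v 0 = 0" using assms by (auto simp: Sr_def permutes_def)
    then have "1 \<le> i" using ij by (cases i) auto
    moreover have "j \<le> r" using Inv_subset[OF assms] \<open>(i, j) \<in> Inv v\<close> by auto
    ultimately show "(i, j) \<in> Inv (w0 r)" using ij by (simp add: Inv_def w0_less_iff)
  qed
  then show ?thesis using finite_Inv[OF w0_Sr] by (simp add: len_Inv card_mono)
qed

text \<open>A generator is moved across the pairing; bar inverts it and \<open>hflip\<close> inverts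
  it once more, so both sides change alike. At the identity only the coefficient of the longest
  element is left, where bar is plain conjugation.\<close>

lemma bar_hinner_Tb:
  assumes "w \<in> Sr r" "hsupp r h"
  shows "hinner r (hbar r (Tb w)) (hflip r (hbar r h)) = lp_bar (hinner r (Tb w) (hflip r h))"
  using assms
proof (induction arbitrary: h rule: Sr_induct)
  case id
  have ev: "hinner r (Tb id) g = g id" for g
    by (simp add: hinner_def Tb_def if_distrib[of "\<lambda>x. x * _"] cong: if_cong)
  have top: "hbar r h (w0 r) = lp_bar (h (w0 r))"
    using len_le_w0 by (intro hbar_top) (auto simp: not_less[symmetric])
  have e: "hflip r g id = lp_neg (g (w0 r))" for g by (simp only: hflip_def Sr_id if_True comp_id)
  show "hinner r (hbar r (Tb id)) (hflip r (hbar r h)) = lp_bar (hinner r (Tb id) (hflip r h))"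
    unfolding hbar_Tb[OF Sr_id] barT_id ev e top lp_bar_neg ..
next
  case (step w i)
  have hs: "hsupp r (Tb w)" "hsupp r (mulTsinv i h)" using step by simp_all
  note i = step(2,3)
  have t: "Tb (w \<circ> sref i) = mulTs i (Tb w)" using mulTs_Tb_up[OF step(1-4)] by simp
  have "hinner r (hbar r (Tb (w \<circ> sref i))) (hflip r (hbar r h))
      = hinner r (hbar r (Tb w)) (hflip r (mulTs i (hbar r h)))"
    by (simp only: t hbar_mulTs[OF hs(1) i] hinner_mulTsinv[OF i] hflip_mulTs[OF i])
  also have "\<dots> = hinner r (hbar r (Tb w)) (hflip r (hbar r (mulTsinv i h)))"
    by (simp only: hbar_mulTsinv[OF step(6) i])
  also have "\<dots> = lp_bar (hinner r (Tb w) (hflip r (mulTsinv i h)))"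
    by (rule step.IH[OF hs(2)])
  also have "\<dots> = lp_bar (hinner r (Tb (w \<circ> sref i)) (hflip r h))"
    by (simp only: t hinner_mulTs[OF i] hflip_mulTsinv[OF i step(6)])
  finally show "hinner r (hbar r (Tb (w \<circ> sref i))) (hflip r (hbar r h))
      = lp_bar (hinner r (Tb (w \<circ> sref i)) (hflip r h))" .
qed

text \<open>The form \<open>(f, h) \<mapsto> \<langle>f, h\<^sup>\<sharp>\<rangle>\<close> reads off the coefficient of the longest element in a product;
  the bar involution preserves that coefficient up to conjugation.\<close>
lemma bar_hinner:
  assumes "hsupp r f" "hsupp r h"
  shows "hinner r (hbar r f) (hflip r (hbar r h)) = lp_bar (hinner r f (hflip r h))"
proof -
  let ?f = "\<lambda>y. \<Sum>x\<in>Sr r. f x * Tb x y"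
  have f: "f = ?f" by (rule hsupp_expand[OF assms(1)])
  have b: "hbar r ?f = (\<lambda>y. \<Sum>x\<in>Sr r. lp_bar (f x) * hbar r (Tb x) y)"
    by (simp only: hbar_sum hbar_scale)
  have "hinner r (hbar r ?f) (hflip r (hbar r h)) = (\<Sum>x\<in>Sr r. lp_bar (f x) * hinner r (hbar r (Tb x)) (hflip r (hbar r h)))"
    by (simp only: b hinner_sum_left)
  also have "\<dots> = (\<Sum>x\<in>Sr r. lp_bar (f x * hinner r (Tb x) (hflip r h)))"
    by (intro sum.cong) (simp_all add: bar_hinner_Tb assms)
  also have "\<dots> = lp_bar (hinner r ?f (hflip r h))"
    by (simp only: hinner_sum_left lp_bar_sum)
  finally show ?thesis by (simp only: f[symmetric])
qed

text \<open>The Kazhdan-Lusztig inversion formula. The pairing is bar invariant by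
  \<open>bar_hinner\<close> and differs from the Kronecker symbol by negative exponents
  only.\<close>

lemma Cp_dual:
  assumes x: "x \<in> Sr r" and y: "y \<in> Sr r"
  shows "hinner r (Cp r x) (hflip r (Cp r (w0 r \<circ> y))) = (if x = y then 1 else 0)"
proof -
  let ?v = "hinner r (Cp r x) (hflip r (Cp r (w0 r \<circ> y)))"
  let ?d = "\<lambda>a b. if a = b then 1 else 0 :: laurent"
  have wy: "w0 r \<circ> y \<in> Sr r" using y by simp
  have "lp_bar ?v = ?v"
    using bar_hinner[OF Cp_hsupp[OF x] Cp_hsupp[OF wy]] by (simp only: Cp_bar[OF x] Cp_bar[OF wy])
  then have b: "lp_bar (?v - ?d x y) = ?v - ?d x y" by simp
  have "neg_part (Cp r x z * hflip r (Cp r (w0 r \<circ> y)) z - ?d z x * ?d z y)" if z: "z \<in> Sr r" for z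
  proof -
    let ?a = "Cp r x z - ?d z x" and ?b = "Cp r (w0 r \<circ> y) (w0 r \<circ> z) - ?d (w0 r \<circ> z) (w0 r \<circ> y)"
    have zy: "w0 r \<circ> z = w0 r \<circ> y \<longleftrightarrow> z = y" by (metis w0_comp(1))
    have e: "hflip r (Cp r (w0 r \<circ> y)) z = lp_neg ?b + ?d z y"
      unfolding zy using z by (simp add: hflip_def)
    have A: "neg_part ?a" by (rule Cp_neg[OF x])
    have B: "neg_part (lp_neg ?b)" by (rule neg_part_lp_neg[OF Cp_neg[OF wy]])
    have "neg_part (if z = x then lp_neg ?b else 0)" "neg_part (if z = y then ?a else 0)"
      using A B neg_part_0 by presburger+
    then have "neg_part (?a * lp_neg ?b + (if z = x then lp_neg ?b else 0) + (if z = y then ?a else 0))"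
      using neg_part_mult[OF A B] by (intro neg_part_add)
    moreover have "Cp r x z * hflip r (Cp r (w0 r \<circ> y)) z - ?d z x * ?d z y
       = ?a * lp_neg ?b + (if z = x then lp_neg ?b else 0) + (if z = y then ?a else 0)"
      unfolding e by (simp add: algebra_simps del: lp_neg_diff)
    ultimately show ?thesis by simp
  qed
  then have "neg_part (\<Sum>z\<in>Sr r. Cp r x z * hflip r (Cp r (w0 r \<circ> y)) z - ?d z x * ?d z y)"
    by (rule neg_part_sum)
  moreover have "(\<Sum>z\<in>Sr r. ?d z x * ?d z y) = ?d x y"
    using x by (simp add: if_distrib[of "\<lambda>x. x * _"] cong: if_cong)
  ultimately have "neg_part (?v - ?d x y)" by (simp only: hinner_def sum_subtractf)
  then show ?thesis using bar_neg_part_zero[OF b] by simp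
qed

lemma sum_mult_delta:
  fixes a :: "'b \<Rightarrow> 'a :: semiring_1"
  assumes "finite A" "x \<in> A"
  shows "(\<Sum>z\<in>A. a z * (if z = x then 1 else 0)) = a x"
proof -
  have "(\<Sum>z\<in>A. a z * (if z = x then 1 else 0)) = (\<Sum>z\<in>A. if z = x then a z else 0)"
    by (rule sum.cong) auto
  then show ?thesis using assms by simp
qed

text \<open>\<open>mulC i\<close> is self-adjoint, so on the dual basis it acts by the transposed
  matrix. There it is also [2] plus the flip of \<open>mulC i\<close>; the [2] contributes nothing
  off the diagonal, and comparing one coefficient gives the identity.\<close>

lemma mu_w0_aux:
  assumes x: "x \<in> Sr r" and y: "y \<in> Sr r" and i: "1 \<le> i" "i < r" and d: "rdesc x i" "\<not> rdesc y i"
  shows "mu r x y = mu r (w0 r \<circ> y) (w0 r \<circ> x)"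
proof -
  let ?F = "\<lambda>x. hflip r (Cp r (w0 r \<circ> x))"
  have wx: "w0 r \<circ> x \<in> Sr r" and wy: "w0 r \<circ> y \<in> Sr r" using x y by simp_all
  have dw: "rdesc (w0 r \<circ> y) i" "\<not> rdesc (w0 r \<circ> x) i"
    using d w0_comp_less_iff[OF x i] w0_comp_less_iff[OF y i] Sr_inj[OF y, of i "Suc i"] by auto
  have "hinner r (mulC i (Cp r y)) (?F x) = (\<Sum>z\<in>Sr r. actc r i z y * (if z = x then 1 else 0))"
    unfolding Cp_mulC[OF y i] hinner_sum_left by (intro sum.cong) (simp_all add: Cp_dual x del: comp_apply)
  then have L: "hinner r (mulC i (Cp r y)) (?F x) = of_int (mu r x y)"
    using d by (simp only: sum_mult_delta[OF finite_Sr x] actc_def if_True if_False)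
  have flin: "hflip r (\<lambda>y. f y - lp_uinv * g y) = (\<lambda>y. hflip r f y + lp_uinv * hflip r g y)" for f g
    by (rule ext) (simp add: hflip_def)
  have m: "mulTs i (Cp r (w0 r \<circ> x)) = (\<lambda>y. mulC i (Cp r (w0 r \<circ> x)) y - lp_uinv * Cp r (w0 r \<circ> x) y)"
    by (rule ext) (simp add: mulC_def)
  have "mulTsinv i (?F x) = (\<lambda>y. hflip r (mulC i (Cp r (w0 r \<circ> x))) y + lp_uinv * ?F x y)"
    using hflip_mulTs[OF i, of "Cp r (w0 r \<circ> x)"] by (simp only: m flin)
  then have "mulC i (?F x) = (\<lambda>y. hflip r (mulC i (Cp r (w0 r \<circ> x))) y - (- l2) * ?F x y)"
    unfolding mulTsinv_def mulC_def by (simp add: fun_eq_iff algebra_simps)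
  then have R1: "hinner r (Cp r y) (mulC i (?F x))
      = hinner r (Cp r y) (hflip r (mulC i (Cp r (w0 r \<circ> x)))) + l2 * hinner r (Cp r y) (?F x)"
    by (simp only: hinner_diff_right) (simp add: algebra_simps)
  have "hflip r (mulC i (Cp r (w0 r \<circ> x)))
      = hflip r (\<lambda>v. \<Sum>z\<in>Sr r. actc r i z (w0 r \<circ> x) * Cp r z v)"
    by (simp only: Cp_mulC[OF wx i])
  also have "\<dots> = (\<lambda>v. \<Sum>z\<in>Sr r. lp_neg (actc r i z (w0 r \<circ> x)) * hflip r (Cp r z) v)"
    by (rule ext) (simp add: hflip_def)
  also have "\<dots> = (\<lambda>v. \<Sum>z\<in>Sr r. lp_neg (actc r i (w0 r \<circ> z) (w0 r \<circ> x)) * ?F z v)"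
  proof
    fix v
    show "(\<Sum>z\<in>Sr r. lp_neg (actc r i z (w0 r \<circ> x)) * hflip r (Cp r z) v)
      = (\<Sum>z\<in>Sr r. lp_neg (actc r i (w0 r \<circ> z) (w0 r \<circ> x)) * ?F z v)"
      by (rule sum.reindex_bij_betw[symmetric], rule bij_betwI[where g = "\<lambda>z. w0 r \<circ> z"]) (auto simp del: comp_apply)
  qed
  finally have "hinner r (Cp r y) (hflip r (mulC i (Cp r (w0 r \<circ> x))))
      = (\<Sum>z\<in>Sr r. lp_neg (actc r i (w0 r \<circ> z) (w0 r \<circ> x)) * (if y = z then 1 else 0))"
    unfolding hinner_sum_right by (simp add: hinner_sum_right Cp_dual y cong: sum.cong del: comp_apply)
  also have "\<dots> = lp_neg (actc r i (w0 r \<circ> y) (w0 r \<circ> x))"     using sum_mult_delta[OF finite_Sr y] by (simp only: eq_commute[of y])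
  also have "\<dots> = of_int (mu r (w0 r \<circ> y) (w0 r \<circ> x))" by (simp only: actc_def dw if_True if_False lp_neg_of_int)
  finally have R2: "hinner r (Cp r y) (hflip r (mulC i (Cp r (w0 r \<circ> x)))) = of_int (mu r (w0 r \<circ> y) (w0 r \<circ> x))" .
  have "x \<noteq> y" using d by auto
  then have R3: "hinner r (Cp r y) (?F x) = 0" using Cp_dual[OF y x] by simp
  have "hinner r (mulC i (Cp r y)) (?F x) = hinner r (Cp r y) (mulC i (?F x))"
  proof -
    have "mulC i f = (\<lambda>y. mulTs i f y - (- lp_uinv) * f y)" for f by (rule ext) (simp add: mulC_def)
    then show ?thesis by (simp only: hinner_diff_left hinner_diff_right hinner_mulTs[OF i])
  qed
  then have "(of_int (mu r x y) :: laurent) = of_int (mu r (w0 r \<circ> y) (w0 r \<circ> x))"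
    using L R1 R2 R3 by simp
  then show ?thesis by (simp only: of_int_eq_iff)
qed

lemma mu_w0:
  assumes "x \<in> Sr r" "y \<in> Sr r" "1 \<le> i" "i < r" "rdesc x i \<noteq> rdesc y i"
  shows "mu r (w0 r \<circ> x) (w0 r \<circ> y) = mu r x y"
  using mu_w0_aux[of x r y i] mu_w0_aux[of y r x i] assms mu_sym by metis

section \<open>Star operations and right cells\<close>

definition lmulC :: "nat \<Rightarrow> nat \<Rightarrow> hecke \<Rightarrow> hecke" where
  "lmulC r i h = hinv r (mulC i (hinv r h))"

lemma lmulC_lmulTs: "hsupp r h \<Longrightarrow> lmulC r i h = (\<lambda>y. lmulTs r i h y + lp_uinv * h y)"
proof -
  assume h: "hsupp r h"
  have "hinv r (\<lambda>y. f y + lp_uinv * g y) = (\<lambda>y. hinv r f y + lp_uinv * hinv r g y)" for f g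
    by (rule ext) (simp add: hinv_def)
  then show ?thesis by (simp only: lmulC_def lmulTs_def mulC_def hinv_hinv[OF h])
qed

lemma lmulC_sum: "lmulC r i (\<lambda>y. \<Sum>x\<in>A. c x * f x y) = (\<lambda>y. \<Sum>x\<in>A. c x * lmulC r i (f x) y)"
proof -
  have "hinv r (\<lambda>y. \<Sum>x\<in>A. c x * f x y) = (\<lambda>y. \<Sum>x\<in>A. c x * hinv r (f x) y)" for f
    by (rule ext) (simp add: hinv_def)
  then show ?thesis by (simp add: lmulC_def mulC_sum)
qed

lemma lmulC_mulC:
  assumes a: "1 \<le> a" "a < r" and b: "1 \<le> b" "b < r" and h: "hsupp r h"
  shows "lmulC r a (mulC b h) = mulC b (lmulC r a h)"
proof -
  have lin: "lmulTs r a (\<lambda>y. f y + lp_uinv * g y) = (\<lambda>y. lmulTs r a f y + lp_uinv * lmulTs r a g y)" for f g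
    by (rule ext) (simp add: lmulTs_def hinv_def mulTs_def algebra_simps)
  have lin': "mulTs b (\<lambda>y. f y + lp_uinv * g y) = (\<lambda>y. mulTs b f y + lp_uinv * mulTs b g y)" for f g
    by (rule ext) (simp add: mulTs_def algebra_simps)
  have A: "lmulC r a (mulC b h) = (\<lambda>y. lmulTs r a (mulC b h) y + lp_uinv * mulC b h y)"
    by (rule lmulC_lmulTs) (use b h in simp)
  show ?thesis
    unfolding A lmulC_lmulTs[OF h] unfolding mulC_def lin lin' lmulTs_mulTs[OF a b h]
    by (rule ext) (simp add: algebra_simps)
qed

lemma Cp_lmulC:
  assumes w: "w \<in> Sr r" and i: "1 \<le> i" "i < r"
  shows "lmulC r i (Cp r w) = (\<lambda>y. \<Sum>x\<in>Sr r. actc r i (inv x) (inv w) * Cp r x y)"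
proof -
  have iw: "inv w \<in> Sr r" using Sr_inv[OF w] .
  have "lmulC r i (Cp r w) = hinv r (mulC i (Cp r (inv w)))"
    by (simp only: lmulC_def Cp_inv[OF w])
  also have "\<dots> = hinv r (\<lambda>y. \<Sum>x\<in>Sr r. actc r i x (inv w) * Cp r x y)"
    by (simp only: Cp_mulC[OF iw i])
  also have "\<dots> = (\<lambda>y. \<Sum>x\<in>Sr r. actc r i x (inv w) * hinv r (Cp r x) y)"
    by (rule ext) (simp add: hinv_def)
  also have "\<dots> = (\<lambda>y. \<Sum>x\<in>Sr r. actc r i x (inv w) * Cp r (inv x) y)"
    by (intro ext sum.cong) (simp_all add: Cp_inv)
  also have "\<dots> = (\<lambda>y. \<Sum>x\<in>Sr r. actc r i (inv x) (inv w) * Cp r x y)"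
    using Sr_inv_reindex[of "\<lambda>x. actc r i x (inv w) * Cp r (inv x) y" r for y]
    by (intro ext) (simp add: Sr_inv_inv cong: sum.cong)
  finally show ?thesis .
qed

lemma mulC_expand:
  assumes "1 \<le> i" "i < r"
  shows "mulC i (\<lambda>y. \<Sum>x\<in>Sr r. a x * Cp r x y)
    = (\<lambda>y. \<Sum>v\<in>Sr r. (\<Sum>x\<in>Sr r. actc r i v x * a x) * Cp r v y)"
proof
  fix y
  have "mulC i (\<lambda>y. \<Sum>x\<in>Sr r. a x * Cp r x y) y
      = (\<Sum>x\<in>Sr r. \<Sum>v\<in>Sr r. actc r i v x * a x * Cp r v y)"
    unfolding mulC_sum by (intro sum.cong) (simp_all add: Cp_mulC[OF _ assms] sum_distrib_left mult_ac)
  also have "\<dots> = (\<Sum>v\<in>Sr r. (\<Sum>x\<in>Sr r. actc r i v x * a x) * Cp r v y)"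
    by (subst sum.swap) (simp add: sum_distrib_right)
  finally show "mulC i (\<lambda>y. \<Sum>x\<in>Sr r. a x * Cp r x y) y
    = (\<Sum>v\<in>Sr r. (\<Sum>x\<in>Sr r. actc r i v x * a x) * Cp r v y)" .
qed

lemma lmulC_expand:
  assumes "1 \<le> i" "i < r"
  shows "lmulC r i (\<lambda>y. \<Sum>x\<in>Sr r. a x * Cp r x y)
    = (\<lambda>y. \<Sum>v\<in>Sr r. (\<Sum>x\<in>Sr r. actc r i (inv v) (inv x) * a x) * Cp r v y)"
proof
  fix y
  have "lmulC r i (\<lambda>y. \<Sum>x\<in>Sr r. a x * Cp r x y) y
      = (\<Sum>x\<in>Sr r. \<Sum>v\<in>Sr r. actc r i (inv v) (inv x) * a x * Cp r v y)"
    unfolding lmulC_sum by (intro sum.cong) (simp_all add: Cp_lmulC[OF _ assms] sum_distrib_left mult_ac)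
  also have "\<dots> = (\<Sum>v\<in>Sr r. (\<Sum>x\<in>Sr r. actc r i (inv v) (inv x) * a x) * Cp r v y)"
    by (subst sum.swap) (simp add: sum_distrib_right)
  finally show "lmulC r i (\<lambda>y. \<Sum>x\<in>Sr r. a x * Cp r x y) y
    = (\<Sum>v\<in>Sr r. (\<Sum>x\<in>Sr r. actc r i (inv v) (inv x) * a x) * Cp r v y)" .
qed

text \<open>Coefficientwise form of the associativity \<open>C'\<^sub>t (C'\<^sub>w C'\<^sub>s) = (C'\<^sub>t C'\<^sub>w) C'\<^sub>s\<close>.\<close>
lemma actc_commute:
  assumes w: "w \<in> Sr r" and y: "y \<in> Sr r" and i: "1 \<le> i" "i < r" and t: "1 \<le> t" "t < r"
  shows "(\<Sum>x\<in>Sr r. actc r t (inv y) (inv x) * actc r i x w)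
    = (\<Sum>x\<in>Sr r. actc r i y x * actc r t (inv x) (inv w))"
proof (rule Cp_lin_indep[OF _ y])
  show "(\<lambda>y. \<Sum>v\<in>Sr r. (\<Sum>x\<in>Sr r. actc r t (inv v) (inv x) * actc r i x w) * Cp r v y)
    = (\<lambda>y. \<Sum>v\<in>Sr r. (\<Sum>x\<in>Sr r. actc r i v x * actc r t (inv x) (inv w)) * Cp r v y)"
    unfolding lmulC_expand[OF t, symmetric] mulC_expand[OF i, symmetric]
      Cp_mulC[OF w i, symmetric] Cp_lmulC[OF w t, symmetric]
    by (rule lmulC_mulC[OF t i Cp_hsupp[OF w]])
qed

text \<open>All basis elements occurring in a left multiple by \<open>C'_s\<close> have
  \<open>s\<close> as a left descent. In \<open>actc_commute\<close> one side thus vanishes at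
  \<open>x\<close> if \<open>s\<close> is not such a descent, while the other side is [2] times
  mu.\<close>

lemma left_descents_mono:
  assumes w: "w \<in> Sr r" and x: "x \<in> Sr r" and i: "1 \<le> i" "i < r" "rdesc x i" "\<not> rdesc w i" "mu r x w \<noteq> 0"
    and s: "1 \<le> s" "s < r" "rdesc (inv w) s"
  shows "rdesc (inv x) s"
proof (rule ccontr)
  assume nd: "\<not> rdesc (inv x) s"
  have z: "actc r s (inv x) (inv v) = 0" if "v \<in> Sr r" for v
    using nd by (auto simp: actc_def)
  have "(\<Sum>v\<in>Sr r. actc r i x v * actc r s (inv v) (inv w)) = actc r i x w * l2"
  proof -
    have "actc r i x v * actc r s (inv v) (inv w) = (if v = w then actc r i x w * l2 else 0)" if "v \<in> Sr r" for v
    proof -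
      have "inv v = inv w \<longleftrightarrow> v = w" using Sr_inv_inv that w by metis
      then show ?thesis using s(3) by (simp add: actc_def)
    qed
    then show ?thesis using w by simp
  qed
  then have "actc r i x w * l2 = 0" using actc_commute[OF w x i(1,2) s(1,2)] z by simp
  moreover have "actc r i x w = of_int (mu r x w)" using i by (simp add: actc_def)
  ultimately have "l2 * of_int (mu r x w) = 0" by (simp add: mult.commute)
  \<comment> \<open>The coefficient of u in [2] times an integer is that integer.\<close>
  then have "Poly_Mapping.lookup (l2 * of_int (mu r x w)) 1 = 0" by (simp only: lookup_zero)
  then have "mu r x w = 0" by (simp add: distrib_right lookup_add lookup_of_int)
  then show False using i by simp
qed

section \<open>Star operations for two adjacent generators\<close>

definition kD :: "nat \<Rightarrow> (nat \<Rightarrow> nat) \<Rightarrow> bool" where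
  "kD k w \<longleftrightarrow> rdesc w k \<noteq> rdesc w (Suc k)"

text \<open>Knuth moves: the two outer values of three consecutive ones are exchanged across the
  middle one.\<close>
definition kstar :: "nat \<Rightarrow> (nat \<Rightarrow> nat) \<Rightarrow> nat \<Rightarrow> nat" where
  "kstar k w = (if min (w (Suc k)) (w (Suc (Suc k))) \<le> w k \<and> w k < max (w (Suc k)) (w (Suc (Suc k)))
     then w \<circ> sref (Suc k) else w \<circ> sref k)"

lemma kstar_Sr: "w \<in> Sr r \<Longrightarrow> 1 \<le> k \<Longrightarrow> Suc k < r \<Longrightarrow> kstar k w \<in> Sr r"
  by (simp add: kstar_def)

text \<open>A finite check on the relative order of three values. The last clause recognizes the
  star operation as the adjacent exchange that changes both descents, which later avoids unfolding
  its definition.\<close>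

lemma kstar_props:
  assumes w: "w \<in> Sr r" and D: "kD k w"
  shows "rdesc (kstar k w) k = rdesc w (Suc k)" "rdesc (kstar k w) (Suc k) = rdesc w k"
    "kstar k (kstar k w) = w" "kD k (kstar k w)"
    "\<And>v. v = w \<circ> sref k \<or> v = w \<circ> sref (Suc k) \<Longrightarrow> rdesc v k \<noteq> rdesc w k \<Longrightarrow>
      rdesc v (Suc k) \<noteq> rdesc w (Suc k) \<Longrightarrow> v = kstar k w"
proof -
  let ?a = "w k" and ?b = "w (Suc k)" and ?c = "w (Suc (Suc k))"
  have ne: "?a \<noteq> ?b" "?b \<noteq> ?c" "?a \<noteq> ?c" using Sr_inj[OF w] by simp_all
  have v: "(w \<circ> sref k) k = ?b" "(w \<circ> sref k) (Suc k) = ?a" "(w \<circ> sref k) (Suc (Suc k)) = ?c"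
     "(w \<circ> sref (Suc k)) k = ?a" "(w \<circ> sref (Suc k)) (Suc k) = ?c" "(w \<circ> sref (Suc k)) (Suc (Suc k)) = ?b"
    by simp_all
  show 1: "rdesc (kstar k w) k = rdesc w (Suc k)" "rdesc (kstar k w) (Suc k) = rdesc w k"
    using ne D unfolding kstar_def kD_def by (auto simp: min_def max_def split: if_splits)
  then show "kD k (kstar k w)" using D by (auto simp: kD_def)
  show "kstar k (kstar k w) = w"
  proof (cases "min ?b ?c \<le> ?a \<and> ?a < max ?b ?c")
    case True
    then have e: "kstar k w = w \<circ> sref (Suc k)" by (simp only: kstar_def if_True simp_thms)
    have "min ?c ?b \<le> ?a \<and> ?a < max ?c ?b" using True by (simp add: min.commute max.commute)
    then show ?thesis unfolding e kstar_def[of k "w \<circ> sref (Suc k)"] v by (simp only: if_True simp_thms comp_sref_sref)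
  next
    case False
    then have e: "kstar k w = w \<circ> sref k" by (simp only: kstar_def if_False simp_thms)
    have "\<not> (min ?a ?c \<le> ?b \<and> ?b < max ?a ?c)"
      using False ne D by (auto simp: kD_def min_def max_def split: if_splits)
    then show ?thesis unfolding e kstar_def[of k "w \<circ> sref k"] v by (simp only: if_False simp_thms comp_sref_sref)
  qed
  show "v' = kstar k w" if "v' = w \<circ> sref k \<or> v' = w \<circ> sref (Suc k)" "rdesc v' k \<noteq> rdesc w k"
      "rdesc v' (Suc k) \<noteq> rdesc w (Suc k)" for v'
    using that ne D unfolding kstar_def kD_def by (elim disjE) (auto simp: min_def max_def split: if_splits)
qed

lemma kstar_cases: "kstar k w = w \<circ> sref k \<or> kstar k w = w \<circ> sref (Suc k)"
  by (simp add: kstar_def)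

text \<open>Of \<open>k\<close> and \<open>Suc k\<close>, one is a descent of \<open>x\<close> only
  and the other of \<open>w\<close> only. So the longer of the two elements has a descent that the
  shorter lacks, and \<open>mu_desc_up\<close> makes them neighbours; changing both descents, the
  neighbour must be the star.\<close>

lemma mu_star:
  assumes x: "x \<in> Sr r" and w: "w \<in> Sr r" and k: "1 \<le> k" "Suc k < r"
    and d: "kD k w" "kD k x" "rdesc x k \<noteq> rdesc w k"
  shows "mu r x w = (if x = kstar k w then 1 else 0)"
proof (cases "x = kstar k w")
  case True
  have up: "mu r (v \<circ> sref i) v = 1" if "v \<in> Sr r" "1 \<le> i" "i < r" for v i
  proof (cases "v i < v (Suc i)")
    case True
    then show ?thesis using mu_sref that mu_sym by metis
  next
    case False
    then have "v (Suc i) < v i" using Sr_inj[OF that(1), of i "Suc i"] by linarith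
    then have "mu r (v \<circ> sref i) (v \<circ> sref i \<circ> sref i) = 1" using that by (intro mu_sref) auto
    then show ?thesis by (simp only: comp_sref_sref)
  qed
  have "mu r x w = 1"
    using kstar_cases[of k w] unfolding True
  proof
    assume e: "kstar k w = w \<circ> sref k"
    show "mu r (kstar k w) w = 1" unfolding e by (rule up) (use w k in auto)
  next
    assume e: "kstar k w = w \<circ> sref (Suc k)"
    show "mu r (kstar k w) w = 1" unfolding e by (rule up) (use w k in auto)
  qed
  then show ?thesis using True by simp
next
  case False
  have d': "rdesc x (Suc k) \<noteq> rdesc w (Suc k)" using d by (auto simp: kD_def)
  have "mu r x w = 0"
  proof (rule ccontr)
    assume nz: "mu r x w \<noteq> 0"
    have "x \<noteq> w" using d by auto
    then have "len x \<noteq> len w" using mu_eq_len[of x w r] nz by auto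
    moreover have False if l: "len w < len x"
    proof -
      obtain i where i: "i = k \<or> i = Suc k" "rdesc x i" "\<not> rdesc w i" using d d' by (auto simp: kD_def)
      have "x = w \<circ> sref i"
        by (rule mu_desc_up[OF w x _ _ i(2,3) l]) (use i k nz mu_sym[of r x w] in auto)
      then have "x = w \<circ> sref k \<or> x = w \<circ> sref (Suc k)" using i(1) by blast
      then have "x = kstar k w" by (rule kstar_props(5)[OF w d(1) _ d(3) d'])
      then show False using \<open>x \<noteq> kstar k w\<close> by simp
    qed
    moreover have False if l: "len x < len w"
    proof -
      obtain i where i: "i = k \<or> i = Suc k" "rdesc w i" "\<not> rdesc x i" using d d' by (auto simp: kD_def)
      have "w = x \<circ> sref i"
        by (rule mu_desc_up[OF x w _ _ i(2,3) l]) (use i k nz in auto)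
      then have "x = w \<circ> sref i" by (simp only: comp_sref_sref)
      then have "x = w \<circ> sref k \<or> x = w \<circ> sref (Suc k)" using i(1) by blast
      then have "x = kstar k w" by (rule kstar_props(5)[OF w d(1) _ d(3) d'])
      then show False using \<open>x \<noteq> kstar k w\<close> by simp
    qed
    ultimately show False by linarith
  qed
  then show ?thesis using False by simp
qed

definition lstar :: "nat \<Rightarrow> (nat \<Rightarrow> nat) \<Rightarrow> nat \<Rightarrow> nat" where
  "lstar k w = inv (kstar k (inv w))"

lemma lstar_Sr: "w \<in> Sr r \<Longrightarrow> 1 \<le> k \<Longrightarrow> Suc k < r \<Longrightarrow> lstar k w \<in> Sr r"
  by (simp add: lstar_def Sr_inv kstar_Sr)

lemma inv_lstar: "w \<in> Sr r \<Longrightarrow> 1 \<le> k \<Longrightarrow> Suc k < r \<Longrightarrow> inv (lstar k w) = kstar k (inv w)"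
  unfolding lstar_def by (rule Sr_inv_inv[where r = r]) (simp add: kstar_Sr Sr_inv)

text \<open>The values exchanged by a left star operation are not adjacent in the word, because
  another value lies between them.\<close>
lemma rdesc_lstar:
  assumes w: "w \<in> Sr r" and k: "1 \<le> k" "Suc k < r" and D: "kD k (inv w)"
  shows "rdesc (lstar k w) i = rdesc w i"
proof -
  let ?v = "inv w"
  have v: "?v \<in> Sr r" using Sr_inv[OF w] .
  obtain j where j: "kstar k ?v = ?v \<circ> sref j"
    and far: "Suc (?v j) \<noteq> ?v (Suc j)" "Suc (?v (Suc j)) \<noteq> ?v j"
  proof (cases "min (?v (Suc k)) (?v (Suc (Suc k))) \<le> ?v k \<and> ?v k < max (?v (Suc k)) (?v (Suc (Suc k)))")
    case True
    show thesis
    proof (rule that[of "Suc k"])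
      show "kstar k ?v = ?v \<circ> sref (Suc k)" using True by (simp only: kstar_def if_True simp_thms)
      have "?v k \<noteq> ?v (Suc k)" "?v k \<noteq> ?v (Suc (Suc k))" using Sr_inj[OF v] by simp_all
      then show "Suc (?v (Suc k)) \<noteq> ?v (Suc (Suc k))" "Suc (?v (Suc (Suc k))) \<noteq> ?v (Suc k)"
        using True by (auto simp: min_def max_def split: if_splits)
    qed
  next
    case False
    show thesis
    proof (rule that[of k])
      show "kstar k ?v = ?v \<circ> sref k" using False by (simp only: kstar_def if_False simp_thms)
      have "?v k \<noteq> ?v (Suc k)" "?v k \<noteq> ?v (Suc (Suc k))" "?v (Suc k) \<noteq> ?v (Suc (Suc k))"
        using Sr_inj[OF v] by simp_all
      then show "Suc (?v k) \<noteq> ?v (Suc k)" "Suc (?v (Suc k)) \<noteq> ?v k"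
        using False D unfolding kD_def by (auto simp: min_def max_def split: if_splits)
    qed
  qed
  have l: "lstar k w = sref j \<circ> w"
    using inv_comp_sref[OF v, of j] Sr_inv_inv[OF w] by (simp only: lstar_def j)
  have "sref j \<circ> w \<noteq> w \<circ> sref i"
  proof
    assume e: "sref j \<circ> w = w \<circ> sref i"
    have "sref i \<circ> ?v = ?v \<circ> sref j"
      using e inv_comp_sref[OF w, of i] inv_sref_comp[OF w, of j] by metis
    then have e': "sref i (?v j) = ?v (Suc j)" by (metis comp_apply sref_simps(1))
    have "?v j \<noteq> ?v (Suc j)" using Sr_inj[OF v] by simp
    then have "?v j = i \<or> ?v j = Suc i" using e' by (metis sref_simps(3))
    then show False using e' far by auto
  qed
  from sref_comp_less_iff[OF w this] show ?thesis by (simp add: l)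
qed

text \<open>Let \<open>t\<close> be the generator of the pair that is not a left descent of
  \<open>w\<close>. Compare the coefficients at \<open>lstar k x\<close> when \<open>C'_w\<close> is
  multiplied by \<open>C'_t\<close> on the left and by \<open>C'_i\<close> on the right. By
  \<open>mu_star\<close>, only \<open>x\<close> contributes in one order of multiplication and only
  \<open>lstar k w\<close> in the other.\<close>

lemma mu_lstar:
  assumes x: "x \<in> Sr r" and w: "w \<in> Sr r" and k: "1 \<le> k" "Suc k < r"
    and D: "kD k (inv w)" "kD k (inv x)" "rdesc (inv x) k = rdesc (inv w) k"
    and i: "1 \<le> i" "i < r" "rdesc x i" "\<not> rdesc w i"
  shows "mu r (lstar k x) (lstar k w) = mu r x w"
proof -
  obtain s t where st: "(s = k \<and> t = Suc k) \<or> (s = Suc k \<and> t = k)"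
    and ws: "rdesc (inv w) s" "\<not> rdesc (inv w) t"
    using D(1) by (auto simp: kD_def)
  have xs: "rdesc (inv x) s" "\<not> rdesc (inv x) t" using st ws D by (auto simp: kD_def)
  have s: "1 \<le> s" "s < r" and t: "1 \<le> t" "t < r" using st k by auto
  let ?y = "lstar k x" and ?z = "lstar k w"
  have y: "?y \<in> Sr r" and z: "?z \<in> Sr r" using lstar_Sr k x w by auto
  have iy: "inv ?y = kstar k (inv x)" and iz: "inv ?z = kstar k (inv w)" using inv_lstar k x w by blast+
  note px = kstar_props[OF Sr_inv[OF x] D(2)] and pw = kstar_props[OF Sr_inv[OF w] D(1)]
  have ys: "\<not> rdesc (inv ?y) s" "rdesc (inv ?y) t" "kD k (inv ?y)"
    unfolding iy using px(1,2,4) st xs by auto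
  have yi: "rdesc ?y i" using rdesc_lstar[OF x k D(2)] i by simp
  have zi: "\<not> rdesc ?z i" using rdesc_lstar[OF w k D(1)] i by simp
  have inj: "inv a = inv b \<longleftrightarrow> a = b" if "a \<in> Sr r" "b \<in> Sr r" for a b
    using Sr_inv_inv that by metis
  have star: "mu r (inv ?y) (inv v) = (if v = x then 1 else 0)"
    if v: "v \<in> Sr r" "rdesc (inv v) s" "\<not> rdesc (inv v) t" for v
  proof -
    have "mu r (inv ?y) (inv v) = (if inv ?y = kstar k (inv v) then 1 else 0)"
      by (rule mu_star[OF Sr_inv[OF y] Sr_inv[OF v(1)] k]) (use ys v st in \<open>auto simp: kD_def\<close>)
    moreover have "kD k (inv v)" using v st by (auto simp: kD_def)
    then have "inv ?y = kstar k (inv v) \<longleftrightarrow> inv v = inv x"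
      using kstar_props(3)[OF Sr_inv[OF v(1)]] px(3) unfolding iy by metis
    ultimately show ?thesis using inj[OF v(1) x] by simp
  qed
  have star': "mu r (inv v) (inv w) = (if v = ?z then 1 else 0)"
    if v: "v \<in> Sr r" "\<not> rdesc (inv v) s" "rdesc (inv v) t" for v
  proof -
    have "mu r (inv v) (inv w) = (if inv v = kstar k (inv w) then 1 else 0)"
      by (rule mu_star[OF Sr_inv[OF v(1)] Sr_inv[OF w] k D(1)]) (use ws v st in \<open>auto simp: kD_def\<close>)
    then show ?thesis using inj[OF v(1) z] iz by simp
  qed
  have "(\<Sum>v\<in>Sr r. actc r t (inv ?y) (inv v) * actc r i v w) = (\<Sum>v\<in>Sr r. if v = x then of_int (mu r x w) else 0)"
  proof (rule sum.cong)
    fix v assume v: "v \<in> Sr r"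
    show "actc r t (inv ?y) (inv v) * actc r i v w = (if v = x then of_int (mu r x w) else 0)"
    proof (cases "rdesc v i \<and> mu r v w \<noteq> 0")
      case True
      \<comment> \<open>Everything that occurs in the right multiple of \<open>C'_w\<close> inherits
        the left descent \<open>s\<close>; this leaves no candidates outside the domain where
        \<open>star\<close> applies.\<close>
      then have vs: "rdesc (inv v) s" using left_descents_mono[OF w v i(1,2) _ i(4) _ s ws(1)] by blast
      show ?thesis
      proof (cases "rdesc (inv v) t")
        case True
        have "inv ?y \<noteq> inv v" using vs ys by auto
        moreover have "v \<noteq> x" using True xs by auto
        ultimately show ?thesis using True by (simp add: actc_def)
      next
        case False
        then show ?thesis using star[OF v vs False] ys i by (simp add: actc_def)
      qed
    next
      case False
      then have "actc r i v w = 0" using i by (auto simp: actc_def)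
      moreover have "v = x \<longrightarrow> mu r x w = 0" using False i by auto
      ultimately show ?thesis by simp
    qed
  qed simp
  also have "\<dots> = of_int (mu r x w)" using x by simp
  finally have L: "(\<Sum>v\<in>Sr r. actc r t (inv ?y) (inv v) * actc r i v w) = of_int (mu r x w)" .
  have "(\<Sum>v\<in>Sr r. actc r i ?y v * actc r t (inv v) (inv w))
      = (\<Sum>v\<in>Sr r. if v = ?z then of_int (mu r ?y ?z) else 0)"
  proof (rule sum.cong)
    fix v assume v: "v \<in> Sr r"
    show "actc r i ?y v * actc r t (inv v) (inv w) = (if v = ?z then of_int (mu r ?y ?z) else 0)"
    proof (cases "rdesc v i")
      case True
      then have "v \<noteq> ?z" using zi by auto
      moreover have "actc r t (inv ?y) (inv w) = 0"
        using star'[OF y ys(1,2)] yi zi ws by (auto simp: actc_def)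
      ultimately show ?thesis using True by (auto simp: actc_def[of r i])
    next
      case ni: False
      have a: "actc r i ?y v = of_int (mu r ?y v)" using ni yi by (simp add: actc_def)
      show ?thesis
      proof (cases "rdesc (inv v) t")
        case False
        have "v \<noteq> ?z" using False iz pw(1,2) st ws by auto
        then show ?thesis using False ws by (simp add: actc_def[of r t])
      next
        case vt: True
        have b: "actc r t (inv v) (inv w) = of_int (mu r (inv v) (inv w))" using vt ws by (simp add: actc_def)
        show ?thesis
        proof (cases "rdesc (inv v) s")
          case True
          then have "mu r ?y v = 0" using left_descents_mono[OF v y i(1,2) yi ni _ s] ys by blast
          moreover have "v \<noteq> ?z" using True iz pw(1,2) st ws by auto
          ultimately show ?thesis using a by simp
        next
          case False
          then show ?thesis unfolding a b using star'[OF v False vt] by simp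
        qed
      qed
    qed
  qed simp
  also have "\<dots> = of_int (mu r ?y ?z)" using z by simp
  finally have R: "(\<Sum>v\<in>Sr r. actc r i ?y v * actc r t (inv v) (inv w)) = of_int (mu r ?y ?z)" .
  have "(of_int (mu r ?y ?z) :: laurent) = of_int (mu r x w)"
    using actc_commute[OF w y i(1,2) t] L R by simp
  then show ?thesis by (simp only: of_int_eq_iff)
qed

section \<open>The right preorder and right cells\<close>

definition redge :: "nat \<Rightarrow> ((nat \<Rightarrow> nat) \<times> (nat \<Rightarrow> nat)) set" where
  "redge r = {(x, w). x \<in> Sr r \<and> w \<in> Sr r \<and> mu r x w \<noteq> 0 \<and> (\<exists>i. 1 \<le> i \<and> i < r \<and> rdesc x i \<and> \<not> rdesc w i)}"

text \<open>Membership in the same Kazhdan-Lusztig right cell: an edge of \<open>redge\<close> leads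
  to \<open>w\<close> from each other basis element that occurs in a right multiple of
  \<open>C'_w\<close> by a generator.\<close>

definition ceq :: "nat \<Rightarrow> (nat \<Rightarrow> nat) \<Rightarrow> (nat \<Rightarrow> nat) \<Rightarrow> bool" where
  "ceq r x w \<longleftrightarrow> x \<in> Sr r \<and> w \<in> Sr r \<and> (x, w) \<in> (redge r)\<^sup>* \<and> (w, x) \<in> (redge r)\<^sup>*"

lemma redge_left_descents:
  assumes "(x, w) \<in> (redge r)\<^sup>*" "1 \<le> s" "s < r" "rdesc (inv w) s"
  shows "rdesc (inv x) s"
  using assms(1)
proof (induction rule: converse_rtrancl_induct)
  case base show ?case by (rule assms(4))
next
  case (step y z)
  then show "rdesc (inv y) s" using left_descents_mono assms(2,3) by (auto simp: redge_def)
qed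

lemma ceq_left_descents: "ceq r x w \<Longrightarrow> 1 \<le> s \<Longrightarrow> s < r \<Longrightarrow> rdesc (inv x) s = rdesc (inv w) s"
  using redge_left_descents by (auto simp: ceq_def)

text \<open>Each of the two elements has a descent that the other lacks, and mu is 1, so there are
  edges in both directions.\<close>

lemma ceq_kstar:
  assumes w: "w \<in> Sr r" and k: "1 \<le> k" "Suc k < r" and D: "kD k w"
  shows "ceq r (kstar k w) w"
proof -
  have x: "kstar k w \<in> Sr r" using kstar_Sr w k by blast
  note p = kstar_props[OF w D]
  have m: "mu r (kstar k w) w = 1" "mu r w (kstar k w) = 1"
    using mu_star[OF x w k D p(4)] mu_sym p D by (auto simp: kD_def)
  have "k < r" "1 \<le> Suc k" using k by auto
  then have "(kstar k w, w) \<in> redge r" "(w, kstar k w) \<in> redge r"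
    using x w m p(1,2) D k unfolding redge_def kD_def by (cases "rdesc w k"; force)+
  then show ?thesis using x w by (auto simp: ceq_def)
qed

lemma ceq_trans: "ceq r x w \<Longrightarrow> ceq r w z \<Longrightarrow> ceq r x z" by (auto simp: ceq_def)

text \<open>The path back from \<open>w\<close> to \<open>x\<close> keeps every intermediate element
  in the cell of \<open>w\<close>. All of them then share its left descents, so the left star
  operation is defined along the whole path and \<open>mu_lstar\<close> moves each edge.\<close>

lemma redge_lstar:
  assumes w: "w \<in> Sr r" and k: "1 \<le> k" "Suc k < r" and D: "kD k (inv w)"
    and xw: "(x, w) \<in> (redge r)\<^sup>*" and wx: "(w, x) \<in> (redge r)\<^sup>*"
  shows "(lstar k x, lstar k w) \<in> (redge r)\<^sup>*"
  using xw wx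
proof (induction rule: converse_rtrancl_induct)
  case base show ?case by simp
next
  case (step y z)
  have wz: "(w, z) \<in> (redge r)\<^sup>*" using step by (meson rtrancl.rtrancl_into_rtrancl)
  have IH: "(lstar k z, lstar k w) \<in> (redge r)\<^sup>*" by (rule step.IH[OF wz])
  obtain i where i: "y \<in> Sr r" "z \<in> Sr r" "mu r y z \<noteq> 0" "1 \<le> i" "i < r" "rdesc y i" "\<not> rdesc z i"
    using step(1) by (auto simp: redge_def)
  have yw: "ceq r y w" "ceq r z w" using step i w wz by (auto simp: ceq_def)
  have L: "rdesc (inv y) k = rdesc (inv w) k" "rdesc (inv z) k = rdesc (inv w) k"
    "rdesc (inv y) (Suc k) = rdesc (inv w) (Suc k)" "rdesc (inv z) (Suc k) = rdesc (inv w) (Suc k)"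
    using ceq_left_descents[OF yw(1)] ceq_left_descents[OF yw(2)] k by auto
  have Dy: "kD k (inv y)" "kD k (inv z)" using L D by (auto simp: kD_def)
  have "mu r (lstar k y) (lstar k z) \<noteq> 0"
    using mu_lstar[OF i(1,2) k Dy(2,1) _ i(4-7)] L i by simp
  then have "(lstar k y, lstar k z) \<in> redge r"
    using i lstar_Sr[OF i(1) k] lstar_Sr[OF i(2) k] rdesc_lstar[OF i(1) k Dy(1)] rdesc_lstar[OF i(2) k Dy(2)]
    by (auto simp: redge_def)
  then show "(lstar k y, lstar k w) \<in> (redge r)\<^sup>*" using IH by (rule converse_rtrancl_into_rtrancl)
qed

lemma ceq_lstar:
  assumes "ceq r x w" and k: "1 \<le> k" "Suc k < r" and D: "kD k (inv w)"
  shows "ceq r (lstar k x) (lstar k w)"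
proof -
  have S: "x \<in> Sr r" "w \<in> Sr r" "(x, w) \<in> (redge r)\<^sup>*" "(w, x) \<in> (redge r)\<^sup>*"
    using assms by (auto simp: ceq_def)
  have "rdesc (inv x) k = rdesc (inv w) k" "rdesc (inv x) (Suc k) = rdesc (inv w) (Suc k)"
    using ceq_left_descents[OF assms(1)] k by auto
  then have "kD k (inv x)" using D by (auto simp: kD_def)
  then show ?thesis using redge_lstar S k D lstar_Sr by (auto simp: ceq_def)
qed

section \<open>Lattice words\<close>

text \<open>A standard tableau is encoded by its lattice word: the sequence of row indices of the
  entries \<open>1, 2, \<dots>\<close>.\<close>
definition LW :: "nat list \<Rightarrow> bool" where
  "LW ks \<longleftrightarrow> (\<forall>n k. count_list (take n ks) (Suc k) \<le> count_list (take n ks) k)"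

text \<open>List positions start at 0, so \<open>wd ks i\<close> is the descent of the tableau at
  \<open>Suc i\<close>: entry \<open>i + 2\<close> lies strictly south of entry
  \<open>i + 1\<close>.\<close>

abbreviation wd :: "nat list \<Rightarrow> nat \<Rightarrow> bool" where
  "wd ks i \<equiv> ks ! i < ks ! Suc i"

definition wD :: "nat \<Rightarrow> nat list \<Rightarrow> bool" where
  "wD i ks \<longleftrightarrow> wd ks i \<noteq> wd ks (Suc i)"

definition swp :: "nat \<Rightarrow> 'a list \<Rightarrow> 'a list" where
  "swp j ks = ks[j := ks ! Suc j, Suc j := ks ! j]"

text \<open>The test of \<open>kstar\<close> applied to row indices. These may coincide, and the
  half-open test breaks ties: a letter equal to the smaller of the other two counts as lying between
  them.\<close>

definition wstar :: "nat \<Rightarrow> nat list \<Rightarrow> nat list" where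
  "wstar i ks = (if min (ks ! Suc i) (ks ! Suc (Suc i)) \<le> ks ! i \<and> ks ! i < max (ks ! Suc i) (ks ! Suc (Suc i))
     then swp (Suc i) ks else swp i ks)"

lemma count_list_snoc [simp]: "count_list (xs @ [x]) y = count_list xs y + (if x = y then 1 else 0)"
  by simp

lemma LW_Nil [simp]: "LW []"
  by (simp add: LW_def)

lemma LW_count: "LW ks \<Longrightarrow> count_list ks (Suc k) \<le> count_list ks k"
  unfolding LW_def by (metis order_refl take_all)

lemma LW_count_le: "LW ks \<Longrightarrow> j \<le> k \<Longrightarrow> count_list ks k \<le> count_list ks j"
  using lift_Suc_antimono_le[of "count_list ks" j k] LW_count by blast

lemma LW_take: "LW ks \<Longrightarrow> LW (take n ks)"
  by (simp add: LW_def)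

lemma LW_append1: "LW (xs @ ys) \<Longrightarrow> LW xs"
  using LW_take[of "xs @ ys" "length xs"] by simp

lemma LW_snoc: "LW (ks @ [k]) \<longleftrightarrow> LW ks \<and> (k = 0 \<or> count_list ks k < count_list ks (k - 1))"
proof
  assume l: "LW (ks @ [k])"
  have "LW ks" using LW_append1[OF l] .
  moreover have "k = 0 \<or> count_list ks k < count_list ks (k - 1)"
    using LW_count[OF l, of "k - 1"] by (cases k) auto
  ultimately show "LW ks \<and> (k = 0 \<or> count_list ks k < count_list ks (k - 1))" by simp
next
  assume r: "LW ks \<and> (k = 0 \<or> count_list ks k < count_list ks (k - 1))"
  show "LW (ks @ [k])"
    unfolding LW_def
  proof (intro allI)
    fix n j
    show "count_list (take n (ks @ [k])) (Suc j) \<le> count_list (take n (ks @ [k])) j"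
    proof (cases "n \<le> length ks")
      case True then show ?thesis using r by (simp add: LW_def)
    next
      case False
      then have "take n (ks @ [k]) = ks @ [k]" by simp
      then show ?thesis using r LW_count[of ks j] by auto
    qed
  qed
qed

text \<open>Every partition is the shape of a lattice word. \<open>K\<close> is the last nonempty
  row, whose final box is always a removable corner.\<close>

lemma LW_exists:
  assumes "\<And>k. c (Suc k) \<le> c k" "\<And>k. N \<le> k \<Longrightarrow> c k = 0"
  shows "\<exists>ks. LW ks \<and> count_list ks = (c :: nat \<Rightarrow> nat)"
  using assms
proof (induction "\<Sum>k<N. c k" arbitrary: c)
  case 0
  have "c k = 0" for k using 0 by (cases "k < N") auto
  then show ?case by (intro exI[of _ "[]"]) auto
next
  case (Suc n)
  define B where "B = {k. c k \<noteq> 0}"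
  have "B \<subseteq> {..<N}" using Suc.prems(2) by (metis (mono_tags) B_def lessThan_iff mem_Collect_eq not_le subsetI)
  then have fin: "finite B" using finite_subset by blast
  have "B \<noteq> {}"
  proof
    assume "B = {}"
    then have "(\<Sum>k<N. c k) = 0" by (auto simp: B_def)
    then show False using Suc.hyps(2) by simp
  qed
  define K where "K = Max B"
  have K: "K \<in> B" and Kmax: "k \<in> B \<Longrightarrow> k \<le> K" for k using fin \<open>B \<noteq> {}\<close> by (simp_all add: K_def)
  have KN: "K < N" using K \<open>B \<subseteq> _\<close> by auto
  have cK: "c (Suc K) = 0" using Kmax[of "Suc K"] by (auto simp: B_def)
  let ?c = "c(K := c K - 1)"
  have "(\<Sum>k<N. c k) = Suc (\<Sum>k<N. ?c k)"
    using KN K by (subst (1 2) sum.remove[of _ K]) (auto simp: B_def)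
  then have "n = (\<Sum>k<N. ?c k)" using Suc.hyps(2) by simp
  moreover have "?c (Suc k) \<le> ?c k" for k
    using Suc.prems(1)[of k] cK by (cases "k = K"; cases "Suc k = K") auto
  moreover have "N \<le> k \<Longrightarrow> ?c k = 0" for k using Suc.prems(2) by simp
  ultimately obtain ks where ks: "LW ks" "count_list ks = ?c" using Suc.hyps(1) by metis
  have "c K > 0" using K by (simp add: B_def)
  then have "LW (ks @ [K])" using ks Suc.prems(1)[of "K - 1"] by (auto simp: LW_snoc)
  moreover have "count_list (ks @ [K]) = c" using ks \<open>c K > 0\<close> by (auto simp: fun_eq_iff)
  ultimately show ?case by blast
qed

lemma split3:
  assumes "Suc (Suc i) < length ks"
  obtains p a b c s where "ks = p @ a # b # c # s" "length p = i"
proof -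
  have "ks = take i ks @ ks ! i # ks ! Suc i # ks ! Suc (Suc i) # drop (Suc (Suc (Suc i))) ks"
    using assms by (metis Cons_nth_drop_Suc Suc_lessD append_take_drop_id)
  then show thesis using that[of "take i ks"] assms by auto
qed

lemma nth_split3 [simp]:
  "(p @ a # b # c # s) ! length p = a" "(p @ a # b # c # s) ! Suc (length p) = b"
  "(p @ a # b # c # s) ! Suc (Suc (length p)) = c"
  by (simp_all add: nth_append)

lemma swp_append: "length p = j \<Longrightarrow> swp j (p @ x # y # s) = p @ y # x # s"
  by (auto simp: swp_def list_update_append nth_append)

lemma swp_append': "length p = j \<Longrightarrow> swp (Suc j) (p @ x # y # z # s) = p @ x # z # y # s"
  using swp_append[of "p @ [x]" "Suc j" y z s] by simp

lemma wstar_split: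
  "wstar (length p) (p @ a # b # c # s)
    = (if min b c \<le> a \<and> a < max b c then p @ a # c # b # s else p @ b # a # c # s)"
  by (simp add: wstar_def swp_append swp_append')

lemma wD_split: "wD (length p) (p @ a # b # c # s) \<longleftrightarrow> (a < b) \<noteq> (b < c)"
  by (simp add: wD_def)

lemma wstar_props:
  assumes "Suc (Suc i) < length ks" "wD i ks"
  shows "wd (wstar i ks) i = wd ks (Suc i)" "wd (wstar i ks) (Suc i) = wd ks i"
    "wstar i (wstar i ks) = ks" "wD i (wstar i ks)"
    "\<And>v. v = swp i ks \<or> v = swp (Suc i) ks \<Longrightarrow> wd v i \<noteq> wd ks i \<Longrightarrow> wd v (Suc i) \<noteq> wd ks (Suc i) \<Longrightarrow>
      v = wstar i ks"
proof -
  obtain p a b c s where ks: "ks = p @ a # b # c # s" and i: "i = length p"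
    using split3[OF assms(1)] by metis
  have D: "(a < b) \<noteq> (b < c)" using assms(2) by (simp add: ks i wD_split)
  show "wd (wstar i ks) i = wd ks (Suc i)" "wd (wstar i ks) (Suc i) = wd ks i" "wD i (wstar i ks)"
    "wstar i (wstar i ks) = ks"
    using D unfolding ks i wstar_split by (auto simp: wD_split wstar_split min_def max_def split: if_splits)
  show "v = wstar i ks" if "v = swp i ks \<or> v = swp (Suc i) ks" "wd v i \<noteq> wd ks i" "wd v (Suc i) \<noteq> wd ks (Suc i)" for v
    using that D unfolding ks i wstar_split swp_append[OF refl] swp_append'[OF refl]
    by (auto simp: min_def max_def)
qed

lemma length_wstar [simp]: "length (wstar i ks) = length ks"
  by (simp add: wstar_def swp_def)

lemma mset_swp: "Suc j < length ks \<Longrightarrow> mset (swp j ks) = mset ks"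
  unfolding swp_def by (rule mset_swap) auto

lemma count_list_wstar:
  assumes "Suc (Suc i) < length ks" shows "count_list (wstar i ks) = count_list ks"
proof -
  have "mset (wstar i ks) = mset ks" 
    using assms mset_swp[of i ks] mset_swp[of "Suc i" ks] by (simp add: wstar_def)
  then show ?thesis by (auto simp: fun_eq_iff simp flip: count_mset)
qed

lemma wstar_snoc: "Suc (Suc i) < length ks \<Longrightarrow> wstar i (ks @ [k]) = wstar i ks @ [k]"
  by (simp add: wstar_def swp_def nth_append list_update_append)

lemma wD_snoc: "Suc (Suc i) < length ks \<Longrightarrow> wD i (ks @ [k]) = wD i ks"
  by (simp add: wD_def nth_append)

section \<open>Connectedness of lattice words of one shape\<close>

definition wrel :: "(nat list \<times> nat list) set" where
  "wrel = {(ks, wstar i ks) | ks i. LW ks \<and> LW (wstar i ks) \<and> Suc (Suc i) < length ks \<and> wD i ks}"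

lemma wrelI:
  "LW ks \<Longrightarrow> LW (wstar i ks) \<Longrightarrow> Suc (Suc i) < length ks \<Longrightarrow> wD i ks \<Longrightarrow> (ks, wstar i ks) \<in> wrel"
  unfolding wrel_def by blast

lemma wrel_sym: "(a, c) \<in> wrel \<Longrightarrow> (c, a) \<in> wrel"
proof -
  assume "(a, c) \<in> wrel"
  then obtain i where i: "c = wstar i a" "LW a" "LW c" "Suc (Suc i) < length a" "wD i a" by (auto simp: wrel_def)
  then have "a = wstar i c" "wD i c" "Suc (Suc i) < length c" using wstar_props by auto
  then show ?thesis using i unfolding wrel_def by blast
qed

lemma wrel_rtrancl_sym: "(a, c) \<in> wrel\<^sup>* \<Longrightarrow> (c, a) \<in> wrel\<^sup>*"
  by (induction rule: rtrancl_induct) (auto intro: converse_rtrancl_into_rtrancl wrel_sym)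

lemma wrel_count: "(a, c) \<in> wrel \<Longrightarrow> count_list a = count_list c \<and> length a = length c"
  by (auto simp: wrel_def count_list_wstar)

text \<open>Whether a letter may be appended depends only on the shape reached, and moves inside the
  prefix keep that shape.\<close>

lemma wrel_snoc:
  assumes "(p, q) \<in> wrel\<^sup>*" "LW (p @ [k])"
  shows "(p @ [k], q @ [k]) \<in> wrel\<^sup>* \<and> LW (q @ [k])"
  using assms(1)
proof (induction rule: rtrancl_induct)
  case base then show ?case using assms by simp
next
  case (step y z)
  obtain i where i: "z = wstar i y" "LW y" "LW z" "Suc (Suc i) < length y" "wD i y" using step(2) by (auto simp: wrel_def)
  have "LW (y @ [k])" using step(3) by blast
  then have l: "LW (z @ [k])" using i(3) wrel_count[OF step(2)] unfolding LW_snoc by metis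
  have e: "wstar i (y @ [k]) = z @ [k]" using wstar_snoc[OF i(4)] i(1) by simp
  have "(y @ [k], wstar i (y @ [k])) \<in> wrel"
  proof (rule wrelI)
    show "LW (y @ [k])" using step(3) by blast
    show "LW (wstar i (y @ [k]))" unfolding e by (rule l)
    show "Suc (Suc i) < length (y @ [k])" using i(4) by simp
    show "wD i (y @ [k])" using wD_snoc[OF i(4)] i(5) by simp
  qed
  then have "(y @ [k], z @ [k]) \<in> wrel" unfolding e .
  then show ?case using step(3) l by (auto intro: rtrancl_into_rtrancl)
qed

lemma count_eq_length: "count_list a = count_list c \<Longrightarrow> length a = length (c :: nat list)"
proof -
  assume "count_list a = count_list c"
  then have "mset a = mset c" by (intro multiset_eqI) (simp add: count_mset fun_eq_iff)
  then show ?thesis by (metis size_mset)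
qed

lemma antimono_drop:
  fixes c :: "nat \<Rightarrow> nat"
  assumes "k < l" "c l < c k"
  obtains d where "k \<le> d" "d < l" "c (Suc d) < c d"
proof -
  have "\<exists>d. k \<le> d \<and> d < l \<and> c (Suc d) < c d"
  proof (rule ccontr)
    assume n: "\<nexists>d. k \<le> d \<and> d < l \<and> c (Suc d) < c d"
    have "c k \<le> c j" if "k \<le> j" "j \<le> l" for j
      using that
    proof (induction j rule: dec_induct)
      case (step m)
      have "c m \<le> c (Suc m)" using n step by (meson Suc_le_lessD not_less)
      then show ?case using step by linarith
    qed simp
    from this[of l] show False using assms by simp
  qed
  then show thesis using that by blast
qed

text \<open>Remove the two last boxes, in rows \<open>k\<close> and \<open>l\<close>, from the
  common shape. The rest has a corner \<open>d\<close> with \<open>k \<le> d < l\<close>; behind a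
  word ending in \<open>d\<close>, the two orders of adding \<open>k\<close> and \<open>l\<close>
  differ by one star move. Induction connects the given prefixes to such words.\<close>

lemma wconn_lt:
  assumes p: "LW (p @ [k])" and q: "LW (q @ [l])" and cnt: "count_list (p @ [k]) = count_list (q @ [l])"
    and kl: "k < l"
    and IH: "\<And>a c. LW a \<Longrightarrow> LW c \<Longrightarrow> length a = length p \<Longrightarrow> count_list a = count_list c \<Longrightarrow> (a, c) \<in> wrel\<^sup>*"
  shows "(p @ [k], q @ [l]) \<in> wrel\<^sup>*"
proof -
  define A where "A = count_list (p @ [k])"
  define \<nu> where "\<nu> j = A j - (if j = k \<or> j = l then 1 else 0)" for j
  have Aq: "A = count_list (q @ [l])" using cnt by (simp add: A_def)
  have cp: "count_list p j = A j - (if j = k then 1 else 0)" for j by (auto simp: A_def)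
  have cq: "count_list q j = A j - (if j = l then 1 else 0)" for j by (auto simp: Aq)
  have Apos: "A k \<ge> 1" "A l \<ge> 1" by (simp add: A_def) (simp add: Aq)
  have Adec: "A (Suc j) \<le> A j" for j using LW_count[OF p] by (simp add: A_def)
  have Ale: "i \<le> j \<Longrightarrow> A j \<le> A i" for i j using LW_count_le[OF p] by (simp add: A_def)
  have pk: "A (Suc k) < A k" using LW_count[OF LW_append1[OF p], of k] Apos by (simp add: cp)
  have ql: "A (Suc l) < A l" using LW_count[OF LW_append1[OF q], of l] Apos by (simp add: cq)
  have \<nu>dec: "\<nu> (Suc j) \<le> \<nu> j" for j
    using Adec[of j] pk ql by (cases "j = k"; cases "j = l") (auto simp: \<nu>_def)
  have "A l \<le> A (Suc k)" using Ale kl by simp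
  then have "\<nu> l < \<nu> k" using pk Apos by (simp add: \<nu>_def)
  \<comment> \<open>A place where the row lengths drop is a removable corner. The case
    \<open>d = k\<close> is admissible thanks to the tie-breaking in \<open>wstar\<close>.\<close>
  then obtain d where d: "k \<le> d" "d < l" "\<nu> (Suc d) < \<nu> d" using antimono_drop kl by metis
  have "\<exists>N. \<forall>j\<ge>N. A j = 0"
  proof (intro exI allI impI)
    fix j assume "Suc (sum_list (p @ [k])) \<le> j"
    then have "j \<notin> set (p @ [k])" using member_le_sum_list[of j "p @ [k]"] by auto
    then show "A j = 0" unfolding A_def using count_list_0_iff by metis
  qed
  then obtain N where N: "\<And>j. N \<le> j \<Longrightarrow> A j = 0" by blast
  let ?c = "\<nu>(d := \<nu> d - 1)"
  have "?c (Suc j) \<le> ?c j" for j using \<nu>dec[of j] d by auto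
  moreover have "N \<le> j \<Longrightarrow> ?c j = 0" for j using N[of j] by (auto simp: \<nu>_def)
  ultimately obtain q0 where q0: "LW q0" "count_list q0 = ?c" using LW_exists by metis
  have c1: "count_list (q0 @ [d]) = \<nu>" using q0 d by (auto simp: fun_eq_iff)
  have l1: "LW (q0 @ [d])" using q0 d \<nu>dec[of "d - 1"] by (cases d) (auto simp: LW_snoc)
  have \<nu>k: "k = 0 \<or> \<nu> k < \<nu> (k - 1)" using Adec[of "k - 1"] Apos kl by (cases k) (auto simp: \<nu>_def)
  have \<nu>l: "\<nu> l < \<nu> (l - 1)"
  proof (cases "l - 1 = k")
    case True then show ?thesis using \<open>\<nu> l < \<nu> k\<close> by simp
  next
    case False then show ?thesis using Adec[of "l - 1"] Apos kl by (auto simp: \<nu>_def)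
  qed
  have lk: "LW ((q0 @ [d]) @ [k])" unfolding LW_snoc[of "q0 @ [d]"] c1 using l1 \<nu>k by simp
  have ll: "LW ((q0 @ [d]) @ [l])" unfolding LW_snoc[of "q0 @ [d]"] c1 using l1 \<nu>l by simp
  have c2: "count_list ((q0 @ [d]) @ [m]) j = \<nu> j + (if m = j then 1 else 0)" for m j
    unfolding count_list_snoc[of "q0 @ [d]"] c1 ..
  have lkl: "LW (((q0 @ [d]) @ [k]) @ [l])"
    unfolding LW_snoc[of "(q0 @ [d]) @ [k]"] c2 using lk \<nu>l kl by auto
  have llk: "LW (((q0 @ [d]) @ [l]) @ [k])"
    unfolding LW_snoc[of "(q0 @ [d]) @ [l]"] c2 using ll \<nu>k kl by auto
  have cl: "count_list ((q0 @ [d]) @ [l]) = count_list p"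
    using Apos kl by (intro ext) (simp only: c2 cp \<nu>_def, simp)
  have ck: "count_list ((q0 @ [d]) @ [k]) = count_list q"
    using Apos kl by (intro ext) (simp only: c2 cq \<nu>_def, simp)
  have "(p, (q0 @ [d]) @ [l]) \<in> wrel\<^sup>*" using IH[OF LW_append1[OF p] ll] cl by simp
  then have 1: "(p @ [k], ((q0 @ [d]) @ [l]) @ [k]) \<in> wrel\<^sup>*" using wrel_snoc p by blast
  have "length q = length p" using count_eq_length[OF cnt] by simp
  then have "length ((q0 @ [d]) @ [k]) = length p" using count_eq_length[OF ck] by simp
  then have "((q0 @ [d]) @ [k], q) \<in> wrel\<^sup>*" using IH[OF lk LW_append1[OF q] _ ck] by blast
  then have 2: "(((q0 @ [d]) @ [k]) @ [l], q @ [l]) \<in> wrel\<^sup>*" using wrel_snoc lkl by blast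
  \<comment> \<open>The letter \<open>d\<close> lies between \<open>k\<close> and \<open>l\<close>,
    hence the move exchanges the last two letters.\<close>
  have "wstar (length q0) (((q0 @ [d]) @ [l]) @ [k]) = ((q0 @ [d]) @ [k]) @ [l]"
    using wstar_split[of q0 d l k "[]"] d kl by simp
  moreover have "wD (length q0) (((q0 @ [d]) @ [l]) @ [k])" using wD_split[of q0 d l k "[]"] d kl by simp
  ultimately have "(((q0 @ [d]) @ [l]) @ [k], ((q0 @ [d]) @ [k]) @ [l]) \<in> wrel"
    using lkl llk unfolding wrel_def mem_Collect_eq
    by (intro exI[of _ "((q0 @ [d]) @ [l]) @ [k]"] exI[of _ "length q0"]) auto
  with 1 2 show ?thesis by (meson rtrancl_into_rtrancl rtrancl_trans)
qed

theorem wconn: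
  assumes "LW a" "LW c" "count_list a = count_list c"
  shows "(a, c) \<in> wrel\<^sup>*"
  using assms
proof (induction "length a" arbitrary: a c)
  case 0
  then have "a = []" "c = []" using count_eq_length[OF "0.prems"(3)] by auto
  then show ?case by simp
next
  case (Suc n)
  have "length c = Suc n" using count_eq_length[OF Suc.prems(3)] Suc.hyps(2) by simp
  then obtain q l where c: "c = q @ [l]" "length q = n" by (metis length_Suc_conv_rev)
  obtain p k where a: "a = p @ [k]" "length p = n" using Suc.hyps(2) by (metis length_Suc_conv_rev)
  have IH: "\<And>a c. LW a \<Longrightarrow> LW c \<Longrightarrow> length a = n \<Longrightarrow> count_list a = count_list c \<Longrightarrow> (a, c) \<in> wrel\<^sup>*"
    using Suc.hyps(1) by blast
  consider "k = l" | "k < l" | "l < k" by linarith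
  then show ?case
  proof cases
    case 1
    then have "count_list p = count_list q" using Suc.prems(3) a c by (auto simp: fun_eq_iff)
    then have "(p, q) \<in> wrel\<^sup>*" using IH[of p q] Suc.prems a c LW_append1 by blast
    then show ?thesis using wrel_snoc Suc.prems(1) a c 1 by blast
  next
    case 2
    then show ?thesis using wconn_lt[of p k q l] Suc.prems a c IH by blast
  next
    case 3
    then have "(c, a) \<in> wrel\<^sup>*" using wconn_lt[of q l p k] Suc.prems a c IH by simp
    then show ?thesis by (rule wrel_rtrancl_sym)
  qed
qed

section \<open>Separation of lattice words by descents and star moves\<close>

definition wbisim :: "nat \<Rightarrow> (nat list \<Rightarrow> nat list \<Rightarrow> bool) \<Rightarrow> bool" where
  "wbisim n R \<longleftrightarrow> (\<forall>a c. R a c \<longrightarrow> LW a \<and> LW c \<and> length a = n \<and> length c = n \<and>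
     (\<forall>i. Suc i < n \<longrightarrow> wd a i = wd c i) \<and>
     (\<forall>i. Suc (Suc i) < n \<longrightarrow> wD i a \<longrightarrow> R (wstar i a) (wstar i c)))"

lemma wbisim_sym: "wbisim n R \<Longrightarrow> wbisim n (\<lambda>a c. R c a)"
  unfolding wbisim_def
proof (intro allI impI)
  fix c a
  assume *: "\<forall>a c. R a c \<longrightarrow> LW a \<and> LW c \<and> length a = n \<and> length c = n \<and>
     (\<forall>i. Suc i < n \<longrightarrow> wd a i = wd c i) \<and>
     (\<forall>i. Suc (Suc i) < n \<longrightarrow> wD i a \<longrightarrow> R (wstar i a) (wstar i c))" and "R a c"
  then have "wD i c = wD i a" if "Suc (Suc i) < n" for i using that by (simp add: wD_def)
  with * \<open>R a c\<close> show "LW c \<and> LW a \<and> length c = n \<and> length a = n \<and>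
     (\<forall>i. Suc i < n \<longrightarrow> wd c i = wd a i) \<and>
     (\<forall>i. Suc (Suc i) < n \<longrightarrow> wD i c \<longrightarrow> R (wstar i a) (wstar i c))" by simp
qed

text \<open>The common prefix is moved to a word ending in \<open>m = l - 1\<close>, both last
  letters staying in place. Then \<open>k \<le> m < l\<close> gives a descent at the end of one word
  and none in the other.\<close>

lemma wbisim_last_lt:
  assumes R: "wbisim (Suc n) R" and pk: "R (p @ [k]) (p @ [l])" and kl: "k < l"
  shows False
proof -
  have LW: "LW (p @ [k])" "LW (p @ [l])" and n: "length p = n" using R pk unfolding wbisim_def by fastforce+
  have p: "LW p" using LW_append1[OF LW(1)] .
  \<comment> \<open>Since a box can be added in row \<open>l\<close>, the row just above is strictly
    longer and its last box can be removed.\<close>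
  obtain m where m: "l = Suc m" using kl by (cases l) auto
  have cm: "count_list p l < count_list p m" using LW(2) m by (simp add: LW_snoc)
  let ?c = "(count_list p)(m := count_list p m - 1)"
  have "?c (Suc j) \<le> ?c j" for j using LW_count[OF p, of j] cm m by auto
  moreover have "?c j = 0" if "Suc (sum_list p) \<le> j" for j
  proof -
    have "j \<notin> set p" using that member_le_sum_list[of j p] by auto
    then have "count_list p j = 0" using count_list_0_iff by metis
    then show ?thesis by auto
  qed
  ultimately obtain q where q: "LW q" "count_list q = ?c" using LW_exists by metis
  have cqm: "count_list (q @ [m]) = count_list p" using q cm by (auto simp: fun_eq_iff)
  have "LW (q @ [m])" using q cm LW_count[OF p, of "m - 1"] by (cases m) (auto simp: LW_snoc)
  then have "(p, q @ [m]) \<in> wrel\<^sup>*" using wconn[OF p] cqm by simp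
  then have "R ((q @ [m]) @ [k]) ((q @ [m]) @ [l])"
  proof (induction rule: rtrancl_induct)
    case base show ?case by (rule pk)
  next
    case (step y z)
    obtain i where i: "z = wstar i y" "Suc (Suc i) < length y" "wD i y" using step(2) by (auto simp: wrel_def)
    have "length y = n" using step(3) R unfolding wbisim_def by fastforce
    then have "R (wstar i (y @ [k])) (wstar i (y @ [l]))"
      using step(3) R i unfolding wbisim_def by (metis wD_snoc less_SucI)
    then show ?case using i by (simp add: wstar_snoc)
  qed
  moreover have "Suc (length q) < Suc n" using count_eq_length[OF cqm] n by auto
  ultimately have "wd ((q @ [m]) @ [k]) (length q) = wd ((q @ [m]) @ [l]) (length q)"
    using R unfolding wbisim_def by blast
  then show False using kl m by (simp add: nth_append)
qed

text \<open>Forgetting last letters turns a bisimulation into one for shorter words, so the prefixes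
  agree; \<open>wbisim_last_lt\<close> in both directions handles the last letters.\<close>

theorem wbisim_eq: "wbisim n R \<Longrightarrow> R a c \<Longrightarrow> a = c"
proof (induction n arbitrary: R a c)
  case 0
  then show ?case by (auto simp: wbisim_def)
next
  case (Suc n)
  define R' where "R' a c \<longleftrightarrow> (\<exists>k l. R (a @ [k]) (c @ [l]))" for a c
  have "wbisim n R'"
    unfolding wbisim_def
  proof (intro allI impI)
    fix a c assume "R' a c"
    then obtain k l where kl: "R (a @ [k]) (c @ [l])" by (auto simp: R'_def)
    have f: "LW (a @ [k])" "LW (c @ [l])" "length a = n" "length c = n"
      "\<And>i. Suc i < Suc n \<Longrightarrow> wd (a @ [k]) i = wd (c @ [l]) i"
      "\<And>i. Suc (Suc i) < Suc n \<Longrightarrow> wD i (a @ [k]) \<Longrightarrow> R (wstar i (a @ [k])) (wstar i (c @ [l]))"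
      using Suc.prems(1) kl unfolding wbisim_def by fastforce+
    have "wd a i = wd c i" if "Suc i < n" for i
      using f(5)[of i] that f(3,4) by (simp add: nth_append)
    moreover have "R' (wstar i a) (wstar i c)" if "Suc (Suc i) < n" "wD i a" for i
      using f(6)[of i] that f(3,4) unfolding R'_def by (auto simp: wstar_snoc wD_snoc)
    ultimately show "LW a \<and> LW c \<and> length a = n \<and> length c = n \<and> (\<forall>i. Suc i < n \<longrightarrow> wd a i = wd c i) \<and>
       (\<forall>i. Suc (Suc i) < n \<longrightarrow> wD i a \<longrightarrow> R' (wstar i a) (wstar i c))"
      using f LW_append1 by blast
  qed
  have "length a = Suc n" "length c = Suc n" using Suc.prems by (auto simp: wbisim_def)
  then obtain p k q l where ac: "a = p @ [k]" "c = q @ [l]" by (metis length_Suc_conv_rev)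
  have "p = q" by (rule Suc.IH[OF \<open>wbisim n R'\<close>]) (use Suc.prems(2) ac in \<open>auto simp: R'_def\<close>)
  moreover have "\<not> k < l" using wbisim_last_lt[OF Suc.prems(1)] Suc.prems(2) ac \<open>p = q\<close> by blast
  moreover have "\<not> l < k" using wbisim_last_lt[OF wbisim_sym[OF Suc.prems(1)]] Suc.prems(2) ac \<open>p = q\<close> by blast
  ultimately show ?case using ac by simp
qed

section \<open>Transposition of lattice words\<close>

text \<open>Column indices instead of row indices; the argument \<open>c\<close> records the current shape.\<close>
fun trf :: "(nat \<Rightarrow> nat) \<Rightarrow> nat list \<Rightarrow> nat list" where
  "trf c [] = []"
| "trf c (x # s) = c x # trf (c(x := Suc (c x))) s"

definition tr :: "nat list \<Rightarrow> nat list" where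
  "tr = trf (\<lambda>_. 0)"

lemma trf_append: "trf c (p @ s) = trf c p @ trf (\<lambda>k. c k + count_list p k) s"
proof (induction p arbitrary: c)
  case (Cons x p)
  have "(\<lambda>k. (c(x := Suc (c x))) k + count_list p k) = (\<lambda>k. c k + count_list (x # p) k)" by auto
  then show ?case using Cons[of "c(x := Suc (c x))"] by (simp only: append_Cons trf.simps)
qed simp

lemma tr_append: "tr (p @ s) = tr p @ trf (count_list p) s"
  by (simp add: tr_def trf_append)

lemma tr_snoc [simp]: "tr (p @ [k]) = tr p @ [count_list p k]"
  by (simp add: tr_append)

lemma tr_Nil [simp]: "tr [] = []"
  by (simp add: tr_def)

lemma length_tr [simp]: "length (tr ks) = length ks"
  by (induction ks rule: rev_induct) auto

lemma tr_take: "tr (take n ks) = take n (tr ks)"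
proof (cases "n \<le> length ks")
  case True
  have "tr ks = tr (take n ks) @ trf (count_list (take n ks)) (drop n ks)"
    by (metis append_take_drop_id tr_append)
  then show ?thesis using True by simp
qed simp

lemma count_list_tr: "count_list (tr ks) j = card {k. j < count_list ks k}"
proof (induction ks rule: rev_induct)
  case (snoc x ks)
  have fin: "finite {k. j < count_list ks k}"
    by (rule finite_subset[of _ "set ks"]) (auto simp: count_list_0_iff intro: ccontr)
  show ?case
  proof (cases "j = count_list ks x")
    case True
    then have "{k. j < count_list (ks @ [x]) k} = insert x {k. j < count_list ks k}" by auto
    then show ?thesis using True fin snoc by simp
  next
    case False
    then have "{k. j < count_list (ks @ [x]) k} = {k. j < count_list ks k}" by auto
    then show ?thesis using False snoc by simp
  qed
qed simp

lemma LW_tr: "LW (tr ks)"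
  unfolding LW_def tr_take[symmetric] count_list_tr
proof (intro allI card_mono)
  fix n k
  show "finite {j. k < count_list (take n ks) j}"
    by (rule finite_subset[of _ "set (take n ks)"]) (auto simp: count_list_0_iff intro: ccontr)
qed auto

text \<open>When \<open>k\<close> is appended, the rows longer than row \<open>k\<close> are exactly
  those above it, so counting boxes in the new box's column recovers \<open>k\<close>.\<close>

lemma tr_tr: "LW ks \<Longrightarrow> tr (tr ks) = ks"
proof (induction ks rule: rev_induct)
  case (snoc k ks)
  have l: "LW ks" using LW_append1[OF snoc.prems] .
  have "{j. count_list ks k < count_list ks j} = {..<k}"
  proof (intro set_eqI iffI)
    fix j assume "j \<in> {j. count_list ks k < count_list ks j}"
    then show "j \<in> {..<k}" using LW_count_le[OF l, of k j] by (auto simp: not_less[symmetric])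
  next
    fix j assume "j \<in> {..<k}"
    then have "count_list ks (k - 1) \<le> count_list ks j" "k > 0" using LW_count_le[OF l, of j "k - 1"] by auto
    then show "j \<in> {j. count_list ks k < count_list ks j}" using snoc.prems by (auto simp: LW_snoc)
  qed
  then show ?case using snoc l by (simp add: count_list_tr)
qed simp

lemma split2:
  assumes "Suc i < length ks"
  obtains p a b s where "ks = p @ a # b # s" "length p = i"
proof -
  have "ks = take i ks @ ks ! i # ks ! Suc i # drop (Suc (Suc i)) ks"
    using assms by (metis Cons_nth_drop_Suc Suc_lessD append_take_drop_id)
  then show thesis using that[of "take i ks"] assms by auto
qed

lemma nth_tr: "i < length ks \<Longrightarrow> tr ks ! i = count_list (take i ks) (ks ! i)"
proof -
  assume i: "i < length ks"
  then have "ks = take i ks @ ks ! i # drop (Suc i) ks" by (simp add: id_take_nth_drop)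
  then have "tr ks = tr (take i ks) @ trf (count_list (take i ks)) (ks ! i # drop (Suc i) ks)"
    by (metis tr_append)
  then show ?thesis using i by (simp add: nth_append)
qed

text \<open>Of two consecutive entries of a standard tableau, the larger lies either strictly south
  and weakly west or strictly east and weakly north of the smaller.\<close>

lemma wd_tr:
  assumes "LW ks" "Suc i < length ks"
  shows "wd (tr ks) i \<longleftrightarrow> \<not> wd ks i"
proof -
  obtain p a b s where ks: "ks = p @ a # b # s" and i: "length p = i" using split2[OF assms(2)] .
  have "LW p" "LW (p @ [a])"
    using LW_append1[of p "a # b # s"] LW_append1[of "p @ [a]" "b # s"] assms(1) ks by simp_all
  have "tr ks ! i = count_list p a" "tr ks ! Suc i = count_list (p @ [a]) b"
    using nth_tr[of i ks] nth_tr[of "Suc i" ks] assms(2) ks i by (simp_all add: nth_append)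
  moreover have "a < b \<Longrightarrow> count_list p b \<le> count_list p a" using LW_count_le[OF \<open>LW p\<close>] by simp
  moreover have "b < a \<Longrightarrow> count_list p a + 1 \<le> count_list p b"
    using LW_count_le[OF \<open>LW (p @ [a])\<close>, of b a] by simp
  ultimately show ?thesis using i ks by (cases "a = b"; cases "a < b") (auto simp: nth_append)
qed

lemma tr_swp:
  assumes "Suc j < length ks" "ks ! j \<noteq> ks ! Suc j"
  shows "tr (swp j ks) = swp j (tr ks)"
proof -
  obtain p a b s where ks: "ks = p @ a # b # s" and j: "length p = j" using split2[OF assms(1)] .
  have ne: "a \<noteq> b" using assms(2) ks j by (auto simp: nth_append)
  then have "tr (p @ b # a # s) = tr p @ count_list p b # count_list p a #
      trf ((count_list p)(a := Suc (count_list p a), b := Suc (count_list p b))) s"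
    by (simp add: tr_append fun_upd_twist)
  moreover have "tr ks = tr p @ count_list p a # count_list p b #
      trf ((count_list p)(a := Suc (count_list p a), b := Suc (count_list p b))) s"
    using ne by (simp add: ks tr_append)
  ultimately show ?thesis using swp_append[of p j a b s] swp_append[of "tr p" j] j ks by simp
qed

text \<open>Transposition complements descents and commutes with exchanges of unequal neighbours,
  and a star move is the exchange that changes both descents.\<close>

lemma tr_wstar:
  assumes "LW ks" "LW (wstar i ks)" "Suc (Suc i) < length ks" "wD i ks"
  shows "tr (wstar i ks) = wstar i (tr ks)"
proof (rule wstar_props(5))
  note p = wstar_props[OF assms(3,4)]
  have w: "wd (tr ks) i = (\<not> wd ks i)" "wd (tr ks) (Suc i) = (\<not> wd ks (Suc i))"
    "wd (tr (wstar i ks)) i = (\<not> wd (wstar i ks) i)" "wd (tr (wstar i ks)) (Suc i) = (\<not> wd (wstar i ks) (Suc i))"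
    using wd_tr[OF assms(1)] wd_tr[OF assms(2)] assms(3) by auto
  show "Suc (Suc i) < length (tr ks)" using assms by simp
  show "wD i (tr ks)" using assms(4) w by (simp add: wD_def)
  show "wd (tr (wstar i ks)) i \<noteq> wd (tr ks) i" "wd (tr (wstar i ks)) (Suc i) \<noteq> wd (tr ks) (Suc i)"
    using w p(1,2) assms(4) by (auto simp: wD_def)
  show "tr (wstar i ks) = swp i (tr ks) \<or> tr (wstar i ks) = swp (Suc i) (tr ks)"
  proof (cases "min (ks ! Suc i) (ks ! Suc (Suc i)) \<le> ks ! i \<and> ks ! i < max (ks ! Suc i) (ks ! Suc (Suc i))")
    case True
    then have "ks ! Suc i \<noteq> ks ! Suc (Suc i)" by auto
    then show ?thesis using tr_swp[of "Suc i" ks] assms(3) True by (simp add: wstar_def)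
  next
    case False
    then have "ks ! i \<noteq> ks ! Suc i" using assms(4) by (auto simp: wD_def min_def max_def)
    moreover have "wstar i ks = swp i ks" unfolding wstar_def using False by (rule if_not_P)
    ultimately show ?thesis using tr_swp[of i ks] assms(3) by simp
  qed
qed

section \<open>Row insertion\<close>

text \<open>The second component lists the rows of the new boxes. Starting from the empty tableau it
  is the lattice word of the recording tableau, which is easier to follow than the tableau
  itself.\<close>

fun insw :: "nat list \<Rightarrow> tableau \<Rightarrow> tableau \<times> nat list" where
  "insw [] P = (P, [])"
| "insw (x # xs) P = (case tab_ins x P of (P', k) \<Rightarrow> case insw xs P' of (P'', ks) \<Rightarrow> (P'', k # ks))"

lemma insw_append:
  "insw (xs @ ys) P = (case insw xs P of (P', ks) \<Rightarrow> case insw ys P' of (P'', ks') \<Rightarrow> (P'', ks @ ks'))"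
  by (induction xs arbitrary: P) (auto split: prod.splits)

lemma length_insw: "length (snd (insw xs P)) = length xs"
  by (induction xs arbitrary: P) (auto split: prod.splits, metis snd_conv)

fun buildQ :: "nat \<Rightarrow> nat list \<Rightarrow> tableau \<Rightarrow> tableau" where
  "buildQ n [] Q = Q"
| "buildQ n (k # ks) Q = buildQ (Suc n) ks (add_box n k Q)"

lemma rsk_aux_insw: "rsk_aux n xs (P, Q) = (fst (insw xs P), buildQ n (snd (insw xs P)) Q)"
  by (induction xs arbitrary: n P Q) (auto split: prod.splits)

lemma row_ins_None: "\<forall>a\<in>set r. \<not> x < a \<Longrightarrow> row_ins x r = (r @ [x], None)"
  by (induction r) auto

lemma row_ins_Some: "\<forall>a\<in>set A. \<not> x < a \<Longrightarrow> x < y \<Longrightarrow> row_ins x (A @ y # B) = (A @ x # B, Some y)"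
  by (induction A) auto

lemma tab_ins_None: "\<forall>a\<in>set r. a < x \<Longrightarrow> tab_ins x (r # rs) = ((r @ [x]) # rs, 0)"
  by (subst tab_ins.simps, subst row_ins_None) auto

lemma tab_ins_Some:
  "\<forall>a\<in>set A. a < x \<Longrightarrow> x < y \<Longrightarrow> tab_ins y rs = (rs', k) \<Longrightarrow>
    tab_ins x ((A @ y # B) # rs) = ((A @ x # B) # rs', Suc k)"
  by (subst tab_ins.simps, subst row_ins_Some) auto

definition hd0 :: "nat list list \<Rightarrow> nat list" where
  "hd0 rs = (case rs of [] \<Rightarrow> [] | r # _ \<Rightarrow> r)"

definition nle :: "nat list \<Rightarrow> nat \<Rightarrow> nat" where
  "nle r t = length (filter (\<lambda>a. a \<le> t) r)"

lemma nle_simps [simp]: "nle [] t = 0" "nle (x # xs) t = (if x \<le> t then Suc (nle xs t) else nle xs t)"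
  "nle (xs @ ys) t = nle xs t + nle ys t"
  by (simp_all add: nle_def)

text \<open>Column strictness of two consecutive rows, expressed by counting entries.\<close>
definition dom :: "nat list \<Rightarrow> nat list \<Rightarrow> bool" where
  "dom r r' \<longleftrightarrow> (\<forall>t. nle r' t \<le> nle r t)"

abbreviation ent :: "tableau \<Rightarrow> nat set" where
  "ent P \<equiv> set (concat P)"

fun vt :: "tableau \<Rightarrow> bool" where
  "vt [] = True"
| "vt (r # rs) \<longleftrightarrow> r \<noteq> [] \<and> sorted_wrt (<) r \<and> vt rs \<and> dom r (hd0 rs) \<and> set r \<inter> ent rs = {}"

lemma row_cases:
  fixes r :: "nat list"
  assumes "sorted_wrt (<) r" "x \<notin> set r"
  obtains (none) "\<forall>a\<in>set r. a < x"
    | (bump) A y B where "r = A @ y # B" "\<forall>a\<in>set A. a < x" "x < y" "\<forall>b\<in>set B. y < b"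
        "sorted_wrt (<) A" "sorted_wrt (<) B" "\<forall>a\<in>set A. a < y" "\<forall>a\<in>set A. \<forall>b\<in>set B. a < b"
proof (cases "\<exists>a\<in>set r. x < a")
  case False
  then have "\<forall>a\<in>set r. a < x" using assms(2) by (force simp: not_less le_less)
  then show thesis by (rule none)
next
  case True
  then obtain A y B where r: "r = A @ y # B" "x < y" "\<forall>a\<in>set A. \<not> x < a"
    using split_list_first_prop[of r "\<lambda>a. x < a"] by blast
  have "\<forall>a\<in>set A. a < x" using r assms(2) by (metis Un_iff linorder_neqE_nat set_append)
  then show thesis using assms(1) r by (intro bump[of A y B]) (auto simp: sorted_wrt_append)
qed

lemma tab_ins_hd0: "tab_ins x rs = (rs', k) \<Longrightarrow> hd0 rs' = fst (row_ins x (hd0 rs))"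
  by (cases rs) (auto simp: hd0_def split: prod.splits option.splits)

lemma nle_mono: "s \<le> t \<Longrightarrow> nle r s \<le> nle r t"
  by (induction r) auto

lemma nle_strict: "y \<in> set r \<Longrightarrow> s < y \<Longrightarrow> y \<le> t \<Longrightarrow> nle r s < nle r t"
proof -
  assume y: "y \<in> set r" "s < y" "y \<le> t"
  obtain A B where "r = A @ y # B" using y(1) by (meson split_list)
  then show ?thesis using y nle_mono[of s t A] nle_mono[of s t B] by simp
qed

lemma nle_cong: "(\<And>a. a \<in> set r \<Longrightarrow> a \<le> s \<longleftrightarrow> a \<le> t) \<Longrightarrow> nle r s = nle r t"
  unfolding nle_def by (metis filter_cong)

lemma vt_tab_ins:
  assumes "vt P" "x \<notin> ent P" "tab_ins x P = (P', k)"
  shows "vt P' \<and> ent P' = insert x (ent P) \<and>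
    (if k < length P then map length P' = (map length P)[k := Suc (length (P ! k))]
     else k = length P \<and> map length P' = map length P @ [1])"
  using assms
proof (induction P arbitrary: x P' k)
  case Nil
  then show ?case by (auto simp: dom_def hd0_def)
next
  case (Cons r rs)
  have r: "sorted_wrt (<) r" "x \<notin> set r" using Cons.prems by auto
  show ?case
    using r
  proof (cases rule: row_cases)
    case none
    then have P': "P' = (r @ [x]) # rs" "k = 0" using Cons.prems(3) tab_ins_None[OF none, of rs] by auto
    have "dom (r @ [x]) (hd0 rs)" using Cons.prems(1) unfolding dom_def
      by (metis add_leD1 le_add1 le_trans nle_simps(3) vt.simps(2) dom_def)
    then show ?thesis using none Cons.prems P' by (auto simp: sorted_wrt_append)
  next
    case (bump A y B)
    obtain rs' k' where rs': "tab_ins y rs = (rs', k')" by (cases "tab_ins y rs")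
    have P': "P' = (A @ x # B) # rs'" "k = Suc k'"
      using Cons.prems(3) tab_ins_Some[OF bump(2,3) rs', of B] bump(1) by auto
    have vrs: "vt rs" "y \<notin> ent rs" using Cons.prems(1) bump(1) by auto
    note IH = Cons.IH[OF vrs rs']
    have "dom (A @ x # B) (hd0 rs')"
      unfolding dom_def
    proof
      fix t
      let ?s = "hd0 rs"
      have h: "hd0 rs' = fst (row_ins y ?s)" using tab_ins_hd0[OF rs'] .
      have d: "nle ?s t \<le> nle r t" for t using Cons.prems(1) by (simp add: dom_def)
      have ss: "sorted_wrt (<) ?s" "y \<notin> set ?s" using vrs by (cases rs; auto simp: hd0_def)+
      have new: "nle (A @ x # B) t = (if x \<le> t \<and> t < y then Suc (nle r t) else nle r t)" for t
        using bump by auto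
      \<comment> \<open>The bumped entry \<open>y\<close> gives the next row one more entry up to
        \<open>t\<close>. There is room for it because \<open>y\<close> itself was counted in the
        row above, while no entry of the next row lies between \<open>y\<close> and
        \<open>t\<close>.\<close>
      have key: "Suc (nle ?s t) \<le> nle r t" if "y \<le> t" "\<And>a. a \<in> set ?s \<Longrightarrow> a \<le> t \<Longrightarrow> a < y" for t
      proof -
        have "nle ?s t = nle ?s (y - 1)" using that(2) by (intro nle_cong) (use \<open>y \<le> t\<close> in fastforce)
        also have "\<dots> \<le> nle r (y - 1)" by (rule d)
        also have "\<dots> < nle r t" using bump(1,3) that by (intro nle_strict[of y]) auto
        finally show ?thesis by simp
      qed
      have old: "nle r t \<le> nle (A @ x # B) t" by (simp only: new) simp
      show "nle (hd0 rs') t \<le> nle (A @ x # B) t"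
        using ss
      proof (cases rule: row_cases)
        case none
        then have "\<forall>a\<in>set ?s. \<not> y < a" by auto
        from row_ins_None[OF this] have e: "hd0 rs' = ?s @ [y]" using h by simp
        show ?thesis
        proof (cases "y \<le> t")
          case True then show ?thesis using key[OF True] none old by (simp add: e)
        next
          case False then show ?thesis using d[of t] old by (simp add: e)
        qed
      next
        case (bump C z D)
        then have "\<forall>a\<in>set C. \<not> y < a" by auto
        from row_ins_Some[OF this bump(3)] have e: "hd0 rs' = C @ y # D" using h bump(1) by simp
        show ?thesis
        proof (cases "y \<le> t \<and> t < z")
          case True
          then have "nle (hd0 rs') t = Suc (nle ?s t)" using bump by (simp add: e)
          moreover have "Suc (nle ?s t) \<le> nle r t" using True bump by (intro key) auto
          ultimately show ?thesis using old by simp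
        next
          case False
          then have "nle (hd0 rs') t \<le> nle ?s t" using bump by (auto simp: e)
          then show ?thesis using d[of t] old by simp
        qed
      qed
    qed
    moreover have "set (A @ x # B) \<inter> ent rs' = {}" using IH Cons.prems bump by auto
    moreover have "sorted_wrt (<) (A @ x # B)" using bump by (auto simp: sorted_wrt_append)
    ultimately show ?thesis using IH P' bump Cons.prems by (auto split: if_splits)
  qed
qed

text \<open>Reverse bumping: the row of the new box tells how many rows were passed, and recursion
  identifies the entry that was pushed out of the top row.\<close>

lemma tab_ins_inj:
  assumes "vt P" "vt R" "x \<notin> ent P" "y \<notin> ent R" "tab_ins x P = (P', k)" "tab_ins y R = (P', k)"
  shows "x = y \<and> P = R"
  using assms
proof (induction P arbitrary: R x y P' k)
  case Nil
  then have P': "P' = [[x]]" "k = 0" by auto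
  show ?case
  proof (cases R)
    case Nil then show ?thesis using P' Nil.prems by auto
  next
    case (Cons r rs)
    have r: "sorted_wrt (<) r" "y \<notin> set r" using Nil.prems Cons by auto
    show ?thesis
      using r
    proof (cases rule: row_cases)
      case none then show ?thesis using Nil.prems P' Cons tab_ins_None[OF none, of rs] by auto
    next
      case (bump A z B)
      then show ?thesis using Nil.prems P' Cons tab_ins_Some[OF bump(2,3), of rs] by (cases "tab_ins z rs") auto
    qed
  qed
next
  case (Cons p ps)
  have p: "sorted_wrt (<) p" "x \<notin> set p" using Cons.prems by auto
  show ?case
    using p
  proof (cases rule: row_cases)
    case none
    then have P': "P' = (p @ [x]) # ps" "k = 0" using Cons.prems tab_ins_None[OF none, of ps] by auto
    show ?thesis
    proof (cases R)
      case Nil then show ?thesis using P' Cons.prems by auto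
    next
      case R: (Cons r rs)
      have r: "sorted_wrt (<) r" "y \<notin> set r" using Cons.prems R by auto
      show ?thesis
        using r
      proof (cases rule: row_cases)
        case none then show ?thesis using Cons.prems P' R tab_ins_None[OF none, of rs] by auto
      next
        case (bump A z B)
        then show ?thesis using Cons.prems P' R tab_ins_Some[OF bump(2,3), of rs] by (cases "tab_ins z rs") auto
      qed
    qed
  next
    case p: (bump A x' B)
    obtain ps' k' where ps': "tab_ins x' ps = (ps', k')" by (cases "tab_ins x' ps")
    have P': "P' = (A @ x # B) # ps'" "k = Suc k'"
      using Cons.prems tab_ins_Some[OF p(2,3) ps', of B] p(1) by auto
    obtain r rs where R: "R = r # rs" using Cons.prems P' by (cases R) auto
    have r: "sorted_wrt (<) r" "y \<notin> set r" using Cons.prems R by auto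
    show ?thesis
      using r
    proof (cases rule: row_cases)
      case none then show ?thesis using Cons.prems P' R tab_ins_None[OF none, of rs] by auto
    next
      case r: (bump C y' D)
      obtain rs' l' where rs': "tab_ins y' rs = (rs', l')" by (cases "tab_ins y' rs")
      have e: "A @ x # B = C @ y # D" "rs' = ps'" "l' = k'"
        using Cons.prems P' R tab_ins_Some[OF r(2,3) rs', of D] r(1) by auto
      have "x' = y' \<and> ps = rs"
        by (rule Cons.IH[of rs x' y' ps' k']) (use Cons.prems R ps' rs' e p r in auto)
      moreover
      \<comment> \<open>The inserted letter is the last entry below the bumped one, so the bumped
        entry fixes where the row is to be cut.\<close>
      have "filter (\<lambda>a. a < x') (A @ x # B) = A @ [x]" "filter (\<lambda>a. a < y') (C @ y # D) = C @ [y]"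
        "filter (\<lambda>a. \<not> a < x') (A @ x # B) = B" "filter (\<lambda>a. \<not> a < y') (C @ y # D) = D"
        using p r by (auto simp: filter_empty_conv filter_id_conv dest: less_asym)
      ultimately have "A @ [x] = C @ [y]" "B = D" using e(1) by metis+
      then show ?thesis using p(1) r(1) R \<open>x' = y' \<and> ps = rs\<close> by simp
    qed
  qed
qed

text \<open>The row bumping lemma. When both letters bump, the bumped entries are ordered like the
  inserted letters, and the comparison passes to the next row.\<close>

lemma row_bump:
  assumes "vt P" "x \<notin> ent P" "y \<notin> ent P" "x \<noteq> y" "tab_ins x P = (P1, k)" "tab_ins y P1 = (P2, l)"
  shows "k < l \<longleftrightarrow> y < x"
  using assms
proof (induction P arbitrary: x y P1 P2 k l)
  case Nil
  then show ?case by (auto split: if_splits)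
next
  case (Cons r rs)
  have r: "sorted_wrt (<) r" "x \<notin> set r" using Cons.prems by auto
  show ?case
    using r
  proof (cases rule: row_cases)
    case none
    then have P1: "P1 = (r @ [x]) # rs" "k = 0" using Cons.prems tab_ins_None[OF none, of rs] by auto
    have "l = 0 \<longleftrightarrow> x < y"
    proof (cases "x < y")
      case True
      then show ?thesis using Cons.prems(6) P1 none tab_ins_None[of "r @ [x]" y rs] by fastforce
    next
      case False
      then have "y < x" using Cons.prems by simp
      have "sorted_wrt (<) (r @ [x])" using r none by (simp add: sorted_wrt_append)
      moreover have "y \<notin> set (r @ [x])" using Cons.prems by auto
      ultimately show ?thesis
      proof (cases rule: row_cases)
        case none then show ?thesis using \<open>y < x\<close> by auto
      next
        case (bump A z B)
        then show ?thesis using Cons.prems(6) P1 tab_ins_Some[OF bump(2,3), of rs] False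
          by (cases "tab_ins z rs") auto
      qed
    qed
    then show ?thesis using P1 Cons.prems by auto
  next
    case (bump A x' B)
    obtain rs' k' where rs': "tab_ins x' rs = (rs', k')" by (cases "tab_ins x' rs")
    have P1: "P1 = (A @ x # B) # rs'" "k = Suc k'"
      using Cons.prems tab_ins_Some[OF bump(2,3) rs', of B] bump(1) by auto
    have s: "sorted_wrt (<) (A @ x # B)" using bump by (auto simp: sorted_wrt_append)
    have ny: "y \<notin> set (A @ x # B)" using Cons.prems bump by auto
    show ?thesis
      using s ny
    proof (cases rule: row_cases)
      case none
      then have "l = 0" using Cons.prems(6) P1 tab_ins_None[OF none, of rs'] by auto
      then show ?thesis using none by auto
    next
      case b2: (bump C y' D)
      obtain rs'' l' where rs'': "tab_ins y' rs' = (rs'', l')" by (cases "tab_ins y' rs'")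
      have l: "l = Suc l'" using Cons.prems(6) P1 tab_ins_Some[OF b2(2,3) rs'', of D] b2(1) by auto
      have mem: "y' \<in> set (A @ x # B)" using b2(1) by simp
      have ord: "y' < x' \<longleftrightarrow> y < x" "x' \<noteq> y'"
      proof -
        show "x' \<noteq> y'" using mem bump by auto
        show "y' < x' \<longleftrightarrow> y < x"
        proof
          assume "y' < x'"
          then have "y' \<in> set A \<or> y' = x" using mem bump by auto
          then show "y < x" using bump b2 Cons.prems(4) by (metis less_trans)
        next
          assume yx: "y < x"
          have "x \<in> set C \<or> x = y' \<or> x \<in> set D" using b2(1)
            by (metis (no_types, lifting) Un_iff in_set_conv_decomp set_ConsD set_append)
          then have "y' \<le> x" using yx b2 by auto
          then show "y' < x'" using bump by simp
        qed
      qed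
      have "k' < l' \<longleftrightarrow> y' < x'"
      proof (rule Cons.IH[OF _ _ _ ord(2) rs' rs''])
        show "vt rs" "x' \<notin> ent rs" using Cons.prems bump by auto
        show "y' \<notin> ent rs" using mem Cons.prems bump by auto
      qed
      then show ?thesis using P1 l ord by simp
    qed
  qed
qed

section \<open>Knuth relations\<close>

lemma insw3:
  "insw [x, y, z] P = (P', [a, b, c]) \<longleftrightarrow>
    (\<exists>P1 P2. tab_ins x P = (P1, a) \<and> tab_ins y P1 = (P2, b) \<and> tab_ins z P2 = (P', c))"
  by (auto split: prod.splits)

text \<open>The elementary Knuth relation together with its effect on the new boxes. If all three
  letters bump, the bumped triple has the same pattern one row further down.\<close>

lemma knuth1:
  assumes "vt P" "x < y" "y < z" "x \<notin> ent P" "y \<notin> ent P" "z \<notin> ent P"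
  shows "\<exists>P' a b c. insw [y, x, z] P = (P', [a, b, c]) \<and> insw [y, z, x] P = (P', [a, c, b])"
  using assms
proof (induction P arbitrary: x y z)
  case Nil
  then show ?case by auto
next
  case (Cons r rs)
  have r: "sorted_wrt (<) r" "y \<notin> set r" using Cons.prems by auto
  show ?case
    using r
  proof (cases rule: row_cases)
    case none
    have s: "sorted_wrt (<) (r @ [y])" "x \<notin> set (r @ [y])"
      using Cons.prems none by (auto simp: sorted_wrt_append)
    show ?thesis
      using s
    proof (cases rule: row_cases)
      case none then show ?thesis using Cons.prems by auto
    next
      case (bump C X D)
      obtain rs' k where rs': "tab_ins X rs = (rs', k)" by (cases "tab_ins X rs")
      have lt: "\<forall>a\<in>set (r @ [y]). a < z" using Cons.prems none by auto
      then have "\<forall>a\<in>set (C @ x # D). a < z" using bump Cons.prems by auto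
      note A = tab_ins_None[OF none, of rs] tab_ins_Some[OF bump(2,3) rs', of D]
        tab_ins_None[OF this, of rs'] tab_ins_None[OF lt, of rs]
        tab_ins_Some[OF bump(2,3) rs', of "D @ [z]"]
      show ?thesis using A bump(1) by (intro exI, subst (1 2) insw3) fastforce
    qed
  next
    case b: (bump A Y B)
    have s: "sorted_wrt (<) (A @ [y])" "x \<notin> set (A @ [y])"
      using Cons.prems b by (auto simp: sorted_wrt_append)
    show ?thesis
      using s
    proof (cases rule: row_cases)
      case none then show ?thesis using Cons.prems by auto
    next
      case c: (bump C X D)
      have XY: "X < Y" "X \<notin> ent rs" "Y \<notin> ent rs"
      proof -
        have "X \<in> set (A @ [y])" using c(1) by simp
        then show "X < Y" "X \<notin> ent rs" using b Cons.prems by auto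
        show "Y \<notin> ent rs" using b Cons.prems by auto
      qed
      have CD: "\<forall>a\<in>set (C @ x # D). a < z"
      proof -
        have "\<forall>a\<in>set (A @ [y]). a < z" using b Cons.prems by auto
        then show ?thesis using c Cons.prems by auto
      qed
      have Ay: "\<forall>a\<in>set (A @ [y]). a < z" using b Cons.prems by auto
      have "sorted_wrt (<) B" "z \<notin> set B" using b Cons.prems by auto
      then show ?thesis
      proof (cases rule: row_cases)
        case none
        obtain rs1 k1 where rs1: "tab_ins Y rs = (rs1, k1)" by (cases "tab_ins Y rs")
        obtain rs2 k2 where rs2: "tab_ins X rs1 = (rs2, k2)" by (cases "tab_ins X rs1")
        have n1: "\<forall>a\<in>set (C @ x # D @ B). a < z" using CD none by auto
        have n2: "\<forall>a\<in>set (A @ y # B). a < z" using Ay none by auto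
        have eq: "A @ y # B = C @ X # D @ B" "A @ y # B @ [z] = C @ X # D @ B @ [z]" using c(1)
          by (metis append.assoc append_Cons append_Nil)+
        note A = tab_ins_Some[OF b(2,3) rs1, of B] tab_ins_Some[OF c(2,3) rs2, of "D @ B"]
          tab_ins_None[OF n1, of rs2] tab_ins_None[OF n2, of rs1]
          tab_ins_Some[OF c(2,3) rs2, of "D @ B @ [z]"]
        show ?thesis unfolding insw3 b(1) using A eq by (intro exI conjI) auto
      next
        case d: (bump E Z F)
        have Z: "Y < Z" "Z \<notin> ent rs" using b d Cons.prems by auto
        obtain P' a b' c' where IH: "insw [Y, X, Z] rs = (P', [a, b', c'])" "insw [Y, Z, X] rs = (P', [a, c', b'])"
          using Cons.IH[OF _ XY(1) Z(1) XY(2,3) Z(2)] Cons.prems by auto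
        obtain rs1 rs2 where t1: "tab_ins Y rs = (rs1, a)" "tab_ins X rs1 = (rs2, b')" "tab_ins Z rs2 = (P', c')"
          using IH(1) unfolding insw3 by blast
        obtain rs3 where t2: "tab_ins Z rs1 = (rs3, c')" "tab_ins X rs3 = (P', b')"
          using IH(2) t1(1) unfolding insw3 by auto
        have n1: "\<forall>a\<in>set (C @ x # D @ E). a < z" using CD d by auto
        have n2: "\<forall>a\<in>set (A @ y # E). a < z" using Ay d by auto
        have eq: "A @ y # G = C @ X # D @ G" for G using c(1) by (metis append.assoc append_Cons append_Nil)
        note A = tab_ins_Some[OF b(2,3) t1(1), of B] tab_ins_Some[OF c(2,3) t1(2), of "D @ B"]
          tab_ins_Some[OF n1 d(3) t1(3), of F] tab_ins_Some[OF n2 d(3) t2(1), of F]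
          tab_ins_Some[OF c(2,3) t2(2), of "D @ E @ z # F"]
        show ?thesis unfolding insw3 b(1) using A eq d(1) by (intro exI conjI) auto
      qed
    qed
  qed
qed

text \<open>The other Knuth relation. The boxes do not follow the letters uniformly: which pair of
  rows is exchanged depends on \<open>c \<le> a\<close>, the comparison that decides the move in
  \<open>wstar\<close>.\<close>

lemma knuth2:
  assumes "vt P" "x < y" "y < z" "x \<notin> ent P" "y \<notin> ent P" "z \<notin> ent P"
  shows "\<exists>P' a b c. insw [z, x, y] P = (P', [a, b, c]) \<and>
    insw [x, z, y] P = (P', if c \<le> a then [a, c, b] else [b, a, c])"
  using assms
proof (induction P arbitrary: x y z)
  case Nil
  then show ?case by auto
next
  case (Cons r rs)
  have out: "x \<notin> ent rs" "y \<notin> ent rs" "z \<notin> ent rs" "vt rs" using Cons.prems by auto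
  have r: "sorted_wrt (<) r" "z \<notin> set r" using Cons.prems by auto
  show ?case
    using r
  proof (cases rule: row_cases)
    case z: none
    have "sorted_wrt (<) r" "x \<notin> set r" using Cons.prems by auto
    then show ?thesis
    proof (cases rule: row_cases)
      case x: none
      obtain rs' k where rs': "tab_ins z rs = (rs', k)" by (cases "tab_ins z rs")
      have n1: "\<forall>a\<in>set (r @ [x]). a < y" "\<forall>a\<in>set (r @ [x]). a < z" using x Cons.prems by auto
      note A = tab_ins_None[OF z, of rs] tab_ins_Some[OF x _ rs', of "[]"] tab_ins_None[OF n1(1), of rs']
        tab_ins_None[OF x, of rs] tab_ins_None[OF n1(2), of rs] tab_ins_Some[OF n1(1) _ rs', of "[]"]
      have "insw [z, x, y] (r # rs) = ((r @ [x, y]) # rs', [0, Suc k, 0])"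
        "insw [x, z, y] (r # rs) = ((r @ [x, y]) # rs', [0, 0, Suc k])"
        unfolding insw3 using A Cons.prems by auto
      then show ?thesis by auto
    next
      case c: (bump C p D)
      have "sorted_wrt (<) (D @ [z])" using c z by (auto simp: sorted_wrt_append)
      moreover have "y \<notin> set (D @ [z])" using c Cons.prems by auto
      ultimately show ?thesis
      proof (cases rule: row_cases)
        case none then show ?thesis using Cons.prems by auto
      next
        case d: (bump E Y F)
        have Y: "Y \<in> set (D @ [z])" using d(1) by simp
        have pY: "p < Y" "p \<notin> ent rs" "Y \<notin> ent rs" using Y c z Cons.prems by auto
        obtain rs1 k1 where rs1: "tab_ins p rs = (rs1, k1)" by (cases "tab_ins p rs")
        obtain rs2 k2 where rs2: "tab_ins Y rs1 = (rs2, k2)" by (cases "tab_ins Y rs1")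
        have "k2 \<le> k1" using row_bump[OF out(4) pY(2,3) _ rs1 rs2] pY(1) by auto
        have n1: "\<forall>a\<in>set (C @ x # E). a < y" using c d Cons.prems by auto
        have n2: "\<forall>a\<in>set (C @ x # D). a < z" using c z Cons.prems by auto
        have eq: "C @ x # D @ [z] = (C @ x # E) @ Y # F" using d(1) by simp
        note A = tab_ins_None[OF z, of rs] tab_ins_Some[OF c(2,3) rs1, of "D @ [z]"]
          tab_ins_Some[OF n1 d(3) rs2, of F] tab_ins_Some[OF c(2,3) rs1, of D] tab_ins_None[OF n2, of rs1]
        have "insw [z, x, y] (r # rs) = ((C @ x # E @ y # F) # rs2, [0, Suc k1, Suc k2])"
          "insw [x, z, y] (r # rs) = ((C @ x # E @ y # F) # rs2, [Suc k1, 0, Suc k2])"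
          unfolding insw3 c(1) using A eq c(1) by auto
        then show ?thesis by auto
      qed
    qed
  next
    case b: (bump A s B)
    have so: "s \<notin> ent rs" using b Cons.prems by auto
    have "sorted_wrt (<) A" "x \<notin> set A" using b Cons.prems by auto
    then show ?thesis
    proof (cases rule: row_cases)
      case x: none
      have xs: "x < s" using b Cons.prems by simp
      have xz: "x < z" using Cons.prems by simp
      have n1: "\<forall>a\<in>set (A @ [x]). a < y" "\<forall>a\<in>set (A @ [x]). a < z" using x Cons.prems by auto
      show ?thesis
      proof (cases B)
        case Nil
        obtain rs1 k1 where rs1: "tab_ins s rs = (rs1, k1)" by (cases "tab_ins s rs")
        obtain rs2 k2 where rs2: "tab_ins z rs1 = (rs2, k2)" by (cases "tab_ins z rs1")
        note A = tab_ins_Some[OF b(2,3) rs1, of "[]"] tab_ins_Some[OF x xz rs2, of "[]"] tab_ins_None[OF n1(1), of rs2]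
          tab_ins_Some[OF x xs rs1, of "[]"] tab_ins_None[OF n1(2), of rs1] tab_ins_Some[OF n1(1) Cons.prems(3) rs2, of "[]"]
        have "insw [z, x, y] (r # rs) = ((A @ [x, y]) # rs2, [Suc k1, Suc k2, 0])"
          "insw [x, z, y] (r # rs) = ((A @ [x, y]) # rs2, [Suc k1, 0, Suc k2])"
          unfolding insw3 b(1) Nil using A by auto
        then show ?thesis by auto
      next
        case B: (Cons s2 B')
        have s2: "s < s2" "s2 \<notin> ent rs" "y < s2" "z < s2" using b B Cons.prems by auto
        \<comment> \<open>Here the pattern changes on the way down: the bumped letters satisfy
          \<open>z < s < s2\<close>, a triple for the first Knuth relation.\<close>
        obtain P' a b' c' where IH: "insw [s, z, s2] rs = (P', [a, b', c'])" "insw [s, s2, z] rs = (P', [a, c', b'])"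
          using knuth1[OF out(4) b(3) s2(1) out(3) so s2(2)] by blast
        obtain rs1 rs2 where t1: "tab_ins s rs = (rs1, a)" "tab_ins z rs1 = (rs2, b')" "tab_ins s2 rs2 = (P', c')"
          using IH(1) unfolding insw3 by blast
        obtain rs3 where t2: "tab_ins s2 rs1 = (rs3, c')" "tab_ins z rs3 = (P', b')"
          using IH(2) t1(1) unfolding insw3 by auto
        have "c' \<le> a"
          using row_bump[OF out(4) so s2(2) _ t1(1) t2(1)] s2(1) by auto
        note A = tab_ins_Some[OF b(2,3) t1(1), of B] tab_ins_Some[OF x xz t1(2), of B]
          tab_ins_Some[OF n1(1) s2(3) t1(3), of B'] tab_ins_Some[OF x xs t1(1), of B]
          tab_ins_Some[OF n1(2) s2(4) t2(1), of B'] tab_ins_Some[OF n1(1) Cons.prems(3) t2(2), of B']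
        have "insw [z, x, y] (r # rs) = ((A @ x # y # B') # P', [Suc a, Suc b', Suc c'])"
          "insw [x, z, y] (r # rs) = ((A @ x # y # B') # P', [Suc a, Suc c', Suc b'])"
          unfolding insw3 b(1) using A B by auto
        then show ?thesis using \<open>c' \<le> a\<close> by auto
      qed
    next
      case c: (bump C p D)
      have "sorted_wrt (<) (D @ [z])" using c b by (auto simp: sorted_wrt_append)
      moreover have "y \<notin> set (D @ [z])" using b c Cons.prems by auto
      ultimately show ?thesis
      proof (cases rule: row_cases)
        case none then show ?thesis using Cons.prems by auto
      next
        case d: (bump E Y F)
        have Y: "Y \<in> set (D @ [z])" using d(1) by simp
        have pY: "p < Y" "Y < s" "p \<notin> ent rs" "Y \<notin> ent rs" using Y b c Cons.prems by auto
        obtain P' a b' c' where IH: "insw [s, p, Y] rs = (P', [a, b', c'])"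
          "insw [p, s, Y] rs = (P', if c' \<le> a then [a, c', b'] else [b', a, c'])"
          using Cons.IH[OF out(4) pY(1,2,3,4) so] by blast
        obtain rs1 rs2 where t1: "tab_ins s rs = (rs1, a)" "tab_ins p rs1 = (rs2, b')" "tab_ins Y rs2 = (P', c')"
          using IH(1) unfolding insw3 by blast
        obtain rs3 rs4 a2 b2 c2 where t2: "tab_ins p rs = (rs3, a2)" "tab_ins s rs3 = (rs4, b2)" "tab_ins Y rs4 = (P', c2)"
          "[a2, b2, c2] = (if c' \<le> a then [a, c', b'] else [b', a, c'])"
        proof -
          have "\<exists>a2 b2 c2. insw [p, s, Y] rs = (P', [a2, b2, c2]) \<and> [a2, b2, c2] = (if c' \<le> a then [a, c', b'] else [b', a, c'])"
            using IH(2) by (cases "c' \<le> a") auto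
          then show thesis using that unfolding insw3 by blast
        qed
        have n1: "\<forall>a\<in>set (C @ x # E). a < y"
          using c d Cons.prems by auto
        have n2: "\<forall>a\<in>set (C @ x # D). a < z" using c b Cons.prems by auto
        have eq: "C @ x # D @ z # B = (C @ x # E) @ Y # (F @ B)" using d(1)
          by (metis append.assoc append_Cons append_Nil)
        note A = tab_ins_Some[OF b(2,3) t1(1), of B] tab_ins_Some[OF c(2,3) t1(2), of "D @ z # B"]
          tab_ins_Some[OF n1 d(3) t1(3), of "F @ B"] tab_ins_Some[OF c(2,3) t2(1), of "D @ s # B"]
          tab_ins_Some[OF n2 b(3) t2(2), of B] tab_ins_Some[OF n1 d(3) t2(3), of "F @ B"]
        have "insw [z, x, y] (r # rs) = ((C @ x # E @ y # F @ B) # P', [Suc a, Suc b', Suc c'])"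
          "insw [x, z, y] (r # rs) = ((C @ x # E @ y # F @ B) # P', [Suc a2, Suc b2, Suc c2])"
          unfolding insw3 b(1) using A eq c(1) by auto
        then show ?thesis using t2(4) by (auto split: if_splits)
      qed
    qed
  qed
qed

section \<open>Reading words\<close>

definition cols :: "nat list \<Rightarrow> nat list \<Rightarrow> bool" where
  "cols R R' \<longleftrightarrow> length R' \<le> length R \<and> (\<forall>j<length R'. R ! j < R' ! j)"

fun vcol :: "tableau \<Rightarrow> bool" where
  "vcol [] = True"
| "vcol [R] \<longleftrightarrow> R \<noteq> [] \<and> sorted_wrt (<) R"
| "vcol (R # R' # Ts) \<longleftrightarrow> R \<noteq> [] \<and> sorted_wrt (<) R \<and> cols R R' \<and> vcol (R' # Ts)"

text \<open>The tableau after inserting the first \<open>j\<close> entries of the top row into the remaining rows: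
  the first \<open>j\<close> columns have been pushed down.\<close>
fun sh :: "nat \<Rightarrow> tableau \<Rightarrow> tableau" where
  "sh j [] = []"
| "sh j [R] = (if j = 0 then [] else [take j R])"
| "sh j (R # R' # Ts) = (take j R @ drop j R') # sh j (R' # Ts)"

lemma sh_0: "sh 0 (R # Ts) = Ts"
  by (induction Ts arbitrary: R) auto

lemma sh_all: "vcol (R # Ts) \<Longrightarrow> length R \<le> j \<Longrightarrow> sh j (R # Ts) = R # Ts"
proof (induction Ts arbitrary: R)
  case Nil then show ?case by (cases j) auto
next
  case (Cons R' Ts)
  then show ?case by (auto simp: cols_def)
qed

lemma tab_ins_sh:
  assumes "vcol (R # Ts)" "j < length R"
  shows "fst (tab_ins (R ! j) (sh j (R # Ts))) = sh (Suc j) (R # Ts)"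
  using assms
proof (induction Ts arbitrary: R)
  case Nil
  then have lt: "\<forall>a\<in>set (take j R). a < R ! j"
    by (auto simp: in_set_conv_nth sorted_wrt_iff_nth_less)
  show ?case
  proof (cases j)
    case 0
    then show ?thesis using Nil by (cases R) auto
  next
    case (Suc n)
    then show ?thesis using tab_ins_None[OF lt, of "[]"] Nil by (simp add: take_Suc_conv_app_nth)
  qed
next
  case (Cons R' Ts)
  have v: "vcol (R' # Ts)" "R' \<noteq> []" using Cons.prems by (cases Ts; simp)+
  have lt: "\<forall>a\<in>set (take j R). a < R ! j"
    using Cons.prems by (auto simp: in_set_conv_nth sorted_wrt_iff_nth_less)
  have tk: "take (Suc j) R = take j R @ [R ! j]" using Cons.prems by (simp add: take_Suc_conv_app_nth)
  show ?case
  proof (cases "j < length R'")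
    case True
    then have d: "drop j R' = R' ! j # drop (Suc j) R'" by (rule Cons_nth_drop_Suc[symmetric])
    have less: "R ! j < R' ! j" using Cons.prems True by (simp add: cols_def)
    obtain rs k where rs: "tab_ins (R' ! j) (sh j (R' # Ts)) = (rs, k)"
      by (cases "tab_ins (R' ! j) (sh j (R' # Ts))")
    then have "rs = sh (Suc j) (R' # Ts)" using Cons.IH[OF v(1) True] by simp
    then show ?thesis
      using tab_ins_Some[OF lt less rs, of "drop (Suc j) R'"] tk by (simp add: d)
  next
    case False
    then have "sh j (R' # Ts) = R' # Ts" "sh (Suc j) (R' # Ts) = R' # Ts" using sh_all v by auto
    then show ?thesis using False tk tab_ins_None[OF lt, of "R' # Ts"] by simp
  qed
qed

lemma insw_sh: "vcol (R # Ts) \<Longrightarrow> j \<le> length R \<Longrightarrow> fst (insw (take j R) Ts) = sh j (R # Ts)"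
proof (induction j)
  case 0 then show ?case by (simp add: sh_0)
next
  case (Suc j)
  then have "take (Suc j) R = take j R @ [R ! j]" by (simp add: take_Suc_conv_app_nth)
  then show ?case using Suc tab_ins_sh[of R Ts j] by (auto simp: insw_append split: prod.splits)
qed

lemma vcol_tl: "vcol (R # Ts) \<Longrightarrow> vcol Ts"
  by (cases Ts) auto

text \<open>Inserting a row into the tableau of the rows below it pushes that tableau down column by
  column. This shows later that every standard tableau is an insertion tableau.\<close>

lemma insw_reading: "vcol T \<Longrightarrow> fst (insw (concat (rev T)) []) = T"
proof (induction T)
  case (Cons R Ts)
  have "fst (insw R Ts) = R # Ts"
    using insw_sh[OF Cons.prems, of "length R"] sh_all[OF Cons.prems] by simp
  then show ?case using Cons vcol_tl[of R Ts] by (auto simp: insw_append split: prod.splits)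
qed simp

section \<open>RSK for permutations\<close>

definition word :: "nat \<Rightarrow> (nat \<Rightarrow> nat) \<Rightarrow> nat list" where
  "word r w = map w [1..<Suc r]"

text \<open>The lattice word of the recording tableau of \<open>w\<close>; it replaces
  \<open>Qtab\<close> throughout the combinatorics.\<close>

definition kw :: "nat \<Rightarrow> (nat \<Rightarrow> nat) \<Rightarrow> nat list" where
  "kw r w = snd (insw (word r w) [])"

lemma Ptab_insw: "Ptab r w = fst (insw (word r w) [])"
  by (simp add: Ptab_def rsk_def rsk_aux_insw word_def)

lemma Qtab_kw: "Qtab r w = buildQ 1 (kw r w) []"
  by (simp add: Qtab_def rsk_def rsk_aux_insw word_def kw_def)

lemma length_word [simp]: "length (word r w) = r"
  by (simp add: word_def del: upt_Suc)

lemma length_kw [simp]: "length (kw r w) = r"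
  by (simp add: kw_def length_insw)

lemma set_word: "w \<in> Sr r \<Longrightarrow> set (word r w) = {1..r}"
  by (auto simp: word_def Sr_def permutes_image atLeastLessThanSuc_atLeastAtMost simp del: upt_Suc)

lemma distinct_word: "w \<in> Sr r \<Longrightarrow> distinct (word r w)"
  using Sr_inj[of w r] by (auto simp: word_def distinct_map inj_on_def simp del: upt_Suc)

lemma nth_word: "i < r \<Longrightarrow> word r w ! i = w (Suc i)"
  by (simp add: word_def del: upt_Suc)

lemma word_inj: "x \<in> Sr r \<Longrightarrow> y \<in> Sr r \<Longrightarrow> word r x = word r y \<Longrightarrow> x = y"
proof
  fix i assume a: "x \<in> Sr r" "y \<in> Sr r" "word r x = word r y"
  show "x i = y i"
  proof (cases "1 \<le> i \<and> i \<le> r")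
    case True
    then have "word r x ! (i - 1) = word r y ! (i - 1)" "i - 1 < r" using a by auto
    then show ?thesis using True by (simp add: nth_word)
  next
    case False then show ?thesis using a by (auto simp: Sr_def permutes_def)
  qed
qed

definition rl :: "tableau \<Rightarrow> nat \<Rightarrow> nat" where
  "rl P k = (if k < length P then length (P ! k) else 0)"

lemma insw_vt:
  assumes "vt P" "distinct xs" "set xs \<inter> ent P = {}"
  shows "vt (fst (insw xs P)) \<and> ent (fst (insw xs P)) = ent P \<union> set xs \<and>
    (\<forall>k. rl (fst (insw xs P)) k = rl P k + count_list (snd (insw xs P)) k)"
  using assms
proof (induction xs arbitrary: P)
  case Nil then show ?case by simp
next
  case (Cons x xs)
  obtain P' k where t: "tab_ins x P = (P', k)" by (cases "tab_ins x P")
  have v: "vt P'" "ent P' = insert x (ent P)"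
    "if k < length P then map length P' = (map length P)[k := Suc (length (P ! k))]
     else k = length P \<and> map length P' = map length P @ [1]"
    using vt_tab_ins[OF Cons.prems(1) _ t] Cons.prems by auto
  have rl: "rl P' j = rl P j + (if k = j then 1 else 0)" for j
  proof -
    have l: "rl T j = (if j < length (map length T) then map length T ! j else 0)" for T by (simp add: rl_def)
    show ?thesis
    proof (cases "k < length P")
      case True
      then have e: "map length P' = (map length P)[k := Suc (length (P ! k))]" using v(3) by simp
      show ?thesis unfolding l e using True by (auto simp: nth_list_update)
    next
      case False
      then have e: "k = length P" "map length P' = map length P @ [1]" using v(3) by simp_all
      show ?thesis unfolding l e(2) by (auto simp: e(1) nth_append)
    qed
  qed
  obtain P'' ks where t2: "insw xs P' = (P'', ks)" by (cases "insw xs P'")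
  have "vt (fst (insw xs P')) \<and> ent (fst (insw xs P')) = ent P' \<union> set xs \<and>
    (\<forall>k. rl (fst (insw xs P')) k = rl P' k + count_list (snd (insw xs P')) k)"
    by (rule Cons.IH) (use v Cons.prems in auto)
  then show ?case using t t2 rl v(2) by auto
qed

lemma dom_length:
  assumes "dom r r'" shows "length r' \<le> length r"
proof -
  let ?t = "Max (insert 0 (set r \<union> set r'))"
  have "nle r ?t = length r" "nle r' ?t = length r'"
    unfolding nle_def by (subst filter_True; simp)+
  then show ?thesis using assms by (metis dom_def)
qed

lemma vt_dom: "vt P \<Longrightarrow> Suc k < length P \<Longrightarrow> dom (P ! k) (P ! Suc k)"
proof (induction P arbitrary: k)
  case (Cons r rs)
  then show ?case by (cases k; cases rs) (auto simp: hd0_def)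
qed simp

lemma vt_nth: "vt P \<Longrightarrow> k < length P \<Longrightarrow> P ! k \<noteq> [] \<and> sorted_wrt (<) (P ! k)"
  by (induction P arbitrary: k) (auto simp: nth_Cons split: nat.splits)

lemma vt_distinct: "vt P \<Longrightarrow> distinct (concat P)"
proof (induction P)
  case (Cons r rs)
  then have "distinct r" using strict_sorted_iff by (metis vt.simps(2))
  then show ?case using Cons by auto
qed simp

lemma vt_rl: "vt P \<Longrightarrow> rl P (Suc k) \<le> rl P k"
  using vt_dom[of P k] dom_length by (auto simp: rl_def)

lemma insw_take: "snd (insw (take n xs) P) = take n (snd (insw xs P))"
proof -
  have "snd (insw xs P) = snd (insw (take n xs @ drop n xs) P)" by simp
  also have "\<dots> = snd (insw (take n xs) P) @ snd (insw (drop n xs) (fst (insw (take n xs) P)))"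
    by (simp only: insw_append) (simp split: prod.split)
  finally show ?thesis
    by (metis (no_types, lifting) append_eq_conv_conj length_insw length_take min.cobounded2 take_all
        append.right_neutral le_cases min.absorb2 min.absorb1 take_take)
qed

lemma LW_insw:
  assumes "distinct xs" shows "LW (snd (insw xs []))"
  unfolding LW_def
proof (intro allI)
  fix n k
  let ?P = "fst (insw (take n xs) [])"
  have "vt ?P" "\<And>k. rl ?P k = count_list (take n (snd (insw xs []))) k"
    using insw_vt[of "[]" "take n xs"] assms by (auto simp: rl_def insw_take)
  then show "count_list (take n (snd (insw xs []))) (Suc k) \<le> count_list (take n (snd (insw xs []))) k"
    using vt_rl by metis
qed

lemma insw_inj:
  assumes "distinct xs" "distinct ys" "insw xs [] = insw ys []"
  shows "xs = ys"
  using assms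
proof (induction xs arbitrary: ys rule: rev_induct)
  case Nil
  then have "length ys = 0" using length_insw[of ys "[]"] by (metis length_0_conv insw.simps(1) snd_conv)
  then show ?case by simp
next
  case (snoc x xs)
  have "length ys = length (xs @ [x])" using length_insw snoc.prems(3) by metis
  then obtain ys' y where ys: "ys = ys' @ [y]" by (metis length_0_conv rev_exhaust snoc_eq_iff_butlast)
  obtain P ks where P: "insw xs [] = (P, ks)" by (cases "insw xs []")
  obtain R ls where R: "insw ys' [] = (R, ls)" by (cases "insw ys' []")
  obtain P' k where P': "tab_ins x P = (P', k)" by (cases "tab_ins x P")
  obtain R' l where R': "tab_ins y R = (R', l)" by (cases "tab_ins y R")
  have e: "P' = R'" "ks = ls" "k = l" using snoc.prems(3) P R P' R' by (auto simp: ys insw_append)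
  have "vt P" "ent P = set xs" "vt R" "ent R = set ys'"
    using insw_vt[of "[]" xs] insw_vt[of "[]" ys'] P R snoc.prems ys by auto
  then have "x = y \<and> P = R" using tab_ins_inj[of P R x y P' k] P' R' e snoc.prems ys by auto
  moreover have "xs = ys'" using snoc.IH[of ys'] snoc.prems ys P R e calculation by auto
  ultimately show ?case using ys by simp
qed

lemma LW_kw: "w \<in> Sr r \<Longrightarrow> LW (kw r w)"
  unfolding kw_def by (intro LW_insw distinct_word)

lemma rsk_inj: "x \<in> Sr r \<Longrightarrow> y \<in> Sr r \<Longrightarrow> Ptab r x = Ptab r y \<Longrightarrow> kw r x = kw r y \<Longrightarrow> x = y"
  using word_inj insw_inj[OF distinct_word distinct_word] by (metis Ptab_insw kw_def prod_eqI)

lemma vt_Ptab: "w \<in> Sr r \<Longrightarrow> vt (Ptab r w) \<and> ent (Ptab r w) = {1..r} \<and> rl (Ptab r w) = count_list (kw r w)"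
  using insw_vt[of "[]" "word r w"] distinct_word[of w r] set_word[of w r]
  by (auto simp: Ptab_insw kw_def rl_def fun_eq_iff)

lemma word_split:
  assumes "i \<le> r"
  shows "word r w = map w [1..<Suc i] @ map w [Suc i..<Suc r]"
  unfolding word_def map_append[symmetric] using upt_add_eq_append[of 1 "Suc i" "r - i"] assms by (simp del: upt_Suc)

text \<open>Row bumping for two neighbouring letters. The shift from \<open>i\<close> to
  \<open>Suc i\<close> reconciles list positions with the arguments of \<open>w\<close>.\<close>

lemma wd_kw:
  assumes w: "w \<in> Sr r" and i: "Suc i < r"
  shows "wd (kw r w) i \<longleftrightarrow> rdesc w (Suc i)"
proof -
  define p where "p = map w [1..<Suc i]"
  define s where "s = map w [Suc (Suc (Suc i))..<Suc r]"
  have word: "word r w = p @ w (Suc i) # w (Suc (Suc i)) # s"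
    using word_split[of i r w] i by (simp add: p_def s_def upt_conv_Cons del: upt_Suc)
  have d: "distinct (p @ w (Suc i) # w (Suc (Suc i)) # s)" using distinct_word[OF w] by (simp add: word)
  obtain P ks where P: "insw p [] = (P, ks)" by (cases "insw p []")
  obtain P1 k where P1: "tab_ins (w (Suc i)) P = (P1, k)" by (cases "tab_ins (w (Suc i)) P")
  obtain P2 l where P2: "tab_ins (w (Suc (Suc i))) P1 = (P2, l)" by (cases "tab_ins (w (Suc (Suc i))) P1")
  have v: "vt P" "ent P = set p" using insw_vt[of "[]" p] d P by auto
  have "length ks = i" using length_insw[of p "[]"] P by (simp add: p_def del: upt_Suc)
  then have "kw r w ! i = k" "kw r w ! Suc i = l"
    by (auto simp: kw_def word insw_append P P1 P2 nth_append split: prod.splits)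
  moreover have "k < l \<longleftrightarrow> w (Suc (Suc i)) < w (Suc i)"
    by (rule row_bump[OF v(1) _ _ _ P1 P2]) (use v d in auto)
  ultimately show ?thesis by simp
qed

lemma insw_triple:
  assumes "insw [a, b, c] (fst (insw p P)) = (P', ks)" "insw [a', b', c'] (fst (insw p P)) = (P', ks')"
  shows "fst (insw (p @ a # b # c # s) P) = fst (insw (p @ a' # b' # c' # s) P) \<and>
    snd (insw (p @ a # b # c # s) P) = snd (insw p P) @ ks @ snd (insw s P') \<and>
    snd (insw (p @ a' # b' # c' # s) P) = snd (insw p P) @ ks' @ snd (insw s P')"
proof -
  have "insw (p @ [a, b, c] @ s) P = (fst (insw s P'), snd (insw p P) @ ks @ snd (insw s P'))"
    "insw (p @ [a', b', c'] @ s) P = (fst (insw s P'), snd (insw p P) @ ks' @ snd (insw s P'))"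
    using assms by (simp_all only: insw_append split: prod.split) auto
  then show ?thesis by simp
qed

text \<open>A descent at \<open>k\<close> in the domain means that the middle of the three letters
  is the smallest. Comparing the outer two selects the Knuth relation, and row bumping shows that
  the recorded rows change by the matching case of \<open>wstar\<close>.\<close>

lemma rsk_kstar_aux:
  assumes w: "w \<in> Sr r" and k: "1 \<le> k" "Suc k < r" and D: "kD k w" and d: "rdesc w k"
  shows "Ptab r (kstar k w) = Ptab r w \<and> kw r (kstar k w) = wstar (k - 1) (kw r w)"
proof -
  obtain i where i: "k = Suc i" using k by (cases k) auto
  define p where "p = map w [1..<Suc i]"
  define s where "s = map w [Suc (Suc (Suc (Suc i)))..<Suc r]"
  let ?a = "w (Suc i)" and ?b = "w (Suc (Suc i))" and ?c = "w (Suc (Suc (Suc i)))"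
  have dec: "word r v = map v [1..<Suc i] @ v (Suc i) # v (Suc (Suc i)) # v (Suc (Suc (Suc i))) # map v [Suc (Suc (Suc (Suc i)))..<Suc r]" for v
    using word_split[of i r v] k i by (simp add: upt_conv_Cons del: upt_Suc)
  have eqs: "map (w \<circ> sref m) [1..<Suc i] = p" "map (w \<circ> sref m) [Suc (Suc (Suc (Suc i)))..<Suc r] = s"
    if "m = Suc i \<or> m = Suc (Suc i)" for m
    using that by (auto simp: p_def s_def simp del: upt_Suc)
  have word: "word r w = p @ ?a # ?b # ?c # s" by (simp add: dec p_def s_def del: upt_Suc)
  have word1: "word r (w \<circ> sref (Suc i)) = p @ ?b # ?a # ?c # s"
    using eqs[of "Suc i"] by (simp add: dec del: upt_Suc map_map)
  have word2: "word r (w \<circ> sref (Suc (Suc i))) = p @ ?a # ?c # ?b # s"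
    using eqs[of "Suc (Suc i)"] by (simp add: dec del: upt_Suc map_map)
  have dist: "distinct (p @ ?a # ?b # ?c # s)" using distinct_word[OF w] by (simp add: word)
  let ?P = "fst (insw p [])"
  have v: "vt ?P" "ent ?P = set p" using insw_vt[of "[]" p] dist by auto
  have out: "?a \<notin> ent ?P" "?b \<notin> ent ?P" "?c \<notin> ent ?P" using v dist by auto
  have lp: "length (snd (insw p [])) = i" using length_insw[of p "[]"] by (simp add: p_def del: upt_Suc)
  have ba: "?b < ?a" and bc: "?b < ?c" using d D i Sr_inj[OF w, of "Suc (Suc i)" "Suc (Suc (Suc i))"]
    by (auto simp: kD_def)
  have ne: "?a \<noteq> ?c" using Sr_inj[OF w] by simp
  show ?thesis
  proof (cases "?a < ?c")
    case True
    obtain P' \<alpha> \<beta> \<gamma> where K: "insw [?a, ?b, ?c] ?P = (P', [\<alpha>, \<beta>, \<gamma>])" "insw [?a, ?c, ?b] ?P = (P', [\<alpha>, \<gamma>, \<beta>])"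
      using knuth1[OF v(1) ba True out(2,1,3)] by blast
    have ks: "kstar k w = w \<circ> sref (Suc (Suc i))" using True bc ba i by (simp add: kstar_def)
    obtain P1 P2 where t: "tab_ins ?a ?P = (P1, \<alpha>)" "tab_ins ?b P1 = (P2, \<beta>)" using K(1) unfolding insw3 by blast
    obtain P3 where t2: "tab_ins ?c P1 = (P3, \<gamma>)" using K(2) t unfolding insw3 by auto
    have "\<alpha> < \<beta>" using row_bump[OF v(1) out(1,2) _ t] ba by auto
    moreover have "\<gamma> \<le> \<alpha>" using row_bump[OF v(1) out(1,3) _ t(1) t2] True by auto
    ultimately have "wstar i (snd (insw p []) @ [\<alpha>, \<beta>, \<gamma>] @ snd (insw s P')) = snd (insw p []) @ [\<alpha>, \<gamma>, \<beta>] @ snd (insw s P')"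
      using wstar_split[of "snd (insw p [])" \<alpha> \<beta> \<gamma> "snd (insw s P')"] lp by auto
    then show ?thesis
      using insw_triple[OF K, of s] unfolding ks by (simp add: Ptab_insw kw_def word word2 i)
  next
    case False
    then have ca: "?c < ?a" using ne by simp
    obtain P' \<alpha> \<beta> \<gamma> where K: "insw [?a, ?b, ?c] ?P = (P', [\<alpha>, \<beta>, \<gamma>])"
      "insw [?b, ?a, ?c] ?P = (P', if \<gamma> \<le> \<alpha> then [\<alpha>, \<gamma>, \<beta>] else [\<beta>, \<alpha>, \<gamma>])"
      using knuth2[OF v(1) bc ca out(2,3,1)] by blast
    have ks: "kstar k w = w \<circ> sref (Suc i)" using False bc ba ca i by (auto simp: kstar_def)
    obtain P1 P2 P3 where t: "tab_ins ?a ?P = (P1, \<alpha>)" "tab_ins ?b P1 = (P2, \<beta>)" "tab_ins ?c P2 = (P3, \<gamma>)"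
      using K(1) unfolding insw3 by blast
    have "\<alpha> < \<beta>" using row_bump[OF v(1) out(1,2) _ t(1,2)] ba by auto
    moreover have "\<gamma> \<le> \<beta>"
    proof -
      have "vt P1 \<and> ent P1 = insert ?a (ent ?P)" using vt_tab_ins[OF v(1) out(1) t(1)] by blast
      then show ?thesis using row_bump[OF _ _ _ _ t(2,3)] bc out dist by auto
    qed
    ultimately have "wstar i (snd (insw p []) @ [\<alpha>, \<beta>, \<gamma>] @ snd (insw s P'))
        = snd (insw p []) @ (if \<gamma> \<le> \<alpha> then [\<alpha>, \<gamma>, \<beta>] else [\<beta>, \<alpha>, \<gamma>]) @ snd (insw s P')"
      using wstar_split[of "snd (insw p [])" \<alpha> \<beta> \<gamma> "snd (insw s P')"] lp by auto
    then show ?thesis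
      using insw_triple[OF K, of s] unfolding ks by (simp add: Ptab_insw kw_def word word1 i)
  qed
qed

lemma wD_kw:
  assumes "w \<in> Sr r" "1 \<le> k" "Suc k < r"
  shows "wD (k - 1) (kw r w) \<longleftrightarrow> kD k w"
  using wd_kw[OF assms(1), of "k - 1"] wd_kw[OF assms(1), of k] assms by (simp add: wD_def kD_def)

text \<open>If \<open>k\<close> is not a descent of \<open>w\<close>, it is one of
  \<open>kstar k w\<close>; both operations are involutions, so the preceding lemma can be read
  backwards.\<close>

theorem rsk_kstar:
  assumes w: "w \<in> Sr r" and k: "1 \<le> k" "Suc k < r" and D: "kD k w"
  shows "Ptab r (kstar k w) = Ptab r w" "kw r (kstar k w) = wstar (k - 1) (kw r w)"
proof -
  have "Ptab r (kstar k w) = Ptab r w \<and> kw r (kstar k w) = wstar (k - 1) (kw r w)"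
  proof (cases "rdesc w k")
    case True then show ?thesis using rsk_kstar_aux[OF w k D] by blast
  next
    case False
    let ?v = "kstar k w"
    have v: "?v \<in> Sr r" using kstar_Sr[OF w k] .
    note p = kstar_props[OF w D]
    have "rdesc ?v k" using p(1) D False by (simp add: kD_def)
    from rsk_kstar_aux[OF v k p(4) this]
    have e: "Ptab r w = Ptab r ?v" "kw r w = wstar (k - 1) (kw r ?v)" by (simp_all add: p(3))
    have "wD (k - 1) (kw r ?v)" using wD_kw[OF v k] p(4) by simp
    then have "wstar (k - 1) (kw r w) = kw r ?v"
      unfolding e(2) by (intro wstar_props(3)) (use k in auto)
    then show ?thesis using e by simp
  qed
  then show "Ptab r (kstar k w) = Ptab r w" "kw r (kstar k w) = wstar (k - 1) (kw r w)" by auto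
qed

section \<open>Tableaux and lattice words\<close>

definition pos :: "nat list \<Rightarrow> nat \<Rightarrow> nat list" where
  "pos ks k = filter (\<lambda>i. ks ! (i - 1) = k) [1..<Suc (length ks)]"

text \<open>\<open>Q\<close> is the tableau with lattice word \<open>ks\<close>.\<close>
definition isQ :: "nat list \<Rightarrow> tableau \<Rightarrow> bool" where
  "isQ ks Q \<longleftrightarrow> (\<forall>k<length Q. Q ! k = pos ks k \<and> Q ! k \<noteq> []) \<and> set ks \<subseteq> {..<length Q}"

lemma pos_snoc: "pos (ks @ [k]) j = pos ks j @ (if j = k then [Suc (length ks)] else [])"
proof -
  have "filter (\<lambda>i. (ks @ [k]) ! (i - 1) = j) [1..<Suc (length ks)] = pos ks j"
    unfolding pos_def by (rule filter_cong) (auto simp: nth_append)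
  then show ?thesis by (simp add: pos_def)
qed

lemma set_pos: "set (pos ks k) = {i. 1 \<le> i \<and> i \<le> length ks \<and> ks ! (i - 1) = k}"
  by (auto simp: pos_def simp del: upt_Suc)

lemma pos_empty_iff: "pos ks k = [] \<longleftrightarrow> k \<notin> set ks"
proof (induction ks rule: rev_induct)
  case Nil then show ?case by (simp add: pos_def)
next
  case (snoc x ks) then show ?case by (auto simp: pos_snoc)
qed

lemma sorted_pos: "sorted_wrt (<) (pos ks k)"
  unfolding pos_def by (intro sorted_wrt_filter) (simp del: upt_Suc)

lemma isQ_unique:
  assumes "isQ ks Q" "isQ ks Q'" shows "Q = Q'"
proof -
  have "{..<length Q} = set ks" "{..<length Q'} = set ks"
    using assms pos_empty_iff unfolding isQ_def by (metis lessThan_iff subsetI subset_antisym)+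
  then have "length Q = length Q'" by (metis lessThan_eq_iff)
  then show ?thesis using assms by (intro nth_equalityI) (auto simp: isQ_def)
qed

lemma isQ_inj:
  assumes "isQ ks Q" "isQ ks' Q" "length ks = length ks'" shows "ks = ks'"
proof (rule nth_equalityI)
  fix i assume i: "i < length ks"
  then have "ks ! i \<in> set ks" by simp
  then have "ks ! i \<in> {..<length Q}" using assms by (auto simp: isQ_def)
  then have "Q ! (ks ! i) = pos ks (ks ! i)" "Q ! (ks ! i) = pos ks' (ks ! i)" using assms by (auto simp: isQ_def)
  moreover have "Suc i \<in> set (pos ks (ks ! i))" using i by (simp add: set_pos)
  ultimately have "Suc i \<in> set (pos ks' (ks ! i))" by simp
  then show "ks ! i = ks' ! i" by (simp add: set_pos)
qed (rule assms)

lemma isQ_snoc: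
  assumes "isQ ks Q" "k \<le> length Q"
  shows "isQ (ks @ [k]) (add_box (Suc (length ks)) k Q)"
proof (cases "k < length Q")
  case True
  then show ?thesis using assms by (auto simp: isQ_def add_box_def pos_snoc nth_list_update)
next
  case False
  then have k: "k = length Q" using assms by simp
  then have "k \<notin> set ks" using assms by (auto simp: isQ_def)
  then have "pos ks k = []" by (simp add: pos_empty_iff)
  then show ?thesis using assms k by (auto simp: isQ_def add_box_def pos_snoc nth_append less_Suc_eq)
qed

lemma buildQ_snoc: "buildQ n (ks @ [k]) Q = add_box (n + length ks) k (buildQ n ks Q)"
  by (induction ks arbitrary: n Q) auto

lemma isQ_buildQ: "LW ks \<Longrightarrow> isQ ks (buildQ 1 ks [])"
proof (induction ks rule: rev_induct)
  case Nil then show ?case by (simp add: isQ_def)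
next
  case (snoc k ks)
  have IH: "isQ ks (buildQ 1 ks [])" using snoc LW_append1 by blast
  have "k \<le> length (buildQ 1 ks [])"
  proof (cases k)
    case (Suc j)
    then have "count_list ks j \<noteq> 0" using snoc.prems by (auto simp: LW_snoc)
    then have "j \<in> set ks" by (metis count_list_0_iff)
    then show ?thesis using IH Suc by (auto simp: isQ_def)
  qed simp
  from isQ_snoc[OF IH this] show ?case by (simp add: buildQ_snoc)
qed

lemma isQ_Qtab: "w \<in> Sr r \<Longrightarrow> isQ (kw r w) (Qtab r w)"
  unfolding Qtab_kw by (intro isQ_buildQ LW_kw)

definition rw :: "nat \<Rightarrow> tableau \<Rightarrow> nat list" where
  "rw n T = map (row_of T) [1..<Suc n]"

lemma length_rw [simp]: "length (rw n T) = n"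
  by (simp add: rw_def del: upt_Suc)

lemma nth_rw: "1 \<le> i \<Longrightarrow> i \<le> n \<Longrightarrow> rw n T ! (i - 1) = row_of T i"
  by (simp add: rw_def del: upt_Suc)

lemma row_of_eqI:
  assumes "distinct (concat T)" "k < length T" "i \<in> set (T ! k)"
  shows "row_of T i = k"
  unfolding row_of_def
proof (rule the_equality)
  fix j assume j: "j < length T \<and> i \<in> set (T ! j)"
  show "j = k"
  proof (rule ccontr)
    assume "j \<noteq> k"
    have "set (T ! a) \<inter> set (T ! b) = {}" if "a < b" "b < length T" for a b
    proof -
      have "T = take b T @ T ! b # drop (Suc b) T" using that by (simp add: id_take_nth_drop)
      then have "distinct (concat (take b T) @ T ! b @ concat (drop (Suc b) T))"
        using assms(1) by (metis concat.simps(2) concat_append)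
      moreover have "set (T ! a) \<subseteq> set (concat (take b T))" 
      proof -
        have "take b T ! a \<in> set (take b T)" using that by (intro nth_mem) simp
        then show ?thesis using that by auto
      qed
      ultimately show ?thesis by auto
    qed
    then show False using j assms \<open>j \<noteq> k\<close> by (metis disjoint_iff linorder_neqE_nat)
  qed
qed (use assms in simp)

lemma isQ_rw:
  assumes d: "distinct (concat T)" and s: "ent T = {1..n}"
    and r: "\<And>k. k < length T \<Longrightarrow> T ! k \<noteq> [] \<and> sorted_wrt (<) (T ! k)"
  shows "isQ (rw n T) T"
proof -
  have ex: "\<exists>k<length T. i \<in> set (T ! k)" if "1 \<le> i" "i \<le> n" for i
  proof -
    have "i \<in> ent T" using that s by simp
    then obtain row where "row \<in> set T" "i \<in> set row" by auto
    then show ?thesis by (metis in_set_conv_nth)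
  qed
  have "T ! k = pos (rw n T) k" if k: "k < length T" for k
  proof (rule strict_sorted_equal[symmetric])
    show "set (pos (rw n T) k) = set (T ! k)"
    proof (intro set_eqI iffI)
      fix i assume "i \<in> set (pos (rw n T) k)"
      then have i: "1 \<le> i" "i \<le> n" "row_of T i = k" using nth_rw[of i n T] by (auto simp: set_pos)
      then show "i \<in> set (T ! k)" using ex row_of_eqI[OF d] by metis
    next
      fix i assume i: "i \<in> set (T ! k)"
      then have "i \<in> ent T" using k by (auto intro!: bexI[of _ "T ! k"])
      then have "1 \<le> i" "i \<le> n" unfolding s by simp_all
      then show "i \<in> set (pos (rw n T) k)" using row_of_eqI[OF d k i] s nth_rw[of i n T] by (auto simp: set_pos)
    qed
  qed (use r k sorted_pos in auto)
  moreover have "set (rw n T) \<subseteq> {..<length T}"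
  proof
    fix k assume "k \<in> set (rw n T)"
    then obtain i where i: "k = row_of T i" "1 \<le> i" "i \<le> n" by (auto simp: rw_def simp del: upt_Suc)
    then show "k \<in> {..<length T}" using ex row_of_eqI[OF d] by (metis lessThan_iff)
  qed
  ultimately show ?thesis using r by (auto simp: isQ_def)
qed

text \<open>This makes \<open>dom\<close> of consecutive rows the same thing as the lattice
  condition on prefixes.\<close>

lemma nle_pos: "t \<le> length ks \<Longrightarrow> nle (pos ks k) t = count_list (take t ks) k"
proof (induction ks arbitrary: t rule: rev_induct)
  case Nil then show ?case by (simp add: pos_def)
next
  case (snoc x ks)
  show ?case
  proof (cases "t \<le> length ks")
    case True then show ?thesis using snoc by (simp add: pos_snoc)
  next
    case False
    then have t: "t = Suc (length ks)" using snoc by simp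
    have "nle (pos ks k) t = nle (pos ks k) (length ks)" by (rule nle_cong) (auto simp: set_pos t)
    then show ?thesis using snoc.IH[of "length ks"] t by (simp add: pos_snoc)
  qed
qed

lemma count_pos: "length (pos ks k) = count_list ks k"
  by (induction ks rule: rev_induct) (auto simp: pos_snoc, simp add: pos_def)

lemma LW_isQ:
  assumes Q: "isQ ks Q" and d: "\<And>k. Suc k < length Q \<Longrightarrow> dom (Q ! k) (Q ! Suc k)"
  shows "LW ks"
  unfolding LW_def
proof (intro allI)
  fix n k
  have "count_list (take n ks) (Suc k) \<le> count_list (take n ks) k" if n: "n \<le> length ks" for n
  proof (cases "Suc k < length Q")
    case True
    then have "nle (pos ks (Suc k)) n \<le> nle (pos ks k) n" using d[OF True] Q by (auto simp: dom_def isQ_def)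
    then show ?thesis using n by (simp add: nle_pos)
  next
    case False
    then have "Suc k \<notin> set (take n ks)" using Q by (auto simp: isQ_def dest: in_set_takeD)
    then have "count_list (take n ks) (Suc k) = 0" by simp
    then show ?thesis by simp
  qed
  from this[of "min n (length ks)"] show "count_list (take n ks) (Suc k) \<le> count_list (take n ks) k"
    by (metis min.cobounded2 take_all take_take nle_le)
qed

lemma nth_le_iff: "sorted_wrt (<) r \<Longrightarrow> j < length r \<Longrightarrow> r ! j \<le> t \<longleftrightarrow> j < nle r t"
proof (induction r arbitrary: j)
  case (Cons x r)
  show ?case
  proof (cases j)
    case 0
    have "\<not> x \<le> t \<Longrightarrow> nle r t = 0" using Cons.prems(1) by (induction r) auto
    then show ?thesis using 0 by auto
  next
    case (Suc i)
    have "x < r ! i" using Cons.prems Suc by simp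
    moreover have "\<not> x \<le> t \<Longrightarrow> nle r t = 0" using Cons.prems(1) by (induction r) auto
    ultimately show ?thesis using Cons.IH[of i] Cons.prems Suc by auto
  qed
qed simp

lemma nle_le: "nle r t \<le> length r"
  by (simp add: nle_def)

lemma cols_dom:
  assumes "sorted_wrt (<) r" "sorted_wrt (<) r'" "cols r r'" shows "dom r r'"
  unfolding dom_def
proof
  fix t
  show "nle r' t \<le> nle r t"
  proof (cases "nle r' t")
    case (Suc j)
    then have j: "j < nle r' t" by simp
    then have jl: "j < length r'" using nle_le[of r' t] by simp
    then have "r' ! j \<le> t" using nth_le_iff[OF assms(2) jl] j by simp
    moreover have "r ! j < r' ! j" "j < length r" using assms(3) jl by (auto simp: cols_def)
    ultimately show ?thesis using nth_le_iff[OF assms(1), of j t] Suc by simp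
  qed simp
qed

text \<open>Counting entries up to the \<open>j\<close>-th one of the lower row gives the weak
  inequality; disjointness of the rows makes it strict.\<close>

lemma dom_cols:
  assumes "sorted_wrt (<) r" "sorted_wrt (<) r'" "dom r r'" "set r \<inter> set r' = {}" shows "cols r r'"
  unfolding cols_def
proof (intro conjI allI impI)
  show "length r' \<le> length r" by (rule dom_length[OF assms(3)])
  fix j assume j: "j < length r'"
  then have jr: "j < length r" using \<open>length r' \<le> length r\<close> by simp
  have "j < nle r' (r' ! j)" using nth_le_iff[OF assms(2) j, of "r' ! j"] by simp
  then have "j < nle r (r' ! j)" using assms(3) by (auto simp: dom_def intro: less_le_trans)
  then have "r ! j \<le> r' ! j" using nth_le_iff[OF assms(1) jr] by simp
  moreover have "r ! j \<noteq> r' ! j" using assms(4) j jr by (metis disjoint_iff nth_mem)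
  ultimately show "r ! j < r' ! j" by simp
qed

lemma SYT_props:
  assumes lam: "is_partition lam" and T: "T \<in> SYT lam"
  shows "distinct (concat T)" "ent T = {1..sum_list lam}" "length T = length lam"
    "\<And>k. k < length T \<Longrightarrow> T ! k \<noteq> [] \<and> sorted_wrt (<) (T ! k) \<and> length (T ! k) = lam ! k"
    "\<And>k. Suc k < length T \<Longrightarrow> cols (T ! k) (T ! Suc k)"
proof -
  have m: "map length T = lam" "mset (concat T) = mset [1..<sum_list lam + 1]"
    "\<forall>row\<in>set T. sorted_wrt (<) row"
    "\<And>i j. Suc i < length T \<Longrightarrow> j < length (T ! Suc i) \<Longrightarrow> T ! i ! j < T ! Suc i ! j"
    using T by (auto simp: SYT_def)
  show "distinct (concat T)" using m(2) mset_eq_imp_distinct_iff distinct_upt by blast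
  show "ent T = {1..sum_list lam}" using mset_eq_setD[OF m(2)] by (auto simp del: upt_Suc)
  show len: "length T = length lam" using m(1) by auto
  have l: "length (T ! k) = lam ! k" if "k < length T" for k using m(1) that by auto
  show "T ! k \<noteq> [] \<and> sorted_wrt (<) (T ! k) \<and> length (T ! k) = lam ! k" if "k < length T" for k
  proof -
    have "lam ! k \<in> set lam" using that len by simp
    then have "0 < lam ! k" using lam by (auto simp: is_partition_def)
    then show ?thesis using l[OF that] m(3) that by auto
  qed
  show "cols (T ! k) (T ! Suc k)" if "Suc k < length T" for k
  proof -
    have "lam ! Suc k \<le> lam ! k" using lam that len
      by (auto simp: is_partition_def sorted_wrt_iff_nth_less)
    then show ?thesis using l that m(4) by (simp add: cols_def)
  qed
qed

lemma SYT_isQ: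
  assumes "is_partition lam" "T \<in> SYT lam"
  shows "isQ (rw (sum_list lam) T) T" "LW (rw (sum_list lam) T)"
    "count_list (rw (sum_list lam) T) = (\<lambda>k. if k < length lam then lam ! k else 0)"
proof -
  note p = SYT_props[OF assms]
  show Q: "isQ (rw (sum_list lam) T) T" using p by (intro isQ_rw) auto
  show "LW (rw (sum_list lam) T)"
    by (rule LW_isQ[OF Q]) (use p in \<open>auto intro!: cols_dom\<close>)
  show "count_list (rw (sum_list lam) T) = (\<lambda>k. if k < length lam then lam ! k else 0)"
  proof
    fix k
    show "count_list (rw (sum_list lam) T) k = (if k < length lam then lam ! k else 0)"
    proof (cases "k < length T")
      case True
      then have "length (T ! k) = count_list (rw (sum_list lam) T) k" using Q count_pos by (auto simp: isQ_def)
      then show ?thesis using p True by auto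
    next
      case False
      then have "k \<notin> set (rw (sum_list lam) T)" using Q by (auto simp: isQ_def)
      then show ?thesis using False p by simp
    qed
  qed
qed

lemma SYT_vcol:
  assumes "is_partition lam" "T \<in> SYT lam" shows "vcol T"
proof -
  note p = SYT_props[OF assms]
  have "vcol T" if "\<And>k. k < length T \<Longrightarrow> T ! k \<noteq> [] \<and> sorted_wrt (<) (T ! k)"
    "\<And>k. Suc k < length T \<Longrightarrow> cols (T ! k) (T ! Suc k)" for T
    using that
  proof (induction T rule: vcol.induct)
    case (2 R) then show ?case using "2.prems"(1)[of 0] by simp
  next
    case (3 R R' Ts)
    have "vcol (R' # Ts)"
    proof (rule "3.IH")
      fix k
      show "k < length (R' # Ts) \<Longrightarrow> (R' # Ts) ! k \<noteq> [] \<and> sorted_wrt (<) ((R' # Ts) ! k)"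
        using "3.prems"(1)[of "Suc k"] by simp
      show "Suc k < length (R' # Ts) \<Longrightarrow> cols ((R' # Ts) ! k) ((R' # Ts) ! Suc k)"
        using "3.prems"(2)[of "Suc k"] by simp
    qed
    then show ?case using "3.prems"(1)[of 0] "3.prems"(2)[of 0] by simp
  qed simp
  then show ?thesis using p by blast
qed

lemma SYT_reading:
  assumes lam: "is_partition lam" and T: "T \<in> SYT lam"
  shows "\<exists>w\<in>Sr (sum_list lam). Ptab (sum_list lam) w = T"
proof -
  let ?n = "sum_list lam" and ?xs = "concat (rev T)"
  note p = SYT_props[OF lam T]
  have "mset ?xs = mset (concat T)" by (induction T) auto
  then have d: "distinct ?xs" using p(1) mset_eq_imp_distinct_iff by blast
  have s: "set ?xs = {1..?n}" using p(2) by simp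
  have l: "length ?xs = ?n" using d s distinct_card[OF d] by simp
  define w where "w i = (if 1 \<le> i \<and> i \<le> ?n then ?xs ! (i - 1) else i)" for i
  have "bij_betw w {1..?n} {1..?n}"
  proof -
    have "inj_on w {1..?n}"
      using d l by (auto simp: inj_on_def w_def nth_eq_iff_index_eq)
    moreover have "w ` {1..?n} \<subseteq> {1..?n}"
    proof
      fix y assume "y \<in> w ` {1..?n}"
      then obtain i where "1 \<le> i" "i \<le> ?n" "y = ?xs ! (i - 1)" by (auto simp: w_def)
      then have "i - 1 < length ?xs" using l by linarith
      then have "y \<in> set ?xs" using \<open>y = ?xs ! (i - 1)\<close> by (simp only: nth_mem)
      then show "y \<in> {1..?n}" by (simp only: s)
    qed
    ultimately show ?thesis by (simp add: bij_betw_def endo_inj_surj)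
  qed
  then have "w \<in> Sr ?n" unfolding Sr_def mem_Collect_eq by (rule bij_imp_permutes) (auto simp: w_def)
  moreover have "word ?n w = ?xs"
  proof (rule nth_equalityI)
    show "length (word ?n w) = length ?xs" by (simp only: length_word l)
    fix i assume "i < length (word ?n w)"
    then have "i < ?n" by (simp only: length_word)
    then show "word ?n w ! i = ?xs ! i" by (simp add: nth_word w_def)
  qed
  ultimately show ?thesis using insw_reading[OF SYT_vcol[OF lam T]] by (intro bexI[of _ w]) (simp_all add: Ptab_insw)
qed

lemma pos_nth:
  assumes "j < length (pos ks k)"
  shows "1 \<le> pos ks k ! j \<and> pos ks k ! j \<le> length ks \<and> ks ! (pos ks k ! j - 1) = k \<and>
    count_list (take (pos ks k ! j - 1) ks) k = j"
  using assms
proof (induction ks rule: rev_induct)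
  case Nil then show ?case by (simp add: pos_def)
next
  case (snoc x ks)
  show ?case
  proof (cases "j < length (pos ks k)")
    case True
    note IH = snoc.IH[OF True]
    have e: "pos (ks @ [x]) k ! j = pos ks k ! j" using True by (simp add: pos_snoc nth_append)
    let ?m = "pos ks k ! j"
    have "?m - 1 < length ks" using IH by linarith
    then have "take (?m - 1) (ks @ [x]) = take (?m - 1) ks" "(ks @ [x]) ! (?m - 1) = ks ! (?m - 1)"
      by (simp_all add: nth_append)
    then show ?thesis using IH by (simp add: e)
  next
    case False
    then have "k = x" "j = length (pos ks k)" using snoc.prems by (auto simp: pos_snoc split: if_splits)
    then have "pos (ks @ [x]) k ! j = Suc (length ks)" by (simp add: pos_snoc)
    then show ?thesis using \<open>k = x\<close> \<open>j = _\<close> by (simp add: count_pos)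
  qed
qed

lemma pos_nth_conv:
  assumes "1 \<le> i" "i \<le> length ks"
  shows "count_list (take (i - 1) ks) (ks ! (i - 1)) < length (pos ks (ks ! (i - 1))) \<and>
    pos ks (ks ! (i - 1)) ! count_list (take (i - 1) ks) (ks ! (i - 1)) = i"
proof -
  have "i \<in> set (pos ks (ks ! (i - 1)))" using assms by (simp add: set_pos)
  then obtain j where j: "j < length (pos ks (ks ! (i - 1)))" "pos ks (ks ! (i - 1)) ! j = i"
    by (auto simp: in_set_conv_nth)
  with pos_nth[OF j(1)] show ?thesis by auto
qed

lemma isQ_row_of: "isQ ks Q \<Longrightarrow> 1 \<le> i \<Longrightarrow> i \<le> length ks \<Longrightarrow> row_of Q i = ks ! (i - 1)"
  unfolding row_of_def
proof (rule the_equality)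
  assume a: "isQ ks Q" "1 \<le> i" "i \<le> length ks"
  then have "ks ! (i - 1) \<in> set ks" by (intro nth_mem) linarith
  then have k: "ks ! (i - 1) < length Q" using a(1) unfolding isQ_def by blast
  then have "Q ! (ks ! (i - 1)) = pos ks (ks ! (i - 1))" using a(1) by (simp only: isQ_def)
  then show "ks ! (i - 1) < length Q \<and> i \<in> set (Q ! (ks ! (i - 1)))" using a k by (simp add: set_pos)
  fix k assume "k < length Q \<and> i \<in> set (Q ! k)"
  then show "k = ks ! (i - 1)" using a by (auto simp: isQ_def set_pos)
qed

lemma isQ_col_of:
  assumes Q: "isQ ks Q" and i: "1 \<le> i" "i \<le> length ks"
  shows "col_of Q i = tr ks ! (i - 1)"
proof -
  let ?k = "ks ! (i - 1)"
  have "?k \<in> set ks" using i by (intro nth_mem) linarith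
  then have k: "Q ! ?k = pos ks ?k" using Q by (auto simp: isQ_def)
  have t: "tr ks ! (i - 1) = count_list (take (i - 1) ks) ?k" using i by (intro nth_tr) linarith
  show ?thesis
    unfolding col_of_def isQ_row_of[OF Q i] k t
  proof (rule the_equality)
    show "count_list (take (i - 1) ks) ?k < length (pos ks ?k) \<and> pos ks ?k ! count_list (take (i - 1) ks) ?k = i"
      by (rule pos_nth_conv[OF i])
    fix j assume "j < length (pos ks ?k) \<and> pos ks ?k ! j = i"
    then show "j = count_list (take (i - 1) ks) ?k" using pos_nth[of j ks ?k] by auto
  qed
qed

text \<open>Row lengths decrease weakly, so \<open>List.transpose\<close> really collects columns.
  An entry lies in column \<open>c\<close> exactly if its letter in \<open>tr ks\<close> is
  \<open>c\<close>.\<close>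

lemma isQ_tabT:
  assumes Q: "isQ ks Q" and ks: "LW ks"
  shows "isQ (tr ks) (tabT Q)"
proof -
  have len: "length (Q ! k) = count_list ks k" if "k < length Q" for k
    using Q that count_pos by (auto simp: isQ_def)
  have sorted: "sorted (rev (map length Q))"
    unfolding sorted_rev_iff_nth_mono using len LW_count_le[OF ks] by auto
  have lt: "length (tabT Q) = (if Q = [] then 0 else length (Q ! 0))"
    unfolding tabT_def by (rule length_transpose_sorted[OF sorted])
  have setQ: "ks = [] \<longleftrightarrow> Q = []"
  proof
    assume "ks = []" then have "pos ks 0 = []" by (simp add: pos_empty_iff)
    then show "Q = []" using Q by (cases Q) (auto simp: isQ_def)
  next
    assume "Q = []" then show "ks = []" using Q by (simp add: isQ_def)
  qed
  have cnt0: "length (tabT Q) = count_list ks 0"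
    using lt len[of 0] setQ by auto
  have dm: "cols (Q ! k) (Q ! Suc k)" if "Suc k < length Q" for k
  proof (rule dom_cols)
    have e: "Q ! k = pos ks k" "Q ! Suc k = pos ks (Suc k)" using Q that by (auto simp: isQ_def)
    show "sorted_wrt (<) (Q ! k)" "sorted_wrt (<) (Q ! Suc k)" "set (Q ! k) \<inter> set (Q ! Suc k) = {}"
      unfolding e using sorted_pos by (auto simp: set_pos)
    show "dom (Q ! k) (Q ! Suc k)"
      unfolding dom_def e
    proof
      fix t
      have "nle (pos ks j) t = count_list (take (min t (length ks)) ks) j" for j
      proof -
        have "nle (pos ks j) t = nle (pos ks j) (min t (length ks))" by (rule nle_cong) (auto simp: set_pos)
        then show ?thesis by (simp add: nle_pos)
      qed
      then show "nle (pos ks (Suc k)) t \<le> nle (pos ks k) t" using ks by (simp only: LW_def)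
    qed
  qed
  have col: "tabT Q ! c = pos (tr ks) c \<and> tabT Q ! c \<noteq> []" if c: "c < length (tabT Q)" for c
  proof -
    let ?F = "filter (\<lambda>row. c < length row) Q"
    have tc: "tabT Q ! c = map (\<lambda>row. row ! c) ?F"
      using c unfolding tabT_def by (rule nth_transpose)
    \<comment> \<open>The rows that reach column \<open>c\<close> form an initial segment of length
      \<open>m\<close>, so filtering them amounts to taking a prefix.\<close>
    define m where "m = length (takeWhile (\<lambda>row. c < length row) Q)"
    have F: "?F = take m Q"
      unfolding m_def using filter_equals_takeWhile_sorted_rev[OF sorted, of c] takeWhile_eq_take by metis
    have mQ: "m \<le> length Q" by (simp add: m_def length_takeWhile_le)
    have mc: "c < length (Q ! k)" if "k < m" for k
    proof -
      have "Q ! k \<in> set ?F" unfolding F using that mQ by (auto simp: in_set_conv_nth)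
      then show ?thesis by simp
    qed
    have step: "Q ! k ! c < Q ! Suc k ! c" if "Suc k < m" for k
      using dm[of k] mc[OF that] that mQ by (simp add: cols_def)
    have "sorted_wrt (<) (tabT Q ! c)"
    proof (rule sorted_wrt_iff_nth_Suc_transp[THEN iffD2])
      show "transp ((<) :: nat \<Rightarrow> nat \<Rightarrow> bool)" by (rule transp_on_less)
      show "\<forall>i. Suc i < length (tabT Q ! c) \<longrightarrow> tabT Q ! c ! i < tabT Q ! c ! Suc i"
        unfolding tc F using step mQ by simp
    qed
    moreover have "set (tabT Q ! c) = set (pos (tr ks) c)"
    proof (intro set_eqI iffI)
      fix i assume "i \<in> set (tabT Q ! c)"
      then obtain k where k: "k < length Q" "c < length (Q ! k)" "i = Q ! k ! c"
        unfolding tc by (auto simp: in_set_conv_nth)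
      have e: "Q ! k = pos ks k" using Q k by (simp add: isQ_def)
      have "1 \<le> i \<and> i \<le> length ks \<and> ks ! (i - 1) = k \<and> count_list (take (i - 1) ks) k = c"
        using pos_nth[of c ks k] k unfolding e by simp
      moreover from this have "tr ks ! (i - 1) = c" by (subst nth_tr) auto
      ultimately show "i \<in> set (pos (tr ks) c)" by (simp add: set_pos)
    next
      fix i assume "i \<in> set (pos (tr ks) c)"
      then have i: "1 \<le> i" "i \<le> length ks" "tr ks ! (i - 1) = c" by (auto simp: set_pos)
      let ?k = "ks ! (i - 1)"
      have "?k \<in> set ks" using i by (intro nth_mem) linarith
      then have k: "?k < length Q" "Q ! ?k = pos ks ?k" using Q by (auto simp: isQ_def)
      have t: "tr ks ! (i - 1) = count_list (take (i - 1) ks) ?k" using i by (intro nth_tr) linarith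
      have "c < length (Q ! ?k) \<and> Q ! ?k ! c = i" using pos_nth_conv[OF i(1,2)] i(3) t k by simp
      then show "i \<in> set (tabT Q ! c)" unfolding tc using nth_mem[OF k(1)]
        by (auto intro: image_eqI[of _ _ "Q ! ?k"])
    qed
    moreover have "tabT Q ! c \<noteq> []"
    proof -
      have Q0: "0 < length Q" using c lt by (cases Q) auto
      moreover have "c < length (Q ! 0)" using c lt by (auto split: if_splits)
      ultimately have "Q ! 0 \<in> set ?F" by simp
      then show ?thesis unfolding tc by (metis empty_iff list.set(1) map_is_Nil_conv)
    qed
    ultimately show ?thesis using strict_sorted_equal[OF _ sorted_pos] by metis
  qed
  moreover have "set (tr ks) \<subseteq> {..<length (tabT Q)}"
  proof
    fix c assume "c \<in> set (tr ks)"
    then have "count_list (tr ks) c \<noteq> 0" by (metis count_list_0_iff)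
    then have "{k. c < count_list ks k} \<noteq> {}" by (metis card.empty count_list_tr)
    then obtain k where "c < count_list ks k" by blast
    then show "c \<in> {..<length (tabT Q)}" using LW_count_le[OF ks, of 0 k] by (simp add: cnt0)
  qed
  ultimately show ?thesis unfolding isQ_def by blast
qed

section \<open>Right cells and tableaux\<close>

text \<open>Elements in one left cell have equal right descent sets, and right star operations
  preserve left cells; the separation property of lattice words does the rest.\<close>
lemma ceq_kw_inv:
  assumes "ceq r x w" shows "kw r (inv x) = kw r (inv w)"
proof -
  define R where "R a c \<longleftrightarrow> (\<exists>x w. ceq r (inv x) (inv w) \<and> x \<in> Sr r \<and> w \<in> Sr r \<and> a = kw r x \<and> c = kw r w)" for a c
  have "wbisim r R"
    unfolding wbisim_def
  proof (intro allI impI)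
    fix a c assume "R a c"
    then obtain x w where xw: "ceq r (inv x) (inv w)" "x \<in> Sr r" "w \<in> Sr r" "a = kw r x" "c = kw r w"
      by (auto simp: R_def)
    have d: "rdesc x i = rdesc w i" if "1 \<le> i" "i < r" for i
      using ceq_left_descents[OF xw(1) that] by (simp add: Sr_inv_inv[OF xw(2)] Sr_inv_inv[OF xw(3)])
    have "wd a i = wd c i" if "Suc i < r" for i
      using wd_kw[OF xw(2) that] wd_kw[OF xw(3) that] d[of "Suc i"] that xw by simp
    moreover have "R (wstar i a) (wstar i c)" if i: "Suc (Suc i) < r" "wD i a" for i
    proof -
      have k: "1 \<le> Suc i" "Suc (Suc i) < r" using i by auto
      have Dx: "kD (Suc i) x" using wD_kw[OF xw(2) k] i xw by simp
      then have Dw: "kD (Suc i) w" using d[of "Suc i"] d[of "Suc (Suc i)"] i by (simp add: kD_def)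
      have "ceq r (lstar (Suc i) (inv x)) (lstar (Suc i) (inv w))"
        by (rule ceq_lstar[OF xw(1) k]) (simp add: Sr_inv_inv[OF xw(3)] Dw)
      then have "ceq r (inv (kstar (Suc i) x)) (inv (kstar (Suc i) w))"
        by (simp add: lstar_def Sr_inv_inv[OF xw(2)] Sr_inv_inv[OF xw(3)])
      then show ?thesis
        unfolding R_def
        using rsk_kstar(2)[OF xw(2) k Dx] rsk_kstar(2)[OF xw(3) k Dw] kstar_Sr[OF xw(2) k] kstar_Sr[OF xw(3) k] xw
        by (intro exI[of _ "kstar (Suc i) x"] exI[of _ "kstar (Suc i) w"]) simp
    qed
    ultimately show "LW a \<and> LW c \<and> length a = r \<and> length c = r \<and> (\<forall>i. Suc i < r \<longrightarrow> wd a i = wd c i) \<and>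
       (\<forall>i. Suc (Suc i) < r \<longrightarrow> wD i a \<longrightarrow> R (wstar i a) (wstar i c))"
      using xw LW_kw by simp
  qed
  moreover have S: "x \<in> Sr r" "w \<in> Sr r" using assms by (auto simp: ceq_def)
  have "R (kw r (inv x)) (kw r (inv w))"
    unfolding R_def using assms S by (intro exI[of _ "inv x"] exI[of _ "inv w"]) (simp add: Sr_inv_inv Sr_inv)
  ultimately show ?thesis by (rule wbisim_eq)
qed

text \<open>The longest element complements all descents, so the image of the star is again an
  adjacent exchange that changes both descents.\<close>

lemma kstar_w0:
  assumes w: "w \<in> Sr r" and k: "1 \<le> k" "Suc k < r" and D: "kD k w"
  shows "kstar k (w0 r \<circ> w) = w0 r \<circ> kstar k w" "kD k (w0 r \<circ> w)"
proof -
  have ww: "w0 r \<circ> w \<in> Sr r" using w by simp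
  have v: "kstar k w \<in> Sr r" by (rule kstar_Sr[OF w k])
  have kk: "1 \<le> k" "k < r" "1 \<le> Suc k" using k by auto
  have neg: "rdesc (w0 r \<circ> u) i \<longleftrightarrow> \<not> rdesc u i" if "u \<in> Sr r" "i = k \<or> i = Suc k" for u i
    using w0_comp_less_iff[OF that(1), of i] Sr_inj[OF that(1), of i "Suc i"] that(2) k by auto
  show D': "kD k (w0 r \<circ> w)" using D neg[OF w] unfolding kD_def by blast
  note p = kstar_props[OF w D]
  have "w0 r \<circ> kstar k w = kstar k (w0 r \<circ> w)"
  proof (rule kstar_props(5)[OF ww D'])
    show "w0 r \<circ> kstar k w = w0 r \<circ> w \<circ> sref k \<or> w0 r \<circ> kstar k w = w0 r \<circ> w \<circ> sref (Suc k)"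
      using kstar_cases[of k w] by (metis comp_assoc)
    show "rdesc (w0 r \<circ> kstar k w) k \<noteq> rdesc (w0 r \<circ> w) k"
      "rdesc (w0 r \<circ> kstar k w) (Suc k) \<noteq> rdesc (w0 r \<circ> w) (Suc k)"
      unfolding neg[OF v disjI1[OF refl]] neg[OF v disjI2[OF refl]] neg[OF w disjI1[OF refl]] neg[OF w disjI2[OF refl]] p(1,2)
      using D by (auto simp: kD_def)
  qed
  then show "kstar k (w0 r \<circ> w) = w0 r \<circ> kstar k w" by simp
qed

text \<open>Each move on recording words lifts to a star operation on permutations. The insertion
  tableau of \<open>w0 r \<circ> z\<close> is tracked as well, because \<open>mu_low\<close> is
  evaluated on permutations multiplied by the longest element.\<close>

lemma realize_path:
  assumes "(a, c) \<in> wrel\<^sup>*" "x \<in> Sr r" "a = kw r x"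
  shows "\<exists>z\<in>Sr r. Ptab r z = Ptab r x \<and> kw r z = c \<and> ceq r z x \<and> Ptab r (w0 r \<circ> z) = Ptab r (w0 r \<circ> x)"
  using assms(1)
proof (induction rule: rtrancl_induct)
  case base
  then show ?case using assms by (intro bexI[of _ x]) (auto simp: ceq_def)
next
  case (step b c)
  then obtain z where z: "z \<in> Sr r" "Ptab r z = Ptab r x" "kw r z = b" "ceq r z x"
    "Ptab r (w0 r \<circ> z) = Ptab r (w0 r \<circ> x)" by blast
  obtain i where i: "c = wstar i b" "Suc (Suc i) < length b" "wD i b" using step(2) by (auto simp: wrel_def)
  have k: "1 \<le> Suc i" "Suc (Suc i) < r" using i z by auto
  have D: "kD (Suc i) z" using wD_kw[OF z(1) k] i z by simp
  note K = rsk_kstar[OF z(1) k D]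
  have "Ptab r (w0 r \<circ> kstar (Suc i) z) = Ptab r (w0 r \<circ> z)"
    using rsk_kstar(1)[OF _ k kstar_w0(2)[OF z(1) k D]] z(1) kstar_w0(1)[OF z(1) k D] by simp
  then have "Ptab r (w0 r \<circ> kstar (Suc i) z) = Ptab r (w0 r \<circ> x)" using z(5) by (rule trans)
  moreover have "kw r (kstar (Suc i) z) = c" using K(2) z(3) i(1) by simp
  moreover have "Ptab r (kstar (Suc i) z) = Ptab r x" using K(1) z(2) by simp
  ultimately show ?case
    using kstar_Sr[OF z(1) k] ceq_trans[OF ceq_kstar[OF z(1) k D] z(4)] by blast
qed

lemma realize_count:
  assumes "x \<in> Sr r" "LW c" "count_list c = count_list (kw r x)"
  shows "\<exists>z\<in>Sr r. Ptab r z = Ptab r x \<and> kw r z = c \<and> ceq r z x \<and> Ptab r (w0 r \<circ> z) = Ptab r (w0 r \<circ> x)"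
  by (rule realize_path[OF wconn]) (use assms LW_kw in auto)

text \<open>The lifted path ends at an element with the insertion tableau and the recording word of
  \<open>y\<close>, which is \<open>y\<close> by injectivity of RSK.\<close>

lemma Ptab_eq_path:
  assumes x: "x \<in> Sr r" and y: "y \<in> Sr r" and P: "Ptab r x = Ptab r y"
  shows "ceq r y x \<and> Ptab r (w0 r \<circ> y) = Ptab r (w0 r \<circ> x)"
proof -
  have "count_list (kw r y) = count_list (kw r x)" using vt_Ptab[OF x] vt_Ptab[OF y] P by metis
  then obtain z where z: "z \<in> Sr r" "Ptab r z = Ptab r x" "kw r z = kw r y" "ceq r z x"
    "Ptab r (w0 r \<circ> z) = Ptab r (w0 r \<circ> x)"
    using realize_count[OF x LW_kw[OF y]] by blast
  then have "z = y" using rsk_inj[OF z(1) y] P by simp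
  then show ?thesis using z by simp
qed

lemma isQ_vt:
  assumes w: "w \<in> Sr r"
  shows "isQ (rw r (Ptab r w)) (Ptab r w)" "LW (rw r (Ptab r w))"
    "count_list (rw r (Ptab r w)) = count_list (kw r w)"
proof -
  note v = vt_Ptab[OF w]
  show Q: "isQ (rw r (Ptab r w)) (Ptab r w)"
    by (rule isQ_rw) (use v vt_distinct vt_nth in auto)
  show "LW (rw r (Ptab r w))" by (rule LW_isQ[OF Q]) (use v vt_dom in auto)
  have "rl (Ptab r w) = count_list (rw r (Ptab r w))"
  proof
    fix k
    show "rl (Ptab r w) k = count_list (rw r (Ptab r w)) k"
    proof (cases "k < length (Ptab r w)")
      case True
      then show ?thesis using Q count_pos by (auto simp: isQ_def rl_def)
    next
      case False
      then have "k \<notin> set (rw r (Ptab r w))" using Q by (auto simp: isQ_def)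
      then show ?thesis using False by (simp add: rl_def)
    qed
  qed
  then show "count_list (rw r (Ptab r w)) = count_list (kw r w)" using v by simp
qed

lemma rw_inj_Ptab:
  assumes "x \<in> Sr r" "y \<in> Sr r" "rw r (Ptab r x) = rw r (Ptab r y)" shows "Ptab r x = Ptab r y"
  using isQ_vt(1)[OF assms(1)] isQ_vt(1)[OF assms(2)] assms(3) isQ_unique by metis

lemma Ptab_eq_imp_kw_inv: "x \<in> Sr r \<Longrightarrow> y \<in> Sr r \<Longrightarrow> Ptab r x = Ptab r y \<Longrightarrow> kw r (inv x) = kw r (inv y)"
  using Ptab_eq_path[of x r y] ceq_kw_inv[of r y x] by simp

text \<open>The map from insertion tableaux to recording words of the inverse is onto, hence one-to-one
  because there are at most as many insertion tableaux as recording words.\<close>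
lemma kw_inv_imp_Ptab_eq:
  assumes "x \<in> Sr r" "y \<in> Sr r" "kw r (inv x) = kw r (inv y)"
  shows "Ptab r x = Ptab r y"
proof -
  define \<phi> where "\<phi> T = kw r (inv (SOME x. x \<in> Sr r \<and> Ptab r x = T))" for T
  have \<phi>: "\<phi> (Ptab r x) = kw r (inv x)" if "x \<in> Sr r" for x
  proof -
    have "\<exists>z. z \<in> Sr r \<and> Ptab r z = Ptab r x" using that by blast
    from someI_ex[OF this] show ?thesis unfolding \<phi>_def using Ptab_eq_imp_kw_inv that by blast
  qed
  have im: "\<phi> ` Ptab r ` Sr r = kw r ` Sr r"
  proof (intro set_eqI iffI)
    fix c assume "c \<in> \<phi> ` Ptab r ` Sr r"
    then show "c \<in> kw r ` Sr r" using \<phi> Sr_inv by auto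
  next
    fix c assume "c \<in> kw r ` Sr r"
    then obtain z where z: "z \<in> Sr r" "c = kw r z" by auto
    then have "c = \<phi> (Ptab r (inv z))" using \<phi>[OF Sr_inv[OF z(1)]] Sr_inv_inv[OF z(1)] by simp
    then show "c \<in> \<phi> ` Ptab r ` Sr r" using Sr_inv[OF z(1)] by blast
  qed
  have "card (Ptab r ` Sr r) \<le> card (kw r ` Sr r)"
  proof (rule card_inj_on_le[of "rw r"])
    show "inj_on (rw r) (Ptab r ` Sr r)" using rw_inj_Ptab by (auto simp: inj_on_def)
    show "rw r ` Ptab r ` Sr r \<subseteq> kw r ` Sr r"
    proof clarify
      fix w assume w: "w \<in> Sr r"
      then show "rw r (Ptab r w) \<in> kw r ` Sr r"
        using realize_count[OF w isQ_vt(2,3)[OF w]] by (metis imageI)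
    qed
  qed simp
  then have "card (\<phi> ` Ptab r ` Sr r) = card (Ptab r ` Sr r)"
    unfolding im[symmetric] by (intro antisym card_image_le) auto
  then have "inj_on \<phi> (Ptab r ` Sr r)" by (intro eq_card_imp_inj_on) auto
  moreover have "\<phi> (Ptab r x) = \<phi> (Ptab r y)" using \<phi> assms by simp
  ultimately show ?thesis using assms by (auto dest: inj_onD)
qed

lemma ceq_iff_Ptab: "x \<in> Sr r \<Longrightarrow> w \<in> Sr r \<Longrightarrow> ceq r x w \<longleftrightarrow> Ptab r x = Ptab r w"
  using kw_inv_imp_Ptab_eq[of x r w] ceq_kw_inv[of r x w] Ptab_eq_path[of w r x] by metis

lemma kw_lstar:
  assumes w: "w \<in> Sr r" and k: "1 \<le> k" "Suc k < r" and D: "kD k (inv w)"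
  shows "kw r (lstar k w) = kw r w"
  using ceq_kw_inv[OF ceq_kstar[OF Sr_inv[OF w] k D]] Sr_inv_inv[OF w] by (simp add: lstar_def)

text \<open>Complementing the values of a permutation transposes its recording tableau. Both words
  have the same descents and follow star moves in parallel, so the separation principle identifies
  them.\<close>

lemma kw_w0:
  assumes "x \<in> Sr r" shows "tr (kw r (w0 r \<circ> x)) = kw r x"
proof -
  define R where "R a c \<longleftrightarrow> (\<exists>x\<in>Sr r. a = kw r x \<and> c = tr (kw r (w0 r \<circ> x)))" for a c
  have "wbisim r R"
    unfolding wbisim_def
  proof (intro allI impI)
    fix a c assume "R a c"
    then obtain x where x: "x \<in> Sr r" "a = kw r x" "c = tr (kw r (w0 r \<circ> x))" by (auto simp: R_def)
    have wx: "w0 r \<circ> x \<in> Sr r" using x by simp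
    have "wd a i = wd c i" if i: "Suc i < r" for i
    proof -
      have "wd c i \<longleftrightarrow> \<not> rdesc (w0 r \<circ> x) (Suc i)"
        unfolding x(3) using wd_tr[OF LW_kw[OF wx], of i] wd_kw[OF wx i] i by simp
      also have "\<dots> \<longleftrightarrow> rdesc x (Suc i)"
        using w0_comp_less_iff[OF x(1), of "Suc i"] Sr_inj[OF x(1), of "Suc i" "Suc (Suc i)"] i by auto
      finally show ?thesis using wd_kw[OF x(1) i] x by simp
    qed
    moreover have "R (wstar i a) (wstar i c)" if i: "Suc (Suc i) < r" "wD i a" for i
    proof -
      have k: "1 \<le> Suc i" "Suc (Suc i) < r" using i by auto
      have D: "kD (Suc i) x" using wD_kw[OF x(1) k] i x by simp
      note k0 = kstar_w0[OF x(1) k D]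
      have e: "kw r (w0 r \<circ> kstar (Suc i) x) = wstar i (kw r (w0 r \<circ> x))"
        using rsk_kstar(2)[OF wx k k0(2)] by (simp add: k0(1))
      have S: "w0 r \<circ> kstar (Suc i) x \<in> Sr r" using kstar_Sr[OF x(1) k] by simp
      have "tr (wstar i (kw r (w0 r \<circ> x))) = wstar i (tr (kw r (w0 r \<circ> x)))"
      proof (rule tr_wstar)
        show "LW (kw r (w0 r \<circ> x))" by (rule LW_kw[OF wx])
        show "LW (wstar i (kw r (w0 r \<circ> x)))" using LW_kw[OF S] e by simp
        show "Suc (Suc i) < length (kw r (w0 r \<circ> x))" using i by simp
        show "wD i (kw r (w0 r \<circ> x))" using wD_kw[OF wx k] k0(2) by simp
      qed
      then show ?thesis
        unfolding R_def using rsk_kstar(2)[OF x(1) k D] kstar_Sr[OF x(1) k] x e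
        by (intro bexI[of _ "kstar (Suc i) x"]) simp_all
    qed
    ultimately show "LW a \<and> LW c \<and> length a = r \<and> length c = r \<and> (\<forall>i. Suc i < r \<longrightarrow> wd a i = wd c i) \<and>
       (\<forall>i. Suc (Suc i) < r \<longrightarrow> wD i a \<longrightarrow> R (wstar i a) (wstar i c))"
      using x LW_kw LW_tr by simp
  qed
  moreover have "R (kw r x) (tr (kw r (w0 r \<circ> x)))" using assms by (auto simp: R_def)
  ultimately show ?thesis using wbisim_eq by metis
qed

lemma rdesc_kw_cong:
  assumes "x \<in> Sr r" "y \<in> Sr r" "kw r x = kw r y" "1 \<le> i" "i < r"
  shows "rdesc x i = rdesc y i"
  using wd_kw[OF assms(1), of "i - 1"] wd_kw[OF assms(2), of "i - 1"] assms by simp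

text \<open>Left star operations keep both recording words and, by \<open>mu_lstar\<close>, the
  value of mu, while they move the common insertion tableau. Connectedness, applied to the recording
  words of the inverses, brings the first pair onto the second.\<close>

lemma mu_cell_indep_aux:
  assumes S: "x \<in> Sr r" "y \<in> Sr r" "x' \<in> Sr r" "y' \<in> Sr r"
    and P: "Ptab r x = Ptab r y" "Ptab r x' = Ptab r y'"
    and Q: "kw r x = kw r x'" "kw r y = kw r y'"
    and i: "1 \<le> i" "i < r" "rdesc x i" "\<not> rdesc y i"
  shows "mu r x y = mu r x' y'"
proof -
  have "Ptab r (inv x) = Ptab r (inv x')"
    using kw_inv_imp_Ptab_eq[OF Sr_inv[OF S(1)] Sr_inv[OF S(3)]] Q(1) by (simp add: Sr_inv_inv[OF S(1)] Sr_inv_inv[OF S(3)])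
  then have "count_list (kw r (inv x)) = count_list (kw r (inv x'))"
    using vt_Ptab[OF Sr_inv[OF S(1)]] vt_Ptab[OF Sr_inv[OF S(3)]] by metis
  then have "(kw r (inv x), kw r (inv x')) \<in> wrel\<^sup>*"
    by (intro wconn LW_kw Sr_inv S)
  then have "\<exists>z\<in>Sr r. \<exists>v\<in>Sr r. kw r (inv z) = kw r (inv x') \<and> kw r z = kw r x \<and> kw r v = kw r y \<and>
      Ptab r z = Ptab r v \<and> mu r z v = mu r x y"
  proof (induction rule: rtrancl_induct)
    case base then show ?case using S P by blast
  next
    case (step b c)
    then obtain z v where z: "z \<in> Sr r" "v \<in> Sr r" "kw r (inv z) = b" "kw r z = kw r x" "kw r v = kw r y"
      "Ptab r z = Ptab r v" "mu r z v = mu r x y" by blast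
    obtain j where j: "c = wstar j b" "Suc (Suc j) < length b" "wD j b" using step(2) by (auto simp: wrel_def)
    have k: "1 \<le> Suc j" "Suc (Suc j) < r" using j z(3) by auto
    note iz = Sr_inv[OF z(1)] and iv = Sr_inv[OF z(2)]
    have kzv: "kw r (inv z) = kw r (inv v)" using Ptab_eq_imp_kw_inv[OF z(1,2,6)] .
    have Dz: "kD (Suc j) (inv z)" using wD_kw[OF iz k] j z by simp
    have Dv: "kD (Suc j) (inv v)" using wD_kw[OF iv k] wD_kw[OF iz k] kzv Dz by simp
    have same: "rdesc (inv z) (Suc j) = rdesc (inv v) (Suc j)" using rdesc_kw_cong[OF iz iv kzv] k by simp
    have di: "rdesc z i" "\<not> rdesc v i"
      using rdesc_kw_cong[OF z(1) S(1) z(4) i(1,2)] rdesc_kw_cong[OF z(2) S(2) z(5) i(1,2)] i by auto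
    let ?z = "lstar (Suc j) z" and ?v = "lstar (Suc j) v"
    have m: "mu r ?z ?v = mu r x y" using mu_lstar[OF z(1,2) k Dv Dz same i(1,2) di] z(7) by simp
    have kz: "kw r (inv ?z) = c" using rsk_kstar(2)[OF iz k Dz] inv_lstar[OF z(1) k] z j by simp
    moreover have kv: "kw r (inv ?v) = c" using rsk_kstar(2)[OF iv k Dv] inv_lstar[OF z(2) k] kzv z j by simp
    ultimately have "Ptab r ?z = Ptab r ?v"
      using kw_inv_imp_Ptab_eq[OF lstar_Sr[OF z(1) k] lstar_Sr[OF z(2) k]] by simp
    then show ?case
      using kz m kw_lstar[OF z(1) k Dz] kw_lstar[OF z(2) k Dv] z lstar_Sr[OF z(1) k] lstar_Sr[OF z(2) k]
      by (intro bexI[of _ ?z] bexI[of _ ?v]) auto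
  qed
  then obtain z v where z: "z \<in> Sr r" "v \<in> Sr r" "kw r (inv z) = kw r (inv x')" "kw r z = kw r x"
    "kw r v = kw r y" "Ptab r z = Ptab r v" "mu r z v = mu r x y" by blast
  have Pz: "Ptab r z = Ptab r x'" by (rule kw_inv_imp_Ptab_eq[OF z(1) S(3) z(3)])
  have "z = x'" by (rule rsk_inj[OF z(1) S(3) Pz]) (use z Q in simp)
  moreover have "v = y'" by (rule rsk_inj[OF z(2) S(4)]) (use z Q P Pz in simp_all)
  ultimately show ?thesis using z by simp
qed

lemma mu_cell_indep:
  assumes S: "x \<in> Sr r" "y \<in> Sr r" "x' \<in> Sr r" "y' \<in> Sr r"
    and P: "Ptab r x = Ptab r y" "Ptab r x' = Ptab r y'"
    and Q: "kw r x = kw r x'" "kw r y = kw r y'"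
    and i: "1 \<le> i" "i < r" "rdesc x i \<noteq> rdesc y i"
  shows "mu r x y = mu r x' y'"
proof (cases "rdesc x i")
  case True
  then show ?thesis using mu_cell_indep_aux[OF assms(1-10)] i by blast
next
  case False
  then have "mu r y x = mu r y' x'"
    using mu_cell_indep_aux[OF S(2,1,4,3) P[symmetric] Q(2,1) i(1,2)] i by blast
  then show ?thesis using mu_sym by metis
qed

lemma isQ_SYT:
  assumes lam: "is_partition lam" and ks: "LW ks" "length ks = sum_list lam"
    and cnt: "count_list ks = (\<lambda>k. if k < length lam then lam ! k else 0)" and Q: "isQ ks Q"
  shows "Q \<in> SYT lam"
proof -
  have pos: "0 < lam ! k" if "k < length lam" for k using lam that by (auto simp: is_partition_def)
  have rows: "Q ! k = pos ks k" if "k < length Q" for k using Q that by (simp add: isQ_def)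
  have iff: "k \<in> set ks \<longleftrightarrow> k < length Q" for k
    using Q pos_empty_iff[of ks k] rows[of k] by (auto simp: isQ_def)
  have "k \<in> set ks \<longleftrightarrow> k < length lam" for k
    using count_list_0_iff[of ks k] cnt pos[of k] by (auto split: if_splits)
  then have "k < length Q \<longleftrightarrow> k < length lam" for k using iff by simp
  then have lQ: "length Q = length lam" by (metis linorder_neqE_nat less_irrefl)
  have ml: "map length Q = lam"
    by (rule nth_equalityI) (use lQ rows count_pos[of ks] cnt in auto)
  have dj: "set (Q ! a) \<inter> set (Q ! b) = {}" if "a < length Q" "b < length Q" "a \<noteq> b" for a b
    using that rows by (auto simp: set_pos)
  have ne: "Q ! a \<noteq> []" if "a < length Q" for a using Q that unfolding isQ_def by blast
  have srt: "sorted_wrt (<) row" if "row \<in> set Q" for row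
    using that rows sorted_pos by (auto simp: in_set_conv_nth)
  have "distinct (concat Q)"
  proof (rule distinct_concat)
    show "distinct Q"
      unfolding distinct_conv_nth
    proof (intro allI impI)
      fix i j assume ij: "i < length Q" "j < length Q" "i \<noteq> j"
      then show "Q ! i \<noteq> Q ! j" using dj[OF ij] ne[OF ij(1)] by auto
    qed
    show "\<And>ys. ys \<in> set Q \<Longrightarrow> distinct ys" using srt strict_sorted_iff by blast
    fix ys zs assume "ys \<in> set Q" "zs \<in> set Q" "ys \<noteq> zs"
    then show "set ys \<inter> set zs = {}" using dj by (metis in_set_conv_nth)
  qed
  moreover have "set (concat Q) = set [1..<sum_list lam + 1]"
  proof (intro set_eqI iffI)
    fix i assume "i \<in> set (concat Q)"
    then obtain row where "row \<in> set Q" "i \<in> set row" by auto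
    then obtain k where "k < length Q" "i \<in> set (Q ! k)" by (metis in_set_conv_nth)
    then show "i \<in> set [1..<sum_list lam + 1]" using rows ks(2) by (auto simp: set_pos)
  next
    fix i assume i: "i \<in> set [1..<sum_list lam + 1]"
    then have "i - 1 < length ks" using ks by (auto simp del: upt_Suc)
    then have k: "ks ! (i - 1) < length Q" using iff nth_mem by blast
    moreover have "i \<in> set (Q ! (ks ! (i - 1)))" using rows[OF k] i ks(2) by (auto simp: set_pos)
    ultimately show "i \<in> set (concat Q)" using nth_mem[OF k] by auto
  qed
  ultimately have ms: "mset (concat Q) = mset [1..<sum_list lam + 1]"
    using set_eq_iff_mset_eq_distinct[of "concat Q" "[1..<sum_list lam + 1]"] by simp
  have "Q ! i ! j < Q ! Suc i ! j" if ij: "Suc i < length Q" "j < length (Q ! Suc i)" for i j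
  proof -
    have e: "Q ! i = pos ks i" "Q ! Suc i = pos ks (Suc i)" using rows ij by auto
    have "cols (Q ! i) (Q ! Suc i)"
      unfolding e
    proof (rule dom_cols[OF sorted_pos sorted_pos])
      show "dom (pos ks i) (pos ks (Suc i))"
        unfolding dom_def
      proof
        fix t
        have "nle (pos ks j) t = count_list (take (min t (length ks)) ks) j" for j
        proof -
          have "nle (pos ks j) t = nle (pos ks j) (min t (length ks))" by (rule nle_cong) (auto simp: set_pos)
          then show ?thesis by (simp add: nle_pos)
        qed
        then show "nle (pos ks (Suc i)) t \<le> nle (pos ks i) t" using ks(1) by (simp only: LW_def)
      qed
    qed (auto simp: set_pos)
    then show ?thesis using ij by (simp add: cols_def)
  qed
  then show ?thesis using ml ms srt by (simp add: SYT_def)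
qed

section \<open>The two realizations in terms of one right cell\<close>

text \<open>\<open>v\<close> parametrizes one right cell by the standard tableaux of the shape: the
  insertion tableau is fixed and \<open>Q\<close> is the recording tableau of
  \<open>v Q\<close>.\<close>

definition cellmap :: "nat list \<Rightarrow> (tableau \<Rightarrow> nat \<Rightarrow> nat) \<Rightarrow> bool" where
  "cellmap lam v \<longleftrightarrow> (\<forall>Q\<in>SYT lam. v Q \<in> Sr (sum_list lam) \<and> kw (sum_list lam) (v Q) = rw (sum_list lam) Q) \<and>
     (\<forall>Q\<in>SYT lam. \<forall>Q'\<in>SYT lam. Ptab (sum_list lam) (v Q) = Ptab (sum_list lam) (v Q'))"

lemma cellmap_ex:
  assumes lam: "is_partition lam" shows "\<exists>v. cellmap lam v"
proof (cases "SYT lam = {}")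
  case True then show ?thesis by (simp add: cellmap_def)
next
  case False
  let ?r = "sum_list lam"
  obtain T where T: "T \<in> SYT lam" using False by blast
  obtain x where x: "x \<in> Sr ?r" "Ptab ?r x = T" using SYT_reading[OF lam T] by blast
  have "\<exists>z. z \<in> Sr ?r \<and> Ptab ?r z = T \<and> kw ?r z = rw ?r Q" if Q: "Q \<in> SYT lam" for Q
  proof -
    have "count_list (rw ?r Q) = count_list (kw ?r x)"
      using SYT_isQ(3)[OF lam Q] SYT_isQ(3)[OF lam T] isQ_vt(3)[OF x(1)] x(2) by simp
    then show ?thesis using realize_count[OF x(1) SYT_isQ(2)[OF lam Q]] x(2) by auto
  qed
  then obtain v where "\<And>Q. Q \<in> SYT lam \<Longrightarrow> v Q \<in> Sr ?r \<and> Ptab ?r (v Q) = T \<and> kw ?r (v Q) = rw ?r Q" by metis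
  then show ?thesis by (intro exI[of _ v]) (simp add: cellmap_def)
qed

lemma Qtab_eq_iff:
  assumes "is_partition lam" "Q \<in> SYT lam" "w \<in> Sr (sum_list lam)"
  shows "Qtab (sum_list lam) w = Q \<longleftrightarrow> kw (sum_list lam) w = rw (sum_list lam) Q"
  using isQ_Qtab[OF assms(3)] SYT_isQ(1)[OF assms(1,2)] isQ_unique isQ_inj
  by (metis length_kw length_rw)

lemma tabT_Qtab_eq_iff:
  assumes lam: "is_partition lam" and Q: "Q \<in> SYT lam" and w: "w \<in> Sr (sum_list lam)"
  shows "tabT (Qtab (sum_list lam) w) = Q \<longleftrightarrow> kw (sum_list lam) (w0 (sum_list lam) \<circ> w) = rw (sum_list lam) Q"
proof -
  let ?r = "sum_list lam"
  have "w0 ?r \<circ> w \<in> Sr ?r" using w by simp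
  from kw_w0[OF this] have t: "tr (kw ?r w) = kw ?r (w0 ?r \<circ> w)" by simp
  have "isQ (tr (kw ?r w)) (tabT (Qtab ?r w))" by (rule isQ_tabT[OF isQ_Qtab[OF w] LW_kw[OF w]])
  then show ?thesis unfolding t
    using SYT_isQ(1)[OF lam Q] isQ_unique isQ_inj by (metis length_kw length_rw)
qed

lemma tabT_Ptab_inj:
  assumes x: "x \<in> Sr r" and y: "y \<in> Sr r" and e: "tabT (Ptab r x) = tabT (Ptab r y)"
  shows "Ptab r x = Ptab r y"
proof -
  have "isQ (tr (rw r (Ptab r x))) (tabT (Ptab r x))" by (rule isQ_tabT[OF isQ_vt(1,2)[OF x]])
  moreover have "isQ (tr (rw r (Ptab r y))) (tabT (Ptab r x))" unfolding e by (rule isQ_tabT[OF isQ_vt(1,2)[OF y]])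
  ultimately have "tr (rw r (Ptab r x)) = tr (rw r (Ptab r y))" by (rule isQ_inj) simp
  then have "rw r (Ptab r x) = rw r (Ptab r y)" using tr_tr isQ_vt(2) x y by metis
  then show ?thesis by (rule rw_inj_Ptab[OF x y])
qed

context
  fixes lam v r
  assumes lam: "is_partition lam" and v: "cellmap lam v" and r: "r = sum_list lam"
begin

lemma cellmap_Sr: "Q \<in> SYT lam \<Longrightarrow> v Q \<in> Sr r"
  and cellmap_kw: "Q \<in> SYT lam \<Longrightarrow> kw r (v Q) = rw r Q"
  and cellmap_P: "Q \<in> SYT lam \<Longrightarrow> Q' \<in> SYT lam \<Longrightarrow> Ptab r (v Q) = Ptab r (v Q')"
  using v unfolding cellmap_def r by blast+

lemma cellmap_inj: "Q \<in> SYT lam \<Longrightarrow> Q' \<in> SYT lam \<Longrightarrow> v Q = v Q' \<longleftrightarrow> Q = Q'"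
  using cellmap_kw SYT_isQ(1)[OF lam] isQ_unique r by metis

lemma R_up_cell:
  assumes Q: "Q \<in> SYT lam" and i: "1 \<le> i" "i < r"
  shows "i \<in> R_up r Q \<longleftrightarrow> rdesc (v Q) i"
proof -
  note iq = SYT_isQ(1)[OF lam Q, folded r]
  have "row_of Q i = rw r Q ! (i - 1)" "row_of Q (Suc i) = rw r Q ! i"
    using isQ_row_of[OF iq, of i] isQ_row_of[OF iq, of "Suc i"] i by auto
  moreover have "wd (kw r (v Q)) (i - 1) = rdesc (v Q) i" using wd_kw[OF cellmap_Sr[OF Q], of "i - 1"] i by simp
  ultimately show ?thesis using i cellmap_kw[OF Q] by (simp add: R_up_def)
qed

lemma R_low_cell:
  assumes Q: "Q \<in> SYT lam" and i: "1 \<le> i" "i < r"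
  shows "i \<in> R_low r Q \<longleftrightarrow> \<not> rdesc (v Q) i"
proof -
  note iq = SYT_isQ(1)[OF lam Q, folded r]
  have "col_of Q i = tr (rw r Q) ! (i - 1)" "col_of Q (Suc i) = tr (rw r Q) ! i"
    using isQ_col_of[OF iq, of i] isQ_col_of[OF iq, of "Suc i"] i by auto
  moreover have "wd (tr (rw r Q)) (i - 1) = (\<not> wd (rw r Q) (i - 1))"
    using wd_tr[OF SYT_isQ(2)[OF lam Q], of "i - 1"] i r by simp
  moreover have "wd (kw r (v Q)) (i - 1) = rdesc (v Q) i" using wd_kw[OF cellmap_Sr[OF Q], of "i - 1"] i by simp
  ultimately show ?thesis using i cellmap_kw[OF Q] by (simp add: R_low_def)
qed

text \<open>The pair \<open>(v Q', v Q)\<close> shows that the choice in \<open>mu_up\<close>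
  succeeds, and \<open>mu_cell_indep\<close> makes its outcome immaterial.\<close>

lemma mu_up_cell:
  assumes Q: "Q \<in> SYT lam" "Q' \<in> SYT lam" and i: "1 \<le> i" "i < r" "rdesc (v Q') i \<noteq> rdesc (v Q) i"
  shows "mu_up r Q' Q = mu r (v Q') (v Q)"
proof -
  let ?P = "\<lambda>(w', w). w' \<in> Sr r \<and> w \<in> Sr r \<and> Ptab r w' = Ptab r w \<and> Qtab r w' = Q' \<and> Qtab r w = Q"
  have S: "v Q \<in> Sr r" "v Q' \<in> Sr r" using cellmap_Sr Q by auto
  have iff: "Qtab r w = Q \<longleftrightarrow> kw r w = rw r Q" if "w \<in> Sr r" "Q \<in> SYT lam" for w Q
    using Qtab_eq_iff[OF lam that(2)] that(1) r by simp
  have "?P (v Q', v Q)"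
    using S cellmap_P[OF Q(2,1)] iff[OF S(2) Q(2)] iff[OF S(1) Q(1)] cellmap_kw Q by simp
  then have "?P (SOME p. ?P p)" by (rule someI)
  then obtain w' w where p: "(SOME p. ?P p) = (w', w)" "w' \<in> Sr r" "w \<in> Sr r" "Ptab r w' = Ptab r w"
    "Qtab r w' = Q'" "Qtab r w = Q" by (cases "SOME p. ?P p") auto
  have "mu r (v Q') (v Q) = mu r w' w"
  proof (rule mu_cell_indep[OF S(2,1) p(2,3) cellmap_P[OF Q(2,1)] p(4) _ _ i])
    show "kw r (v Q') = kw r w'" "kw r (v Q) = kw r w"
      using p(5,6) iff[OF p(2) Q(2)] iff[OF p(3) Q(1)] cellmap_kw Q by simp_all
  qed
  then show ?thesis unfolding mu_up_def p(1) by simp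
qed

text \<open>The pair chosen in \<open>mu_low\<close> has transposed recording tableaux. Multiplying
  it by the longest element undoes the transposition by \<open>kw_w0\<close> and preserves mu by
  \<open>mu_w0\<close>, after which cells can be compared.\<close>

lemma mu_low_cell:
  assumes Q: "Q \<in> SYT lam" "Q' \<in> SYT lam" and i: "1 \<le> i" "i < r" "rdesc (v Q') i \<noteq> rdesc (v Q) i"
  shows "mu_low r Q' Q = mu r (v Q') (v Q)"
proof -
  let ?P = "\<lambda>(w', w). w' \<in> Sr r \<and> w \<in> Sr r \<and> tabT (Ptab r w') = tabT (Ptab r w) \<and>
    tabT (Qtab r w') = Q' \<and> tabT (Qtab r w) = Q"
  have S: "v Q \<in> Sr r" "v Q' \<in> Sr r" using cellmap_Sr Q by auto
  have wS: "w0 r \<circ> v Q \<in> Sr r" "w0 r \<circ> v Q' \<in> Sr r" using S by simp_all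
  have iff: "tabT (Qtab r w) = Q \<longleftrightarrow> kw r (w0 r \<circ> w) = rw r Q" if "w \<in> Sr r" "Q \<in> SYT lam" for w Q
    using tabT_Qtab_eq_iff[OF lam that(2)] that(1) r by simp
  have "Ptab r (w0 r \<circ> v Q') = Ptab r (w0 r \<circ> v Q)"
    using Ptab_eq_path[OF S(1,2)] cellmap_P[OF Q] by simp
  moreover have "tabT (Qtab r (w0 r \<circ> v Q')) = Q'" "tabT (Qtab r (w0 r \<circ> v Q)) = Q"
    unfolding iff[OF wS(2) Q(2)] iff[OF wS(1) Q(1)] w0_comp(1) using cellmap_kw Q by auto
  ultimately have "?P (w0 r \<circ> v Q', w0 r \<circ> v Q)" using wS by simp
  then have "?P (SOME p. ?P p)" by (rule someI)
  then obtain w' w where p: "(SOME p. ?P p) = (w', w)" "w' \<in> Sr r" "w \<in> Sr r"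
    "tabT (Ptab r w') = tabT (Ptab r w)" "tabT (Qtab r w') = Q'" "tabT (Qtab r w) = Q"
    by (cases "SOME p. ?P p") auto
  have wp: "w0 r \<circ> w' \<in> Sr r" "w0 r \<circ> w \<in> Sr r" using p by simp_all
  have k: "kw r (w0 r \<circ> w') = kw r (v Q')" "kw r (w0 r \<circ> w) = kw r (v Q)"
    using p iff Q cellmap_kw by auto
  have "Ptab r w' = Ptab r w" by (rule tabT_Ptab_inj[OF p(2,3,4)])
  then have "Ptab r (w0 r \<circ> w') = Ptab r (w0 r \<circ> w)" using Ptab_eq_path[OF p(3,2)] by simp
  then have "mu r (v Q') (v Q) = mu r (w0 r \<circ> w') (w0 r \<circ> w)"
    by (intro mu_cell_indep[OF S(2,1) wp cellmap_P[OF Q(2,1)] _ k[symmetric] i])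
  also have "\<dots> = mu r w' w"
  proof (rule mu_w0[OF p(2,3) i(1,2)])
    have "rdesc (w0 r \<circ> u) i \<longleftrightarrow> \<not> rdesc u i" if "u \<in> Sr r" for u
      using w0_comp_less_iff[OF that i(1,2)] Sr_inj[OF that, of i "Suc i"] by auto
    moreover have "rdesc (w0 r \<circ> w') i = rdesc (v Q') i" "rdesc (w0 r \<circ> w) i = rdesc (v Q) i"
      using rdesc_kw_cong[OF wp(1) S(2) k(1) i(1,2)] rdesc_kw_cong[OF wp(2) S(1) k(2) i(1,2)] by auto
    ultimately show "rdesc w' i \<noteq> rdesc w i" using i(3) p by blast
  qed
  finally show ?thesis unfolding mu_low_def p(1) by simp
qed

lemma cellmap_onto:
  assumes T: "T \<in> SYT lam" and w: "w \<in> Sr r" "Ptab r w = Ptab r (v T)"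
  shows "\<exists>Q\<in>SYT lam. w = v Q"
proof -
  have "count_list (kw r w) = count_list (kw r (v T))" using vt_Ptab[OF w(1)] vt_Ptab[OF cellmap_Sr[OF T]] w(2) by metis
  then have "count_list (kw r w) = (\<lambda>k. if k < length lam then lam ! k else 0)"
    using SYT_isQ(3)[OF lam T] cellmap_kw[OF T] r by simp
  then have Q: "Qtab r w \<in> SYT lam"
    using isQ_SYT[OF lam LW_kw[OF w(1)] _ _ isQ_Qtab[OF w(1)]] r by simp
  have "kw r w = rw r (Qtab r w)" using Qtab_eq_iff[OF lam Q, of w] w(1) unfolding r by blast
  then have "w = v (Qtab r w)" using rsk_inj[OF w(1) cellmap_Sr[OF Q]] w(2) cellmap_P[OF T Q] cellmap_kw[OF Q] by simp
  then show ?thesis using Q by blast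
qed

text \<open>Equality of insertion tableaux survives multiplication by the longest element, so the
  image of the cell is again a full right cell.\<close>

lemma dual_cell:
  assumes T: "T \<in> SYT lam"
  shows "ceq r w (w0 r \<circ> v T) \<longleftrightarrow> (\<exists>Q\<in>SYT lam. w = w0 r \<circ> v Q)"
proof
  assume c: "ceq r w (w0 r \<circ> v T)"
  then have w: "w \<in> Sr r" by (simp add: ceq_def)
  have wT: "w0 r \<circ> v T \<in> Sr r" using cellmap_Sr[OF T] by simp
  have "Ptab r w = Ptab r (w0 r \<circ> v T)" using c ceq_iff_Ptab[OF w wT] by simp
  then have "Ptab r (w0 r \<circ> w) = Ptab r (w0 r \<circ> (w0 r \<circ> v T))" using Ptab_eq_path[OF wT w] by simp
  then have "Ptab r (w0 r \<circ> w) = Ptab r (v T)" by (simp only: w0_comp(1))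
  then obtain Q where "Q \<in> SYT lam" "w0 r \<circ> w = v Q" using cellmap_onto[OF T, of "w0 r \<circ> w"] w by auto
  then show "\<exists>Q\<in>SYT lam. w = w0 r \<circ> v Q" by (metis w0_comp(1))
next
  assume "\<exists>Q\<in>SYT lam. w = w0 r \<circ> v Q"
  then obtain Q where Q: "Q \<in> SYT lam" "w = w0 r \<circ> v Q" by blast
  have S: "w0 r \<circ> v T \<in> Sr r" "w0 r \<circ> v Q \<in> Sr r" using cellmap_Sr T Q by simp_all
  have "Ptab r (w0 r \<circ> v Q) = Ptab r (w0 r \<circ> v T)"
    using Ptab_eq_path[OF cellmap_Sr[OF T] cellmap_Sr[OF Q(1)] cellmap_P[OF T Q(1)]] by simp
  then show "ceq r w (w0 r \<circ> v T)" using ceq_iff_Ptab[OF S(2,1)] Q by simp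
qed

lemma cell_star:
  assumes Q: "Q \<in> SYT lam" and k: "1 \<le> k" "Suc k < r" and D: "kD k (v Q)"
  obtains Q' where "Q' \<in> SYT lam" "v Q' = kstar k (v Q)"
  using cellmap_onto[OF Q, of "kstar k (v Q)"] kstar_Sr[OF cellmap_Sr[OF Q] k]
    rsk_kstar(1)[OF cellmap_Sr[OF Q] k D] by metis

end

section \<open>Rational functions\<close>

definition KU :: fieldK where "KU = Fract [:0, 1:] 1"

lemma KU_nz [simp]: "KU \<noteq> 0"
  by (simp add: KU_def Zero_fract_def eq_fract)

lemma inverse_KU: "inverse KU = Fract 1 [:0, 1:]"
  by (simp add: KU_def inverse_fract)

lemma q2_KU: "q2 = KU + inverse KU"
  unfolding inverse_KU by (simp add: KU_def q2_def add_fract eq_fract one_pCons)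

definition cK :: "rat \<Rightarrow> fieldK" where "cK a = Fract [:a:] 1"

lemma cK_0 [simp]: "cK 0 = 0" by (simp add: cK_def Zero_fract_def)

lemma cK_1 [simp]: "cK 1 = 1" by (simp add: cK_def One_fract_def one_pCons)

lemma cK_add: "cK (a + b) = cK a + cK b" by (simp add: cK_def)

lemma cK_nz: "a \<noteq> 0 \<Longrightarrow> cK a \<noteq> 0" by (simp add: cK_def Zero_fract_def eq_fract)

lemma Fract_pCons: "Fract (pCons a p) 1 = cK a + KU * Fract p 1"
  by (simp add: cK_def KU_def)

text \<open>The inclusion of the Laurent polynomials into the field K, with u sent to
  \<open>KU\<close>.\<close>

definition lpK :: "laurent \<Rightarrow> fieldK" where
  "lpK f = (\<Sum>k\<in>Poly_Mapping.keys f. of_int (Poly_Mapping.lookup f k) * KU powi k)"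

lemma lpK_superset:
  assumes "finite A" "Poly_Mapping.keys f \<subseteq> A"
  shows "lpK f = (\<Sum>k\<in>A. of_int (Poly_Mapping.lookup f k) * KU powi k)"
  unfolding lpK_def by (rule sum.mono_neutral_left) (use assms in \<open>auto simp: in_keys_iff\<close>)

lemma lpK_add [simp]: "lpK (f + g) = lpK f + lpK g"
proof -
  let ?A = "Poly_Mapping.keys f \<union> Poly_Mapping.keys g"
  have "Poly_Mapping.keys (f + g) \<subseteq> ?A" by (rule keys_add)
  then show ?thesis
    by (simp add: lpK_superset[of ?A] lookup_add distrib_right sum.distrib)
qed

lemma lpK_single: "lpK (Poly_Mapping.single k v) = of_int v * KU powi k"
  by (simp add: lpK_superset[of "{k}"])

lemma lpK_0 [simp]: "lpK 0 = 0" by (simp add: lpK_def)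

lemma lpK_mult [simp]: "lpK (f * g) = lpK f * lpK g"
proof (induction f rule: laurent_induct)
  case (single k v)
  show ?case
  proof (induction g rule: laurent_induct)
    case (single l x)
    then show ?case by (simp add: mult_single lpK_single power_int_add)
  qed (simp add: distrib_left)
qed (simp add: distrib_right)

lemma lpK_sum [simp]: "lpK (sum f A) = (\<Sum>x\<in>A. lpK (f x))"
  by (induction A rule: infinite_finite_induct) auto

lemma lpK_of_int [simp]: "lpK (of_int n) = of_int n"
  by (simp add: of_int_laurent lpK_single)

lemma lpK_1 [simp]: "lpK 1 = 1"
  using lpK_of_int[of 1] by simp

lemma lpK_u [simp]: "lpK lp_u = KU" "lpK lp_uinv = inverse KU"
  by (simp_all add: lp_u_def lp_uinv_def lpK_single power_int_minus)

lemma poly_nz_at_0: "poly q 0 \<noteq> 0 \<Longrightarrow> q \<noteq> (0 :: rat poly)"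
  by auto

section \<open>Regularity and value at u = 0\<close>

lemma val0_Fract:
  assumes "poly q 0 \<noteq> 0" shows "val0 (Fract p q) = poly p 0 / poly q 0"
proof -
  let ?P = "\<lambda>(p', q'). poly q' 0 \<noteq> 0 \<and> Fract p q = Fract p' q'"
  have "?P (p, q)" using assms by simp
  then have "?P (SOME x. ?P x)" by (rule someI)
  then obtain p' q' where s: "(SOME x. ?P x) = (p', q')" "poly q' 0 \<noteq> 0" "Fract p q = Fract p' q'"
    by (cases "SOME x. ?P x") auto
  then have "p * q' = p' * q" using assms poly_nz_at_0 by (simp add: eq_fract)
  then have "poly (p * q') 0 = poly (p' * q) 0" by simp
  then show ?thesis unfolding val0_def s(1) using s(2) assms by (simp add: field_simps)
qed

lemma K0_Fract: "poly q 0 \<noteq> 0 \<Longrightarrow> Fract p q \<in> K0"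
  by (auto simp: K0_def)

lemma K0E:
  assumes "f \<in> K0" obtains p q where "f = Fract p q" "poly q 0 \<noteq> 0" "val0 f = poly p 0 / poly q 0"
  using assms val0_Fract by (auto simp: K0_def)

lemma K0_add: "f \<in> K0 \<Longrightarrow> g \<in> K0 \<Longrightarrow> f + g \<in> K0 \<and> val0 (f + g) = val0 f + val0 g"
proof -
  assume "f \<in> K0" "g \<in> K0"
  then obtain p q p' q' where e: "f = Fract p q" "poly q 0 \<noteq> 0" "g = Fract p' q'" "poly q' 0 \<noteq> 0"
    by (auto simp: K0_def)
  have "f + g = Fract (p * q' + p' * q) (q * q')" using e poly_nz_at_0 by (simp add: add_fract)
  then show ?thesis using e by (simp add: val0_Fract K0_Fract field_simps)
qed

lemma K0_mult: "f \<in> K0 \<Longrightarrow> g \<in> K0 \<Longrightarrow> f * g \<in> K0 \<and> val0 (f * g) = val0 f * val0 g"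
proof -
  assume "f \<in> K0" "g \<in> K0"
  then obtain p q p' q' where e: "f = Fract p q" "poly q 0 \<noteq> 0" "g = Fract p' q'" "poly q' 0 \<noteq> 0"
    by (auto simp: K0_def)
  then show ?thesis by (simp add: val0_Fract K0_Fract)
qed

lemma K0_cK: "cK a \<in> K0 \<and> val0 (cK a) = a"
  unfolding cK_def using K0_Fract[of 1 "[:a:]"] val0_Fract[of 1 "[:a:]"] by simp

lemma K0_0 [simp]: "0 \<in> K0" "val0 0 = 0"
  using K0_cK[of 0] by simp_all

lemma K0_1 [simp]: "1 \<in> K0" "val0 1 = 1"
  using K0_cK[of 1] by simp_all

lemma K0_KU [simp]: "KU \<in> K0" "val0 KU = 0"
  unfolding KU_def using K0_Fract[of 1 "[:0, 1:]"] val0_Fract[of 1 "[:0, 1:]"] by simp_all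

lemma K0_inverse: "f \<in> K0 \<Longrightarrow> val0 f \<noteq> 0 \<Longrightarrow> inverse f \<in> K0 \<and> val0 (inverse f) = inverse (val0 f)"
proof -
  assume "f \<in> K0" "val0 f \<noteq> 0"
  then obtain p q where e: "f = Fract p q" "poly q 0 \<noteq> 0" "poly p 0 \<noteq> 0"
    by (elim K0E) auto
  then show ?thesis by (simp add: inverse_fract K0_Fract val0_Fract)
qed

lemma cK_of_int: "cK (of_int n) = of_int n"
proof -
  have "cK (of_nat m) = of_nat m" for m by (induction m) (auto simp: cK_add)
  moreover have "cK (- a) = - cK a" for a by (simp add: cK_def)
  ultimately show ?thesis by (cases n rule: int_cases2) auto
qed

lemma K0_of_int: "of_int n \<in> K0 \<and> val0 (of_int n) = of_int n"
  using K0_cK[of "of_int n"] by (simp add: cK_of_int)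

lemma K0_sum:
  "finite A \<Longrightarrow> (\<And>x. x \<in> A \<Longrightarrow> f x \<in> K0) \<Longrightarrow> sum f A \<in> K0 \<and> val0 (sum f A) = (\<Sum>x\<in>A. val0 (f x))"
  by (induction A rule: finite_induct) (auto simp: K0_add)

lemma K0_power_int: "0 \<le> n \<Longrightarrow> KU powi n \<in> K0"
proof -
  have "KU ^ m \<in> K0" for m by (induction m) (auto simp: K0_mult)
  then show "0 \<le> n \<Longrightarrow> KU powi n \<in> K0" by (simp add: power_int_def)
qed

lemma power_X_decomp:
  assumes "p \<noteq> (0 :: rat poly)"
  obtains n p' where "p = [:0, 1:] ^ n * p'" "poly p' 0 \<noteq> 0"
proof -
  obtain p' where "p = [:- 0, 1:] ^ order 0 p * p'" "\<not> [:- 0, 1:] dvd p'"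
    using order_decomp[OF assms] by blast
  then show thesis using that[of "order 0 p" p'] by (simp add: poly_eq_0_iff_dvd)
qed

lemma Fract_X_power: "Fract ([:0, 1:] ^ n) 1 = KU ^ n"
proof (induction n)
  case (Suc n)
  have "Fract ([:0, 1:] ^ Suc n) 1 = Fract [:0, 1:] 1 * Fract ([:0, 1:] ^ n) 1"
    by (simp only: power_Suc mult_fract mult_1_right)
  also have "\<dots> = KU ^ Suc n" by (simp only: Suc KU_def[symmetric] power_Suc)
  finally show ?case .
qed (simp add: One_fract_def)

lemma K0_scale:
  assumes "f \<noteq> 0" shows "\<exists>n. KU powi n * f \<in> K0 \<and> val0 (KU powi n * f) \<noteq> 0"
proof -
  obtain p q where f: "f = Fract p q" "q \<noteq> 0" by (cases f) auto
  have "p \<noteq> 0" using assms f by (auto simp: Zero_fract_def eq_fract)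
  then obtain a p' where p: "p = [:0, 1:] ^ a * p'" "poly p' 0 \<noteq> 0" by (rule power_X_decomp)
  obtain b q' where q: "q = [:0, 1:] ^ b * q'" "poly q' 0 \<noteq> 0" using f(2) by (rule power_X_decomp)
  have "f = Fract ([:0, 1:] ^ a) 1 * inverse (Fract ([:0, 1:] ^ b) 1) * Fract p' q'"
    by (simp add: f(1) p q inverse_fract)
  also have "\<dots> = KU powi (int a - int b) * Fract p' q'"
    unfolding Fract_X_power by (simp add: power_int_diff divide_inverse)
  finally have "KU powi (int b - int a) * f = Fract p' q'"
    by (simp add: power_int_diff divide_simps mult.commute)
  then show ?thesis using p q by (intro exI[of _ "int b - int a"]) (simp add: K0_Fract val0_Fract)
qed

text \<open>Each nonzero entry has an exponent that makes it a unit at 0. The largest of these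
  exponents makes all entries regular and keeps an entry attaining it nonzero at 0.\<close>

lemma K0_scale_family:
  assumes fin: "finite B" and nz: "\<exists>b\<in>B. f b \<noteq> 0"
  shows "\<exists>n. (\<forall>b\<in>B. KU powi n * f b \<in> K0) \<and> (\<exists>b\<in>B. val0 (KU powi n * f b) \<noteq> 0)"
proof -
  let ?B = "{b \<in> B. f b \<noteq> 0}"
  have "\<forall>b\<in>?B. \<exists>n. KU powi n * f b \<in> K0 \<and> val0 (KU powi n * f b) \<noteq> 0" using K0_scale by blast
  then obtain e where e: "\<And>b. b \<in> ?B \<Longrightarrow> KU powi (e b) * f b \<in> K0 \<and> val0 (KU powi (e b) * f b) \<noteq> 0"
    by metis
  have fB: "finite (e ` ?B)" "e ` ?B \<noteq> {}" using fin nz by auto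
  define n where "n = Max (e ` ?B)"
  have "n \<in> e ` ?B" unfolding n_def by (rule Max_in[OF fB])
  then obtain b0 where b0: "b0 \<in> ?B" "e b0 = n" by auto
  have "KU powi n * f b \<in> K0" if b: "b \<in> B" for b
  proof (cases "f b = 0")
    case False
    then have "e b \<le> n" unfolding n_def using b fB by (intro Max_ge) auto
    then have "KU powi n * f b = KU powi (n - e b) * (KU powi (e b) * f b)"
      by (simp add: power_int_diff)
    then show ?thesis using K0_power_int[of "n - e b"] e[of b] b False \<open>e b \<le> n\<close>
        K0_mult[of "KU powi (n - e b)" "KU powi (e b) * f b"] by (simp add: mult.assoc)
  qed simp
  then show ?thesis using e[OF b0(1)] b0 by (intro exI[of _ n]) auto
qed

section \<open>The bar involution on rational functions\<close>

text \<open>The polynomial evaluated at the inverse of u.\<close>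

definition evb :: "rat poly \<Rightarrow> fieldK" where
  "evb p = (\<Sum>i\<le>degree p. cK (coeff p i) * inverse KU ^ i)"

lemma evb_ge: "degree p \<le> n \<Longrightarrow> evb p = (\<Sum>i\<le>n. cK (coeff p i) * inverse KU ^ i)"
  unfolding evb_def by (rule sum.mono_neutral_left) (auto simp: coeff_eq_0)

lemma Fract_sum: "degree p \<le> n \<Longrightarrow> Fract p 1 = (\<Sum>i\<le>n. cK (coeff p i) * KU ^ i)"
proof (induction p arbitrary: n)
  case 0
  have "Fract 0 1 = (0 :: fieldK)" by (simp add: Zero_fract_def)
  then show ?case by simp
next
  case (pCons a p)
  show ?case
  proof (cases n)
    case 0
    then have "p = 0" using pCons.prems by (auto split: if_splits)
    then show ?thesis using 0 by (simp add: cK_def)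
  next
    case (Suc m)
    then have "degree p \<le> m" using pCons.prems by (auto split: if_splits)
    then have "Fract p 1 = (\<Sum>i\<le>m. cK (coeff p i) * KU ^ i)" by (rule pCons.IH)
    then show ?thesis unfolding Fract_pCons Suc sum.atMost_Suc_shift
      by (simp add: sum_distrib_left mult_ac)
  qed
qed

lemma Fract_reflect: "Fract (reflect_poly p) 1 = KU ^ degree p * evb p"
proof -
  let ?n = "degree p"
  have "Fract (reflect_poly p) 1 = (\<Sum>i\<le>?n. cK (coeff (reflect_poly p) i) * KU ^ i)"
    by (rule Fract_sum) (rule degree_reflect_poly_le)
  also have "\<dots> = (\<Sum>i\<le>?n. cK (coeff p (?n - i)) * KU ^ i)"
    by (intro sum.cong) (auto simp: coeff_reflect_poly)
  also have "\<dots> = (\<Sum>i\<le>?n. cK (coeff p i) * KU ^ (?n - i))"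
    by (rule sum.reindex_bij_witness[of _ "\<lambda>i. ?n - i" "\<lambda>i. ?n - i"]) auto
  also have "\<dots> = KU ^ ?n * evb p"
    unfolding evb_def sum_distrib_left
    by (intro sum.cong) (simp_all add: power_diff power_inverse field_simps)
  finally show ?thesis .
qed

lemma evb_add: "evb (p + q) = evb p + evb q"
proof -
  let ?n = "max (degree p) (degree q)"
  have "degree (p + q) \<le> ?n" by (rule degree_add_le_max)
  then show ?thesis by (simp add: evb_ge[of _ ?n] cK_add distrib_right sum.distrib)
qed

lemma evb_reflect: "evb p = inverse (KU ^ degree p) * Fract (reflect_poly p) 1"
  by (simp add: Fract_reflect)

lemma evb_0 [simp]: "evb 0 = 0"
  by (simp add: evb_def)

lemma evb_mult: "evb (p * q) = evb p * evb q"
proof (cases "p = 0 \<or> q = 0")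
  case False
  then show ?thesis by (simp add: evb_reflect reflect_poly_mult degree_mult_eq power_add)
qed auto

lemma evb_nz: "p \<noteq> 0 \<Longrightarrow> evb p \<noteq> 0"
proof -
  assume "p \<noteq> 0"
  then have "Fract (reflect_poly p) 1 \<noteq> 0" by (simp add: Zero_fract_def eq_fract)
  then show ?thesis by (simp add: evb_reflect)
qed

lemma Fract_div: "q \<noteq> 0 \<Longrightarrow> Fract p q = Fract p 1 / Fract q 1"
  by (simp add: divide_inverse inverse_fract)

text \<open>Reversing the coefficients multiplies the value at \<open>u^-1\<close> by the power of u
  given by the degree; the two monomials in \<open>barK\<close> compensate these powers.\<close>

lemma barK_rep:
  assumes "q \<noteq> 0"
  shows "Fract (reflect_poly p * monom 1 (degree q)) (reflect_poly q * monom 1 (degree p)) = evb p / evb q"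
proof -
  have m: "Fract (a * monom 1 n) 1 = Fract a 1 * KU ^ n" for a n
  proof -
    have "Fract (a * monom 1 n) 1 = Fract a 1 * Fract (monom 1 n) 1" by simp
    then show ?thesis using Fract_X_power[of n] by (simp add: monom_altdef)
  qed
  have "reflect_poly q * monom 1 (degree p) \<noteq> 0" using assms by (simp add: monom_eq_0_iff)
  then show ?thesis
    using evb_nz[OF assms] by (simp add: Fract_div m Fract_reflect field_simps)
qed

lemma barK_Fract:
  assumes "q \<noteq> 0" shows "barK (Fract p q) = evb p / evb q"
proof -
  let ?P = "\<lambda>(p', q'). q' \<noteq> 0 \<and> Fract p q = Fract p' q'"
  have "?P (p, q)" using assms by simp
  then have "?P (SOME x. ?P x)" by (rule someI)
  then obtain p' q' where s: "(SOME x. ?P x) = (p', q')" "q' \<noteq> 0" "Fract p q = Fract p' q'"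
    by (cases "SOME x. ?P x") auto
  then have "p * q' = p' * q" using assms by (simp add: eq_fract)
  then have "evb p * evb q' = evb p' * evb q" using evb_mult by metis
  then have "evb p' / evb q' = evb p / evb q" using evb_nz s(2) assms by (simp add: field_simps)
  then show ?thesis unfolding barK_def s(1) using barK_rep[OF s(2)] by simp
qed

lemma barK_add: "barK (f + g) = barK f + barK g"
proof -
  obtain p q where f: "f = Fract p q" "q \<noteq> 0" by (cases f) auto
  obtain p' q' where g: "g = Fract p' q'" "q' \<noteq> 0" by (cases g) auto
  show ?thesis using f g evb_nz
    by (simp add: add_fract barK_Fract evb_add evb_mult field_simps)
qed

lemma barK_mult: "barK (f * g) = barK f * barK g"
proof -
  obtain p q where f: "f = Fract p q" "q \<noteq> 0" by (cases f) auto
  obtain p' q' where g: "g = Fract p' q'" "q' \<noteq> 0" by (cases g) auto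
  show ?thesis using f g by (simp add: barK_Fract evb_mult)
qed

lemma barK_cK: "barK (cK a) = cK a"
  unfolding cK_def barK_Fract[OF one_neq_zero] by (simp add: evb_def) (simp add: cK_def)

lemma barK_0 [simp]: "barK 0 = 0" using barK_cK[of 0] by simp

lemma barK_1 [simp]: "barK 1 = 1" using barK_cK[of 1] by simp

lemma barK_of_int [simp]: "barK (of_int n) = of_int n"
  using barK_cK[of "of_int n"] by (simp add: cK_of_int)

lemma barK_sum: "barK (sum f A) = (\<Sum>x\<in>A. barK (f x))"
  by (induction A rule: infinite_finite_induct) (auto simp: barK_add)

lemma barK_KU: "barK KU = inverse KU"
  unfolding KU_def barK_Fract[OF one_neq_zero] by (simp add: evb_def) (simp add: KU_def)

lemma barK_q2 [simp]: "barK q2 = q2"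
proof -
  have "barK KU * barK (inverse KU) = 1" using barK_mult[of KU "inverse KU"] by simp
  then have "barK (inverse KU) = KU" by (simp add: barK_KU field_simps)
  then show ?thesis by (simp add: q2_KU barK_add barK_KU)
qed

lemma coeff_mult_top:
  fixes p q :: "rat poly"
  assumes "degree p \<le> m" "degree q \<le> n"
  shows "coeff (p * q) (m + n) = coeff p m * coeff q n"
proof -
  have "coeff (p * q) (m + n) = (\<Sum>i\<le>m + n. coeff p i * coeff q (m + n - i))" by (simp add: coeff_mult)
  also have "\<dots> = (\<Sum>i\<le>m + n. if i = m then coeff p m * coeff q n else 0)"
  proof (rule sum.cong)
    fix i assume "i \<in> {..m + n}"
    show "coeff p i * coeff q (m + n - i) = (if i = m then coeff p m * coeff q n else 0)"
    proof (cases "i < m")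
      case True
      then have "coeff q (m + n - i) = 0" using assms by (intro coeff_eq_0) auto
      then show ?thesis using True by simp
    next
      case False
      then show ?thesis using assms by (cases "i = m") (auto simp: coeff_eq_0)
    qed
  qed simp
  finally show ?thesis by simp
qed

lemma valinf_Fract:
  assumes "q \<noteq> 0" "degree p \<le> degree q"
  shows "valinf (Fract p q) = coeff p (degree q) / lead_coeff q"
proof -
  let ?P = "\<lambda>(p', q'). q' \<noteq> 0 \<and> degree p' \<le> degree q' \<and> Fract p q = Fract p' q'"
  have "?P (p, q)" using assms by simp
  then have "?P (SOME x. ?P x)" by (rule someI)
  then obtain p' q' where s: "(SOME x. ?P x) = (p', q')" "q' \<noteq> 0" "degree p' \<le> degree q'" "Fract p q = Fract p' q'"
    by (cases "SOME x. ?P x") auto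
  then have "p * q' = p' * q" using assms by (simp add: eq_fract)
  then have "coeff (p * q') (degree q + degree q') = coeff (p' * q) (degree q' + degree q)" by (simp add: add.commute)
  then have "coeff p (degree q) * lead_coeff q' = coeff p' (degree q') * lead_coeff q"
    using coeff_mult_top[of p "degree q" q' "degree q'"] coeff_mult_top[of p' "degree q'" q "degree q"] assms s by simp
  then have "coeff p' (degree q') / lead_coeff q' = coeff p (degree q) / lead_coeff q"
    using assms s by (simp add: field_simps)
  moreover have "valinf (Fract p q) = coeff p' (degree q') / lead_coeff q'"
    unfolding valinf_def s(1) using s(3) by (auto simp: coeff_eq_0)
  ultimately show ?thesis by simp
qed

text \<open>The function equals its own reflected fraction. As \<open>q\<close> does not vanish at
  0, the reflected denominator keeps full degree, and the coefficients that determine the value at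
  infinity are the constant terms of \<open>p\<close> and \<open>q\<close>.\<close>

lemma bar_invariant_Kinf:
  assumes "f \<in> K0" "barK f = f" shows "f \<in> Kinf" "valinf f = val0 f"
proof -
  obtain p q where f: "f = Fract p q" "poly q 0 \<noteq> 0" "val0 f = poly p 0 / poly q 0" using assms(1) by (rule K0E)
  have q: "q \<noteq> 0" "coeff q 0 \<noteq> 0" using f by (auto simp: poly_0_coeff_0)
  let ?A = "reflect_poly p * monom 1 (degree q)" and ?B = "reflect_poly q * monom 1 (degree p)"
  have fAB: "f = Fract ?A ?B" using assms(2) barK_Fract[OF q(1)] barK_rep[OF q(1)] f(1) by simp
  have B: "?B \<noteq> 0" using q by (simp add: monom_eq_0_iff)
  have dB: "degree ?B = degree q + degree p"
    using q by (simp add: degree_mult_eq degree_monom_eq monom_eq_0_iff degree_reflect_poly_eq)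
  have dA: "degree ?A \<le> degree ?B"
    unfolding dB using degree_mult_le[of "reflect_poly p" "monom 1 (degree q)"] degree_reflect_poly_le[of p]
      degree_monom_le[of "1::rat" "degree q"] by linarith
  show "f \<in> Kinf" unfolding Kinf_def using B dA fAB by blast
  have "coeff ?A (degree p + degree q) = coeff p 0"
    using coeff_mult_top[OF degree_reflect_poly_le[of p] degree_monom_le[of "1::rat" "degree q"]]
    by (simp add: coeff_reflect_poly)
  moreover have "coeff ?B (degree q + degree p) = coeff q 0"
    using coeff_mult_top[OF degree_reflect_poly_le[of q] degree_monom_le[of "1::rat" "degree p"]]
    by (simp add: coeff_reflect_poly)
  ultimately show "valinf f = val0 f"
    using valinf_Fract[OF B dA] f(3) fAB dB by (simp add: poly_0_coeff_0 add.commute)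
qed

section \<open>Invariant forms on subquotients\<close>

definition supp_in :: "'a set \<Rightarrow> ('a \<Rightarrow> 'k :: zero) \<Rightarrow> bool" where
  "supp_in J c \<longleftrightarrow> (\<forall>x. x \<notin> J \<longrightarrow> c x = 0)"

text \<open>Definite means anisotropic. This property, unlike nondegeneracy, passes to all
  subspaces, so orthogonal projections onto coordinate subspaces exist.\<close>

locale definite_form =
  fixes A :: "'a set" and B :: "('a \<Rightarrow> 'k :: field) \<Rightarrow> ('a \<Rightarrow> 'k) \<Rightarrow> 'k"
  assumes lin: "\<And>s c d e. B (\<lambda>x. s * c x + d x) e = s * B c e + B d e"
    and sym: "\<And>c d. B c d = B d c"
    and definite: "\<And>c. supp_in A c \<Longrightarrow> B c c = 0 \<Longrightarrow> c = (\<lambda>_. 0)"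
    and finite_A: "finite A"
begin

lemma B_zero: "B (\<lambda>_. 0) d = 0"
  using lin[of "-1" "\<lambda>_. 0" "\<lambda>_. 0" d] by simp

lemma B_sub: "B (\<lambda>x. c x - t * e x) d = B c d - t * B e d"
  using lin[of "- t" e c d] by (simp add: algebra_simps)

lemma B_add: "B (\<lambda>x. c x + e x) d = B c d + B e d"
  using lin[of 1 c e d] by simp

lemma B_sum: "finite C \<Longrightarrow> B (\<lambda>x. \<Sum>q\<in>C. a q * f q x) d = (\<Sum>q\<in>C. a q * B (f q) d)"
  by (induction C rule: finite_induct) (simp_all add: B_zero lin)

definition unitv :: "'a \<Rightarrow> 'a \<Rightarrow> 'k" where
  "unitv a = (\<lambda>x. if x = a then 1 else 0)"

text \<open>Gram-Schmidt, one coordinate at a time: \<open>e\<close> is the new unit vector made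
  orthogonal to the earlier coordinates, and it cannot be isotropic because its coordinate at
  \<open>j\<close> is 1.\<close>

lemma projection:
  assumes "finite J" "J \<subseteq> A"
  shows "\<exists>h. supp_in J h \<and> (\<forall>d. supp_in J d \<longrightarrow> B (\<lambda>x. c x - h x) d = 0)"
  using assms
proof (induction J arbitrary: c rule: finite_induct)
  case empty
  show ?case
  proof (intro exI conjI allI impI)
    show "supp_in {} (\<lambda>_. 0 :: 'k)" by (simp add: supp_in_def)
    fix d :: "'a \<Rightarrow> 'k" assume "supp_in {} d"
    then have d: "d = (\<lambda>_. 0)" by (auto simp: supp_in_def)
    show "B (\<lambda>x. c x - 0) d = 0" unfolding d by (subst sym) (rule B_zero)
  qed
next
  case (insert j J)
  obtain g where g: "supp_in J g" "\<And>d. supp_in J d \<Longrightarrow> B (\<lambda>x. unitv j x - g x) d = 0"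
    using insert by blast
  obtain h where h: "supp_in J h" "\<And>d. supp_in J d \<Longrightarrow> B (\<lambda>x. c x - h x) d = 0"
    using insert by blast
  define e where "e x = unitv j x - g x" for x
  define c' where "c' x = c x - h x" for x
  have ej: "e j = 1" using g(1) insert.hyps by (simp add: e_def unitv_def supp_in_def)
  have se: "supp_in (insert j J) e" using g(1) by (auto simp: e_def unitv_def supp_in_def)
  then have "supp_in A e" using insert.prems by (auto simp: supp_in_def)
  moreover have "e \<noteq> (\<lambda>_. 0)" using ej by (metis zero_neq_one)
  ultimately have Bee: "B e e \<noteq> 0" using definite by blast
  \<comment> \<open>The coefficient that makes the remainder orthogonal to \<open>e\<close> as
    well.\<close>
  define t where "t = B c' e / B e e"
  show ?case
  proof (intro exI[of _ "\<lambda>x. h x + t * e x"] conjI allI impI)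
    show "supp_in (insert j J) (\<lambda>x. h x + t * e x)" using se h(1) by (auto simp: supp_in_def)
    fix d :: "'a \<Rightarrow> 'k" assume d: "supp_in (insert j J) d"
    define d1 where "d1 x = d x - d j * e x" for x
    have "supp_in J d1"
      unfolding supp_in_def
    proof (intro allI impI)
      fix x assume "x \<notin> J"
      then show "d1 x = 0" using d se ej by (cases "x = j") (auto simp: supp_in_def d1_def)
    qed
    then have z: "B c' d1 = 0" "B e d1 = 0" using g(2) h(2) by (simp_all add: c'_def[abs_def] e_def[abs_def])
    have dd: "d = (\<lambda>x. d j * e x + d1 x)" by (simp add: d1_def)
    have c: "(\<lambda>x. c x - (h x + t * e x)) = (\<lambda>x. c' x - t * e x)" by (simp add: c'_def algebra_simps)
    have "B (\<lambda>x. c' x - t * e x) d = d j * B e (\<lambda>x. c' x - t * e x) + B d1 (\<lambda>x. c' x - t * e x)"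
      by (subst dd, subst sym, subst lin) rule
    also have "B d1 (\<lambda>x. c' x - t * e x) = 0" using z by (subst sym) (simp add: B_sub)
    also have "B e (\<lambda>x. c' x - t * e x) = 0" using Bee by (subst sym) (simp only: B_sub, simp add: t_def)
    finally show "B (\<lambda>x. c x - (h x + t * e x)) d = 0" unfolding c by simp
  qed
qed

text \<open>A self-adjoint action induces an invariant nondegenerate form on each subquotient: take
  representatives orthogonal to the smaller submodule.\<close>
lemma invariant_form:
  fixes M :: "'i \<Rightarrow> 'a \<Rightarrow> 'a \<Rightarrow> 'k"
  defines "act \<equiv> \<lambda>i c x. if x \<in> A then \<Sum>w\<in>A. M i x w * c w else 0"
  assumes sa: "\<And>i c d. i \<in> I \<Longrightarrow> supp_in A c \<Longrightarrow> supp_in A d \<Longrightarrow> B (act i c) d = B c (act i d)"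
    and JC: "J \<subseteq> A" "C \<subseteq> A" "J \<inter> C = {}"
    and MJ: "\<And>i x w. i \<in> I \<Longrightarrow> x \<in> A \<Longrightarrow> w \<in> J \<Longrightarrow> x \<notin> J \<Longrightarrow> M i x w = 0"
    and MC: "\<And>i x w. i \<in> I \<Longrightarrow> x \<in> A \<Longrightarrow> w \<in> C \<Longrightarrow> x \<notin> C \<union> J \<Longrightarrow> M i x w = 0"
  shows "\<exists>S. (\<forall>i\<in>I. \<forall>a\<in>C. \<forall>b\<in>C. (\<Sum>c\<in>C. S a c * M i c b) = (\<Sum>c\<in>C. M i c a * S c b)) \<and>
    (\<exists>S'. \<forall>a\<in>C. \<forall>b\<in>C. (\<Sum>c\<in>C. S a c * S' c b) = (if a = b then 1 else 0))"
proof -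
  have fin: "finite J" "finite C"
    using finite_subset[OF JC(1) finite_A] finite_subset[OF JC(2) finite_A] .
  have "\<forall>a. \<exists>h. supp_in J h \<and> (\<forall>d. supp_in J d \<longrightarrow> B (\<lambda>x. unitv a x - h x) d = 0)"
    using projection[OF fin(1) JC(1)] by blast
  then obtain h where h: "\<And>a. supp_in J (h a)" "\<And>a d. supp_in J d \<Longrightarrow> B (\<lambda>x. unitv a x - h a x) d = 0"
    by metis
  define v where "v a = (\<lambda>x. unitv a x - h a x)" for a
  define S where "S a b = B (v a) (v b)" for a b
  have ort: "B d (v a) = 0" if "supp_in J d" for a d using h(2)[OF that] by (simp add: v_def sym)
  have vout: "v a x = (if x = a then 1 else 0)" if "x \<notin> J" for a x
    using h(1)[of a] that by (simp add: v_def unitv_def supp_in_def)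
  have sv: "supp_in A (v a)" if "a \<in> C" for a
    unfolding supp_in_def
  proof (intro allI impI)
    fix x assume "x \<notin> A"
    then have "x \<notin> J" "x \<noteq> a" using JC that by auto
    then show "v a x = 0" by (simp add: vout)
  qed
  have comb: "(\<Sum>c\<in>C. y c * v c x) = (if x \<in> C then y x else 0)" if "x \<notin> J" for y x
    using that fin by (simp add: vout if_distrib cong: if_cong)
  have BS: "B (act i (v a)) (v b) = (\<Sum>c\<in>C. M i c a * S c b)" if i: "i \<in> I" and a: "a \<in> C" for i a b
  proof -
    \<comment> \<open>The error of acting on representatives instead of classes. It lies in the
      submodule on \<open>J\<close>, to which all representatives are orthogonal.\<close>
    define d where "d x = act i (v a) x - (\<Sum>c\<in>C. M i c a * v c x)" for x
    have "supp_in J d"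
      unfolding supp_in_def
    proof (intro allI impI)
      fix x assume x: "x \<notin> J"
      show "d x = 0"
      proof (cases "x \<in> A")
        case False
        then show ?thesis using comb[OF x] JC by (auto simp: d_def act_def)
      next
        case True
        have "M i x w * v a w = (if w = a then M i x a else 0)" if "w \<in> A" for w
          using MJ[OF i True _ x] vout[of w a] a JC by (cases "w \<in> J") auto
        then have "act i (v a) x = M i x a"
          using True a JC finite_A by (auto simp: act_def)
        then show ?thesis using comb[OF x] MC[OF i True a] x by (auto simp: d_def)
      qed
    qed
    moreover have "act i (v a) = (\<lambda>x. (\<Sum>c\<in>C. M i c a * v c x) + d x)" by (simp add: d_def)
    ultimately show ?thesis by (simp add: B_add B_sum[OF fin(2)] ort S_def)
  qed
  have "(\<Sum>c\<in>C. S a c * M i c b) = (\<Sum>c\<in>C. M i c a * S c b)" if "i \<in> I" "a \<in> C" "b \<in> C" for i a b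
  proof -
    have "(\<Sum>c\<in>C. M i c a * S c b) = B (act i (v b)) (v a)"
      using BS[OF that(1,2), of b] sa[OF that(1) sv[OF that(2)] sv[OF that(3)]] sym by simp
    also have "\<dots> = (\<Sum>c\<in>C. M i c b * S c a)" by (rule BS[OF that(1,3)])
    finally show ?thesis by (simp add: S_def sym mult.commute)
  qed
  moreover have "\<exists>S'. \<forall>a\<in>C. \<forall>b\<in>C. (\<Sum>c\<in>C. S a c * S' c b) = (if a = b then 1 else 0)"
  proof -
    have "\<exists>y. \<forall>a\<in>C. (\<Sum>c\<in>C. S a c * y c) = (if a = b then 1 else 0)" if b: "b \<in> C" for b
    proof -
      \<comment> \<open>Making the unit vector at \<open>b\<close> orthogonal to \<open>J\<close>
        and to all other coordinates of the cell yields a vector \<open>z\<close> that, divided by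
        \<open>B z z\<close>, has column \<open>b\<close> of the inverse Gram matrix as its
        coordinates on \<open>C\<close>.\<close>
      let ?K = "J \<union> (C - {b})"
      have "finite ?K" "?K \<subseteq> A" using fin JC by auto
      from projection[OF this] obtain g where g: "supp_in ?K g" "\<And>d. supp_in ?K d \<Longrightarrow> B (\<lambda>x. unitv b x - g x) d = 0"
        by blast
      define z where "z x = unitv b x - g x" for x
      have bJ: "b \<notin> J" using b JC by auto
      have zb: "z b = 1" using g(1) bJ by (simp add: z_def unitv_def supp_in_def)
      have sz: "supp_in (J \<union> C) z" using g(1) b by (auto simp: z_def unitv_def supp_in_def)
      then have "supp_in A z" using JC by (auto simp: supp_in_def)
      moreover have "z \<noteq> (\<lambda>_. 0)" using zb by (metis zero_neq_one)
      ultimately have Bz: "B z z \<noteq> 0" using definite by blast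
      have oz: "B z d = 0" if "supp_in ?K d" for d using g(2)[OF that] by (simp add: z_def[abs_def])
      have "(\<Sum>c\<in>C. S a c * z c) = (if a = b then B z z else 0)" if a: "a \<in> C" for a
      proof -
        define d where "d x = z x - (\<Sum>c\<in>C. z c * v c x)" for x
        have "supp_in J d" using comb sz by (auto simp: supp_in_def d_def)
        have "(\<Sum>c\<in>C. S a c * z c) = B (\<lambda>x. \<Sum>c\<in>C. z c * v c x) (v a)"
          by (simp add: B_sum[OF fin(2)] S_def sym mult.commute)
        also have "\<dots> = B (\<lambda>x. (\<Sum>c\<in>C. z c * v c x) + d x) (v a)"
          unfolding B_add ort[OF \<open>supp_in J d\<close>] by simp
        also have "\<dots> = B z (v a)" by (simp add: d_def)
        also have "\<dots> = (if a = b then B z z else 0)"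
        proof (cases "a = b")
          case False
          then have "supp_in ?K (v a)" using vout a by (auto simp: supp_in_def)
          then show ?thesis using oz False by simp
        next
          case True
          define d' where "d' x = v b x - z x" for x
          have "supp_in ?K d'" using vout[of _ b] sz zb by (auto simp: supp_in_def d'_def)
          moreover have "v b = (\<lambda>x. z x + d' x)" by (simp add: d'_def)
          moreover have "B z (\<lambda>x. z x + d' x) = B z z + B z d'" by (subst sym) (simp add: B_add sym)
          ultimately show ?thesis using oz True by simp
        qed
        finally show ?thesis .
      qed
      then show ?thesis using Bz
        by (intro exI[of _ "\<lambda>c. z c / B z z"]) (simp add: sum_divide_distrib[symmetric])
    qed
    then have "\<forall>b. \<exists>y. b \<in> C \<longrightarrow> (\<forall>a\<in>C. (\<Sum>c\<in>C. S a c * y c) = (if a = b then 1 else 0))" by blast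
    then obtain y where "\<And>b. b \<in> C \<Longrightarrow> \<forall>a\<in>C. (\<Sum>c\<in>C. S a c * y b c) = (if a = b then 1 else 0)" by metis
    then show ?thesis by (intro exI[of _ "\<lambda>c b. y b c"]) blast
  qed
  ultimately show ?thesis by blast
qed

end

text \<open>Coordinates with respect to the Kazhdan--Lusztig basis, and the trace form
  \<open>\<langle>T\<^sub>x, T\<^sub>y\<rangle> = \<delta>\<^sub>x\<^sub>y\<close>, which is definite because the field of rational functions is orderable.\<close>
definition comb :: "nat \<Rightarrow> ((nat \<Rightarrow> nat) \<Rightarrow> fieldK) \<Rightarrow> (nat \<Rightarrow> nat) \<Rightarrow> fieldK" where
  "comb r c y = (\<Sum>x\<in>Sr r. c x * lpK (Cp r x y))"

definition trf_form :: "nat \<Rightarrow> ((nat \<Rightarrow> nat) \<Rightarrow> fieldK) \<Rightarrow> ((nat \<Rightarrow> nat) \<Rightarrow> fieldK) \<Rightarrow> fieldK" where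
  "trf_form r c d = (\<Sum>y\<in>Sr r. comb r c y * comb r d y)"

text \<open>The Kazhdan-Lusztig basis is unitriangular for the length, so a longest element of the
  support would give a nonzero standard coordinate.\<close>

lemma comb_eq_0:
  assumes c: "supp_in (Sr r) c" and z: "\<And>y. y \<in> Sr r \<Longrightarrow> comb r c y = 0"
  shows "c = (\<lambda>_. 0)"
proof (rule ccontr)
  assume ne: "c \<noteq> (\<lambda>_. 0)"
  define B where "B = {x \<in> Sr r. c x \<noteq> 0}"
  have fin: "finite B" "B \<noteq> {}" using ne c by (auto simp: B_def supp_in_def fun_eq_iff)
  define n where "n = Max (len ` B)"
  have "n \<in> len ` B" unfolding n_def by (rule Max_in) (use fin in auto)
  then obtain w where w: "w \<in> B" "len w = n" by auto
  have max: "len v \<le> len w" if "v \<in> B" for v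
    unfolding w(2) n_def using that fin by (intro Max_ge) auto
  have wS: "w \<in> Sr r" using w by (simp add: B_def)
  have "c v * lpK (Cp r v w) = (if v = w then c w else 0)" if v: "v \<in> Sr r" for v
  proof (cases "v = w")
    case False
    have "Cp r v w = 0 \<or> c v = 0"
      using Cp_supp_len[OF v, of w] max[of v] False v by (fastforce simp: B_def)
    then show ?thesis using False by auto
  qed (use Cp_self wS in auto)
  then have "comb r c w = c w" using wS by (simp add: comb_def)
  then show False using z[OF wS] w by (simp add: B_def)
qed

lemma comb_linear: "comb r (\<lambda>x. s * c x + d x) y = s * comb r c y + comb r d y"
  by (simp add: comb_def distrib_right sum.distrib sum_distrib_left mult.assoc)

lemma definite_trf_form: "definite_form (Sr r) (trf_form r)"
proof
  show "trf_form r (\<lambda>x. s * c x + d x) e = s * trf_form r c e + trf_form r d e" for s c d e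
    by (simp add: trf_form_def comb_linear distrib_right sum.distrib sum_distrib_left mult.assoc)
  show "trf_form r c d = trf_form r d c" for c d by (simp add: trf_form_def mult.commute)
  show "finite (Sr r)" by simp
  fix c assume c: "supp_in (Sr r) c" "trf_form r c c = 0"
  have "(\<Sum>y\<in>Sr r. comb r c y * comb r c y) = 0" using c(2) by (simp add: trf_form_def)
  \<comment> \<open>Squares in the ordered field \<open>fieldK\<close> are nonnegative, so a
    vanishing sum of squares has vanishing terms.\<close>
  then have "\<forall>y\<in>Sr r. comb r c y * comb r c y = 0"
    by (subst (asm) sum_nonneg_eq_0_iff) auto
  then show "c = (\<lambda>_. 0)" using comb_eq_0[OF c(1)] by auto
qed

definition mulK :: "nat \<Rightarrow> ((nat \<Rightarrow> nat) \<Rightarrow> fieldK) \<Rightarrow> (nat \<Rightarrow> nat) \<Rightarrow> fieldK" where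
  "mulK i f y = f (y \<circ> sref i) + (if rdesc y i then KU else inverse KU) * f y"

lemma mulK_sa:
  assumes "1 \<le> i" "i < r"
  shows "(\<Sum>y\<in>Sr r. mulK i f y * g y) = (\<Sum>y\<in>Sr r. f y * mulK i g y)"
proof -
  have "(\<Sum>y\<in>Sr r. f (y \<circ> sref i) * g y) = (\<Sum>y\<in>Sr r. f y * g (y \<circ> sref i))"
    using Sr_reindex[OF assms, of "\<lambda>x. f (x \<circ> sref i) * g x"] by (simp only: comp_sref_sref)
  then show ?thesis by (simp add: mulK_def distrib_right distrib_left sum.distrib mult.assoc mult.left_commute)
qed

lemma mulK_Cp:
  assumes "w \<in> Sr r" "1 \<le> i" "i < r" "y \<in> Sr r"
  shows "mulK i (\<lambda>y. lpK (Cp r w y)) y = (\<Sum>x\<in>Sr r. lpK (actc r i x w) * lpK (Cp r x y))"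
proof -
  have "mulK i (\<lambda>y. lpK (Cp r w y)) y = lpK (mulC i (Cp r w) y)"
    by (simp only: mulC_at[OF assms(4,2)] mulK_def) simp
  then show ?thesis by (simp add: Cp_mulC[OF assms(1-3)])
qed

text \<open>The matrix action of \<open>actc\<close> on Kazhdan-Lusztig coordinates becomes
  \<open>mulK\<close> on standard coordinates, where self-adjointness is visible.\<close>

lemma comb_act:
  assumes i: "1 \<le> i" "i < r" and y: "y \<in> Sr r"
  shows "comb r (\<lambda>x. if x \<in> Sr r then \<Sum>w\<in>Sr r. lpK (actc r i x w) * c w else 0) y = mulK i (comb r c) y"
proof -
  have "comb r (\<lambda>x. if x \<in> Sr r then \<Sum>w\<in>Sr r. lpK (actc r i x w) * c w else 0) y
      = (\<Sum>x\<in>Sr r. \<Sum>w\<in>Sr r. c w * (lpK (actc r i x w) * lpK (Cp r x y)))"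
    unfolding comb_def by (intro sum.cong) (simp_all add: sum_distrib_right sum_distrib_left mult_ac)
  also have "\<dots> = (\<Sum>w\<in>Sr r. c w * (\<Sum>x\<in>Sr r. lpK (actc r i x w) * lpK (Cp r x y)))"
    by (subst sum.swap) (simp add: sum_distrib_left)
  also have "\<dots> = (\<Sum>w\<in>Sr r. c w * mulK i (\<lambda>y. lpK (Cp r w y)) y)"
    by (intro sum.cong) (simp_all add: mulK_Cp[OF _ i y])
  also have "\<dots> = mulK i (comb r c) y"
    unfolding mulK_def comb_def
    by (simp only: distrib_left sum.distrib sum_distrib_left mult.left_commute)
  finally show ?thesis .
qed

section \<open>Intertwiners between the two realizations\<close>

context
  fixes lam v r
  assumes lam: "is_partition lam" and v: "cellmap lam v" and r: "r = sum_list lam"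
begin

private abbreviation "d i Q \<equiv> rdesc (v Q) i"
private abbreviation "m a b \<equiv> of_int (mu r (v a) (v b)) :: fieldK"

private lemmas cSr = cellmap_Sr[OF lam v r]
private lemmas ckw = cellmap_kw[OF lam v r]
private lemmas cinj = cellmap_inj[OF lam v r]

lemma finite_SYT: "finite (SYT lam)"
proof (rule finite_imageD)
  show "finite (v ` SYT lam)" by (rule finite_subset[of _ "Sr r"]) (use cSr in auto)
  show "inj_on v (SYT lam)" using cinj by (auto simp: inj_on_def)
qed

lemma Lact_cell:
  assumes "a \<in> SYT lam" "b \<in> SYT lam" "1 \<le> i" "i < r"
  shows "Lact r i a b = (if \<not> d i b then if a = b then q2 else 0 else if \<not> d i a then m a b else 0)"
  using R_low_cell[OF lam v r assms(1,3,4)] R_low_cell[OF lam v r assms(2,3,4)]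
    mu_low_cell[OF lam v r assms(2,1,3,4)] by (auto simp: Lact_def)

lemma Uact_cell:
  assumes "a \<in> SYT lam" "b \<in> SYT lam" "1 \<le> i" "i < r"
  shows "Uact r i a b + (if a = b then q2 else 0) = Lact r i b a"
  using R_up_cell[OF lam v r assms(1,3,4)] R_up_cell[OF lam v r assms(2,3,4)]
    mu_up_cell[OF lam v r assms(2,1,3,4)] mu_sym[of r "v a" "v b"]
  by (auto simp: Uact_def Lact_cell[OF assms(2,1,3,4)])

definition intw :: "(tableau \<Rightarrow> tableau \<Rightarrow> fieldK) \<Rightarrow> bool" where
  "intw S \<longleftrightarrow> (\<forall>i\<in>{1..<r}. \<forall>a\<in>SYT lam. \<forall>b\<in>SYT lam.
     (\<Sum>c\<in>SYT lam. S a c * Lact r i c b) = (\<Sum>c\<in>SYT lam. Lact r i c a * S c b))"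

text \<open>The upper action is the transpose of the lower one, so an isomorphism is the Gram matrix of
  an invariant form.\<close>
lemma is_iso_intw:
  "is_iso lam S \<longleftrightarrow> intw S \<and> (\<exists>S'. \<forall>a\<in>SYT lam. \<forall>b\<in>SYT lam.
     (\<Sum>c\<in>SYT lam. S a c * S' c b) = (if a = b then 1 else 0))"
proof -
  have "(\<Sum>c\<in>SYT lam. Uact r i a c * S c b) + q2 * S a b = (\<Sum>c\<in>SYT lam. Lact r i c a * S c b)"
    if ab: "a \<in> SYT lam" "b \<in> SYT lam" and i: "1 \<le> i" "i < r" for i a b
  proof -
    have "q2 * S a b = (\<Sum>c\<in>SYT lam. (if a = c then q2 else 0) * S c b)"
      using ab finite_SYT by (simp add: if_distrib[of "\<lambda>x. x * _"] cong: if_cong)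
    then have "(\<Sum>c\<in>SYT lam. Uact r i a c * S c b) + q2 * S a b
        = (\<Sum>c\<in>SYT lam. (Uact r i a c + (if a = c then q2 else 0)) * S c b)"
      by (simp only: distrib_right sum.distrib)
    also have "\<dots> = (\<Sum>c\<in>SYT lam. Lact r i c a * S c b)"
      by (intro sum.cong) (simp_all add: Uact_cell[OF ab(1) _ i])
    finally show ?thesis .
  qed
  then show ?thesis unfolding is_iso_def Let_def intw_def r[symmetric] by auto
qed

text \<open>\<open>d\<close> is the upper descent, so its failure at \<open>a\<close> makes
  \<open>a\<close> an eigenvector of the lower action. One side of the intertwining relation is then
  a single term with the factor [2], while the other has integer coefficients.\<close>

lemma intw_low:
  assumes S: "intw S" and ab: "a \<in> SYT lam" "b \<in> SYT lam" and i: "1 \<le> i" "i < r" and d: "\<not> d i a" "d i b"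
  shows "q2 * S a b = (\<Sum>c\<in>SYT lam. S a c * (if \<not> d i c then m c b else 0))"
proof -
  have "(\<Sum>c\<in>SYT lam. Lact r i c a * S c b) = (\<Sum>c\<in>SYT lam. if c = a then q2 * S a b else 0)"
    by (intro sum.cong) (auto simp: Lact_cell[OF _ ab(1) i] d)
  moreover have "(\<Sum>c\<in>SYT lam. S a c * Lact r i c b) = (\<Sum>c\<in>SYT lam. S a c * (if \<not> d i c then m c b else 0))"
    by (intro sum.cong) (auto simp: Lact_cell[OF _ ab(2) i] d)
  moreover have "(\<Sum>c\<in>SYT lam. S a c * Lact r i c b) = (\<Sum>c\<in>SYT lam. Lact r i c a * S c b)"
    using S ab i by (simp add: intw_def)
  ultimately show ?thesis using ab finite_SYT by simp
qed

lemma intw_up: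
  assumes S: "intw S" and ab: "a \<in> SYT lam" "b \<in> SYT lam" and i: "1 \<le> i" "i < r" and d: "d i a" "\<not> d i b"
  shows "q2 * S a b = (\<Sum>c\<in>SYT lam. (if \<not> d i c then m c a else 0) * S c b)"
proof -
  have "(\<Sum>c\<in>SYT lam. S a c * Lact r i c b) = (\<Sum>c\<in>SYT lam. if c = b then q2 * S a b else 0)"
    by (intro sum.cong) (auto simp: Lact_cell[OF _ ab(2) i] d)
  moreover have "(\<Sum>c\<in>SYT lam. Lact r i c a * S c b) = (\<Sum>c\<in>SYT lam. (if \<not> d i c then m c a else 0) * S c b)"
    by (intro sum.cong) (auto simp: Lact_cell[OF _ ab(1) i] d)
  moreover have "(\<Sum>c\<in>SYT lam. S a c * Lact r i c b) = (\<Sum>c\<in>SYT lam. Lact r i c a * S c b)"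
    using S ab i by (simp add: intw_def)
  ultimately show ?thesis using ab finite_SYT by simp
qed

text \<open>Multiplied by u, the factor [2] becomes \<open>u^2 + 1\<close>, which is 1 at u = 0,
  whereas the right-hand side becomes 0 there.\<close>

lemma val0_q2_mult:
  assumes "f \<in> K0" "g \<in> K0" "q2 * f = g" shows "val0 f = 0"
proof -
  have "(KU * KU + 1) * f = KU * g"
    unfolding assms(3)[symmetric] q2_KU by (simp add: algebra_simps)
  moreover have "val0 ((KU * KU + 1) * f) = val0 f" using assms(1) by (simp add: K0_mult K0_add)
  moreover have "val0 (KU * g) = 0" using assms(2) by (simp add: K0_mult)
  ultimately show ?thesis by simp
qed

text \<open>The value at \<open>u = 0\<close> of an integral intertwiner commutes with the star operations and is
  block diagonal with respect to descent sets; the separation property makes it scalar.\<close>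
context
  fixes S s
  assumes S: "intw S" and int: "\<And>a b. a \<in> SYT lam \<Longrightarrow> b \<in> SYT lam \<Longrightarrow> S a b \<in> K0"
    and s: "s = (\<lambda>a b. val0 (S a b))"
begin

lemma val_low:
  assumes "a \<in> SYT lam" "b \<in> SYT lam"
  shows "(\<Sum>c\<in>SYT lam. S a c * (if \<not> d i c then m c b else 0)) \<in> K0 \<and>
    val0 (\<Sum>c\<in>SYT lam. S a c * (if \<not> d i c then m c b else 0))
      = (\<Sum>c\<in>SYT lam. s a c * (if \<not> d i c then of_int (mu r (v c) (v b)) else 0))"
proof -
  have "S a c * (if \<not> d i c then m c b else 0) \<in> K0 \<and>
    val0 (S a c * (if \<not> d i c then m c b else 0)) = s a c * (if \<not> d i c then of_int (mu r (v c) (v b)) else 0)"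
    if "c \<in> SYT lam" for c
    using int[OF assms(1) that] K0_of_int K0_mult by (auto simp: s)
  then show ?thesis using K0_sum[OF finite_SYT] by auto
qed

lemma val_up:
  assumes "a \<in> SYT lam" "b \<in> SYT lam"
  shows "val0 (\<Sum>c\<in>SYT lam. (if \<not> d i c then m c a else 0) * S c b)
      = (\<Sum>c\<in>SYT lam. (if \<not> d i c then of_int (mu r (v c) (v a)) else 0) * s c b) \<and>
    (\<Sum>c\<in>SYT lam. (if \<not> d i c then m c a else 0) * S c b) \<in> K0"
proof -
  have "(if \<not> d i c then m c a else 0) * S c b \<in> K0 \<and>
    val0 ((if \<not> d i c then m c a else 0) * S c b) = (if \<not> d i c then of_int (mu r (v c) (v a)) else 0) * s c b"
    if "c \<in> SYT lam" for c
    using int[OF that assms(2)] K0_of_int K0_mult by (auto simp: s)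
  then show ?thesis using K0_sum[OF finite_SYT] by auto
qed

text \<open>If exactly one of the two indices has the descent, [2] times the entry is an integer
  combination of regular entries.\<close>

lemma val_descents:
  assumes ab: "a \<in> SYT lam" "b \<in> SYT lam" and i: "1 \<le> i" "i < r" and nz: "s a b \<noteq> 0"
  shows "d i a = d i b"
proof (rule ccontr)
  assume "d i a \<noteq> d i b"
  then consider "\<not> d i a" "d i b" | "d i a" "\<not> d i b" by blast
  then have "val0 (S a b) = 0"
  proof cases
    case 1
    show ?thesis
      by (rule val0_q2_mult[OF int[OF ab] _ intw_low[OF S ab i 1]]) (use val_low[OF ab] in blast)
  next
    case 2
    show ?thesis
      by (rule val0_q2_mult[OF int[OF ab] _ intw_up[OF S ab i 2]]) (use val_up[OF ab] in blast)
  qed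
  then show False using nz by (simp add: s)
qed

text \<open>The mixed entry at \<open>(a, c')\<close> times [2] has two expansions: through the
  generator that is not a descent of \<open>a\<close> and through the one that is. At u = 0 the
  first reduces to \<open>s a c\<close> and the second to \<open>s a' c'\<close>, since
  \<open>val_descents\<close> and \<open>mu_star\<close> eliminate all other terms.\<close>

lemma val_star:
  assumes X: "a \<in> SYT lam" "c \<in> SYT lam" "a' \<in> SYT lam" "c' \<in> SYT lam"
    and k: "1 \<le> k" "Suc k < r" and D: "kD k (v a)" "kD k (v c)"
    and st: "v a' = kstar k (v a)" "v c' = kstar k (v c)"
  shows "s a c = s a' c'"
proof -
  note pa = kstar_props[OF cSr[OF X(1)] D(1), folded st] and pc = kstar_props[OF cSr[OF X(2)] D(2), folded st]
  have kk: "1 \<le> k" "k < r" "1 \<le> Suc k" "Suc k < r" using k by auto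
  show ?thesis
  proof (cases "d k a = d k c")
    case False
    then have "d k a' \<noteq> d k c'" using pa(1) pc(1) D by (auto simp: kD_def)
    then show ?thesis
      using val_descents[OF X(1,2) kk(1,2)] val_descents[OF X(3,4) kk(1,2)] False by metis
  next
    case same: True
    obtain i j where ij: "(i = k \<and> j = Suc k) \<or> (i = Suc k \<and> j = k)" "\<not> d i a" "d j a"
      using D(1) by (auto simp: kD_def)
    have i: "1 \<le> i" "i < r" and j: "1 \<le> j" "j < r" using ij kk by auto
    have dc: "\<not> d i c" "d j c" using ij same D by (auto simp: kD_def)
    have db: "d i c'" "\<not> d j c'" using ij dc pc(1,2) by auto
    have dk: "kD k (v e) \<and> d k e \<noteq> d k c'" if e: "e \<in> SYT lam" "s a e \<noteq> 0" for e
      using val_descents[OF X(1) e(1) kk(1,2) e(2)] val_descents[OF X(1) e(1) kk(3,4) e(2)] D same pc(1)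
      by (auto simp: kD_def)
    have L: "s a e * (if \<not> d i e then of_int (mu r (v e) (v c')) else 0) = (if e = c then s a c else 0)"
      if e: "e \<in> SYT lam" for e
    proof (cases "s a e = 0")
      case False
      have "\<not> d i e" using val_descents[OF X(1) e i False] ij by simp
      moreover have "mu r (v e) (v c') = (if v e = kstar k (v c') then 1 else 0)"
        using dk[OF e False] pc(4) by (intro mu_star[OF cSr[OF e] cSr[OF X(4)] k]) auto
      moreover have "v e = kstar k (v c') \<longleftrightarrow> e = c" using pc(3) cinj[OF e X(2)] by simp
      ultimately show ?thesis by simp
    qed auto
    have dk': "kD k (v e) \<and> d k e \<noteq> d k a" if e: "e \<in> SYT lam" "s e c' \<noteq> 0" for e
      using val_descents[OF e(1) X(4) kk(1,2) e(2)] val_descents[OF e(1) X(4) kk(3,4) e(2)] D same pc(1,2)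
      by (auto simp: kD_def)
    have R: "(if \<not> d j e then of_int (mu r (v e) (v a)) else 0) * s e c' = (if e = a' then s a' c' else 0)"
      if e: "e \<in> SYT lam" for e
    proof (cases "s e c' = 0")
      case False
      have "\<not> d j e" using val_descents[OF e X(4) j False] db by simp
      moreover have "mu r (v e) (v a) = (if v e = kstar k (v a) then 1 else 0)"
        using dk'[OF e False] D by (intro mu_star[OF cSr[OF e] cSr[OF X(1)] k]) auto
      moreover have "v e = kstar k (v a) \<longleftrightarrow> e = a'" using st cinj[OF e X(3)] by simp
      ultimately show ?thesis by simp
    qed auto
    \<comment> \<open>Both sums equal [2] times the entry at \<open>(a, c')\<close>; values at 0 are
      taken only after [2], with its pole, has been eliminated.\<close>
    have "(\<Sum>e\<in>SYT lam. S a e * (if \<not> d i e then m e c' else 0)) = (\<Sum>e\<in>SYT lam. (if \<not> d j e then m e a else 0) * S e c')"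
      using intw_low[OF S X(1,4) i ij(2) db(1)] intw_up[OF S X(1,4) j ij(3) db(2)] by simp
    then have "(\<Sum>e\<in>SYT lam. s a e * (if \<not> d i e then of_int (mu r (v e) (v c')) else 0))
        = (\<Sum>e\<in>SYT lam. (if \<not> d j e then of_int (mu r (v e) (v a)) else 0) * s e c')"
      using val_low[OF X(1,4), of i, THEN conjunct2] val_up[OF X(1,4), of j, THEN conjunct1] by simp
    then show ?thesis using X finite_SYT by (simp add: L R cong: sum.cong)
  qed
qed

lemma val_star_word:
  assumes X: "a \<in> SYT lam" "c \<in> SYT lam" and i: "Suc (Suc i) < r" "wD i (rw r a)" "wD i (rw r c)"
  obtains a' c' where "a' \<in> SYT lam" "c' \<in> SYT lam" "rw r a' = wstar i (rw r a)" "rw r c' = wstar i (rw r c)"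
    "s a c = s a' c'"
proof -
  have k: "1 \<le> Suc i" "Suc (Suc i) < r" using i by auto
  have D: "kD (Suc i) (v a)" "kD (Suc i) (v c)"
    using wD_kw[OF cSr[OF X(1)] k] wD_kw[OF cSr[OF X(2)] k] ckw X i by simp_all
  obtain a' where a': "a' \<in> SYT lam" "v a' = kstar (Suc i) (v a)" using cell_star[OF lam v r X(1) k D(1)] .
  obtain c' where c': "c' \<in> SYT lam" "v c' = kstar (Suc i) (v c)" using cell_star[OF lam v r X(2) k D(2)] .
  show thesis
  proof (rule that[OF a'(1) c'(1)])
    show "rw r a' = wstar i (rw r a)" using rsk_kstar(2)[OF cSr[OF X(1)] k D(1)] a' ckw X by (metis diff_Suc_1)
    show "rw r c' = wstar i (rw r c)" using rsk_kstar(2)[OF cSr[OF X(2)] k D(2)] c' ckw X by (metis diff_Suc_1)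
    show "s a c = s a' c'" by (rule val_star[OF X a'(1) c'(1) k D a'(2) c'(2)])
  qed
qed

lemma rw_LW: "a \<in> SYT lam \<Longrightarrow> LW (rw r a)"
  using SYT_isQ(2)[OF lam] r by simp

lemma rw_eq: "a \<in> SYT lam \<Longrightarrow> b \<in> SYT lam \<Longrightarrow> rw r a = rw r b \<Longrightarrow> a = b"
  using SYT_isQ(1)[OF lam] r isQ_unique by metis

text \<open>Nonvanishing of \<open>s\<close> at a pair of tableaux is a bisimulation of their
  lattice words.\<close>

lemma val_diagonal:
  assumes ab: "a \<in> SYT lam" "b \<in> SYT lam" "a \<noteq> b" shows "s a b = 0"
proof (rule ccontr)
  assume nz: "s a b \<noteq> 0"
  define R where "R A C \<longleftrightarrow> (\<exists>a\<in>SYT lam. \<exists>c\<in>SYT lam. A = rw r a \<and> C = rw r c \<and> s a c \<noteq> 0)" for A C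
  have "wbisim r R"
    unfolding wbisim_def
  proof (intro allI impI)
    fix A C assume "R A C"
    then obtain a c where ac: "a \<in> SYT lam" "c \<in> SYT lam" "A = rw r a" "C = rw r c" "s a c \<noteq> 0"
      by (auto simp: R_def)
    have wd: "wd A i = wd C i" if "Suc i < r" for i
      using wd_kw[OF cSr[OF ac(1)] that] wd_kw[OF cSr[OF ac(2)] that] ckw ac
        val_descents[OF ac(1,2) _ that ac(5)] by simp
    have "R (wstar i A) (wstar i C)" if i: "Suc (Suc i) < r" "wD i A" for i
    proof -
      have "wD i C" using i wd[of i] wd[of "Suc i"] by (simp add: wD_def)
      then obtain a' c' where "a' \<in> SYT lam" "c' \<in> SYT lam" "rw r a' = wstar i (rw r a)" "rw r c' = wstar i (rw r c)"
        "s a c = s a' c'" using val_star_word[OF ac(1,2) i(1)] i(2) ac by blast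
      then show ?thesis unfolding R_def using ac by metis
    qed
    then show "LW A \<and> LW C \<and> length A = r \<and> length C = r \<and> (\<forall>i. Suc i < r \<longrightarrow> wd A i = wd C i) \<and>
       (\<forall>i. Suc (Suc i) < r \<longrightarrow> wD i A \<longrightarrow> R (wstar i A) (wstar i C))"
      using ac rw_LW wd by simp
  qed
  moreover have "R (rw r a) (rw r b)" using ab nz by (auto simp: R_def)
  ultimately have "rw r a = rw r b" by (rule wbisim_eq)
  then show False using rw_eq ab by blast
qed

lemma val_scalar:
  assumes ab: "a \<in> SYT lam" "b \<in> SYT lam" shows "s a a = s b b"
proof -
  have "(rw r a, rw r b) \<in> wrel\<^sup>*"
    by (rule wconn[OF rw_LW[OF ab(1)] rw_LW[OF ab(2)]]) (use SYT_isQ(3)[OF lam] ab r in simp)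
  then have "\<exists>e\<in>SYT lam. rw r e = rw r b \<and> s e e = s a a"
  proof (induction rule: rtrancl_induct)
    case base then show ?case using ab by blast
  next
    case (step B C)
    then obtain e where e: "e \<in> SYT lam" "rw r e = B" "s e e = s a a" by blast
    obtain i where i: "C = wstar i B" "Suc (Suc i) < length B" "wD i B" using step(2) by (auto simp: wrel_def)
    have ir: "Suc (Suc i) < r" "wD i (rw r e)" using i e by auto
    obtain a' c' where ac: "a' \<in> SYT lam" "c' \<in> SYT lam" "rw r a' = wstar i (rw r e)" "rw r c' = wstar i (rw r e)"
      "s e e = s a' c'" using val_star_word[OF e(1,1) ir(1,2,2)] by metis
    then have "a' = c'" using rw_eq by metis
    then show ?case using ac e i by (intro bexI[of _ a']) auto
  qed
  then show ?thesis using rw_eq ab by metis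
qed

end

section \<open>Scaling, bar conjugation and existence of intertwiners\<close>

lemma intw_scale: "intw S \<Longrightarrow> intw (\<lambda>a b. c * S a b)"
proof -
  assume "intw S"
  then have "c * (\<Sum>e\<in>SYT lam. S a e * Lact r i e b) = c * (\<Sum>e\<in>SYT lam. Lact r i e a * S e b)"
    if "i \<in> {1..<r}" "a \<in> SYT lam" "b \<in> SYT lam" for i a b using that by (simp add: intw_def)
  then show ?thesis by (simp add: intw_def sum_distrib_left mult_ac)
qed

lemma intw_diff: "intw S \<Longrightarrow> intw S' \<Longrightarrow> intw (\<lambda>a b. S a b - S' a b)"
  by (simp add: intw_def left_diff_distrib right_diff_distrib sum_subtractf)

lemma barK_Lact: "barK (Lact r i a b) = Lact r i a b"
  by (simp add: Lact_def)

lemma intw_bar: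
  assumes "intw S" shows "intw (\<lambda>a b. barK (S a b))"
  unfolding intw_def
proof (intro ballI)
  fix i a b assume i: "i \<in> {1..<r}" and ab: "a \<in> SYT lam" "b \<in> SYT lam"
  have "barK (\<Sum>c\<in>SYT lam. S a c * Lact r i c b) = barK (\<Sum>c\<in>SYT lam. Lact r i c a * S c b)"
    using assms i ab by (simp add: intw_def)
  then show "(\<Sum>c\<in>SYT lam. barK (S a c) * Lact r i c b) = (\<Sum>c\<in>SYT lam. Lact r i c a * barK (S c b))"
    by (simp add: barK_sum barK_mult barK_Lact)
qed

text \<open>A power of u makes the entries regular with some value at 0 nonzero. That value sits on
  the diagonal, so the common diagonal value \<open>k\<close> is nonzero and can be divided
  out.\<close>

lemma intw_normalize:
  assumes S: "intw S" and nz: "a0 \<in> SYT lam" "b0 \<in> SYT lam" "S a0 b0 \<noteq> 0"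
  shows "\<exists>c. c \<noteq> 0 \<and> (\<forall>a\<in>SYT lam. \<forall>b\<in>SYT lam. c * S a b \<in> K0 \<and> val0 (c * S a b) = (if a = b then 1 else 0))"
proof -
  let ?X = "SYT lam \<times> SYT lam"
  have "\<exists>p\<in>?X. (case p of (a, b) \<Rightarrow> S a b) \<noteq> 0" using nz by (intro bexI[of _ "(a0, b0)"]) auto
  then obtain n where n: "\<forall>p\<in>?X. KU powi n * (case p of (a, b) \<Rightarrow> S a b) \<in> K0"
    "\<exists>p\<in>?X. val0 (KU powi n * (case p of (a, b) \<Rightarrow> S a b)) \<noteq> 0"
    using K0_scale_family[of ?X "\<lambda>p. case p of (a, b) \<Rightarrow> S a b"] finite_SYT by auto
  define T where "T a b = KU powi n * S a b" for a b
  have T: "intw T" unfolding T_def[abs_def] by (rule intw_scale[OF S])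
  have int: "T a b \<in> K0" if "a \<in> SYT lam" "b \<in> SYT lam" for a b using n(1) that by (auto simp: T_def)
  obtain a1 b1 where ab1: "a1 \<in> SYT lam" "b1 \<in> SYT lam" "val0 (T a1 b1) \<noteq> 0" using n(2) by (auto simp: T_def)
  note diag = val_diagonal[OF T int refl] and scal = val_scalar[OF T int refl]
  define k where "k = val0 (T a1 a1)"
  have "k \<noteq> 0" using ab1 diag[of a1 b1] by (cases "a1 = b1") (auto simp: k_def)
  have val: "val0 (T a b) = (if a = b then k else 0)" if "a \<in> SYT lam" "b \<in> SYT lam" for a b
    using that diag[of a b] scal[of a a1] ab1 by (auto simp: k_def)
  let ?c = "cK (inverse k) * KU powi n"
  have "?c \<noteq> 0" using \<open>k \<noteq> 0\<close> cK_nz by simp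
  moreover have "?c * S a b \<in> K0 \<and> val0 (?c * S a b) = (if a = b then 1 else 0)"
    if ab: "a \<in> SYT lam" "b \<in> SYT lam" for a b
    using K0_mult[of "cK (inverse k)" "T a b"] K0_cK[of "inverse k"] int[OF ab] val[OF ab] \<open>k \<noteq> 0\<close>
    by (simp add: T_def mult.assoc)
  ultimately show ?thesis by blast
qed

text \<open>Normalizing a nonzero intertwiner would give every diagonal entry the value 1 at u = 0,
  including the one that vanishes.\<close>

lemma intw_zero:
  assumes S: "intw S" and a0: "a0 \<in> SYT lam" "S a0 a0 = 0" and ab: "a \<in> SYT lam" "b \<in> SYT lam"
  shows "S a b = 0"
proof (rule ccontr)
  assume "S a b \<noteq> 0"
  from intw_normalize[OF S ab this] obtain c
    where "\<forall>a\<in>SYT lam. \<forall>b\<in>SYT lam. c * S a b \<in> K0 \<and> val0 (c * S a b) = (if a = b then 1 else 0)" by blast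
  then have "val0 (c * S a0 a0) = 1" using a0(1) by auto
  then show False using a0(2) by simp
qed

lemma intw_normal_form:
  assumes S: "intw S" and nz: "a0 \<in> SYT lam" "b0 \<in> SYT lam" "S a0 b0 \<noteq> 0"
  shows "\<exists>c. c \<noteq> 0 \<and> (\<forall>a\<in>SYT lam. \<forall>b\<in>SYT lam.
    barK (c * S a b) = c * S a b \<and> c * S a b \<in> K0 \<and> c * S a b \<in> Kinf \<and>
    val0 (c * S a b) = (if a = b then 1 else 0) \<and> valinf (c * S a b) = (if a = b then 1 else 0))"
proof -
  obtain c where c: "c \<noteq> 0"
    "\<And>a b. a \<in> SYT lam \<Longrightarrow> b \<in> SYT lam \<Longrightarrow> c * S a b \<in> K0 \<and> val0 (c * S a b) = (if a = b then 1 else 0)"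
    using intw_normalize[OF S nz] by blast
  define t where "t = c * S a0 a0"
  have t: "t \<in> K0" "val0 t = 1" using c(2)[OF nz(1,1)] by (auto simp: t_def)
  then have "t \<noteq> 0" by auto
  have it: "inverse t \<in> K0" "val0 (inverse t) = 1" using K0_inverse[of t] t by auto
  \<comment> \<open>Since \<open>t\<close> has value 1 at u = 0, dividing by it keeps the
    normalization there and makes the entry at \<open>(a0, a0)\<close> exactly 1, which bar
    fixes.\<close>
  let ?c = "inverse t * c"
  define T where "T a b = ?c * S a b" for a b
  have T: "intw T" unfolding T_def[abs_def] by (rule intw_scale[OF S])
  have K: "T a b \<in> K0 \<and> val0 (T a b) = (if a = b then 1 else 0)" if "a \<in> SYT lam" "b \<in> SYT lam" for a b
    using K0_mult[OF it(1), of "c * S a b"] c(2)[OF that] it(2) by (simp add: T_def mult.assoc)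
  have "T a0 a0 = inverse t * t" by (simp only: T_def t_def mult.assoc)
  then have "T a0 a0 = 1" using \<open>t \<noteq> 0\<close> by simp
  then have "barK (T a0 a0) - T a0 a0 = 0" by simp
  then have "barK (T a b) - T a b = 0" if "a \<in> SYT lam" "b \<in> SYT lam" for a b
    using intw_zero[OF intw_diff[OF intw_bar[OF T] T] nz(1) _ that] by blast
  then have bar: "barK (T a b) = T a b" if "a \<in> SYT lam" "b \<in> SYT lam" for a b using that by simp
  have "?c \<noteq> 0" using c(1) \<open>t \<noteq> 0\<close> by simp
  moreover have "barK (T a b) = T a b \<and> T a b \<in> K0 \<and> T a b \<in> Kinf \<and>
      val0 (T a b) = (if a = b then 1 else 0) \<and> valinf (T a b) = (if a = b then 1 else 0)"
    if ab: "a \<in> SYT lam" "b \<in> SYT lam" for a b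
    using bar[OF ab] K[OF ab] bar_invariant_Kinf[of "T a b"] by simp
  ultimately show ?thesis unfolding T_def by blast
qed

lemma is_iso_exists: "\<exists>S. is_iso lam S"
proof (cases "SYT lam = {}")
  case True
  then show ?thesis by (auto simp: is_iso_def Let_def)
next
  case False
  then obtain T where T: "T \<in> SYT lam" by blast
  define x where "x Q = w0 r \<circ> v Q" for Q
  have xS: "x Q \<in> Sr r" if "Q \<in> SYT lam" for Q using cSr[OF that] by (simp add: x_def)
  have xinj: "x Q = x Q' \<longleftrightarrow> Q = Q'" if "Q \<in> SYT lam" "Q' \<in> SYT lam" for Q Q'
    using cinj[OF that] unfolding x_def by (metis w0_comp(1))
  have xd: "rdesc (x Q) i \<longleftrightarrow> \<not> d i Q" if "Q \<in> SYT lam" "1 \<le> i" "i < r" for Q i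
    unfolding x_def using w0_comp_less_iff[OF cSr[OF that(1)] that(2,3)] Sr_inj[OF cSr[OF that(1)], of i "Suc i"] by auto
  define C where "C = x ` SYT lam"
  \<comment> \<open>The elements strictly below the cell in the right preorder. They span the
    submodule to be factored out, and together with the cell they are closed under the
    action.\<close>
  define J where "J = {z \<in> Sr r. (z, x T) \<in> (redge r)\<^sup>*} - C"
  have Ceq: "z \<in> C \<longleftrightarrow> ceq r z (x T)" for z
    using dual_cell[OF lam v r T, of z] by (auto simp: C_def x_def)
  have CI: "z \<in> Sr r \<and> (z, x T) \<in> (redge r)\<^sup>* \<and> (x T, z) \<in> (redge r)\<^sup>*" if "z \<in> C" for z
    using that by (simp add: Ceq ceq_def)
  have edge: "z = w \<or> (z, w) \<in> redge r"
    if "z \<in> Sr r" "w \<in> Sr r" "1 \<le> i" "i < r" "actc r i z w \<noteq> 0" for i z w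
    using that by (auto simp: actc_def redge_def split: if_splits)
  interpret definite_form "Sr r" "trf_form r" by (rule definite_trf_form)
  have "\<exists>S. (\<forall>i\<in>{1..<r}. \<forall>a\<in>C. \<forall>b\<in>C. (\<Sum>c\<in>C. S a c * lpK (actc r i c b)) = (\<Sum>c\<in>C. lpK (actc r i c a) * S c b)) \<and>
    (\<exists>S'. \<forall>a\<in>C. \<forall>b\<in>C. (\<Sum>c\<in>C. S a c * S' c b) = (if a = b then 1 else 0))"
  proof (rule invariant_form[where J = J])
    fix i c e assume i: "i \<in> {1..<r}"
    then have i': "1 \<le> i" "i < r" by auto
    show "trf_form r (\<lambda>x. if x \<in> Sr r then \<Sum>w\<in>Sr r. lpK (actc r i x w) * c w else 0) e
      = trf_form r c (\<lambda>x. if x \<in> Sr r then \<Sum>w\<in>Sr r. lpK (actc r i x w) * e w else 0)"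
      unfolding trf_form_def using mulK_sa[OF i', of "comb r c" "comb r e"]
      by (simp add: comb_act[OF i'] cong: sum.cong)
  next
    show "J \<subseteq> Sr r" "C \<subseteq> Sr r" "J \<inter> C = {}" using CI by (auto simp: J_def)
  next
    fix i z w assume a: "i \<in> {1..<r}" "z \<in> Sr r" "w \<in> J" "z \<notin> J"
    show "lpK (actc r i z w) = 0"
    proof (rule ccontr)
      assume "lpK (actc r i z w) \<noteq> 0"
      then have "actc r i z w \<noteq> 0" by auto
      then have "z = w \<or> (z, w) \<in> redge r" using edge[of z w i] a by (auto simp: J_def)
      then have zw: "(z, w) \<in> redge r" using a by auto
      then have zI: "(z, x T) \<in> (redge r)\<^sup>*" using a by (auto simp: J_def intro: converse_rtrancl_into_rtrancl)
      then have "z \<in> C" using a by (auto simp: J_def)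
      \<comment> \<open>An edge from the cell into \<open>J\<close> would put \<open>w\<close> both
        above and below \<open>x T\<close>, that is, into the cell itself.\<close>
      then have "(x T, w) \<in> (redge r)\<^sup>*" using CI zw by (meson rtrancl.rtrancl_into_rtrancl)
      then have "w \<in> C" using a xS[OF T] by (auto simp: J_def Ceq ceq_def)
      then show False using a by (simp add: J_def)
    qed
  next
    fix i z w assume a: "i \<in> {1..<r}" "z \<in> Sr r" "w \<in> C" "z \<notin> C \<union> J"
    show "lpK (actc r i z w) = 0"
    proof (rule ccontr)
      assume "lpK (actc r i z w) \<noteq> 0"
      then have "actc r i z w \<noteq> 0" by auto
      then have "z = w \<or> (z, w) \<in> redge r" using edge[of z w i] a CI by fastforce
      then have "(z, x T) \<in> (redge r)\<^sup>*" using a CI by (auto intro: converse_rtrancl_into_rtrancl)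
      then show False using a by (auto simp: J_def)
    qed
  qed
  then obtain S S' where S: "\<And>i a b. i \<in> {1..<r} \<Longrightarrow> a \<in> C \<Longrightarrow> b \<in> C \<Longrightarrow>
      (\<Sum>c\<in>C. S a c * lpK (actc r i c b)) = (\<Sum>c\<in>C. lpK (actc r i c a) * S c b)"
    "\<And>a b. a \<in> C \<Longrightarrow> b \<in> C \<Longrightarrow> (\<Sum>c\<in>C. S a c * S' c b) = (if a = b then 1 else 0)"
    by blast
  have re: "(\<Sum>c\<in>C. f c) = (\<Sum>Q\<in>SYT lam. f (x Q))" for f :: "_ \<Rightarrow> fieldK"
    unfolding C_def by (subst sum.reindex) (auto simp: inj_on_def xinj)
  \<comment> \<open>The longest element turns right descents of \<open>x Q\<close> into lower
    descents of \<open>Q\<close>. For \<open>a\<close> and \<open>b\<close> on different sides,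
    \<open>mu_w0\<close> identifies the two values of mu; on the same side only the diagonal [2] can
    occur.\<close>
  have L: "lpK (actc r i (x a) (x b)) = Lact r i a b" if "a \<in> SYT lam" "b \<in> SYT lam" "1 \<le> i" "i < r" for i a b
  proof (cases "d i a = d i b")
    case True
    then show ?thesis using xd[OF that(1,3,4)] xd[OF that(2,3,4)] xinj[OF that(1,2)]
      by (simp add: Lact_cell[OF that] actc_def q2_KU)
  next
    case False
    then have "mu r (x a) (x b) = mu r (v a) (v b)" "a \<noteq> b"
      unfolding x_def using mu_w0[OF cSr[OF that(1)] cSr[OF that(2)] that(3,4)] by auto
    then show ?thesis using xd[OF that(1,3,4)] xd[OF that(2,3,4)] xinj[OF that(1,2)] False
      by (simp add: Lact_cell[OF that] actc_def)
  qed
  have "intw (\<lambda>a b. S (x a) (x b))"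
    unfolding intw_def
  proof (intro ballI)
    fix i a b assume a: "i \<in> {1..<r}" "a \<in> SYT lam" "b \<in> SYT lam"
    have "x a \<in> C" "x b \<in> C" using a by (auto simp: C_def)
    from S(1)[OF a(1) this] show "(\<Sum>c\<in>SYT lam. S (x a) (x c) * Lact r i c b) = (\<Sum>c\<in>SYT lam. Lact r i c a * S (x c) (x b))"
      using a by (simp add: re L cong: sum.cong)
  qed
  moreover have "(\<Sum>c\<in>SYT lam. S (x a) (x c) * S' (x c) (x b)) = (if a = b then 1 else 0)"
    if "a \<in> SYT lam" "b \<in> SYT lam" for a b
  proof -
    have "x a \<in> C" "x b \<in> C" using that by (auto simp: C_def)
    from S(2)[OF this] show ?thesis unfolding re xinj[OF that] .
  qed
  ultimately have "intw (\<lambda>a b. S (x a) (x b)) \<and> (\<exists>S'. \<forall>a\<in>SYT lam. \<forall>b\<in>SYT lam.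
      (\<Sum>c\<in>SYT lam. S (x a) (x c) * S' c b) = (if a = b then 1 else 0))"
    by (intro conjI exI[of _ "\<lambda>c b. S' (x c) (x b)"] ballI) simp_all
  then show ?thesis
    by (intro exI[of _ "\<lambda>a b. S (x a) (x b)"]) (simp only: is_iso_intw)
qed

end

theorem theorem7p12:
  fixes lam :: "nat list"
  assumes "is_partition lam" and "1 \<le> sum_list lam"
  shows "(\<exists>S. is_iso lam S) \<and>
    (\<forall>S. is_iso lam S \<longrightarrow>
      (\<exists>c::fieldK. c \<noteq> 0 \<and>
        (\<forall>Q'\<in>SYT lam. \<forall>Q\<in>SYT lam.
           barK (c * S Q' Q) = c * S Q' Q \<and>
           c * S Q' Q \<in> K0 \<and> c * S Q' Q \<in> Kinf \<and>
           val0 (c * S Q' Q) = (if Q' = Q then 1 else 0) \<and>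
           valinf (c * S Q' Q) = (if Q' = Q then 1 else 0))))"
proof -
  obtain v where v: "cellmap lam v" using cellmap_ex[OF assms(1)] by blast
  note iso = is_iso_intw[OF assms(1) v refl]
  have "\<exists>c::fieldK. c \<noteq> 0 \<and> (\<forall>Q'\<in>SYT lam. \<forall>Q\<in>SYT lam.
      barK (c * S Q' Q) = c * S Q' Q \<and> c * S Q' Q \<in> K0 \<and> c * S Q' Q \<in> Kinf \<and>
      val0 (c * S Q' Q) = (if Q' = Q then 1 else 0) \<and> valinf (c * S Q' Q) = (if Q' = Q then 1 else 0))"
    if S: "is_iso lam S" for S
  proof (cases "SYT lam = {}")
    case True
    then show ?thesis by (intro exI[of _ 1]) simp
  next
    case False
    then obtain a where a: "a \<in> SYT lam" by blast
    obtain S' where "\<forall>a\<in>SYT lam. \<forall>b\<in>SYT lam. (\<Sum>c\<in>SYT lam. S a c * S' c b) = (if a = b then 1 else 0)"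
      using S unfolding iso by blast
    then have S': "(\<Sum>c\<in>SYT lam. S a c * S' c a) = 1" using a by simp
    have "\<exists>b\<in>SYT lam. S a b \<noteq> 0"
    proof (rule ccontr)
      assume "\<not> ?thesis"
      then have "(\<Sum>c\<in>SYT lam. S a c * S' c a) = 0" by (intro sum.neutral) simp
      then show False using S' by simp
    qed
    then obtain b where "b \<in> SYT lam" "S a b \<noteq> 0" by blast
    then show ?thesis using intw_normal_form[OF assms(1) v refl _ a] S unfolding iso by blast
  qed
  then show ?thesis using is_iso_exists[OF assms(1) v refl] by blast
qed

end
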